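(* Let $m>0$. There is $\overline{\Omega}>m$ such that for every $\Omega>\overline{\Omega}$ and every $k\in\mathbb{N}$ the following holds, where for all sufficiently small $p>0$, $(u_p,v_p)$ denotes the compactly supported solution with $k$ nodes of the Cauchy problem described in the context. There exist finitely many points $R^1<\dots<R^l$ in $(0,\infty)$ with $l\leq 2k+1$, a function $(u_0,v_0)\in\mathcal{C}^1(\mathbb{R}^+\setminus\{R^1,\dots,R^l\})\cap L^\infty(\mathbb{R}^+)$ and a decreasing sequence $(p_n)$ converging to zero such that: (i) $v_0^2-u_0^2$ is continuous on $\mathbb{R}^+$, positive on $[0,R^1)$ and on exactly $k$ of the intervals $(R^i,R^{i+1})$; (ii) $(u_{p_n},v_{p_n})$ converges to $(u_0,v_0)$ uniformly on every compact interval contained in $\{|v_0^2-u_0^2|>0\}$; (iii) $(u_0,v_0)$ is a solution on $[0,R^l]\setminus\{R^1,\dots,R^l\}$ of the free Dirac equation $$\left\{\begin{array}{l}u'+\dfrac{2u}{r}=v(\Omega-m)\\[1mm] v'=-u(\Omega+m),\end{array}\right.$$ and it is discontinuous at $R^1,\dots,R^l$; (iv) $(u_0,v_0)\equiv0$ on $[R^l,\infty)$ and $(v_0^2-u_0^2)(R^i)=0$ for each $i$.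
   Context: Here $\mathbb{R}^+=[0,\infty)$ and $\mathbb{N}=\{0,1,2,\dots\}$. For $p\in(0,1)$ let $F_p:\mathbb{R}\to\mathbb{R}$, $F_p(s)=p|s|^{p-1}$ for $s\neq0$, $F_p(0)=0$. For $x\geq0$ consider the Cauchy problem on $[0,\infty)$ $$u'+\frac{2u}{r}=v\left(-F_p(v^2-u^2)-(m-\Omega)\right),\quad v'=u\left(-F_p(v^2-u^2)-(m+\Omega)\right),\quad (u(0),v(0))=(0,x).$$ Solutions of this problem are understood in the extended sense: a continuous function $w$ on an interval is a solution in the extended sense of a system of ordinary differential equations if there are at most finitely many points of the interval outside of which (in its interior) $w$ is of class $\mathcal{C}^1$ and satisfies the equations. The solutions $(u_p,v_p)$: by the existence theorem of the same paper there are $\overline{p}\in(0,1)$ and, for each $p\in(0,\overline p)$, a constant $\Omega_p>m$ such that for $\Omega>\Omega_p$ and each $k\in\mathbb{N}$ there is an initial datum $x=x_k$ for which the Cauchy problem has a compactly supported solution (in the extended sense) which crosses $\{(u,0)\,|\,u\neq0\}$ exactly $k$ times. For $\Omega>\overline\Omega$ this applies to all sufficiently small $p$, and $(u_p,v_p)$ denotes this solution for the parameters $p,\Omega$ and for the given $k$. *)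

theory Defs
  imports "HOL-Analysis.Analysis"
begin

definition F :: "real \<Rightarrow> real \<Rightarrow> real" where
  "F p s = (if s = 0 then 0 else p * \<bar>s\<bar> powr (p - 1))"

text \<open>A state is a pair \<open>(u, v)\<close>. The first components below solve the equation for \<open>u'\<close>, that is,
  the term \<open>2 u / r\<close> has been moved to the right-hand side. At \<open>r = 0\<close> that term is singular (and has the
  meaningless value \<open>0\<close> in HOL), so the equations are only ever imposed for \<open>r > 0\<close>.\<close>

definition soler_field :: "real \<Rightarrow> real \<Rightarrow> real \<Rightarrow> real \<Rightarrow> real \<times> real \<Rightarrow> real \<times> real" where
  "soler_field m \<Omega> p r = (\<lambda>(u, v).
     (v * (- F p (v\<^sup>2 - u\<^sup>2) - (m - \<Omega>)) - 2 * u / r,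
      u * (- F p (v\<^sup>2 - u\<^sup>2) - (m + \<Omega>))))"

definition dirac_field :: "real \<Rightarrow> real \<Rightarrow> real \<Rightarrow> real \<times> real \<Rightarrow> real \<times> real" where
  "dirac_field m \<Omega> r = (\<lambda>(u, v). (v * (\<Omega> - m) - 2 * u / r, - u * (\<Omega> + m)))"

definition extended_solution ::
  "(real \<Rightarrow> 'a \<Rightarrow> 'a) \<Rightarrow> real set \<Rightarrow> (real \<Rightarrow> 'a::real_normed_vector) \<Rightarrow> bool" where
  "extended_solution f I w \<longleftrightarrow>
     continuous_on I w \<and>
     (\<exists>S. finite S \<and> w C1_differentiable_on (interior I - S) \<and>
          (\<forall>r\<in>interior I - S. (w has_vector_derivative f r (w r)) (at r)))"

definition cauchy_solution ::
  "real \<Rightarrow> real \<Rightarrow> real \<Rightarrow> real \<Rightarrow> (real \<Rightarrow> real \<times> real) \<Rightarrow> bool" where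
  "cauchy_solution m \<Omega> p x w \<longleftrightarrow>
     extended_solution (soler_field m \<Omega> p) {0..} w \<and> w 0 = (0, x)"

definition compactly_supported :: "(real \<Rightarrow> real \<times> real) \<Rightarrow> bool" where
  "compactly_supported w \<longleftrightarrow> compact (closure {r. 0 \<le> r \<and> w r \<noteq> 0})"

text \<open>The radii at which the orbit passes through \<open>{(u, 0) | u \<noteq> 0}\<close> from one side to the other.\<close>

definition crossings :: "(real \<Rightarrow> real \<times> real) \<Rightarrow> real set" where
  "crossings w = {r. 0 < r \<and> fst (w r) \<noteq> 0 \<and> snd (w r) = 0 \<and>
     (\<exists>\<epsilon>>0. \<forall>t\<in>{0<..<\<epsilon>}. snd (w (r - t)) * snd (w (r + t)) < 0)}"

text \<open>The initial datum is required to be nonzero: \<open>x = 0\<close> gives the trivial solution, which is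
  compactly supported and has no crossing, and must not count as a solution with \<open>k = 0\<close> nodes.\<close>

definition nodal_solution ::
  "real \<Rightarrow> real \<Rightarrow> nat \<Rightarrow> real \<Rightarrow> (real \<Rightarrow> real \<times> real) \<Rightarrow> bool" where
  "nodal_solution m \<Omega> k p w \<longleftrightarrow>
     (\<exists>x>0. cauchy_solution m \<Omega> p x w) \<and> compactly_supported w \<and>
     finite (crossings w) \<and> card (crossings w) = k"

text \<open>In contrast to \<^const>\<open>C1_differentiable_on\<close>, the derivatives are taken within the set, so they
  are one-sided at an endpoint belonging to it.\<close>

definition C1_within :: "real set \<Rightarrow> (real \<Rightarrow> 'a::real_normed_vector) \<Rightarrow> bool" where
  "C1_within S w \<longleftrightarrow>
     (\<exists>D. continuous_on S D \<and> (\<forall>r\<in>S. (w has_vector_derivative D r) (at r within S)))"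

definition L_infinity_on :: "real set \<Rightarrow> (real \<Rightarrow> real \<times> real) \<Rightarrow> bool" where
  "L_infinity_on S w \<longleftrightarrow>
     w \<in> borel_measurable (lebesgue_on S) \<and> (\<exists>C. AE r in lebesgue_on S. norm (w r) \<le> C)"

definition minkowski :: "real \<times> real \<Rightarrow> real" where
  "minkowski = (\<lambda>(u, v). v\<^sup>2 - u\<^sup>2)"

text \<open>A function that is \<open>C\<^sup>1\<close> off a point can be made discontinuous there just by changing its
  value. Hence a discontinuity is understood as the absence of a limit, so that no choice of the value
  at the point removes it.\<close>

definition nonremovable_discontinuity :: "(real \<Rightarrow> real \<times> real) \<Rightarrow> real \<Rightarrow> bool" where
  "nonremovable_discontinuity w r \<longleftrightarrow> (\<nexists>L. (w \<longlongrightarrow> L) (at r))"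

end

theory Submission
  imports Defs "HOL-Real_Asymp.Real_Asymp"
begin

text \<open>
 With \<open>u = \<surd>E sin (\<phi>/2)\<close>, \<open>v = \<surd>E cos (\<phi>/2)\<close> and \<open>s = v\<^sup>2 - u\<^sup>2 = E cos \<phi>\<close>, the energy
 \<open>h = E (\<Omega> - m cos \<phi>) - sgn s \<bar>s\<bar>\<^sup>p\<close> decreases, and while it is nonnegative the phase grows at a definite rate
 away from the origin. In a time scale that removes \<open>F\<close> the equation is regular. The shooting datum is the
 infimum of the \<open>x\<close> whose orbit completes \<open>k + 1\<close> half revolutions with positive energy: its orbit keeps
 \<open>h \<ge> 0\<close> with bounded phase, so that it must reach the origin at a finite radius.

 As \<open>p\<close> tends to \<open>0\<close>, \<open>h \<ge> 0\<close> forces \<open>F = O(p)\<close> where \<open>s > 0\<close>. Where \<open>s < 0\<close>, \<open>ln E\<close> has bounded variation, so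
 that either \<open>E\<close> tends to \<open>0\<close> or again \<open>F = O(p)\<close>. Gronwall's lemma then gives convergence to the free Dirac
 flow between the limits of the radii where \<open>s = 0\<close>. There \<open>v\<close> jumps, because its decrease controls that of
 \<open>sgn s \<bar>s\<bar>\<^sup>p\<close>, which tends to \<open>sgn s\<close>.
\<close>

section \<open>Orbits in polar coordinates\<close>

text \<open>The obstacle is that \<open>F\<close> blows up on the light cone \<open>s = 0\<close>. A
  solution cannot satisfy the equation as a \<open>C1\<close> function where it crosses the cone,
  and in the radial form neither uniqueness nor continuous dependence is available there or at the
  origin. For this reason the estimates are proved for orbits in an arbitrary parametrisation: the
  same lemmas then serve the regular flow used for shooting and, with the radius as parameter, every
  given nodal solution. They are uniform in \<open>p\<close> because \<open>F\<close> is never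
  estimated near the cone. Where cos phi > 0, nonnegative energy bounds \<open>F\<close>; where cos
  phi < 0, \<open>F\<close> speeds up the rotation, so the bounded phase bounds its integral; across
  the cone only \<open>s\<close> and \<open>Gp p s\<close> are followed. In the limit a negative
  interval may shrink to a point or carry the zero solution, while a positive one keeps a length of
  at least \<open>c1\<close>. This is why there are at most \<open>2 * k + 1\<close> radii but
  exactly \<open>k\<close> further positive intervals. On each interval the limit is a free solution
  whose two constants are not transmitted across a jump; compactness at the midpoint selects
  them.\<close>

lemma nondecreasing_off_finite:
 fixes g g' :: "real => real"
 assumes "finite S" "a <= b" "continuous_on {a..b} g"
  and "!!x. x \<in> {a<..<b} - S ==> DERIV g x :> g' x"
  and "!!x. x \<in> {a<..<b} - S ==> 0 <= g' x"
 shows "g a <= g b"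
proof -
 \<comment> \<open>The integrand is set to 0 at the exceptional points so that it is nonnegative
   everywhere; the version of the fundamental theorem of calculus used here tolerates finitely many
   points without a derivative.\<close>
 define g'' where "g'' x = (if x \<in> {a<..<b} - S then g' x else 0)" for x
 have "(g'' has_integral (g b - g a)) {a..b}"
  by (rule fundamental_theorem_of_calculus_interior_strong[OF assms(1,2) _ assms(3)])
   (use assms(4) in \<open>auto simp: g''_def has_real_derivative_iff_has_vector_derivative\<close>)
 from has_integral_nonneg[OF this] assms(5) show ?thesis
  by (auto simp: g''_def)
qed

lemma increment_bound_off_finite:
 fixes g h :: "real => real"
 assumes S: "finite S" "a <= b" and c: "continuous_on {a..b} g" "continuous_on {a..b} h"
  and d: "!!x. x \<in> {a<..<b} - S ==> DERIV g x :> g' x"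
   "!!x. x \<in> {a<..<b} - S ==> DERIV h x :> h' x"
  and bd: "!!x. x \<in> {a<..<b} - S ==> \<bar>g' x\<bar> <= h' x"
 shows "\<bar>g b - g a\<bar> <= h b - h a"
proof -
 have "h a + g a <= h b + g b"
  by (rule nondecreasing_off_finite[OF S continuous_on_add[OF c(2,1)] DERIV_add[OF d(2,1)]]) (use bd in force)+
 moreover have "h a - g a <= h b - g b"
  by (rule nondecreasing_off_finite[OF S continuous_on_diff[OF c(2,1)] DERIV_diff[OF d(2,1)]]) (use bd in force)+
 ultimately show ?thesis by linarith
qed

text \<open>A primitive of \<open>F p\<close> that stays continuous at 0, where \<open>F p\<close>
  is unbounded. It gives the energy a meaning on the light cone, and it tends to the sign function
  as \<open>p\<close> tends to 0.\<close>

definition Gp :: "real => real => real" where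
 "Gp p s = sgn s * \<bar>s\<bar> powr p"

text \<open>This is how the energy controls \<open>F\<close>: multiplied by \<open>s\<close>, it
  becomes a small multiple of a term of the energy.\<close>

lemma F_mult_eq_Gp: "F p s * s = p * Gp p s"
 by (cases "s = 0") (auto simp: F_def Gp_def powr_mult_base sgn_if abs_if powr_diff)

lemma powr_le_affine:
 fixes x :: real
 assumes "0 < x" "0 < p" "p < 1"
 shows "x powr p <= 1 + p * x"
proof -
 have "x powr p * 1 powr (1 - p) <= p * x + (1 - p) * 1"
  by (rule Youngs_inequality_0) (use assms in auto)
 then show ?thesis using assms by simp
qed

lemma abs_Gp_le:
 assumes "0 < x" "\<bar>s\<bar> <= x" "0 < p" "p < 1"
 shows "\<bar>Gp p s\<bar> <= 1 + p * x"
proof (cases "s = 0")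
 case True then show ?thesis using assms by (simp add: Gp_def)
next
 case False
 have "\<bar>Gp p s\<bar> <= \<bar>s\<bar> powr p" by (simp add: Gp_def abs_mult abs_sgn_eq)
 also have "\<dots> <= x powr p" using assms by (intro powr_mono2) auto
 also have "\<dots> <= 1 + p * x" using assms powr_le_affine by simp
 finally show ?thesis .
qed

lemma Gp_pos: "0 < s ==> Gp p s = s powr p"
 by (simp add: Gp_def)

lemma Gp_neg: "s < 0 ==> Gp p s = - ((- s) powr p)"
 by (simp add: Gp_def)

lemma Gp_zero [simp]: "Gp p 0 = 0"
 by (simp add: Gp_def)

lemma Gp_nonneg: "0 <= s ==> 0 <= Gp p s"
 by (simp add: Gp_def)

lemma Gp_nonpos: "s <= 0 ==> Gp p s <= 0"
 by (cases "s = 0") (auto simp: Gp_neg)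

lemma continuous_on_Gp:
 assumes "0 < p" shows "continuous_on UNIV (Gp p)"
proof -
 have eq: "Gp p s = (max s 0) powr p - (max (- s) 0) powr p" for s
  by (cases s "0::real" rule: linorder_cases) (auto simp: Gp_def)
 have "continuous_on UNIV (\<lambda>s. (max s 0) powr p - (max (- s) 0) powr p)"
  using assms by (intro continuous_intros continuous_on_powr') auto
 then show ?thesis by (simp add: eq)
qed

lemma DERIV_Gp:
 assumes "s \<noteq> 0"
 shows "DERIV (Gp p) s :> F p s"
proof (cases "s > 0")
 case True
 have "DERIV (\<lambda>s. s powr p) s :> F p s"
  using True by (auto intro!: derivative_eq_intros simp: F_def powr_diff)
 then show ?thesis
  by (rule has_field_derivative_transform_within_open[where S="{0<..}"]) (use True in \<open>auto simp: Gp_def\<close>)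
next
 case False
 with assms have "s < 0" by simp
 have "DERIV (\<lambda>s. - ((- s) powr p)) s :> F p s"
  using \<open>s < 0\<close> by (auto intro!: derivative_eq_intros simp: F_def powr_diff)
 then show ?thesis
  by (rule has_field_derivative_transform_within_open[where S="{..<0}"]) (use \<open>s < 0\<close> in \<open>auto simp: Gp_def\<close>)
qed

section \<open>Constants and the weight of the quadratic energy\<close>

locale frequency =
 fixes m \<Omega> :: real
 assumes m_pos: "0 < m" and m_less: "m < \<Omega>"
begin

definition "a = \<Omega> - m"
definition "b = \<Omega> + m"
definition "\<kappa> = sqrt (a * b)"
text \<open>From this radius on the phase is shown to increase. The factor 1.3 meets two opposite
  demands: it is sufficiently above 1 for sin phi / r to take at most the fraction 10/13 of
  \<open>wt\<close>, and below sqrt 2, so that the bound \<open>a / 2 * r\<close> on tan (phi / 2)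
  is still smaller than \<open>q1\<close> at this radius.\<close>

definition "r0 = 13 / (10 * \<kappa>)"
text \<open>The bound 1/10 keeps \<open>F\<close> from using up the rotation that the radial term
  leaves; the bound a/20 makes \<open>p * E\<close> negligible against \<open>a * E\<close> in the
  energy and yields \<open>Cg * p <= 1 / 2\<close>.\<close>

definition "p1 = min (1 / 10) (a / 20)"

lemma a_pos: "0 < a" and b_pos: "0 < b" and a_less_b: "a < b" and Om_pos: "0 < \<Omega>"
 using m_pos m_less by (auto simp: a_def b_def)

lemma kappa_pos: "0 < \<kappa>"
 using a_pos b_pos by (simp add: \<kappa>_def)

lemma kappa_sq: "\<kappa>\<^sup>2 = a * b"
 using a_pos b_pos by (simp add: \<kappa>_def)

lemma kappa_le: "\<kappa> <= \<Omega>"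
proof -
 have "a * b <= \<Omega>\<^sup>2" by (simp add: a_def b_def power2_eq_square algebra_simps)
 then show ?thesis unfolding \<kappa>_def using Om_pos by (simp add: real_le_lsqrt)
qed

lemma r0_pos: "0 < r0"
 using kappa_pos by (simp add: r0_def)

lemma a_le_Om: "a <= \<Omega>"
 using m_pos by (simp add: a_def)

lemma p1_pos: "0 < p1"
 using a_pos by (simp add: p1_def)

text \<open>The quadratic part of the energy per unit of amplitude: \<open>E * wt \<phi>\<close> is
  \<open>b * u^2 + a * v^2\<close>, see \<open>E_wt\<close>. It is also half the speed of rotation
  without \<open>F\<close> and without the term in 1/r.\<close>

definition wt :: "real => real" where
 "wt \<phi> = \<Omega> - m * cos \<phi>"

lemma wt_bounds: "a <= wt \<phi>" "wt \<phi> <= b" "0 < wt \<phi>"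
proof -
 have "\<bar>m * cos \<phi>\<bar> <= m * 1" unfolding abs_mult using m_pos by (intro mult_mono) auto
 then show "a <= wt \<phi>" "wt \<phi> <= b" by (auto simp: wt_def a_def b_def abs_le_iff)
 with a_pos show "0 < wt \<phi>" by simp
qed

text \<open>The difference of the squares is (Omega cos phi - m)^2, so \<open>\<kappa>\<close> is
  the best constant. This ties the length scale \<open>r0\<close> to
  \<open>\<kappa>\<close>.\<close>

lemma kappa_sin_le: "\<kappa> * \<bar>sin \<phi>\<bar> <= wt \<phi>"
proof -
 have "(\<kappa> * \<bar>sin \<phi>\<bar>)\<^sup>2 = (\<Omega>\<^sup>2 - m\<^sup>2) * (1 - (cos \<phi>)\<^sup>2)"
  by (simp add: power_mult_distrib kappa_sq a_def b_def sin_squared_eq) (simp add: algebra_simps power2_eq_square)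
 also have "\<dots> = (wt \<phi>)\<^sup>2 - (\<Omega> * cos \<phi> - m)\<^sup>2"
  by (simp add: wt_def power2_eq_square algebra_simps)
 also have "\<dots> <= (wt \<phi>)\<^sup>2" by simp
 finally show ?thesis using wt_bounds(3)[of \<phi>] power2_le_imp_le by fastforce
qed

lemma sin_div_le:
 assumes "r0 <= \<rho>"
 shows "\<bar>sin \<phi>\<bar> / \<rho> <= 10 / 13 * wt \<phi>"
proof -
 have "\<bar>sin \<phi>\<bar> / \<rho> <= \<bar>sin \<phi>\<bar> / r0"
  using assms r0_pos by (intro divide_left_mono) auto
 also have "\<dots> = 10 / 13 * (\<kappa> * \<bar>sin \<phi>\<bar>)" by (simp add: r0_def)
 finally show ?thesis using kappa_sin_le[of \<phi>] by linarith
qed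

end

text \<open>
 With \<open>u = \<surd>E sin (\<phi>/2)\<close>, \<open>v = \<surd>E cos (\<phi>/2)\<close> and \<open>l = ln E\<close>, an orbit is a solution of the system
 in an arbitrary parametrisation: \<open>f\<close> is the speed of the radius and \<open>e\<close> stands for \<open>f Fp(s)\<close>,
 \<open>s = v\<^sup>2 - u\<^sup>2 = E cos \<phi>\<close>. The parametrisation \<open>f = 1\<close> is the original one; for \<open>e = 1\<close> the system
 is regular also at the zeros of \<open>s\<close>, where \<open>f = 0\<close>.
\<close>

locale orbit = frequency +
 fixes p :: real and I S :: "real set" and r f e l \<phi> :: "real => real"
 assumes p_pos: "0 < p" and p_le: "p <= p1"
  and I: "is_interval I" and S: "finite S"
  and cont_r: "continuous_on I r" and cont_l: "continuous_on I l" and cont_phi: "continuous_on I \<phi>"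
  and r_nonneg: "!!t. t \<in> I ==> 0 <= r t"
  and r_pos: "!!t. t \<in> interior I - S ==> 0 < r t"
  and f_nonneg: "!!t. t \<in> interior I - S ==> 0 <= f t"
  and e_nonneg: "!!t. t \<in> interior I - S ==> 0 <= e t"
  \<comment> \<open>This is \<open>e = f * F p s\<close> multiplied by \<open>s\<close>, a form that
    keeps its meaning on the light cone.\<close>
  and rel: "!!t. t \<in> interior I - S ==> e t * (exp (l t) * cos (\<phi> t)) = p * Gp p (exp (l t) * cos (\<phi> t)) * f t"
  and dr: "!!t. t \<in> interior I - S ==> DERIV r t :> f t"
  and dl: "!!t. t \<in> interior I - S ==> DERIV l t :> - 2 * (sin (\<phi> t) * (m * f t + e t) + f t * (1 - cos (\<phi> t)) / r t)"
  and dphi: "!!t. t \<in> interior I - S ==> DERIV \<phi> t :> 2 * f t * (wt (\<phi> t) - sin (\<phi> t) / r t) - 2 * e t * cos (\<phi> t)"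
  \<comment> \<open>Assumed instead of derived, since the chain rule through \<open>Gp\<close> fails
    at zeros of \<open>s\<close>; in the regular parametrisation \<open>G\<close> is differentiable
    there all the same.\<close>
  and dG: "!!t. t \<in> interior I - S ==> DERIV (\<lambda>t. Gp p (exp (l t) * cos (\<phi> t))) t :> - 2 * e t * exp (l t) * (\<Omega> * sin (\<phi> t) - (1 - cos (\<phi> t)) / r t)"
begin

definition "E t = exp (l t)"
definition "G t = Gp p (exp (l t) * cos (\<phi> t))"
definition "h t = E t * wt (\<phi> t) - G t"
definition "u t = exp (l t / 2) * sin (\<phi> t / 2)"
definition "v t = exp (l t / 2) * cos (\<phi> t / 2)"

lemma p_bounds: "p <= 1 / 10" "p <= a / 20" "p < 1"
 using p_le by (auto simp: p1_def)

lemma E_pos: "0 < E t"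
 by (simp add: E_def)

lemma cont_E: "continuous_on I E"
 unfolding E_def[abs_def] by (intro continuous_intros cont_l)

lemma cont_G: "continuous_on I G"
 unfolding G_def[abs_def]
 by (intro continuous_on_compose2[OF continuous_on_Gp] continuous_intros cont_l cont_phi p_pos) auto

lemma cont_h: "continuous_on I h"
 unfolding h_def[abs_def] wt_def by (intro continuous_intros cont_E cont_G cont_phi)

lemma cont_u: "continuous_on I u" and cont_v: "continuous_on I v"
 unfolding u_def[abs_def] v_def[abs_def] by (intro continuous_intros cont_l cont_phi; simp)+

lemma E_eq: "E t = (u t)\<^sup>2 + (v t)\<^sup>2"
proof -
 have "(u t)\<^sup>2 + (v t)\<^sup>2 = (exp (l t / 2))\<^sup>2 * ((sin (\<phi> t / 2))\<^sup>2 + (cos (\<phi> t / 2))\<^sup>2)"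
  unfolding u_def v_def by (simp only: power_mult_distrib distrib_left)
 also have "\<dots> = E t" unfolding E_def by (simp flip: exp_double)
 finally show ?thesis by simp
qed

lemma s_eq: "E t * cos (\<phi> t) = (v t)\<^sup>2 - (u t)\<^sup>2"
proof -
 have "cos (\<phi> t) = (cos (\<phi> t / 2))\<^sup>2 - (sin (\<phi> t / 2))\<^sup>2"
  using cos_double[of "\<phi> t / 2"] by simp
 then show ?thesis unfolding u_def v_def E_def
  by (simp add: power_mult_distrib right_diff_distrib flip: exp_double)
qed

lemma Icc: "s \<in> I ==> t \<in> I ==> {s..t} \<subseteq> I"
 using I unfolding is_interval_1 by (meson atLeastAtMost_iff subsetI)

lemma Ioo: "s \<in> I ==> t \<in> I ==> {s<..<t} \<subseteq> interior I"
 by (rule interior_maximal) (use Icc[of s t] in auto)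

lemma nondecreasing:
 assumes "s \<in> I" "t \<in> I" "s <= t" "continuous_on {s..t} g"
  and "!!x. x \<in> {s<..<t} - S ==> DERIV g x :> g' x"
  and "!!x. x \<in> {s<..<t} - S ==> x \<in> I ==> x \<in> interior I - S ==> 0 <= g' x"
 shows "g s <= g t"
proof (rule nondecreasing_off_finite[OF S assms(3,4,5)])
 fix x assume x: "x \<in> {s<..<t} - S"
 then have "x \<in> interior I - S" using Ioo[OF assms(1,2)] by blast
 moreover from this have "x \<in> I" using interior_subset[of I] by blast
 ultimately show "0 <= g' x" using assms(6) x by simp
qed

lemmas cont_sub = continuous_on_subset[OF _ Icc]

lemma G_abs: "\<bar>G t\<bar> <= 1 + p * E t"
 unfolding G_def E_def
 by (rule abs_Gp_le) (use p_pos p_bounds in \<open>auto simp: abs_mult\<close>)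

lemma dE: "t \<in> interior I - S ==> DERIV E t :> E t * (- 2 * (sin (\<phi> t) * (m * f t + e t) + f t * (1 - cos (\<phi> t)) / r t))"
 unfolding E_def[abs_def] by (rule derivative_eq_intros dl refl | assumption)+

text \<open>Without the term 2 u / r the equations are Hamiltonian, with half the energy as
  Hamiltonian. Hence only terms with a factor 1/r survive: energy is lost to the radial friction
  alone.\<close>

lemma dh: assumes "t \<in> interior I - S"
 shows "DERIV h t :> - 2 * E t * (1 - cos (\<phi> t)) * (b * f t + e t) / r t"
proof -
 define R where "R = inverse (r t)"
 have sq: "(sin (\<phi> t))\<^sup>2 = 1 - (cos (\<phi> t))\<^sup>2" by (simp add: sin_squared_eq)
 show ?thesis
  unfolding h_def[abs_def] G_def[abs_def] wt_def
  apply (rule derivative_eq_intros dE dphi dG assms refl)+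
  unfolding divide_inverse R_def[symmetric] wt_def b_def E_def[symmetric]
  using sq by algebra
qed

lemma h_antimono: assumes "s \<in> I" "t \<in> I" "s <= t" shows "h t <= h s"
proof -
 have "- h s <= - h t"
 proof (rule nondecreasing[OF assms])
  show "continuous_on {s..t} (\<lambda>t. - h t)"
   by (intro continuous_intros cont_sub[OF cont_h] assms)
  show "DERIV (\<lambda>t. - h t) x :> - (- 2 * E x * (1 - cos (\<phi> x)) * (b * f x + e x) / r x)" if "x \<in> {s<..<t} - S" for x
   by (rule DERIV_minus[OF dh]) (use that Ioo[OF assms(1,2)] in blast)
  show "0 <= - (- 2 * E x * (1 - cos (\<phi> x)) * (b * f x + e x) / r x)" if x: "x \<in> interior I - S" for x
  proof -
   have "0 <= b * f x + e x" using f_nonneg[OF x] e_nonneg[OF x] b_pos by simp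
   moreover have "0 <= 1 - cos (\<phi> x)" by simp
   ultimately have "0 <= 2 * E x * (1 - cos (\<phi> x)) * (b * f x + e x) / r x"
    using r_pos[OF x] less_imp_le[OF E_pos[of x]] by (intro divide_nonneg_pos mult_nonneg_nonneg) auto
   then show ?thesis by simp
  qed
 qed
 then show ?thesis by simp
qed

lemma r_mono: assumes "s \<in> I" "t \<in> I" "s <= t" shows "r s <= r t"
proof (rule nondecreasing[OF assms cont_sub[OF cont_r assms(1,2)]])
 show "DERIV r x :> f x" if "x \<in> {s<..<t} - S" for x
  by (rule dr) (use that Ioo[OF assms(1,2)] in blast)
qed (rule f_nonneg)

text \<open>Nonnegative energy bounds the singular term, which opposes the rotation, by a small multiple of the regular one.\<close>

lemma e_cos_le:
 assumes "t \<in> interior I - S" "0 <= h t"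
 shows "e t * cos (\<phi> t) <= p * f t * wt (\<phi> t)"
proof -
 have "E t * (e t * cos (\<phi> t)) = p * f t * G t"
  using rel[OF assms(1)] by (simp add: E_def G_def mult_ac)
 also have "\<dots> <= p * f t * (E t * wt (\<phi> t))"
  using assms(2) p_pos f_nonneg[OF assms(1)] by (intro mult_left_mono) (auto simp: h_def)
 finally have "E t * (e t * cos (\<phi> t)) <= E t * (p * f t * wt (\<phi> t))" by (simp add: mult_ac)
 then show ?thesis using E_pos by simp
qed

text \<open>The full speed of rotation is twice \<open>f * wt\<close>. Of it the radial term takes
  at most 10/13 and \<open>F\<close> at most 1/10, and twice the remaining 17/130 exceeds
  1/4.\<close>

lemma dphi_lower:
 assumes "t \<in> interior I - S" "0 <= h t" "r0 <= r t"
 shows "a / 4 * f t <= 2 * f t * (wt (\<phi> t) - sin (\<phi> t) / r t) - 2 * e t * cos (\<phi> t)"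
proof -
 have 1: "sin (\<phi> t) / r t <= 10 / 13 * wt (\<phi> t)"
 proof -
  have "sin (\<phi> t) / r t <= \<bar>sin (\<phi> t)\<bar> / r t"
   using assms(3) r0_pos by (intro divide_right_mono) auto
  then show ?thesis using sin_div_le[OF assms(3), of "\<phi> t"] by linarith
 qed
 have f: "0 <= f t" using f_nonneg[OF assms(1)] .
 have "p * f t * wt (\<phi> t) <= 1 / 10 * f t * wt (\<phi> t)"
  using p_bounds f wt_bounds[of "\<phi> t"] by (intro mult_right_mono) auto
 with e_cos_le[OF assms(1,2)] have 2: "e t * cos (\<phi> t) <= f t * (1 / 10 * wt (\<phi> t))" by simp
 have "f t * (a / 4) <= f t * (2 * (wt (\<phi> t) - 10 / 13 * wt (\<phi> t) - 1 / 10 * wt (\<phi> t)))"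
  using wt_bounds(1)[of "\<phi> t"] a_pos by (intro mult_left_mono f) simp
 also have "\<dots> <= 2 * (f t * (wt (\<phi> t) - sin (\<phi> t) / r t)) - 2 * (f t * (1 / 10 * wt (\<phi> t)))"
 proof -
  have "f t * (wt (\<phi> t) - 10 / 13 * wt (\<phi> t)) <= f t * (wt (\<phi> t) - sin (\<phi> t) / r t)"
   using 1 by (intro mult_left_mono f) simp
  then show ?thesis by (simp add: algebra_simps)
 qed
 finally show ?thesis using 2 by (simp add: algebra_simps)
qed

text \<open>Read the other way round, a bound on the phase is a bound on the radius: an orbit with
  nonnegative energy and bounded phase cannot extend to infinity.\<close>

lemma phi_increase:
 assumes "s \<in> I" "t \<in> I" "s <= t" "0 <= h t" "r0 <= r s"
 shows "a / 4 * (r t - r s) <= \<phi> t - \<phi> s"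
proof -
 have "\<phi> s - a / 4 * r s <= \<phi> t - a / 4 * r t"
 proof (rule nondecreasing[OF assms(1-3)])
  show "continuous_on {s..t} (\<lambda>t. \<phi> t - a / 4 * r t)"
   by (intro continuous_intros cont_sub[OF cont_phi] cont_sub[OF cont_r] assms)
  show "DERIV (\<lambda>t. \<phi> t - a / 4 * r t) x :> (2 * f x * (wt (\<phi> x) - sin (\<phi> x) / r x) - 2 * e x * cos (\<phi> x)) - a / 4 * f x"
   if "x \<in> {s<..<t} - S" for x
  proof -
   have x: "x \<in> interior I - S" using that Ioo[OF assms(1,2)] by blast
   show ?thesis by (rule DERIV_diff[OF dphi[OF x] DERIV_cmult[OF dr[OF x]]])
  qed
  show "0 <= (2 * f x * (wt (\<phi> x) - sin (\<phi> x) / r x) - 2 * e x * cos (\<phi> x)) - a / 4 * f x"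
   if "x \<in> {s<..<t} - S" "x \<in> I" "x \<in> interior I - S" for x
   using dphi_lower[OF that(3)] h_antimono[OF that(2) assms(2)] r_mono[OF assms(1) that(2)] that assms
   by auto
 qed
 then show ?thesis by (simp add: right_diff_distrib)
qed

lemma phi_mono:
 assumes "s \<in> I" "t \<in> I" "s <= t" "0 <= h t" "r0 <= r s"
 shows "\<phi> s <= \<phi> t"
proof -
 have "0 <= a / 4 * (r t - r s)" using r_mono[OF assms(1-3)] a_pos by simp
 then show ?thesis using phi_increase[OF assms] by linarith
qed

text \<open>\<open>G\<close> grows at most like \<open>1 + p * E\<close>, so the energy bounds the
  amplitude; \<open>h_lower\<close> is the opposite bound. The additive 1 reflects that
  \<open>G\<close> is of order 1 for small \<open>p\<close>.\<close>

lemma E_upper: "a / 2 * E t <= h t + 1"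
proof -
 have "a * E t <= wt (\<phi> t) * E t" using wt_bounds(1) E_pos[of t] by (intro mult_right_mono) auto
 also have "\<dots> = h t + G t" by (simp add: h_def)
 also have "\<dots> <= h t + 1 + p * E t" using G_abs[of t] by linarith
 also have "p * E t <= a / 20 * E t" using p_bounds E_pos[of t] by (intro mult_right_mono) auto
 finally have "a * E t - a / 20 * E t <= h t + 1" by simp
 moreover have "a / 2 * E t <= a * E t - a / 20 * E t" using a_pos E_pos[of t] by (simp add: field_simps)
 ultimately show ?thesis by linarith
qed

end

section \<open>The phase near the centre\<close>

context frequency
begin

text \<open>At tan (phi / 2) = \<open>q1\<close> the term \<open>b * q^2\<close> equals
  \<open>a / 2\<close>; below it \<open>a + b * q^2\<close> is at most \<open>3 / 2 * a\<close>,
  which is the slope that \<open>initial_phase_aux\<close> can afford.\<close>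

definition "q1 = sqrt (a / (2 * b))"

lemma q1_bounds: "0 < q1" "q1\<^sup>2 = a / (2 * b)" "q1 < 1" "a / 2 * r0 < q1" "2 * q1\<^sup>2 <= 1"
proof -
 show 0: "0 < q1" using a_pos b_pos by (simp add: q1_def)
 show 1: "q1\<^sup>2 = a / (2 * b)" using a_pos b_pos by (simp add: q1_def)
 show 2: "2 * q1\<^sup>2 <= 1" unfolding 1 using a_less_b b_pos by (simp add: field_simps)
 show "q1 < 1"
 proof (rule ccontr)
  assume "\<not> q1 < 1"
  then have "1\<^sup>2 <= q1\<^sup>2" by (intro power_mono) auto
  with 2 show False by simp
 qed
 have "(a / 2 * r0)\<^sup>2 = a\<^sup>2 / 4 * (169 / (100 * (a * b)))"
  by (simp add: r0_def power_mult_distrib power_divide kappa_sq)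
 also have "\<dots> < a / (2 * b)"
  using a_pos b_pos by (simp add: field_simps power2_eq_square)
 finally have "(a / 2 * r0)\<^sup>2 < q1\<^sup>2" by (simp add: 1)
 then show "a / 2 * r0 < q1" using 0 by (meson less_imp_le power_less_imp_less_base)
qed

lemma cos_half_pos:
 fixes x :: real
 assumes "\<bar>x\<bar> < pi" shows "0 < cos (x / 2)"
 using assms by (intro cos_gt_zero_pi) auto

lemma half_angle:
 assumes "\<bar>x\<bar> < pi"
 shows "cos x * (1 + (tan (x / 2))\<^sup>2) = 1 - (tan (x / 2))\<^sup>2"
  and "sin x * (1 + (tan (x / 2))\<^sup>2) = 2 * tan (x / 2)"
  and "wt x * (1 + (tan (x / 2))\<^sup>2) = a + b * (tan (x / 2))\<^sup>2"
proof -
 have c: "cos (x / 2) \<noteq> 0" using cos_half_pos[OF assms] by simp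
 have n: "1 + (tan (x / 2))\<^sup>2 \<noteq> 0" by (metis add.commute power_one sum_power2_eq_zero_iff zero_neq_one)
 show 1: "cos x * (1 + (tan (x / 2))\<^sup>2) = 1 - (tan (x / 2))\<^sup>2"
  using cos_tan_half[OF c] n by (simp add: field_simps)
 show "sin x * (1 + (tan (x / 2))\<^sup>2) = 2 * tan (x / 2)"
  using sin_tan_half[of "x / 2"] n by (simp add: field_simps)
 show "wt x * (1 + (tan (x / 2))\<^sup>2) = a + b * (tan (x / 2))\<^sup>2"
  using 1 unfolding wt_def a_def b_def by algebra
qed

end

context orbit
begin

lemma r_pos': assumes "s \<in> I" "t \<in> I" "s < t" shows "0 < r t"
proof -
 have "infinite ({s<..<t} - S)" using assms S by simp
 then obtain x where x: "x \<in> {s<..<t} - S" by (metis ex_in_conv finite.emptyI)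
 then have i: "x \<in> interior I - S" using Ioo[OF assms(1,2)] by blast
 then have "x \<in> I" using interior_subset[of I] by blast
 from r_mono[OF this assms(2)] r_pos[OF i] x show ?thesis by simp
qed

text \<open>The quotient \<open>u / v\<close>. It satisfies a Riccati equation, which stays
  manageable near the centre, where 1/r is too large for \<open>dphi_lower\<close>.\<close>

definition "q t = tan (\<phi> t / 2)"

lemma dq:
 assumes "t \<in> interior I - S" "\<bar>\<phi> t\<bar> < pi"
 shows "DERIV q t :> f t * (a + b * (q t)\<^sup>2 - 2 * q t / r t) - e t * (1 - (q t)\<^sup>2)"
proof -
 have c: "cos (\<phi> t / 2) \<noteq> 0" using cos_half_pos[OF assms(2)] by simp
 define D where "D = f t * (wt (\<phi> t) - sin (\<phi> t) * inverse (r t)) - e t * cos (\<phi> t)"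
 have "(2 * f t * (wt (\<phi> t) - sin (\<phi> t) / r t) - 2 * e t * cos (\<phi> t)) / 2 = D"
  unfolding D_def divide_inverse[of _ "r t"] by (simp only: diff_divide_distrib mult.assoc)
 then have "DERIV (\<lambda>t. \<phi> t / 2) t :> D"
  using DERIV_cdivide[OF dphi[OF assms(1)], of 2] by simp
 from DERIV_chain2[OF DERIV_tan[OF c] this]
 have 1: "DERIV q t :> inverse ((cos (\<phi> t / 2))\<^sup>2) * D"
  unfolding q_def[abs_def] .
 have "inverse ((cos (\<phi> t / 2))\<^sup>2) = 1 + (q t)\<^sup>2"
  using tan_sec[OF c] by (simp add: q_def power_inverse)
 moreover have "(1 + (q t)\<^sup>2) * D = f t * (a + b * (q t)\<^sup>2 - 2 * q t / r t) - e t * (1 - (q t)\<^sup>2)"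
 proof -
  note half = half_angle[OF assms(2), folded q_def]
  have "(1 + (q t)\<^sup>2) * D = f t * (a + b * (q t)\<^sup>2 - 2 * q t * inverse (r t)) - e t * (1 - (q t)\<^sup>2)"
   unfolding D_def using half by algebra
  then show ?thesis by (simp add: divide_inverse)
 qed
 ultimately show ?thesis using 1 by simp
qed

lemma e_q_le:
 assumes "t \<in> interior I - S" "\<bar>\<phi> t\<bar> < pi" "0 <= h t"
 shows "e t * (1 - (q t)\<^sup>2) <= f t * (a + b * (q t)\<^sup>2)"
proof -
 have "e t * cos (\<phi> t) * (1 + (q t)\<^sup>2) <= p * f t * wt (\<phi> t) * (1 + (q t)\<^sup>2)"
  by (intro mult_right_mono e_cos_le assms) simp
 then have "e t * (1 - (q t)\<^sup>2) <= p * f t * (a + b * (q t)\<^sup>2)"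
  using half_angle[OF assms(2)] by (simp add: q_def mult.assoc)
 also have "\<dots> = p * (f t * (a + b * (q t)\<^sup>2))" by simp
 also have "\<dots> <= 1 * (f t * (a + b * (q t)\<^sup>2))"
  using p_bounds f_nonneg[OF assms(1)] a_pos b_pos by (intro mult_right_mono mult_nonneg_nonneg) auto
 finally show ?thesis by simp
qed

lemma cont_q: assumes "!!x. x \<in> {s..t} ==> \<bar>\<phi> x\<bar> < pi" "s \<in> I" "t \<in> I"
 shows "continuous_on {s..t} q"
proof -
 have "cos (\<phi> x / 2) \<noteq> 0" if "x \<in> {s..t}" for x
  using cos_half_pos[OF assms(1)[OF that]] by simp
 then show ?thesis
  unfolding q_def[abs_def] by (intro continuous_intros cont_sub[OF cont_phi] assms) auto
qed

text \<open>The weight \<open>r^2\<close> removes the singular term of the Riccati equation. The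
  remaining derivative of \<open>r^2 * q\<close> lies between 0 and that of
  \<open>a / 2 * r^3\<close> as long as \<open>q\<close> stays below \<open>q1\<close>, which is
  guaranteed by the assumption \<open>small\<close>.\<close>

lemma initial_phase_aux:
 assumes st: "s \<in> I" "t \<in> I" "s <= t" and h: "0 <= h t"
  and init: "0 <= q s" "q s <= a / 2 * r s"
  and small: "!!x. x \<in> {s..t} ==> \<bar>\<phi> x\<bar> <= 2 * arctan q1"
 shows "0 <= q t" "q t <= a / 2 * r t"
proof -
 have lt: "2 * arctan q1 < pi" using arctan_ubound[of q1] by simp
 have phi: "\<bar>\<phi> x\<bar> < pi" if "x \<in> {s..t}" for x using small[OF that] lt by simp
 have qx: "\<bar>q x\<bar> <= q1" if "x \<in> {s..t}" for x
 proof -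
  have "tan \<bar>\<phi> x / 2\<bar> <= tan (arctan q1)"
   using small[OF that] arctan_ubound[of q1] by (intro tan_mono_le) auto
  moreover have "tan \<bar>\<phi> x / 2\<bar> = \<bar>q x\<bar> \<or> - \<bar>q x\<bar> <= tan \<bar>\<phi> x / 2\<bar>"
   by (cases "\<phi> x \<ge> 0") (auto simp: q_def abs_if)
  moreover have "0 <= tan \<bar>\<phi> x / 2\<bar>"
   using phi[OF that] tan_pos_pi2_le[of "\<bar>\<phi> x / 2\<bar>"] by simp
  ultimately show ?thesis
   by (cases "\<phi> x \<ge> 0") (auto simp: q_def abs_if tan_arctan)
 qed
 have cq: "continuous_on {s..t} q" by (rule cont_q[OF phi st(1,2)])
 have cr: "continuous_on {s..t} r" by (rule cont_sub[OF cont_r st(1,2)])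
 have int: "x \<in> interior I - S" "x \<in> I" "0 <= h x" "\<bar>\<phi> x\<bar> < pi" "\<bar>q x\<bar> <= q1" if "x \<in> {s<..<t} - S" for x
 proof -
  show "x \<in> interior I - S" using that Ioo[OF st(1,2)] by blast
  then show "x \<in> I" using interior_subset by blast
  from h_antimono[OF this st(2)] that h show "0 <= h x" by simp
  show "\<bar>\<phi> x\<bar> < pi" "\<bar>q x\<bar> <= q1" using phi[of x] qx[of x] that by auto
 qed
 define Q where "Q x = f x * (a + b * (q x)\<^sup>2) - e x * (1 - (q x)\<^sup>2)" for x
 have der: "DERIV (\<lambda>x. (r x)\<^sup>2 * q x) x :> (r x)\<^sup>2 * Q x" if "x \<in> {s<..<t} - S" for x
  apply (rule derivative_eq_intros dq[OF int(1,4)[OF that]] dr[OF int(1)[OF that]] refl)+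
  using r_pos[OF int(1)[OF that]] by (simp add: Q_def power2_eq_square field_simps)
 have der2: "DERIV (\<lambda>x. a / 2 * (r x) ^ 3 - (r x)\<^sup>2 * q x) x :> (r x)\<^sup>2 * (3 / 2 * a * f x - Q x)" if "x \<in> {s<..<t} - S" for x
  apply (rule DERIV_cong[OF DERIV_diff[OF _ der[OF that]]])
  apply (rule derivative_eq_intros dr[OF int(1)[OF that]] refl)+
  by (simp add: power2_eq_square algebra_simps)
 have "(r s)\<^sup>2 * q s <= (r t)\<^sup>2 * q t"
 proof (rule nondecreasing[OF st _ der])
  show "continuous_on {s..t} (\<lambda>x. (r x)\<^sup>2 * q x)" by (intro continuous_intros cq cr)
  show "0 <= (r x)\<^sup>2 * Q x" if "x \<in> {s<..<t} - S" for x
   using e_q_le[OF int(1,4,3)[OF that]] by (simp add: Q_def)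
 qed auto
 with init(1) have 1: "0 <= (r t)\<^sup>2 * q t"
  by (meson mult_nonneg_nonneg order_trans zero_le_power2)
 have "a / 2 * (r s) ^ 3 - (r s)\<^sup>2 * q s <= a / 2 * (r t) ^ 3 - (r t)\<^sup>2 * q t"
 proof (rule nondecreasing[OF st _ der2])
  show "continuous_on {s..t} (\<lambda>x. a / 2 * (r x) ^ 3 - (r x)\<^sup>2 * q x)" by (intro continuous_intros cq cr)
  show "0 <= (r x)\<^sup>2 * (3 / 2 * a * f x - Q x)" if "x \<in> {s<..<t} - S" for x
  proof -
   note i = int[OF that]
   have q2: "(q x)\<^sup>2 <= q1\<^sup>2" using i(5) q1_bounds(1) by (simp add: abs_le_square_iff[symmetric])
   then have "b * (q x)\<^sup>2 <= b * (a / (2 * b))" using b_pos q1_bounds(2) by (intro mult_left_mono) auto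
   then have "b * (q x)\<^sup>2 <= a / 2" using b_pos by simp
   then have "f x * (a + b * (q x)\<^sup>2) <= f x * (3 / 2 * a)"
    using f_nonneg[OF i(1)] by (intro mult_left_mono) auto
   moreover have "0 <= e x * (1 - (q x)\<^sup>2)"
    using q2 q1_bounds(5) e_nonneg[OF i(1)] by (intro mult_nonneg_nonneg) auto
   ultimately have "0 <= 3 / 2 * a * f x - Q x" unfolding Q_def by (simp add: mult.commute)
   then show ?thesis by simp
  qed
 qed auto
 moreover have "0 <= a / 2 * (r s) ^ 3 - (r s)\<^sup>2 * q s"
 proof -
  have "(r s)\<^sup>2 * q s <= (r s)\<^sup>2 * (a / 2 * r s)" using init(2) by (intro mult_left_mono) auto
  then show ?thesis by (simp add: power2_eq_square power3_eq_cube mult_ac)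
 qed
 ultimately have 2: "(r t)\<^sup>2 * q t <= (r t)\<^sup>2 * (a / 2 * r t)"
  by (simp add: power2_eq_square power3_eq_cube mult_ac)
 show "0 <= q t"
  using 1 r_pos'[OF st(1,2)] st(3) init(1) by (cases "s = t") (auto simp: zero_le_mult_iff)
 show "q t <= a / 2 * r t"
  using 2 r_pos'[OF st(1,2)] st(3) init(2) by (cases "s = t") auto
qed

lemma arctan_q: "\<bar>\<phi> t\<bar> < pi ==> \<phi> t = 2 * arctan (q t)"
 unfolding q_def by (subst arctan_tan) auto

text \<open>A continuity argument disposes of the assumption \<open>small\<close> of
  \<open>initial_phase_aux\<close>: at the first parameter where the phase reaches
  \<open>2 * arctan q1\<close>, the bound \<open>a / 2 * r\<close> on \<open>q\<close> is still
  strictly below \<open>q1\<close>, a contradiction.\<close>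

lemma initial_phase:
 assumes st: "s \<in> I" "t \<in> I" "s <= t" and h: "0 <= h t" and r: "r t <= r0"
  and init: "\<bar>\<phi> s\<bar> < pi" "0 <= q s" "q s <= a / 2 * r s"
 shows "0 <= q t" "q t <= a / 2 * r t" "q t < q1" "0 <= \<phi> t" "\<phi> t < pi / 2"
proof -
 have lt: "2 * arctan q1 < pi / 2"
  using arctan_less_iff[of q1 1] q1_bounds(3) by (simp add: arctan_one)
 have bd: "0 <= \<phi> x \<and> \<phi> x < 2 * arctan q1 \<and> q x < q1"
  if "\<bar>\<phi> x\<bar> < pi" "0 <= q x" "q x <= a / 2 * r x" "r x <= r0" for x
 proof -
  have "a / 2 * r x <= a / 2 * r0" using that a_pos by (intro mult_left_mono) auto
  then have "q x < q1" using that q1_bounds(4) by linarith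
  then show ?thesis using that arctan_q[of x] by (simp add: arctan_less_iff)
 qed
 have rle: "r x <= r0" if "x \<in> {s..t}" for x
  using r_mono[of x t] r st Icc[OF st(1,2)] that by fastforce
 have small: "\<bar>\<phi> x\<bar> <= 2 * arctan q1" if x: "x \<in> {s..t}" for x
 proof (rule ccontr)
  define X where "X = {y \<in> {s..t}. 2 * arctan q1 <= \<bar>\<phi> y\<bar>}"
  assume "\<not> \<bar>\<phi> x\<bar> <= 2 * arctan q1"
  then have "X \<noteq> {}" using x by (auto simp: X_def)
  moreover have "compact X"
  proof -
   have "closed ({s..t} \<inter> (\<lambda>y. \<bar>\<phi> y\<bar>) -` {2 * arctan q1..})"
    by (rule continuous_closed_preimage)
     (auto intro!: continuous_intros cont_sub[OF cont_phi] st)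
   also have "{s..t} \<inter> (\<lambda>y. \<bar>\<phi> y\<bar>) -` {2 * arctan q1..} = X" by (auto simp: X_def)
   finally show ?thesis by (auto simp: X_def compact_eq_bounded_closed intro: bounded_subset[of "{s..t}"])
  qed
  ultimately obtain y where y: "y \<in> X" and min: "!!z. z \<in> X ==> y <= z"
   using compact_attains_inf by metis
  have y': "y \<in> {s..t}" using y by (simp add: X_def)
  then have yI: "y \<in> I" using Icc[OF st(1,2)] by blast
  have below: "\<bar>\<phi> z\<bar> < 2 * arctan q1" if "z \<in> {s..<y}" for z
  proof (rule ccontr)
   assume "\<not> \<bar>\<phi> z\<bar> < 2 * arctan q1"
   then have "z \<in> X" using that y' by (auto simp: X_def)
   from min[OF this] that show False by simp
  qed
  have ys: "\<bar>\<phi> y\<bar> <= 2 * arctan q1"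
  proof (cases "y = s")
   case True
   then show ?thesis using bd[OF init rle[of s]] st by auto
  next
   case False
   then have "s < y" using y' by simp
   have "continuous_on {s..y} (\<lambda>y. \<bar>\<phi> y\<bar>)" by (intro continuous_intros cont_sub[OF cont_phi] st yI)
   moreover have "closure {s<..<y} = {s..y}" using \<open>s < y\<close> by simp
   ultimately show ?thesis
    using continuous_le_on_closure[of "{s<..<y}" "\<lambda>y. \<bar>\<phi> y\<bar>" y "2 * arctan q1"] below \<open>s < y\<close>
    by (simp add: less_imp_le)
  qed
  have hy: "0 <= h y" using h_antimono[OF yI st(2)] h y' by simp
  have "\<bar>\<phi> z\<bar> <= 2 * arctan q1" if "z \<in> {s..y}" for z
   using below[of z] ys that by (cases "z = y") auto
  from initial_phase_aux[OF st(1) yI _ hy init(2,3) this] y'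
  have "0 <= q y" "q y <= a / 2 * r y" by auto
  from bd[OF _ this rle[OF y']] ys lt pi_gt_zero have "\<bar>\<phi> y\<bar> < 2 * arctan q1" by auto
  then show False using y by (simp add: X_def)
 qed
 from initial_phase_aux[OF st h init(2,3) this]
 show 1: "0 <= q t" "q t <= a / 2 * r t" by auto
 have "\<bar>\<phi> t\<bar> < pi" using small[of t] lt pi_gt_zero st by simp
 from bd[OF this 1 r] lt show "q t < q1" "0 <= \<phi> t" "\<phi> t < pi / 2" by auto
qed

end

section \<open>Decay of the amplitude, arc by arc\<close>

context frequency
begin

text \<open>Beyond \<open>r0\<close> the logarithm of the amplitude decreases at most at this rate
  per unit of radius, up to the contribution of \<open>F\<close>.\<close>

definition "Kg = 2 * m + 4 / r0"
text \<open>Chosen so that \<open>Cg\<close> times the decrease of \<open>G\<close> pays for the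
  amplitude lost to \<open>F\<close>: \<open>2 * Cg * (2 / 13 * \<Omega>) = 2\<close>, where 2/13 is
  the part of \<open>\<Omega> * sin \<phi>\<close> that the radial term leaves in
  \<open>E_phase_falling\<close>.\<close>

definition "Cg = 13 / (2 * \<Omega>)"
text \<open>One factor for all three arcs of \<open>mark\<close>: \<open>4 * pi / a\<close> bounds
  the radius spent on half a turn, 100/9 is the price of \<open>F\<close> where cos phi is below
  -9/100, and the 3 comes from comparing \<open>E\<close> with the corrected amplitude in
  \<open>E_phase_falling\<close>.\<close>

definition "\<gamma> = exp (- (2 * Kg * (4 * pi / a)) - 100 * pi / 9) / 3"

lemma Kg_pos: "0 < Kg"
 using m_pos r0_pos by (simp add: Kg_def add_pos_pos)

lemma Cg_pos: "0 < Cg"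
 using Om_pos by (simp add: Cg_def)

lemma gamma_bounds: "0 < \<gamma>" "\<gamma> <= 1" "3 * \<gamma> <= exp (- (2 * (Kg * (4 * pi / a))))"
 "\<gamma> <= exp (- (Kg * (4 * pi / a)) - 100 * pi / 9)"
proof -
 define X where "X = Kg * (4 * pi / a)"
 have X: "0 <= X" using Kg_pos a_pos by (simp add: X_def)
 have g: "3 * \<gamma> = exp (- (2 * X) - 100 * pi / 9)" by (simp add: \<gamma>_def X_def)
 show pos: "0 < \<gamma>" by (simp add: \<gamma>_def)
 have "exp (- (2 * X) - 100 * pi / 9) <= exp (- (2 * X))" by simp
 with g show "3 * \<gamma> <= exp (- (2 * (Kg * (4 * pi / a))))" by (simp add: X_def)
 have "exp (- (2 * X) - 100 * pi / 9) <= exp (- X - 100 * pi / 9)" using X by simp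
 with g pos show "\<gamma> <= exp (- (Kg * (4 * pi / a)) - 100 * pi / 9)" unfolding X_def[symmetric] by linarith
 have "exp (- (2 * X) - 100 * pi / 9) <= exp 0" unfolding exp_le_cancel_iff using X pi_gt_zero by linarith
 with g pos show "\<gamma> <= 1" unfolding exp_zero by linarith
qed

end

context orbit
begin

lemma Cg_p_le: "Cg * p <= 1 / 2"
proof -
 have "Cg * p <= Cg * (\<Omega> / 20)" using Cg_pos p_bounds a_le_Om by (intro mult_left_mono) auto
 also have "\<dots> <= 1 / 2" using Om_pos by (simp add: Cg_def)
 finally show ?thesis .
qed

lemma inside:
 assumes "s \<in> I" "t \<in> I" "0 <= h t" "x \<in> {s<..<t} - S"
 shows "x \<in> interior I - S" "x \<in> I" "0 <= h x" "r s <= r x" "r x <= r t"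
  "0 <= f x" "0 <= e x" "0 < r x"
proof -
 show i: "x \<in> interior I - S" using assms(4) Ioo[OF assms(1,2)] by blast
 then show j: "x \<in> I" using interior_subset by blast
 from h_antimono[OF this assms(2)] assms(3,4) show "0 <= h x" by simp
 from r_mono[OF assms(1) j] r_mono[OF j assms(2)] assms(4) show "r s <= r x" "r x <= r t" by auto
 show "0 <= f x" "0 <= e x" "0 < r x" using i f_nonneg e_nonneg r_pos by auto
qed

lemma r_diff_le:
 assumes "s \<in> I" "t \<in> I" "s <= t" "0 <= h t" "r0 <= r s"
 shows "r t - r s <= 4 * (\<phi> t - \<phi> s) / a"
 using phi_increase[OF assms] a_pos by (simp add: field_simps)

lemma dl_lower:
 assumes "x \<in> interior I - S" "r0 <= r x"
 shows "- Kg * f x - 2 * (e x * sin (\<phi> x))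
  <= - 2 * (sin (\<phi> x) * (m * f x + e x) + f x * (1 - cos (\<phi> x)) / r x)"
proof -
 have f: "0 <= f x" using f_nonneg[OF assms(1)] .
 have "m * f x * sin (\<phi> x) <= m * f x * 1" using m_pos f by (intro mult_left_mono) auto
 moreover have "f x * (1 - cos (\<phi> x)) / r x <= f x * 2 / r0"
  using assms(2) r0_pos f cos_ge_minus_one[of "\<phi> x"] by (intro frac_le mult_left_mono) auto
 moreover have "Kg * f x = 2 * (m * f x * 1) + 2 * (f x * 2 / r0)"
  by (simp add: Kg_def distrib_right)
 moreover have eq: "- 2 * (sin (\<phi> x) * (m * f x + e x) + Y)
   = - 2 * (m * f x * sin (\<phi> x)) - 2 * (e x * sin (\<phi> x)) - 2 * Y" for Y
  by (simp add: algebra_simps)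
 ultimately show ?thesis unfolding eq by linarith
qed

lemma sin_r_le:
 assumes "r0 <= r x" shows "sin (\<phi> x) / r x <= wt (\<phi> x)"
proof -
 have "sin (\<phi> x) / r x <= \<bar>sin (\<phi> x)\<bar> / r x" using assms r0_pos by (intro divide_right_mono) auto
 also have "\<dots> <= 10 / 13 * wt (\<phi> x)" by (rule sin_div_le[OF assms])
 also have "\<dots> <= wt (\<phi> x)" using wt_bounds(3)[of "\<phi> x"] by simp
 finally show ?thesis .
qed

text \<open>On this arc the term with \<open>F\<close> increases the amplitude, so only the mass
  term and the radial term have to be paid for.\<close>

lemma E_phase_rising:
 assumes st: "s \<in> I" "t \<in> I" "s <= t" "0 <= h t" "r0 <= r s" "\<phi> t - \<phi> s <= pi"
  and sgn: "!!x. x \<in> {s..t} ==> sin (\<phi> x) <= 0"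
 shows "\<gamma> * E s <= E t"
proof -
 have "l s + Kg * r s <= l t + Kg * r t"
 proof (rule nondecreasing[OF st(1-3)])
  show "continuous_on {s..t} (\<lambda>t. l t + Kg * r t)"
   by (intro continuous_intros cont_sub[OF cont_l] cont_sub[OF cont_r] st)
  fix x assume x: "x \<in> {s<..<t} - S"
  note i = inside[OF st(1,2,4) x]
  show "DERIV (\<lambda>t. l t + Kg * r t) x :> (- 2 * (sin (\<phi> x) * (m * f x + e x) + f x * (1 - cos (\<phi> x)) / r x)) + Kg * f x"
   by (rule DERIV_add[OF dl[OF i(1)] DERIV_cmult[OF dr[OF i(1)]]])
  have rx: "r0 <= r x" using i(4) st(5) by linarith
  have "e x * sin (\<phi> x) <= 0" using sgn[of x] x i(7) by (simp add: mult_nonneg_nonpos)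
  then show "0 <= (- 2 * (sin (\<phi> x) * (m * f x + e x) + f x * (1 - cos (\<phi> x)) / r x)) + Kg * f x"
   using dl_lower[OF i(1) rx] by linarith
 qed
 moreover have "Kg * (r t - r s) <= Kg * (4 * pi / a)"
 proof -
  have "r t - r s <= 4 * pi / a"
   using r_diff_le[OF st(1-5)] st(6) a_pos by (simp add: field_simps)
  then show ?thesis using Kg_pos by (intro mult_left_mono) auto
 qed
 ultimately have "- (Kg * (4 * pi / a)) - 100 * pi / 9 + l s <= l t"
  using pi_gt_zero unfolding right_diff_distrib by linarith
 then have "exp (- (Kg * (4 * pi / a)) - 100 * pi / 9) * E s <= E t"
  by (simp add: E_def flip: exp_add)
 moreover have "\<gamma> * E s <= exp (- (Kg * (4 * pi / a)) - 100 * pi / 9) * E s"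
  using gamma_bounds(4) E_pos[of s] by (intro mult_right_mono) auto
 ultimately show ?thesis by linarith
qed

text \<open>With cos phi negative, \<open>F\<close> also speeds up the rotation. Adding 100/9 times
  the phase to \<open>ln E\<close> offsets what \<open>F\<close> takes from the amplitude, and the
  phase gains at most \<open>pi\<close>.\<close>

lemma E_phase_negative:
 assumes st: "s \<in> I" "t \<in> I" "s <= t" "0 <= h t" "r0 <= r s" "\<phi> t - \<phi> s <= pi"
  and sgn: "!!x. x \<in> {s..t} ==> 0 <= sin (\<phi> x) \<and> cos (\<phi> x) <= - 9 / 100"
 shows "\<gamma> * E s <= E t"
proof -
 have "l s + Kg * r s + 100 / 9 * \<phi> s <= l t + Kg * r t + 100 / 9 * \<phi> t"
 proof (rule nondecreasing[OF st(1-3)])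
  show "continuous_on {s..t} (\<lambda>t. l t + Kg * r t + 100 / 9 * \<phi> t)"
   by (intro continuous_intros cont_sub[OF cont_l] cont_sub[OF cont_r] cont_sub[OF cont_phi] st)
  fix x assume x: "x \<in> {s<..<t} - S"
  note i = inside[OF st(1,2,4) x]
  have sx: "0 <= sin (\<phi> x)" "cos (\<phi> x) <= - 9 / 100" using sgn[of x] x by auto
  show "DERIV (\<lambda>t. l t + Kg * r t + 100 / 9 * \<phi> t) x :> (- 2 * (sin (\<phi> x) * (m * f x + e x) + f x * (1 - cos (\<phi> x)) / r x)) + Kg * f x
    + 100 / 9 * (2 * f x * (wt (\<phi> x) - sin (\<phi> x) / r x) - 2 * e x * cos (\<phi> x))"
   by (rule DERIV_add[OF DERIV_add[OF dl[OF i(1)] DERIV_cmult[OF dr[OF i(1)]]] DERIV_cmult[OF dphi[OF i(1)]]])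
  have rx: "r0 <= r x" using i(4) st(5) by linarith
  have 1: "e x * sin (\<phi> x) <= e x * 1" using i(7) by (intro mult_left_mono) auto
  have 2: "e x * cos (\<phi> x) <= e x * (- 9 / 100)" by (intro mult_left_mono i sx)
  have 3: "0 <= f x * (wt (\<phi> x) - sin (\<phi> x) / r x)"
   using sin_r_le[of x] i st(5) by (intro mult_nonneg_nonneg) auto
  define L where "L = - 2 * (sin (\<phi> x) * (m * f x + e x) + f x * (1 - cos (\<phi> x)) / r x)"
  define W where "W = f x * (wt (\<phi> x) - sin (\<phi> x) / r x)"
  have "0 <= L + Kg * f x + 100 / 9 * (2 * W - 2 * (e x * cos (\<phi> x)))"
   using dl_lower[OF i(1) rx, folded L_def] 1 2 3[folded W_def] by (simp add: algebra_simps)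
  then show "0 <= (- 2 * (sin (\<phi> x) * (m * f x + e x) + f x * (1 - cos (\<phi> x)) / r x)) + Kg * f x
    + 100 / 9 * (2 * f x * (wt (\<phi> x) - sin (\<phi> x) / r x) - 2 * e x * cos (\<phi> x))"
   by (simp add: L_def W_def mult.assoc)
 qed
 moreover have "Kg * (r t - r s) <= Kg * (4 * pi / a)"
 proof -
  have "r t - r s <= 4 * pi / a"
   using r_diff_le[OF st(1-5)] st(6) a_pos by (simp add: field_simps)
  then show ?thesis using Kg_pos by (intro mult_left_mono) auto
 qed
 moreover have "100 / 9 * (\<phi> t - \<phi> s) <= 100 / 9 * pi" using st(6) by (intro mult_left_mono) auto
 ultimately have "- (Kg * (4 * pi / a)) - 100 * pi / 9 + l s <= l t"
  using pi_gt_zero unfolding right_diff_distrib by linarith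
 then have "exp (- (Kg * (4 * pi / a)) - 100 * pi / 9) * E s <= E t"
  by (simp add: E_def flip: exp_add)
 moreover have "\<gamma> * E s <= exp (- (Kg * (4 * pi / a)) - 100 * pi / 9) * E s"
  using gamma_bounds(4) E_pos[of s] by (intro mult_right_mono) auto
 ultimately show ?thesis by linarith
qed

text \<open>Here \<open>s\<close> may change sign, so that \<open>e\<close> is not controlled by \<open>f\<close>; the derivative of \<open>G\<close> absorbs it.\<close>

lemma E_phase_falling:
 assumes st: "s \<in> I" "t \<in> I" "s <= t" "0 <= h t" "r0 <= r s" "\<phi> t - \<phi> s <= pi"
  and sgn: "!!x. x \<in> {s..t} ==> 0 <= sin (\<phi> x) \<and> 1 - cos (\<phi> x) <= 11 / 10 * sin (\<phi> x)"
 shows "\<gamma> * E s - 2 * Cg <= E t"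
proof -
 \<comment> \<open>The amplitude corrected by \<open>G\<close>. The added constant and the bound
   \<open>Cg * p <= 1 / 2\<close> keep \<open>Z\<close> comparable with \<open>E\<close> in spite of
   the correction.\<close>
 define Z where "Z x = E x - Cg * G x + Cg" for x
 have CG: "Cg * \<bar>G x\<bar> <= Cg + E x / 2" for x
 proof -
  have "Cg * \<bar>G x\<bar> <= Cg * (1 + p * E x)" using G_abs Cg_pos by (intro mult_left_mono) auto
  also have "\<dots> = Cg + Cg * p * E x" by (simp add: algebra_simps)
  also have "\<dots> <= Cg + 1 / 2 * E x"
   using Cg_p_le E_pos[of x] by (intro add_left_mono mult_right_mono) auto
  finally show ?thesis by simp
 qed
 have ZE: "E x / 2 <= Z x" "Z x <= 3 / 2 * E x + 2 * Cg" for x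
 proof -
  have "\<bar>Cg * G x\<bar> <= Cg + E x / 2" using CG[of x] Cg_pos by (simp add: abs_mult)
  then show "E x / 2 <= Z x" "Z x <= 3 / 2 * E x + 2 * Cg" unfolding Z_def by (auto simp: abs_le_iff)
 qed
 have "Z s * exp (2 * Kg * r s) <= Z t * exp (2 * Kg * r t)"
 proof (rule nondecreasing[OF st(1-3)])
  show "continuous_on {s..t} (\<lambda>x. Z x * exp (2 * Kg * r x))" unfolding Z_def
   by (intro continuous_intros cont_sub[OF cont_E] cont_sub[OF cont_r] cont_sub[OF cont_G] st)
  fix x assume x: "x \<in> {s<..<t} - S"
  note i = inside[OF st(1,2,4) x]
  have sx: "0 <= sin (\<phi> x)" "1 - cos (\<phi> x) <= 11 / 10 * sin (\<phi> x)" using sgn[of x] x by auto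
  define E' where "E' = E x * (- 2 * (sin (\<phi> x) * (m * f x + e x) + f x * (1 - cos (\<phi> x)) / r x))"
  define G' where "G' = - 2 * e x * exp (l x) * (\<Omega> * sin (\<phi> x) - (1 - cos (\<phi> x)) / r x)"
  have dZ: "DERIV Z x :> (E' - Cg * G')"
   unfolding Z_def[abs_def] E'_def G'_def G_def[abs_def]
   using DERIV_add[OF DERIV_diff[OF dE[OF i(1)] DERIV_cmult[OF dG[OF i(1)]]] DERIV_const] by simp
  have "DERIV (\<lambda>x. exp (2 * Kg * r x)) x :> exp (2 * Kg * r x) * (2 * Kg * f x)"
   by (rule DERIV_chain2[OF DERIV_exp DERIV_cmult[OF dr[OF i(1)]]])
  from DERIV_mult[OF dZ this]
  show "DERIV (\<lambda>x. Z x * exp (2 * Kg * r x)) x :> (E' - Cg * G' + 2 * Kg * f x * Z x) * exp (2 * Kg * r x)"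
   by (simp add: algebra_simps)
  have rx: "r0 <= r x" using i(4) st(5) by linarith
  \<comment> \<open>The ratio 11/10 of this arc and the 10/13 coming from \<open>r0\<close> combine
    to 11/13, which leaves 2/13 of \<open>\<Omega> * sin \<phi>\<close>.\<close>
  have "(1 - cos (\<phi> x)) / r x <= 11 / 10 * (sin (\<phi> x) / r x)"
   using divide_right_mono[OF sx(2), of "r x"] i(8) by simp
  also have "sin (\<phi> x) / r x <= sin (\<phi> x) / r0"
   using rx r0_pos sx i(8) by (intro divide_left_mono) auto
  also have "sin (\<phi> x) / r0 = 10 / 13 * (\<kappa> * sin (\<phi> x))" by (simp add: r0_def)
  also have "\<kappa> * sin (\<phi> x) <= \<Omega> * sin (\<phi> x)" using kappa_le sx by (intro mult_right_mono) auto
  finally have "2 / 13 * (\<Omega> * sin (\<phi> x)) <= \<Omega> * sin (\<phi> x) - (1 - cos (\<phi> x)) / r x" by simp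
  then have "2 * Cg * e x * exp (l x) * (2 / 13 * (\<Omega> * sin (\<phi> x)))
    <= 2 * Cg * e x * exp (l x) * (\<Omega> * sin (\<phi> x) - (1 - cos (\<phi> x)) / r x)"
   using Cg_pos i(7) by (intro mult_left_mono) auto
  also have "\<dots> = - Cg * G'" by (simp add: G'_def)
  also have "2 * Cg * e x * exp (l x) * (2 / 13 * (\<Omega> * sin (\<phi> x))) = E x * (2 * (e x * sin (\<phi> x)))"
   using Om_pos by (simp add: Cg_def E_def)
  finally have 1: "E x * (2 * (e x * sin (\<phi> x))) <= - Cg * G'" .
  have "E x * (- Kg * f x - 2 * (e x * sin (\<phi> x))) <= E'"
   unfolding E'_def using dl_lower[OF i(1) rx] E_pos[of x] by (intro mult_left_mono) auto
  with 1 have "- (Kg * f x * E x) <= E' - Cg * G'" by (simp add: algebra_simps)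
  moreover have "Kg * f x * E x <= Kg * f x * (2 * Z x)"
   using ZE(1)[of x] Kg_pos i(6) by (intro mult_left_mono) auto
  ultimately show "0 <= (E' - Cg * G' + 2 * Kg * f x * Z x) * exp (2 * Kg * r x)"
   by (intro mult_nonneg_nonneg) auto
 qed
 then have "Z s * exp (- (2 * Kg * (r t - r s))) <= Z t"
  by (simp add: right_diff_distrib exp_diff exp_minus field_simps)
 moreover have "exp (- (2 * (Kg * (4 * pi / a)))) <= exp (- (2 * Kg * (r t - r s)))"
 proof -
  have "r t - r s <= 4 * pi / a"
   using r_diff_le[OF st(1-5)] st(6) a_pos by (simp add: field_simps)
  then have "2 * Kg * (r t - r s) <= 2 * Kg * (4 * pi / a)" using Kg_pos by (intro mult_left_mono) auto
  then show ?thesis by (simp add: mult.assoc)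
 qed
 ultimately have "Z s * (3 * \<gamma>) <= Z t"
  using ZE(1)[of s] E_pos[of s] gamma_bounds(3)
  by (meson mult_left_mono order_trans less_imp_le half_gt_zero)
 moreover have "E s / 2 * (3 * \<gamma>) <= Z s * (3 * \<gamma>)"
  using ZE(1)[of s] gamma_bounds(1) by (intro mult_right_mono) auto
 ultimately have "E s / 2 * (3 * \<gamma>) <= 3 / 2 * E t + 2 * Cg" using ZE(2)[of t] by linarith
 then have "3 * (\<gamma> * E s) <= 3 * E t + 4 * Cg" by (simp add: mult_ac)
 then show ?thesis using Cg_pos by linarith
qed

end

context frequency
begin

text \<open>Three arcs per revolution, starting at 0, at \<open>2 * arctan (11 / 10)\<close> and at
  \<open>pi\<close>. The middle mark lies slightly beyond \<open>pi / 2\<close>: far enough for cos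
  phi to be below -9/100 after it, and close enough for
  \<open>1 - cos \<phi> <= 11 / 10 * sin \<phi>\<close> before it, where 11/10 has to stay below the
  factor 13/10 of \<open>r0\<close>.\<close>

definition mark :: "nat => real" where
 "mark i = of_nat (i div 3) * (2 * pi) +
  (if i mod 3 = 0 then 0 else if i mod 3 = 1 then 2 * arctan (11 / 10) else pi)"

lemma mark_0 [simp]: "mark 0 = 0"
 by (simp add: mark_def)

lemma mark_triple: "mark (3 * n) = of_nat n * (2 * pi)" "mark (3 * n + 1) = of_nat n * (2 * pi) + 2 * arctan (11 / 10)"
 "mark (3 * n + 2) = of_nat n * (2 * pi) + pi" "mark (3 * n + 3) = of_nat n * (2 * pi) + 2 * pi"
proof -
 have dm: "(3 * n + 2) div 3 = n" "(3 * n + 2) mod 3 = 2" by presburger+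
 show "mark (3 * n) = of_nat n * (2 * pi)" "mark (3 * n + 1) = of_nat n * (2 * pi) + 2 * arctan (11 / 10)"
  "mark (3 * n + 2) = of_nat n * (2 * pi) + pi"
  by (simp_all add: mark_def dm del: add_2_eq_Suc')
 have "mark (3 * n + 3) = mark (3 * Suc n)" by (simp only: mult_Suc_right add.commute)
 also have "\<dots> = of_nat (Suc n) * (2 * pi)" unfolding mark_def by (subst nonzero_mult_div_cancel_left) simp_all
 finally show "mark (3 * n + 3) = of_nat n * (2 * pi) + 2 * pi" by (simp add: algebra_simps)
qed

lemma arctan_11_10: "cos (2 * arctan (11 / 10)) <= - 9 / 100" "0 < arctan (11 / 10)" "2 * arctan (11 / 10) < pi"
proof -
 have c: "cos (arctan (11 / 10)) \<noteq> 0" by simp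
 show "cos (2 * arctan (11 / 10)) <= - 9 / 100"
  unfolding cos_tan_half[OF c] tan_arctan by (simp add: power2_eq_square)
 show "0 < arctan (11 / 10)" by simp
 show "2 * arctan (11 / 10) < pi" using arctan_ubound[of "11 / 10"] by simp
qed

lemma falling_range:
 assumes "0 <= x" "x <= 2 * arctan (11 / 10)"
 shows "0 <= sin x \<and> 1 - cos x <= 11 / 10 * sin x"
proof -
 have x: "\<bar>x\<bar> < pi" using assms arctan_11_10(3) by simp
 have t: "0 <= tan (x / 2)" using assms x by (intro tan_pos_pi2_le) auto
 have "tan (x / 2) <= tan (arctan (11 / 10))"
  using assms arctan_ubound[of "11 / 10"] by (intro tan_mono_le) auto
 then have t2: "tan (x / 2) <= 11 / 10" by (simp only: tan_arctan)
 have s: "0 <= sin x" using assms x by (intro sin_ge_zero) auto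
 have n: "0 < 1 + (tan (x / 2))\<^sup>2" by (smt (verit) zero_le_power2)
 have "(1 - cos x) * (1 + (tan (x / 2))\<^sup>2) = tan (x / 2) * sin x * (1 + (tan (x / 2))\<^sup>2)"
  using half_angle[OF x] by algebra
 with n have "1 - cos x = tan (x / 2) * sin x" by simp
 also have "\<dots> <= 11 / 10 * sin x" using t2 s by (intro mult_right_mono) auto
 finally show ?thesis using s by simp
qed

lemma negative_range:
 assumes "2 * arctan (11 / 10) <= x" "x <= pi"
 shows "0 <= sin x \<and> cos x <= - 9 / 100"
proof
 have "0 <= x" using assms(1) arctan_11_10(2) by linarith
 then show "0 <= sin x" using assms by (intro sin_ge_zero) auto
 have "cos x <= cos (2 * arctan (11 / 10))"
  using assms by (intro cos_monotone_0_pi_le) auto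
 then show "cos x <= - 9 / 100" using arctan_11_10(1) by linarith
qed

end

context orbit
begin

lemma E_phase:
 assumes st: "s \<in> I" "t \<in> I" "s <= t" "0 <= h t" "r0 <= r s"
  and ms: "mark i <= \<phi> s" and mt: "\<phi> t <= mark (Suc i)"
 shows "\<gamma> * E s - 2 * Cg <= E t"
proof -
 define n where "n = i div 3"
 define P where "P = of_nat n * (2 * pi)"
 have rng: "mark i <= \<phi> x \<and> \<phi> x <= mark (Suc i)" if "x \<in> {s..t}" for x
 proof -
  have x: "x \<in> I" using Icc[OF st(1,2)] that by blast
  have hx: "0 <= h x" "r0 <= r x" using h_antimono[OF x st(2)] r_mono[OF st(1) x] that st(4,5) by auto
  show ?thesis using phi_mono[OF st(1) x _ hx(1) st(5)] phi_mono[OF x st(2) _ st(4) hx(2)] that ms mt by auto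
 qed
 have per: "sin y = sin (y - P)" "cos y = cos (y - P)" for y
  unfolding P_def using sin.minus_of_nat[of y n] cos.minus_of_nat[of y n] by simp_all
 consider "i = 3 * n" | "i = 3 * n + 1" | "i = 3 * n + 2" unfolding n_def by linarith
 then show ?thesis
 proof cases
  case 1
  have mk: "mark i = P" "mark (Suc i) = P + 2 * arctan (11 / 10)"
   using mark_triple[of n] by (simp_all add: 1 P_def)
  show ?thesis
  proof (rule E_phase_falling[OF st])
   show "\<phi> t - \<phi> s <= pi" using ms mt mk arctan_11_10(3) by simp
   fix x assume "x \<in> {s..t}"
   from rng[OF this] mk show "0 <= sin (\<phi> x) \<and> 1 - cos (\<phi> x) <= 11 / 10 * sin (\<phi> x)"
    unfolding per[of "\<phi> x"] by (intro falling_range) auto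
  qed
 next
  case 2
  have mk: "mark i = P + 2 * arctan (11 / 10)" "mark (Suc i) = P + pi"
   using mark_triple[of n] by (simp_all add: 2 P_def)
  have "\<gamma> * E s <= E t"
  proof (rule E_phase_negative[OF st])
   show "\<phi> t - \<phi> s <= pi" using ms mt mk arctan_11_10(2) by linarith
   fix x assume "x \<in> {s..t}"
   from rng[OF this] mk show "0 <= sin (\<phi> x) \<and> cos (\<phi> x) <= - 9 / 100"
    unfolding per[of "\<phi> x"] by (intro negative_range) auto
  qed
  then show ?thesis using Cg_pos by simp
 next
  case 3
  have mk: "mark i = P + pi" "mark (Suc i) = P + 2 * pi"
   using mark_triple[of n] by (simp_all add: 3 P_def numeral_3_eq_3)
  have "\<gamma> * E s <= E t"
  proof (rule E_phase_rising[OF st])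
   show "\<phi> t - \<phi> s <= pi" using ms mt mk by simp
   fix x assume "x \<in> {s..t}"
   from rng[OF this] mk have "0 <= sin (\<phi> x - P - pi)" by (intro sin_ge_zero) auto
   then show "sin (\<phi> x) <= 0" unfolding per[of "\<phi> x"] by (simp add: sin_diff)
  qed
  then show ?thesis using Cg_pos by simp
 qed
qed

lemma mark_mono: "mark i <= mark (Suc i)"
proof -
 define n where "n = i div 3"
 consider "i = 3 * n" | "i = 3 * n + 1" | "i = 3 * n + 2" unfolding n_def by linarith
 then show ?thesis
  using mark_triple[of n] arctan_11_10 pi_gt_zero by cases (simp_all add: numeral_3_eq_3)
qed

text \<open>Each arc multiplies the amplitude by at least \<open>\<gamma>\<close> and may subtract
  \<open>2 * Cg\<close>. As \<open>\<gamma> <= 1\<close>, the subtracted amounts merely add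
  up.\<close>

lemma E_lower_marks:
 assumes st: "s \<in> I" "t \<in> I" "s <= t" "0 <= h t" "r0 <= r s"
  and ms: "0 <= \<phi> s" and mt: "\<phi> t <= mark i"
 shows "\<gamma> ^ i * E s - 2 * Cg * i <= E t"
 using st(2,3,4) mt
proof (induction i arbitrary: t)
 case 0
 have "a / 4 * (r t - r s) <= \<phi> t - \<phi> s" "\<phi> s <= \<phi> t"
  using phi_increase[OF st(1) 0(1-3) st(5)] phi_mono[OF st(1) 0(1-3) st(5)] by auto
 then have "\<phi> t = 0" "\<phi> s = 0" using 0 ms by auto
 have "\<gamma> * E s - 2 * Cg <= E t"
  by (rule E_phase[OF st(1) 0(1-3) st(5), of 0]) (use ms mark_mono[of 0] 0 in auto)
 show ?case
 proof -
  \<comment> \<open>Here the phase is confined to the single value 0, where the derivative of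
    \<open>l\<close> vanishes.\<close>
  have "l s <= l t"
  proof -
   have rr: "r x = r s" if "x \<in> {s..t}" for x
   proof -
    have x: "x \<in> I" using Icc[OF st(1) 0(1)] that by blast
    have "a / 4 * (r t - r s) <= 0" using \<open>a / 4 * (r t - r s) <= \<phi> t - \<phi> s\<close> \<open>\<phi> t = 0\<close> \<open>\<phi> s = 0\<close> by simp
    then have "r t <= r s" using a_pos by (simp add: mult_le_0_iff)
    then show ?thesis using r_mono[OF st(1) x] r_mono[OF x 0(1)] that by auto
   qed
   have pp: "\<phi> x = 0" if "x \<in> {s..t}" for x
   proof -
    have x: "x \<in> I" using Icc[OF st(1) 0(1)] that by blast
    have hx: "0 <= h x" "r0 <= r x" using h_antimono[OF x 0(1)] r_mono[OF st(1) x] that 0(3) st(5) by auto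
    show ?thesis using phi_mono[OF st(1) x _ hx(1) st(5)] phi_mono[OF x 0(1) _ 0(3) hx(2)] that \<open>\<phi> t = 0\<close> \<open>\<phi> s = 0\<close> by auto
   qed
   show ?thesis
   proof (rule nondecreasing[OF st(1) 0(1,2) cont_sub[OF cont_l st(1) 0(1)]])
    fix x assume x: "x \<in> {s<..<t} - S"
    note i = inside[OF st(1) 0(1) 0(3) x]
    show "DERIV l x :> - 2 * (sin (\<phi> x) * (m * f x + e x) + f x * (1 - cos (\<phi> x)) / r x)"
     by (rule dl[OF i(1)])
    show "0 <= - 2 * (sin (\<phi> x) * (m * f x + e x) + f x * (1 - cos (\<phi> x)) / r x)"
     using pp[of x] x by simp
   qed
  qed
  then show ?thesis by (simp add: E_def)
 qed
next
 case (Suc i)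
 have nn: "0 <= Cg * real i" using Cg_pos by simp
 show ?case
 proof (cases "\<phi> t <= mark i")
  case True
  have "\<gamma> ^ Suc i * E s <= \<gamma> ^ i * E s"
   using gamma_bounds E_pos[of s] by (intro mult_right_mono) (auto simp: mult_left_le_one_le)
  then show ?thesis using Suc.IH[OF Suc.prems(1-3) True] Cg_pos by (simp add: algebra_simps)
 next
  case False
  \<comment> \<open>The point where the phase crosses mark \<open>i\<close>, or the start itself
    when it already lies beyond that mark.\<close>
  obtain t' where t': "t' \<in> I" "s <= t'" "t' <= t" "mark i <= \<phi> t'" "\<phi> t' = mark i \<or> t' = s"
  proof (cases "\<phi> s <= mark i")
   case True
   then obtain y where y: "s <= y" "y <= t" "\<phi> y = mark i"
    using IVT'[of \<phi> s "mark i" t] False Suc.prems cont_sub[OF cont_phi st(1) Suc.prems(1)] by auto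
   then show ?thesis using that[of y] Icc[OF st(1) Suc.prems(1)] by auto
  next
   case False
   then show ?thesis using that[of s] st Suc.prems by auto
  qed
  have h': "0 <= h t'" "r0 <= r t'"
   using h_antimono[OF t'(1) Suc.prems(1)] r_mono[OF st(1) t'(1)] t' Suc.prems(3) st(5) by auto
  have 1: "\<gamma> * E t' - 2 * Cg <= E t"
   by (rule E_phase[OF t'(1) Suc.prems(1) t'(3) Suc.prems(3) h'(2) t'(4) Suc.prems(4)])
  have 2: "\<gamma> ^ i * E s - 2 * Cg * i <= E t'"
  proof (cases "t' = s")
   case True
   have "\<gamma> ^ i * E s <= 1 * E s"
    using gamma_bounds E_pos[of s] by (intro mult_right_mono power_le_one) auto
   then show ?thesis using True nn by simp
  next
   case False
   then show ?thesis using Suc.IH[OF t'(1,2) h'(1)] t'(5) by simp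
  qed
  have "\<gamma> * (\<gamma> ^ i * E s - 2 * Cg * i) <= \<gamma> * E t'" using 2 gamma_bounds(1) by (intro mult_left_mono) auto
  moreover have "\<gamma> * (2 * Cg * i) <= 1 * (2 * Cg * i)"
   using Cg_pos by (intro mult_right_mono[OF gamma_bounds(2)] mult_nonneg_nonneg) auto
  ultimately show ?thesis using 1 by (simp add: algebra_simps)
 qed
qed

end

section \<open>Cartesian components and the amplitude bound from the centre on\<close>

context orbit
begin

lemma half_angle_id: "E t * sin (\<phi> t) = 2 * u t * v t" "E t * (1 - cos (\<phi> t)) = 2 * (u t)\<^sup>2"
proof -
 have ee: "exp (l t / 2) * exp (l t / 2) = E t" unfolding E_def by (simp flip: exp_add)
 have "sin (\<phi> t) = 2 * sin (\<phi> t / 2) * cos (\<phi> t / 2)" using sin_double[of "\<phi> t / 2"] by simp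
 then show "E t * sin (\<phi> t) = 2 * u t * v t" unfolding u_def v_def using ee by algebra
 have "cos (\<phi> t) = 1 - 2 * (sin (\<phi> t / 2))\<^sup>2" using cos_double_sin[of "\<phi> t / 2"] by simp
 then show "E t * (1 - cos (\<phi> t)) = 2 * (u t)\<^sup>2" unfolding u_def using ee by algebra
qed

lemma E_wt: "E t * wt (\<phi> t) = b * (u t)\<^sup>2 + a * (v t)\<^sup>2"
 using s_eq[of t] E_eq[of t] unfolding wt_def a_def b_def by algebra

lemma dv:
 assumes "t \<in> interior I - S"
 shows "DERIV v t :> - u t * (b * f t + e t)"
proof -
 define L where "L = - 2 * (sin (\<phi> t) * (m * f t + e t) + f t * (1 - cos (\<phi> t)) * inverse (r t))"
 define P where "P = 2 * f t * (wt (\<phi> t) - sin (\<phi> t) * inverse (r t)) - 2 * e t * cos (\<phi> t)"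
 define c where "c = cos (\<phi> t / 2)"
 define s where "s = sin (\<phi> t / 2)"
 have "DERIV l t :> L" unfolding L_def using dl[OF assms] by (simp add: divide_inverse)
 from DERIV_chain2[OF DERIV_exp DERIV_cdivide[OF this, of 2]]
 have 1: "DERIV (\<lambda>t. exp (l t / 2)) t :> exp (l t / 2) * (L / 2)" .
 have "DERIV \<phi> t :> P" unfolding P_def using dphi[OF assms] by (simp add: divide_inverse)
 from DERIV_chain2[OF DERIV_cos DERIV_cdivide[OF this, of 2]]
 have "DERIV (\<lambda>t. cos (\<phi> t / 2)) t :> - s * (P / 2)" unfolding s_def .
 from DERIV_mult[OF 1 this]
 have 2: "DERIV v t :> exp (l t / 2) * (c * (L / 2) - s * (P / 2))"
  unfolding v_def[abs_def] c_def by (simp add: algebra_simps)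
 have cs: "s\<^sup>2 + c\<^sup>2 = 1" by (simp add: s_def c_def)
 have C: "cos (\<phi> t) = c\<^sup>2 - s\<^sup>2" using cos_double[of "\<phi> t / 2"] by (simp add: s_def c_def)
 have S: "sin (\<phi> t) = 2 * s * c" using sin_double[of "\<phi> t / 2"] by (simp add: s_def c_def)
 have L2: "L / 2 = - (2 * s * c * (m * f t + e t) + f t * (1 - (c\<^sup>2 - s\<^sup>2)) * inverse (r t))"
  unfolding L_def C S by simp
 have P2: "P / 2 = f t * (\<Omega> - m * (c\<^sup>2 - s\<^sup>2) - 2 * s * c * inverse (r t)) - e t * (c\<^sup>2 - s\<^sup>2)"
  unfolding P_def wt_def C S by (simp add: diff_divide_distrib mult.assoc)
 have "c * (L / 2) - s * (P / 2) = - s * ((\<Omega> + m) * f t + e t)"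
  unfolding L2 P2 using cs by algebra
 with 2 show ?thesis by (simp add: u_def b_def s_def mult_ac)
qed

text \<open>Together with \<open>E_upper\<close> this makes energy and amplitude comparable. An
  amplitude of at least \<open>4 / a\<close> forces an energy of at least 1; this is the origin of
  the constant \<open>4 / a\<close> in the shooting.\<close>

lemma h_lower: "a / 2 * E t - 1 <= h t"
proof -
 have "a * E t <= wt (\<phi> t) * E t" using wt_bounds(1) E_pos[of t] by (intro mult_right_mono) auto
 moreover have "p * E t <= a / 20 * E t" using p_bounds E_pos[of t] by (intro mult_right_mono) auto
 moreover have "0 <= a * E t" using a_pos E_pos[of t] by simp
 ultimately show ?thesis using G_abs[of t] by (simp add: h_def mult_ac)
qed

text \<open>Up to \<open>r0\<close> the phase bounds keep cos phi above 1/3, so that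
  \<open>e_cos_le\<close> bounds \<open>e\<close> by \<open>b * f\<close>, and
  \<open>q <= a / 2 * r\<close> makes (1 - cos phi) / r at most \<open>a\<close>. Hence
  \<open>ln E\<close> falls at most at the rate \<open>2 * (m + b + a)\<close>.\<close>

lemma E_initial:
 assumes st: "s \<in> I" "t \<in> I" "s <= t" and h: "0 <= h t" and r: "r t <= r0"
  and init: "\<bar>\<phi> s\<bar> < pi" "0 <= q s" "q s <= a / 2 * r s"
 shows "exp (- (2 * (m + b + a) * r0)) * E s <= E t"
proof -
 define K where "K = 2 * (m + b + a)"
 have K: "0 < K" using m_pos b_pos a_pos by (simp add: K_def)
 have "l s + K * r s <= l t + K * r t"
 proof (rule nondecreasing[OF st])
  show "continuous_on {s..t} (\<lambda>t. l t + K * r t)"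
   by (intro continuous_intros cont_sub[OF cont_l] cont_sub[OF cont_r] st)
  fix x assume x: "x \<in> {s<..<t} - S"
  note i = inside[OF st(1,2) h x]
  show "DERIV (\<lambda>t. l t + K * r t) x :> (- 2 * (sin (\<phi> x) * (m * f x + e x) + f x * (1 - cos (\<phi> x)) / r x)) + K * f x"
   by (rule DERIV_add[OF dl[OF i(1)] DERIV_cmult[OF dr[OF i(1)]]])
  have "r x <= r0" using i(5) r by linarith
  from initial_phase[OF st(1) i(2) _ i(3) this init] x
  have q: "0 <= q x" "q x <= a / 2 * r x" "q x < q1" "0 <= \<phi> x" "\<phi> x < pi / 2" by auto
  have "(q x)\<^sup>2 <= q1\<^sup>2" using q by (intro power_mono) auto
  then have q2: "2 * (q x)\<^sup>2 <= 1" using q1_bounds(5) by linarith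
  have ph: "\<bar>\<phi> x\<bar> < pi" using q(4,5) pi_gt_zero by simp
  note half = half_angle[OF ph, folded q_def]
  have cpos: "0 <= cos (\<phi> x)" "0 <= sin (\<phi> x)" using q(4,5) by (auto intro!: cos_ge_zero sin_ge_zero)
  have c3: "1 / 3 <= cos (\<phi> x)"
  proof -
   have "cos (\<phi> x) * (1 + (q x)\<^sup>2) <= cos (\<phi> x) * (3 / 2)" using q2 cpos by (intro mult_left_mono) auto
   then show ?thesis using half(1) q2 by simp
  qed
  have "e x * (1 / 3) <= e x * cos (\<phi> x)" using c3 i(7) by (intro mult_left_mono) auto
  also have "\<dots> <= p * f x * wt (\<phi> x)" by (rule e_cos_le[OF i(1,3)])
  also have "\<dots> <= 1 / 10 * f x * b"
   using p_bounds wt_bounds(2,3)[of "\<phi> x"] i(6) p_pos by (intro mult_mono mult_right_mono mult_nonneg_nonneg) auto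
  finally have "e x <= 3 / 10 * (b * f x)" by (simp add: mult_ac)
  moreover have "0 <= b * f x" using b_pos i(6) by simp
  ultimately have ef: "e x <= b * f x" by linarith
  have "m * f x + e x <= (m + b) * f x" using ef by (simp add: algebra_simps)
  then have A: "sin (\<phi> x) * (m * f x + e x) <= 1 * ((m + b) * f x)"
   using cpos m_pos i b_pos by (intro mult_mono) auto
  have "1 - cos (\<phi> x) <= (1 - cos (\<phi> x)) * (1 + (q x)\<^sup>2)"
   using mult_left_mono[of 1 "1 + (q x)\<^sup>2" "1 - cos (\<phi> x)"] by simp
  also have "\<dots> = 2 * (q x * q x)" using half(1) by (simp add: algebra_simps power2_eq_square)
  also have "\<dots> <= 2 * (1 * (a / 2 * r x))"
   using q q1_bounds(3) i(8) by (intro mult_left_mono mult_mono) auto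
  finally have "(1 - cos (\<phi> x)) / r x <= a" using i(8) by (simp add: field_simps)
  from mult_left_mono[OF this i(6)] have B: "f x * (1 - cos (\<phi> x)) / r x <= f x * a" by simp
  show "0 <= (- 2 * (sin (\<phi> x) * (m * f x + e x) + f x * (1 - cos (\<phi> x)) / r x)) + K * f x"
  proof -
   have "K * f x = 2 * ((m + b) * f x) + 2 * (f x * a)" by (simp add: K_def algebra_simps)
   moreover have "X <= 1 * P ==> Y <= Q ==> Z = 2 * P + 2 * Q ==> 0 <= - 2 * (X + Y) + Z" for X Y Z P Q :: real
    by (simp add: algebra_simps)
   ultimately show ?thesis using A B by blast
  qed
 qed
 moreover have "K * r t <= K * r0" using r K by (intro mult_left_mono) auto
 moreover have "0 <= K * r s" using K r_nonneg[OF st(1)] by simp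
 ultimately have "- (K * r0) + l s <= l t" by linarith
 then show ?thesis by (simp add: E_def K_def flip: exp_add)
qed

text \<open>A lower bound for the amplitude up to the \<open>(k+1)\<close>st node, linear in the initial amplitude and uniform in \<open>p\<close>.\<close>

lemma E_lower:
 assumes st: "s \<in> I" "t \<in> I" "s <= t" and h: "0 <= h t" and rs: "r s <= r0"
  and init: "\<bar>\<phi> s\<bar> < pi" "0 <= q s" "q s <= a / 2 * r s"
  and phi: "\<phi> t <= of_nat k * (2 * pi) + pi"
 shows "\<gamma> ^ (3 * k + 2) * (exp (- (2 * (m + b + a) * r0)) * E s) - 2 * Cg * (3 * k + 2) <= E t"
proof (cases "r t <= r0")
 case True
 have "\<gamma> ^ (3 * k + 2) * (exp (- (2 * (m + b + a) * r0)) * E s) <= 1 * (exp (- (2 * (m + b + a) * r0)) * E s)"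
  using gamma_bounds E_pos[of s] by (intro mult_right_mono power_le_one) auto
 also have "\<dots> <= E t" using E_initial[OF st h True init] by simp
 finally show ?thesis using Cg_pos by (smt (verit) mult_nonneg_nonneg of_nat_0_le_iff)
next
 case False
 then obtain y where y: "s <= y" "y <= t" "r y = r0"
  using IVT'[of r s "r0" t] rs st cont_sub[OF cont_r st(1,2)] by auto
 then have yI: "y \<in> I" using Icc[OF st(1,2)] by auto
 have hy: "0 <= h y" using h_antimono[OF yI st(2) y(2)] h by linarith
 have "0 <= \<phi> y" using initial_phase[OF st(1) yI y(1) hy _ init] y(3) by simp
 moreover have "\<phi> t <= mark (3 * k + 2)" using phi by (simp only: mark_triple)
 ultimately have "\<gamma> ^ (3 * k + 2) * E y - 2 * Cg * (3 * k + 2) <= E t"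
  using E_lower_marks[OF yI st(2) y(2) h, of "3 * k + 2"] y(3) by simp
 moreover have "\<gamma> ^ (3 * k + 2) * (exp (- (2 * (m + b + a) * r0)) * E s) <= \<gamma> ^ (3 * k + 2) * E y"
  using E_initial[OF st(1) yI y(1) hy _ init] y(3) gamma_bounds(1) by (intro mult_left_mono) auto
 ultimately show ?thesis by linarith
qed

text \<open>Between two consecutive zeros of \<open>u\<close>, the component \<open>v\<close> moves by at least the variation of \<open>G\<close>:
 a change of sign of \<open>s\<close> makes \<open>v\<close> jump in the limit \<open>p \<rightarrow> 0\<close>, where \<open>G\<close> jumps from \<open>1\<close> to \<open>-1\<close> or back.\<close>

lemma v_jump:
 assumes st: "s \<in> I" "t \<in> I" "s <= t" and M: "0 < M"
  and upos: "!!x. x \<in> {s<..<t} - S ==> 0 <= u x"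
  and bd: "!!x. x \<in> {s<..<t} - S ==> \<bar>\<Omega> * v x - u x / r x\<bar> <= M"
 shows "\<bar>G t - G s\<bar> / (4 * M) <= v s - v t"
proof -
 \<comment> \<open>In Cartesian terms the derivative of \<open>G\<close> is
   \<open>- 4 * e * u * (\<Omega> * v - u / r)\<close>, and \<open>v\<close> decreases at least at
   the rate \<open>e * u\<close>. The common factor \<open>e * u\<close>, however large, allows the
   comparison; the two signs \<open>\<sigma>\<close> give the absolute value.\<close>
 have "\<sigma> * G s / (4 * M) - v s <= \<sigma> * G t / (4 * M) - v t" if \<sigma>: "\<bar>\<sigma>\<bar> = 1" for \<sigma> :: real
 proof (rule nondecreasing[OF st])
  show "continuous_on {s..t} (\<lambda>x. \<sigma> * G x / (4 * M) - v x)"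
   using M by (intro continuous_intros cont_sub[OF cont_G] cont_sub[OF cont_v] st) auto
  fix x assume x: "x \<in> {s<..<t} - S"
  have i: "x \<in> interior I - S" using x Ioo[OF st(1,2)] by blast
  have eq: "- 2 * e x * exp (l x) * (\<Omega> * sin (\<phi> x) - (1 - cos (\<phi> x)) / r x)
    = - 4 * e x * u x * (\<Omega> * v x - u x / r x)"
  proof -
   have "- 2 * e x * E x * (\<Omega> * sin (\<phi> x) - (1 - cos (\<phi> x)) * inverse (r x))
    = - 4 * e x * u x * (\<Omega> * v x - u x * inverse (r x))"
    using half_angle_id[of x] by algebra
   then show ?thesis by (simp add: E_def divide_inverse)
  qed
  show "DERIV (\<lambda>x. \<sigma> * G x / (4 * M) - v x) x :> \<sigma> * (- 4 * e x * u x * (\<Omega> * v x - u x / r x)) / (4 * M) - (- u x * (b * f x + e x))"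
   using DERIV_diff[OF DERIV_cdivide[OF DERIV_cmult[OF dG[OF i, unfolded eq]]] dv[OF i]]
   unfolding G_def[abs_def] .
  have "\<bar>\<sigma> * (\<Omega> * v x - u x / r x)\<bar> <= M" using bd[OF x] \<sigma> by (simp add: abs_mult)
  then have "\<sigma> * (\<Omega> * v x - u x / r x) / M <= 1" using M by (simp add: abs_le_iff)
  then have "e x * u x * (\<sigma> * (\<Omega> * v x - u x / r x) / M) <= e x * u x * 1"
   using e_nonneg[OF i] upos[OF x] by (intro mult_left_mono) auto
  moreover have "0 <= u x * (b * f x)" using upos[OF x] f_nonneg[OF i] b_pos by simp
  moreover have "\<sigma> * (- 4 * e x * u x * (\<Omega> * v x - u x / r x)) / (4 * M)
    = - (e x * u x * (\<sigma> * (\<Omega> * v x - u x / r x) / M))" by simp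
  moreover have "- u x * (b * f x + e x) = - (u x * (b * f x)) - e x * u x * 1" by (simp add: algebra_simps)
  ultimately show "0 <= \<sigma> * (- 4 * e x * u x * (\<Omega> * v x - u x / r x)) / (4 * M) - (- u x * (b * f x + e x))"
   by linarith
 qed
 from this[of 1] this[of "- 1"] have "\<bar>G t / (4 * M) - G s / (4 * M)\<bar> <= v s - v t" by simp
 then show ?thesis using M by (simp add: diff_divide_distrib[symmetric])
qed

end

section \<open>The energy lost in half a revolution\<close>

context frequency
begin

text \<open>On the positive half of the axis \<open>u = 0\<close> the energy is
  \<open>a * v^2 - (v^2) powr p\<close>, which is nonnegative exactly from this value of
  \<open>v\<close> on.\<close>

definition vmin :: "real => real" where
 "vmin p = sqrt ((1 / a) powr (1 / (1 - p)))"

lemma vmin_pos: "0 < vmin p"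
 using a_pos by (simp add: vmin_def)

text \<open>While \<open>v\<close> moves from \<open>vmin p / 4\<close> to
  \<open>vmin p / 2\<close>, the inner factor \<open>sqrt (a / (4 * b)) * (vmin p / 4)\<close>
  bounds the size of \<open>u\<close> from below, and along an orbit the energy changes by
  \<open>4 * u / r\<close> per unit of \<open>v\<close>.\<close>

definition loss :: "real => real => real" where
 "loss p \<rho> = 4 * (sqrt (a / (4 * b)) * (vmin p / 4)) / \<rho> * (vmin p / 4)"

lemma loss_pos: "0 < \<rho> ==> 0 < loss p \<rho>"
 using a_pos b_pos vmin_pos[of p] by (simp add: loss_def)

end

context orbit
begin

text \<open>If \<open>u\<close> were small, \<open>s\<close> would be close to \<open>v^2\<close>.
  Since \<open>v^2\<close> is at most a quarter of the square of \<open>vmin p\<close>, the power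
  \<open>s powr p\<close> would then exceed the quadratic part and make the energy negative.\<close>

lemma u_large:
 assumes "0 <= h t" "0 < v t" "v t <= vmin p / 2"
 shows "a / (4 * b) * (v t)\<^sup>2 <= (u t)\<^sup>2"
proof (rule ccontr)
 assume "\<not> a / (4 * b) * (v t)\<^sup>2 <= (u t)\<^sup>2"
 then have lt: "(u t)\<^sup>2 < a / (4 * b) * (v t)\<^sup>2" by simp
 define \<epsilon> where "\<epsilon> = a / (4 * b)"
 have eps: "0 < \<epsilon>" "\<epsilon> < 1" using a_pos a_less_b b_pos by (auto simp: \<epsilon>_def field_simps)
 have be: "b * \<epsilon> = a / 4" using b_pos by (simp add: \<epsilon>_def)
 have ae: "a * \<epsilon> <= a / 4" using mult_right_mono[of a b \<epsilon>] a_less_b eps be by simp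
 define w where "w = (v t)\<^sup>2"
 have w: "0 < w" using assms(2) by (simp add: w_def)
 have s: "(1 - \<epsilon>) * w <= E t * cos (\<phi> t)" using lt by (simp add: s_eq w_def \<epsilon>_def algebra_simps)
 have sp: "0 < E t * cos (\<phi> t)" using s eps w by (meson diff_gt_0_iff_gt less_le_trans mult_pos_pos)
 have "(vmin p)\<^sup>2 = (1 / a) powr (1 / (1 - p))" using a_pos by (simp add: vmin_def)
 moreover have "(p - 1) / (1 - p) = - 1" using p_bounds by (simp add: field_simps)
 ultimately have "((vmin p)\<^sup>2) powr (p - 1) = (1 / a) powr (- 1)"
  by (simp add: powr_powr)
 also have "\<dots> = a" using a_pos by (simp add: powr_minus_divide)
 finally have vp: "((vmin p)\<^sup>2) powr (p - 1) = a" .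
 have "w <= (vmin p)\<^sup>2 * (1 / 4)"
  using power_mono[OF assms(3), of 2] assms(2) by (simp add: w_def power_divide)
 then have "((vmin p)\<^sup>2 * (1 / 4)) powr (p - 1) <= w powr (p - 1)"
  using w p_bounds by (intro powr_mono2') auto
 moreover have "((vmin p)\<^sup>2 * (1 / 4)) powr (p - 1) = a * 4 powr (1 - p)"
 proof -
  have "(1 / 4 :: real) powr (p - 1) = 4 powr (1 - p)"
   using powr_minus_divide[of 4 "p - 1"] by (simp add: powr_divide)
  then show ?thesis unfolding powr_mult vp by simp
 qed
 \<comment> \<open>The quarter gains the factor \<open>4 powr (1 - p)\<close>, which is at least 2
   because \<open>1 - p >= 1 / 2\<close>.\<close>
 moreover have "a * 2 <= a * 4 powr (1 - p)"
 proof -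
  have "4 powr (1 / 2) <= (4::real) powr (1 - p)" using p_bounds by (intro powr_mono) auto
  then show ?thesis using a_pos by (simp add: powr_half_sqrt)
 qed
 ultimately have wp: "2 * a <= w powr (p - 1)" by linarith
 have "G t = (E t * cos (\<phi> t)) powr p" using sp by (simp add: G_def E_def Gp_pos)
 also have "\<dots> \<ge> ((1 - \<epsilon>) * w) powr p" using s eps w p_pos by (intro powr_mono2) auto
 also have "((1 - \<epsilon>) * w) powr p = (1 - \<epsilon>) powr p * (w * w powr (p - 1))"
  using eps w by (simp add: powr_mult powr_mult_base)
 also have "\<dots> \<ge> (1 - \<epsilon>) powr 1 * (w * (2 * a))"
  using eps w wp p_bounds a_pos by (intro mult_mono mult_left_mono powr_mono') auto
 finally have "(1 - \<epsilon>) * (w * (2 * a)) <= G t" using eps by simp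
 then have "h t <= b * (u t)\<^sup>2 + a * w - (1 - \<epsilon>) * (w * (2 * a))" by (simp add: h_def E_wt w_def)
 also have "b * (u t)\<^sup>2 < b * (\<epsilon> * w)"
  using lt b_pos unfolding \<epsilon>_def w_def by (intro mult_strict_left_mono)
 also have "b * (\<epsilon> * w) + a * w - (1 - \<epsilon>) * (w * (2 * a)) = w * (b * \<epsilon> - a + 2 * (a * \<epsilon>))"
  by (simp add: algebra_simps)
 also have "\<dots> <= 0"
 proof -
  have "b * \<epsilon> - a + 2 * (a * \<epsilon>) <= 0" using be ae a_pos by linarith
  then show ?thesis using w by (simp add: mult_nonneg_nonpos)
 qed
 finally show False using assms(1) by simp
qed

text \<open>Half a revolution with nonnegative energy sweeps \<open>v\<close> through a fixed interval on which \<open>u\<close> is not small.\<close>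

lemma energy_loss:
 assumes st: "s \<in> I" "t \<in> I" "s <= t" and ht: "0 <= h t"
  and phi: "\<phi> s = - pi" "\<phi> t = 0" "!!x. x \<in> {s..t} ==> - pi <= \<phi> x \<and> \<phi> x <= 0"
  and \<rho>: "r t <= \<rho>" "0 < \<rho>"
 shows "h t + loss p \<rho> <= h s"
proof -
 have uv: "u x <= 0" "0 <= v x" if "x \<in> {s..t}" for x
 proof -
  have "0 <= sin (- (\<phi> x / 2))" using phi(3)[OF that] by (intro sin_ge_zero) auto
  then show "u x <= 0" by (simp add: u_def mult_nonneg_nonpos)
  have "0 <= cos (\<phi> x / 2)" using phi(3)[OF that] by (intro cos_ge_zero) auto
  then show "0 <= v x" by (simp add: v_def)
 qed
 have mono: "v x <= v y" if "x \<in> {s..t}" "y \<in> {s..t}" "x <= y" for x y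
 proof -
  have xy: "x \<in> I" "y \<in> I" using that Icc[OF st(1,2)] by auto
  show ?thesis
  proof (rule nondecreasing[OF xy that(3) cont_sub[OF cont_v xy]])
   fix z assume z: "z \<in> {x<..<y} - S"
   have i: "z \<in> interior I - S" using z Ioo[OF xy] by blast
   show "DERIV v z :> - u z * (b * f z + e z)" by (rule dv[OF i])
   show "0 <= - u z * (b * f z + e z)"
    using uv(1)[of z] z that f_nonneg[OF i] e_nonneg[OF i] b_pos by (intro mult_nonneg_nonneg) auto
  qed
 qed
 define V where "V = vmin p"
 have V: "0 < V" using vmin_pos by (simp add: V_def)
 have vs: "v s = 0" using phi(1) by (simp add: v_def)
 \<comment> \<open>At phase 0 the orbit lies on the axis \<open>u = 0\<close>, where nonnegative
   energy means that \<open>v\<close> is at least \<open>vmin p\<close>.\<close>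
 have vt: "V <= v t"
 proof -
  have vE: "(v t)\<^sup>2 = E t" using E_eq[of t] phi(2) by (simp add: u_def)
  have "0 <= a * E t - E t powr p" using ht phi(2) E_pos[of t] by (simp add: h_def wt_def a_def G_def Gp_pos E_def mult.commute)
  then have "E t powr p / E t <= a" using E_pos[of t] by (simp add: field_simps)
  then have "E t powr (p - 1) <= a" using E_pos[of t] by (simp add: powr_diff)
  then have "(1 / a) <= E t powr (1 - p)"
  proof -
   have "E t powr (1 - p) = 1 / E t powr (p - 1)" using powr_minus_divide[of "E t" "p - 1"] by simp
   then show ?thesis using \<open>E t powr (p - 1) <= a\<close> E_pos[of t] a_pos by (simp add: frac_le)
  qed
  then have "(1 / a) powr (1 / (1 - p)) <= (E t powr (1 - p)) powr (1 / (1 - p))"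
   using a_pos p_bounds by (intro powr_mono2) auto
  also have "\<dots> = E t" using E_pos[of t] p_bounds by (simp add: powr_powr)
  finally have "V\<^sup>2 <= (v t)\<^sup>2" using a_pos by (simp add: V_def vmin_def vE)
  then show ?thesis using uv(2)[of t] st by (auto intro: power2_le_imp_le)
 qed
 obtain x where x: "s <= x" "x <= t" "v x = V / 4"
  using IVT'[of v s "V / 4" t] cont_sub[OF cont_v st(1,2)] vs vt V st by auto
 then have xI: "x \<in> I" using Icc[OF st(1,2)] by auto
 obtain y where y: "x <= y" "y <= t" "v y = V / 2"
  using IVT'[of v x "V / 2" t] cont_sub[OF cont_v xI st(2)] x vt V by auto
 then have yI: "y \<in> I" using Icc[OF xI st(2)] by auto
 define U where "U = sqrt (a / (4 * b)) * (V / 4)"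
 have U: "0 < U" using a_pos b_pos V by (simp add: U_def)
 have hxy: "0 <= h y" using h_antimono[OF yI st(2) y(2)] ht by linarith
 have ularge: "U <= - u z" if z: "z \<in> {x<..<y} - S" for z
 proof -
  note i = inside[OF xI yI hxy z]
  have zst: "z \<in> {s..t}" using z x y by auto
  have v: "V / 4 <= v z" "v z <= V / 2"
   using mono[of x z] mono[of z y] x y z by auto
  have "U\<^sup>2 = a / (4 * b) * (V / 4)\<^sup>2" using a_pos b_pos by (simp only: U_def power_mult_distrib real_sqrt_pow2_iff) simp
  also have "\<dots> <= a / (4 * b) * (v z)\<^sup>2" using v V a_pos b_pos by (intro mult_left_mono power_mono) auto
  also have "\<dots> <= (u z)\<^sup>2" by (rule u_large[OF i(3)]) (use v V in \<open>auto simp: V_def\<close>)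
  finally have "U\<^sup>2 <= (- u z)\<^sup>2" by simp
  from power2_le_imp_le[OF this] uv(1)[OF zst] show ?thesis by simp
 qed
 \<comment> \<open>The derivatives of \<open>h\<close> and of \<open>v\<close> share the factor
   \<open>b * f + e\<close>, which may be large because of \<open>F\<close>; their quotient
   \<open>4 * u / r\<close> does not contain it.\<close>
 have "- h x - 4 * U / \<rho> * v x <= - h y - 4 * U / \<rho> * v y"
 proof (rule nondecreasing[OF xI yI y(1)])
  show "continuous_on {x..y} (\<lambda>z. - h z - 4 * U / \<rho> * v z)"
   by (intro continuous_intros cont_sub[OF cont_h] cont_sub[OF cont_v] xI yI)
  fix z assume z: "z \<in> {x<..<y} - S"
  note i = inside[OF xI yI hxy z]
  show "DERIV (\<lambda>z. - h z - 4 * U / \<rho> * v z) z :> - (- 2 * E z * (1 - cos (\<phi> z)) * (b * f z + e z) / r z) - 4 * U / \<rho> * (- u z * (b * f z + e z))"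
   by (rule DERIV_diff[OF DERIV_minus[OF dh[OF i(1)]] DERIV_cmult[OF dv[OF i(1)]]])
  have eq: "- 2 * E z * (1 - cos (\<phi> z)) * (b * f z + e z) / r z = - 4 * (u z)\<^sup>2 * (b * f z + e z) / r z"
   using half_angle_id(2)[of z] by (simp add: mult.assoc)
  have rz: "r z <= \<rho>" using i(5) \<rho> r_mono[OF yI st(2) y(2)] by linarith
  have W: "0 <= b * f z + e z" using b_pos i by simp
  have "U / \<rho> <= - u z / r z"
   using ularge[OF z] rz U i(8) by (intro frac_le) auto
  then have "(- u z * (b * f z + e z)) * (U / \<rho>) <= (- u z * (b * f z + e z)) * (- u z / r z)"
   using ularge[OF z] U W by (intro mult_left_mono mult_nonneg_nonneg) auto
  also have "\<dots> = (u z)\<^sup>2 * (b * f z + e z) / r z" by (simp add: power2_eq_square)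
  finally have le: "- u z * (b * f z + e z) * (U / \<rho>) <= (u z)\<^sup>2 * (b * f z + e z) / r z" .
  define K where "K = b * f z + e z"
  show "0 <= - (- 2 * E z * (1 - cos (\<phi> z)) * (b * f z + e z) / r z) - 4 * U / \<rho> * (- u z * (b * f z + e z))"
  proof -
   have 1: "- (- 4 * (u z)\<^sup>2 * K / r z) = 4 * ((u z)\<^sup>2 * K / r z)" by simp
   have 2: "4 * U / \<rho> * (- u z * K) = 4 * (- u z * K * (U / \<rho>))" by simp
   show ?thesis using le unfolding eq unfolding K_def[symmetric] 1 2 by (simp only: diff_ge_0_iff_ge mult_le_cancel_left_pos zero_less_numeral)
  qed
 qed
 then have "h y + 4 * U / \<rho> * (V / 4) <= h x" unfolding x(3) y(3) by (simp add: field_simps)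
 moreover have "h t <= h y" by (rule h_antimono[OF yI st(2) y(2)])
 moreover have "h x <= h s" by (rule h_antimono[OF st(1) xI x(1)])
 ultimately show ?thesis by (simp add: loss_def U_def V_def)
qed

text \<open>Subtracting whole revolutions multiplies \<open>(u, v)\<close> by a sign, so that lemmas
  about a fixed range of phases apply to every revolution.\<close>

lemma orbit_shift: "orbit m \<Omega> p I S r f e l (\<lambda>t. \<phi> t - of_nat n * (2 * pi))"
proof -
 have [simp]: "sin (x - of_nat n * (2 * pi)) = sin x" "cos (x - of_nat n * (2 * pi)) = cos x" for x :: real
  using sin.minus_of_nat[of x n] cos.minus_of_nat[of x n] by simp_all
 have [simp]: "wt (x - of_nat n * (2 * pi)) = wt x" for x by (simp add: wt_def)
 show ?thesis
  apply (unfold_locales)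
  using p_pos p_le I S r_nonneg r_pos f_nonneg e_nonneg rel dr dl dG
  by (auto intro!: continuous_intros cont_r cont_l cont_phi DERIV_diff[OF dphi DERIV_const, simplified])
qed

end

section \<open>Causal Lipschitz operators and bounded Lipschitz vector fields\<close>

lemma continuous_on_halfline:
 fixes f :: "real => 'a::topological_space"
 assumes "!!T. continuous_on {0..T} f"
 shows "continuous_on {0..} f"
 unfolding continuous_on_eq_continuous_within
proof
 fix t :: real assume t: "t \<in> {0..}"
 have "at t within {0..} = at t within {0..t + 1}"
  by (rule at_within_nhd[of _ "{..<t + 1}"]) auto
 then show "continuous (at t within {0..}) f"
  using assms[of "t + 1"] t by (auto simp: continuous_on_eq_continuous_within)
qed

lemma exp_ge_self: "0 <= x ==> x <= exp (x::real)"
 using exp_ge_add_one_self[of x] by linarith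

text \<open>Picard iteration in the weighted norm sup |y t| exp (- K t), written without that norm:
  \<open>lip\<close> says that \<open>T\<close> halves the weighted distance, up to the change of
  the parameter. Stated for operators, it serves both an ordinary flow and the singular radial
  problem. The factor 2 in the dependence on \<open>x\<close> is 1 / (1 - 1/2).\<close>

lemma causal_fixpoint:
 fixes T :: "'a::banach => (real => 'a) => real => 'a" and K B :: real
 assumes K: "0 < K" and B: "0 <= B"
  and cont: "!!x y. continuous_on {0..} y ==> continuous_on {0..} (T x y)"
  and bnd: "!!x y t. continuous_on {0..} y ==> 0 <= t ==> norm (T x y t - x) <= B * t"
  and lip: "!!x x' y y' C t. continuous_on {0..} y ==> continuous_on {0..} y' ==> 0 <= t ==>
   (!!s. s \<in> {0..t} ==> norm (y s - y' s) <= C * exp (K * s)) ==>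
   norm (T x y t - T x' y' t) <= norm (x - x') + C / 2 * exp (K * t)"
 obtains Y where "!!x. continuous_on {0..} (Y x)" "!!x t. 0 <= t ==> Y x t = T x (Y x) t"
  "!!x x' t. 0 <= t ==> norm (Y x t - Y x' t) <= 2 * norm (x - x') * exp (K * t)"
proof -
 define it where "it x n = ((T x) ^^ n) (\<lambda>_. x)" for x n
 have it_Suc: "it x (Suc n) = T x (it x n)" for x n by (simp add: it_def)
 have itc: "continuous_on {0..} (it x n)" for x n
 proof (induction n)
  case 0
  have "it x 0 = (\<lambda>_. x)" by (simp add: it_def)
  then show ?case by simp
 qed (auto simp: it_Suc intro: cont)
 have Bt: "B * t <= B / K * exp (K * t)" if "0 <= t" for t
 proof -
  have "K * t <= exp (K * t)" using that K by (intro exp_ge_self) auto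
  then have "B / K * (K * t) <= B / K * exp (K * t)" using B K by (intro mult_left_mono) auto
  then show ?thesis using K by simp
 qed
 have step: "norm (it x (Suc n) t - it x n t) <= B / K * (1 / 2) ^ n * exp (K * t)" if "0 <= t" for x n t
  using that
 proof (induction n arbitrary: t)
  case 0
  then show ?case using bnd[OF itc[of x 0], of t x] Bt[of t] by (simp add: it_Suc) (simp add: it_def)
 next
  case (Suc n)
  have "norm (T x (it x (Suc n)) t - T x (it x n) t)
    <= norm (x - x) + (B / K * (1 / 2) ^ n) / 2 * exp (K * t)"
   by (rule lip[OF itc itc Suc.prems]) (use Suc.IH in auto)
  then show ?case by (simp add: it_Suc)
 qed
 define d where "d x n t = it x (Suc n) t - it x n t" for x n t
 have tele: "(\<Sum>i<n. d x i t) = it x n t - x" for x n t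
  unfolding d_def by (subst sum_lessThan_telescope) (simp add: it_def)
 define Y where "Y x t = x + (\<Sum>i. d x i t)" for x t
 have ul: "uniform_limit {0..\<tau>} (\<lambda>n t. \<Sum>i<n. d x i t) (\<lambda>t. \<Sum>i. d x i t) sequentially" for x \<tau>
 proof (rule Weierstrass_m_test[where M = "\<lambda>n. B / K * exp (K * \<tau>) * (1 / 2) ^ n"])
  show "summable (\<lambda>n. B / K * exp (K * \<tau>) * (1 / 2) ^ n)"
   by (intro summable_mult summable_geometric) auto
  fix n t assume t: "t \<in> {0..\<tau>}"
  have "norm (d x n t) <= B / K * (1 / 2) ^ n * exp (K * t)" using step[of t x n] t by (simp add: d_def)
  also have "\<dots> <= B / K * (1 / 2) ^ n * exp (K * \<tau>)"
   using t K B by (intro mult_left_mono) auto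
  finally show "norm (d x n t) <= B / K * exp (K * \<tau>) * (1 / 2) ^ n" by (simp add: mult_ac)
 qed
 have ulY: "uniform_limit {0..\<tau>} (it x) (Y x) sequentially" for x \<tau>
 proof -
  have "uniform_limit {0..\<tau>} (\<lambda>n t. x + (\<Sum>i<n. d x i t)) (\<lambda>t. x + (\<Sum>i. d x i t)) sequentially"
   by (intro uniform_limit_add ul uniform_limit_const)
  then show ?thesis by (simp add: tele Y_def[abs_def])
 qed
 have Yc: "continuous_on {0..} (Y x)" for x
 proof (rule continuous_on_halfline)
  fix \<tau>
  show "continuous_on {0..\<tau>} (Y x)"
   by (rule uniform_limit_theorem[OF _ ulY[where x=x and \<tau>=\<tau>]])
    (auto intro!: always_eventually continuous_on_subset[OF itc])
 qed
 have lim: "(\<lambda>n. it x n t) \<longlonglongrightarrow> Y x t" if "0 <= t" for x t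
  by (rule tendsto_uniform_limitI[OF ulY[where x=x and \<tau>=t]]) (use that in auto)
 have diff: "norm (it x (n + j) t - it x n t) <= 2 * B / K * (1 / 2) ^ n * exp (K * t)"
  if t: "0 <= t" for x n j t
 proof -
  have "norm (it x (n + j) t - it x n t) <= 2 * B / K * (1 / 2) ^ n * (1 - (1 / 2) ^ j) * exp (K * t)"
  proof (induction j)
   case (Suc j)
   have "norm (it x (n + Suc j) t - it x n t) <=
    norm (it x (Suc (n + j)) t - it x (n + j) t) + norm (it x (n + j) t - it x n t)"
    by (simp add: norm_triangle_ineq[of "it x (Suc (n + j)) t - it x (n + j) t" "it x (n + j) t - it x n t", simplified])
   also have "\<dots> <= B / K * (1 / 2) ^ (n + j) * exp (K * t) + 2 * B / K * (1 / 2) ^ n * (1 - (1 / 2) ^ j) * exp (K * t)"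
    by (intro add_mono step[OF t] Suc.IH)
   also have "\<dots> = 2 * B / K * (1 / 2) ^ n * (1 - (1 / 2) ^ Suc j) * exp (K * t)"
    using K by (simp add: power_add field_simps)
   finally show ?case .
  qed simp
  also have "\<dots> <= 2 * B / K * (1 / 2) ^ n * 1 * exp (K * t)"
   using K B by (intro mult_right_mono mult_left_mono) auto
  finally show ?thesis by simp
 qed
 have tail: "norm (Y x t - it x n t) <= 2 * B / K * (1 / 2) ^ n * exp (K * t)" if t: "0 <= t" for x n t
 proof (rule LIMSEQ_le_const2)
  have "(\<lambda>j. it x (j + n) t) \<longlonglongrightarrow> Y x t" using lim[OF t] by (rule LIMSEQ_ignore_initial_segment)
  then show "(\<lambda>j. norm (it x (j + n) t - it x n t)) \<longlonglongrightarrow> norm (Y x t - it x n t)"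
   by (intro tendsto_intros)
  show "\<exists>N. \<forall>j\<ge>N. norm (it x (j + n) t - it x n t) <= 2 * B / K * (1 / 2) ^ n * exp (K * t)"
   using diff[OF t] by (metis add.commute)
 qed
 have zero: "z <= 0" if "!!n. z <= c * (1 / 2) ^ n" for z c :: real
 proof (rule LIMSEQ_le_const)
  have "(\<lambda>n. c * (1 / 2) ^ n) \<longlonglongrightarrow> c * 0"
   by (intro tendsto_intros LIMSEQ_power_zero) auto
  then show "(\<lambda>n. c * (1 / 2) ^ n) \<longlonglongrightarrow> 0" by simp
 qed (use that in auto)
 have fixp: "Y x t = T x (Y x) t" if t: "0 <= t" for x t
 proof -
  have "norm (Y x t - T x (Y x) t) <= 2 * B / K * exp (K * t) * (1 / 2) ^ n" for n
  proof -
   have "norm (T x (it x n) t - T x (Y x) t) <= norm (x - x) + (2 * B / K * (1 / 2) ^ n) / 2 * exp (K * t)"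
    by (rule lip[OF itc Yc t]) (use tail in \<open>auto simp: norm_minus_commute\<close>)
   then have "norm (it x (Suc n) t - T x (Y x) t) <= B / K * (1 / 2) ^ n * exp (K * t)" by (simp add: it_Suc)
   moreover have "norm (Y x t - it x (Suc n) t) <= B / K * (1 / 2) ^ n * exp (K * t)"
    using tail[OF t, of x "Suc n"] by simp
   ultimately have "norm ((Y x t - it x (Suc n) t) + (it x (Suc n) t - T x (Y x) t))
     <= B / K * (1 / 2) ^ n * exp (K * t) + B / K * (1 / 2) ^ n * exp (K * t)"
    by (intro norm_triangle_le add_mono)
   then show ?thesis by (simp add: mult_ac)
  qed
  from zero[OF this] show ?thesis by simp
 qed
 have dep: "norm (Y x t - Y x' t) <= 2 * norm (x - x') * exp (K * t)" if t: "0 <= t" for x x' t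
 proof -
  define \<delta> where "\<delta> = norm (x - x')"
  \<comment> \<open>Each application of \<open>T\<close> halves the excess over
    \<open>2 * \<delta>\<close>, starting from the crude bound that \<open>bnd\<close>
    provides.\<close>
  have "norm (Y x t - Y x' t) <= (2 * \<delta> + 2 * B / K * (1 / 2) ^ n) * exp (K * t)" for n
   using t
  proof (induction n arbitrary: t)
   case (Suc n)
   have "norm (T x (Y x) t - T x' (Y x') t) <= norm (x - x') + (2 * \<delta> + 2 * B / K * (1 / 2) ^ n) / 2 * exp (K * t)"
    by (rule lip[OF Yc Yc Suc.prems]) (use Suc.IH in auto)
   moreover have "norm (x - x') <= \<delta> * exp (K * t)"
    using mult_left_mono[of 1 "exp (K * t)" \<delta>] Suc.prems K by (simp add: \<delta>_def)
   ultimately show ?case using fixp[OF Suc.prems] by (simp add: algebra_simps add_divide_distrib)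
  next
   case 0
   have "norm (Y x t - Y x' t) = norm ((T x (Y x) t - x) + (x - x') + (x' - T x' (Y x') t))"
    using fixp[OF 0] by simp
   also have "\<dots> <= norm (T x (Y x) t - x) + norm (x - x') + norm (x' - T x' (Y x') t)"
    by (intro norm_triangle_le add_mono order_refl)
   also have "\<dots> <= B * t + \<delta> + B * t"
    using bnd[OF Yc 0, of x x] bnd[OF Yc 0, of x' x'] by (simp add: \<delta>_def norm_minus_commute)
   also have "\<dots> <= B / K * exp (K * t) + 2 * \<delta> * exp (K * t) + B / K * exp (K * t)"
   proof -
    have "\<delta> * 1 <= (2 * \<delta>) * exp (K * t)" using 0 K by (intro mult_mono) (auto simp: \<delta>_def)
    then show ?thesis using Bt[OF 0] by simp
   qed
   finally show ?case by (simp add: algebra_simps)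
  qed
  then have "norm (Y x t - Y x' t) - 2 * \<delta> * exp (K * t) <= 2 * B / K * exp (K * t) * (1 / 2) ^ n" for n
   by (simp add: algebra_simps)
  from zero[OF this] show ?thesis by (simp add: \<delta>_def)
 qed
 show thesis by (rule that[OF Yc fixp dep])
qed

lemma integral_exp_bound:
 fixes g :: "real => 'a::euclidean_space"
 assumes g: "continuous_on {0..t} g" "0 <= t" and K: "0 < K" and D: "0 <= D"
  and bd: "!!s. s \<in> {0..t} ==> norm (g s) <= D * exp (K * s)"
 shows "norm (integral {0..t} g) <= D / K * exp (K * t)"
proof -
 have "((\<lambda>s. D * exp (K * s)) has_integral (D / K * exp (K * t) - D / K * exp (K * 0))) {0..t}"
  by (rule fundamental_theorem_of_calculus[OF g(2)])
   (use K in \<open>auto intro!: derivative_eq_intros simp: has_real_derivative_iff_has_vector_derivative[symmetric]\<close>)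
 note hi = this
 have "norm (integral {0..t} g) <= integral {0..t} (\<lambda>s. D * exp (K * s))"
  by (rule integral_norm_bound_integral)
   (use g(1) bd hi in \<open>auto intro: integrable_continuous_interval has_integral_integrable\<close>)
 also have "\<dots> = D / K * exp (K * t) - D / K * exp (K * 0)" using hi by (rule integral_unique)
 also have "\<dots> <= D / K * exp (K * t)" using K D by simp
 finally show ?thesis .
qed

lemma continuous_on_integral_halfline:
 fixes g :: "real => 'a::banach"
 assumes "continuous_on {0..} g"
 shows "continuous_on {0..} (\<lambda>t. integral {0..t} g)"
proof (rule continuous_on_halfline)
 fix T
 have "continuous_on {0..T} g" by (rule continuous_on_subset[OF assms]) auto
 then show "continuous_on {0..T} (\<lambda>t. integral {0..t} g)"
  by (intro indefinite_integral_continuous_1 integrable_continuous_interval)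
qed

lemma integral_halfline_derivative:
 fixes g :: "real => 'a::banach"
 assumes "continuous_on {0..} g" "0 < t"
 shows "((\<lambda>t. integral {0..t} g) has_vector_derivative g t) (at t)"
proof -
 have "continuous_on {0..t + 1} g" by (rule continuous_on_subset[OF assms(1)]) auto
 from integral_has_vector_derivative[OF this, of t] assms(2)
 have "((\<lambda>t. integral {0..t} g) has_vector_derivative g t) (at t within {0..t + 1})" by simp
 moreover have "at t within {0..t + 1} = at t" by (rule at_within_interior) (use assms(2) in auto)
 ultimately show ?thesis by simp
qed

lemma bounded_lipschitz_flow:
 fixes \<Phi> :: "'a::euclidean_space => 'a"
 assumes L: "0 < L" and B: "!!x. norm (\<Phi> x) <= B" and lipschitz: "!!x y. norm (\<Phi> x - \<Phi> y) <= L * norm (x - y)"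
 obtains Y where "!!x. continuous_on {0..} (Y x)" "!!x. Y x 0 = x"
  "!!x t. 0 < t ==> (Y x has_vector_derivative \<Phi> (Y x t)) (at t)"
  "!!x x' t. 0 <= t ==> norm (Y x t - Y x' t) <= 2 * norm (x - x') * exp (2 * L * t)"
proof -
 have "continuous_on UNIV \<Phi>"
  by (rule lipschitz_on_continuous_on[of L]) (use L lipschitz in \<open>auto simp: lipschitz_on_def dist_norm\<close>)
 then have c\<Phi>: "continuous_on {0..} (\<lambda>s. \<Phi> (y s))" if "continuous_on {0..} y" for y :: "real => 'a"
  by (rule continuous_on_compose2[OF _ that]) auto
 define T where "T x y t = x + integral {0..t} (\<lambda>s. \<Phi> (y s))" for x y and t :: real
 have B0: "0 <= B" using B[of 0] norm_ge_zero order_trans by blast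
 obtain Y where Y: "!!x. continuous_on {0..} (Y x)" "!!x t. 0 <= t ==> Y x t = T x (Y x) t"
  "!!x x' t. 0 <= t ==> norm (Y x t - Y x' t) <= 2 * norm (x - x') * exp ((2 * L) * t)"
 \<comment> \<open>With the exponent \<open>2 * L\<close> the integral of an
   \<open>L\<close>-Lipschitz integrand gains exactly the factor 1/2.\<close>
 proof (rule causal_fixpoint[of "2 * L" B T])
  show "continuous_on {0..} (T x y)" if "continuous_on {0..} y" for x y
   unfolding T_def[abs_def] by (intro continuous_intros continuous_on_integral_halfline c\<Phi> that)
  show "norm (T x y t - x) <= B * t" if "continuous_on {0..} y" "0 <= t" for x y t
   using integral_bound[of 0 t "\<lambda>s. \<Phi> (y s)" B] continuous_on_subset[OF c\<Phi>[OF that(1)], of "{0..t}"] B that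
   by (simp add: T_def)
  fix x x' C and y y' :: "real => 'a" and t :: real
  assume y: "continuous_on {0..} y" "continuous_on {0..} y'" and t: "0 <= t"
   and C: "!!s. s \<in> {0..t} ==> norm (y s - y' s) <= C * exp (2 * L * s)"
  have "0 <= C" using C[of 0] t order_trans[OF norm_ge_zero[of "y 0 - y' 0"]] by simp
  have ci: "continuous_on {0..t} (\<lambda>s. \<Phi> (y s))" "continuous_on {0..t} (\<lambda>s. \<Phi> (y' s))"
   using continuous_on_subset[OF c\<Phi>] y by auto
  have "norm (integral {0..t} (\<lambda>s. \<Phi> (y s) - \<Phi> (y' s))) <= (L * C) / (2 * L) * exp (2 * L * t)"
  proof (rule integral_exp_bound)
   fix s assume s: "s \<in> {0..t}"
   have "norm (\<Phi> (y s) - \<Phi> (y' s)) <= L * norm (y s - y' s)" by (rule lipschitz)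
   also have "\<dots> <= L * (C * exp (2 * L * s))" using L C[OF s] by (intro mult_left_mono) auto
   finally show "norm (\<Phi> (y s) - \<Phi> (y' s)) <= L * C * exp (2 * L * s)" by simp
  qed (use L \<open>0 <= C\<close> t ci in \<open>auto intro!: continuous_intros\<close>)
  also have "integral {0..t} (\<lambda>s. \<Phi> (y s) - \<Phi> (y' s)) = integral {0..t} (\<lambda>s. \<Phi> (y s)) - integral {0..t} (\<lambda>s. \<Phi> (y' s))"
   by (intro integral_diff integrable_continuous_interval ci)
  finally have 1: "norm (integral {0..t} (\<lambda>s. \<Phi> (y s)) - integral {0..t} (\<lambda>s. \<Phi> (y' s))) <= C / 2 * exp (2 * L * t)"
   using L by simp
  have "T x y t - T x' y' t = (x - x') + (integral {0..t} (\<lambda>s. \<Phi> (y s)) - integral {0..t} (\<lambda>s. \<Phi> (y' s)))"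
   by (simp add: T_def)
  then have "norm (T x y t - T x' y' t) <= norm (x - x') + norm (integral {0..t} (\<lambda>s. \<Phi> (y s)) - integral {0..t} (\<lambda>s. \<Phi> (y' s)))"
   by (simp only: norm_triangle_ineq)
  with 1 show "norm (T x y t - T x' y' t) <= norm (x - x') + C / 2 * exp (2 * L * t)" by linarith
 qed (use L B0 in auto)
 show thesis
 proof (rule that[of Y])
  fix x
  show "Y x 0 = x" using Y(2)[of 0 x] by (simp add: T_def)
  fix t :: real assume t: "0 < t"
  have "((\<lambda>t. x + integral {0..t} (\<lambda>s. \<Phi> (Y x s))) has_vector_derivative 0 + \<Phi> (Y x t)) (at t)"
   by (intro has_vector_derivative_add has_vector_derivative_const integral_halfline_derivative c\<Phi> Y(1) t)
  then have "(T x (Y x) has_vector_derivative \<Phi> (Y x t)) (at t)" by (simp add: T_def[abs_def])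
  then show "(Y x has_vector_derivative \<Phi> (Y x t)) (at t)"
   by (rule has_vector_derivative_transform_within_open[where S="{0<..}"]) (use t Y(2) in auto)
 qed (use Y in auto)
qed

text \<open>The factor \<open>t\<^sup>2\<close> integrates the singular term \<open>2 u / t\<close>.\<close>

lemma bounded_lipschitz_radial:
 fixes \<Phi>1 \<Phi>2 :: "real \<times> real => real"
 assumes L: "0 < L" and B: "!!x. \<bar>\<Phi>1 x\<bar> <= B" "!!x. \<bar>\<Phi>2 x\<bar> <= B"
  and lipschitz: "!!x y. \<bar>\<Phi>1 x - \<Phi>1 y\<bar> <= L * norm (x - y)" "!!x y. \<bar>\<Phi>2 x - \<Phi>2 y\<bar> <= L * norm (x - y)"
 obtains Y :: "real => real => real \<times> real" where "!!x. continuous_on {0..} (Y x)" "!!x. Y x 0 = (0, x)"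
  "!!x t. 0 < t ==> (Y x has_vector_derivative (\<Phi>1 (Y x t) - 2 * fst (Y x t) / t, \<Phi>2 (Y x t))) (at t)"
  "!!x x' t. 0 <= t ==> norm (Y x t - Y x' t) <= 2 * \<bar>x - x'\<bar> * exp (4 * L * t)"
  "!!x t. 0 <= t ==> norm (Y x t - (0, x)) <= 2 * B * t"
proof -
 have "continuous_on UNIV \<Phi>1" "continuous_on UNIV \<Phi>2"
  by (rule lipschitz_on_continuous_on[of L], use L lipschitz in \<open>auto simp: lipschitz_on_def dist_norm\<close>)+
 then have c\<Phi>: "continuous_on {0..} (\<lambda>s. \<Phi>1 (y s))" "continuous_on {0..} (\<lambda>s. \<Phi>2 (y s))"
  if "continuous_on {0..} y" for y :: "real => real \<times> real"
  using continuous_on_compose2[OF _ that, of UNIV] by auto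
 define T where "T z y t = z + (integral {0..t} (\<lambda>s. s\<^sup>2 * \<Phi>1 (y s)) / t\<^sup>2, integral {0..t} (\<lambda>s. \<Phi>2 (y s)))"
  for z y and t :: real
 have B0: "0 <= B" using B(1)[of 0] abs_ge_zero order_trans by blast
 have pair: "norm (p, q) <= \<bar>p\<bar> + \<bar>q\<bar>" for p q :: real
  using norm_Pair_le[of p q] by simp
 have c1: "continuous_on {0..t} (\<lambda>s. s\<^sup>2 * \<Phi>1 (y s))" "continuous_on {0..t} (\<lambda>s. \<Phi>2 (y s))"
  "continuous_on {0..t} (\<lambda>s. \<Phi>1 (y s))"
  if "continuous_on {0..} y" for y t
  using continuous_on_subset[OF c\<Phi>(1)[OF that], of "{0..t}"] continuous_on_subset[OF c\<Phi>(2)[OF that], of "{0..t}"]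
  by (auto intro!: continuous_intros)
 have b1: "\<bar>integral {0..t} (\<lambda>s. s\<^sup>2 * \<Phi>1 (y s)) / t\<^sup>2\<bar> <= B * t" "\<bar>integral {0..t} (\<lambda>s. \<Phi>2 (y s))\<bar> <= B * t"
  if y: "continuous_on {0..} y" and t: "0 <= t" for y t
 proof -
  have "norm (integral {0..t} (\<lambda>s. s\<^sup>2 * \<Phi>1 (y s))) <= (t\<^sup>2 * B) * (t - 0)"
  proof (rule integral_bound[OF t c1(1)[OF y]])
   fix s assume "s \<in> {0..t}"
   then show "norm (s\<^sup>2 * \<Phi>1 (y s)) <= t\<^sup>2 * B"
    using B(1)[of "y s"] by (auto simp: abs_mult intro!: mult_mono power_mono)
  qed
  then show "\<bar>integral {0..t} (\<lambda>s. s\<^sup>2 * \<Phi>1 (y s)) / t\<^sup>2\<bar> <= B * t"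
   using t by (cases "t = 0") (auto simp: field_simps power2_eq_square)
  show "\<bar>integral {0..t} (\<lambda>s. \<Phi>2 (y s))\<bar> <= B * t"
   using integral_bound[OF t c1(2)[OF y], of B] B by simp
 qed
 have bT: "norm (T z y t - z) <= 2 * B * t" if "continuous_on {0..} y" "0 <= t" for z y t
  using b1[OF that] pair[of "integral {0..t} (\<lambda>s. s\<^sup>2 * \<Phi>1 (y s)) / t\<^sup>2" "integral {0..t} (\<lambda>s. \<Phi>2 (y s))"]
  by (simp add: T_def)
 obtain Y where Y: "!!z. continuous_on {0..} (Y z)" "!!z t. 0 <= t ==> Y z t = T z (Y z) t"
  "!!z z' t. 0 <= t ==> norm (Y z t - Y z' t) <= 2 * norm (z - z') * exp ((4 * L) * t)"
 \<comment> \<open>With the exponent \<open>4 * L\<close> each of the two components contributes a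
   quarter.\<close>
 proof (rule causal_fixpoint[of "4 * L" "2 * B" T])
  show "continuous_on {0..} (T z y)" if y: "continuous_on {0..} y" for z y
  proof -
   have "continuous_on {0..} (\<lambda>t. integral {0..t} (\<lambda>s. s\<^sup>2 * \<Phi>1 (y s)) / t\<^sup>2)"
    unfolding continuous_on_eq_continuous_within
   proof
    fix t :: real assume t: "t \<in> {0..}"
    have ci: "continuous_on {0..} (\<lambda>t. integral {0..t} (\<lambda>s. s\<^sup>2 * \<Phi>1 (y s)))"
     by (intro continuous_on_integral_halfline continuous_intros c\<Phi> y)
    show "continuous (at t within {0..}) (\<lambda>t. integral {0..t} (\<lambda>s. s\<^sup>2 * \<Phi>1 (y s)) / t\<^sup>2)"
    proof (cases "t = 0")
     case True
     \<comment> \<open>At \<open>t = 0\<close> the quotient has the default value 0 of a division by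
       0, which is also its limit.\<close>
     have "((\<lambda>t. integral {0..t} (\<lambda>s. s\<^sup>2 * \<Phi>1 (y s)) / t\<^sup>2) \<longlongrightarrow> 0) (at 0 within {0..})"
     proof (rule Lim_null_comparison)
      show "\<forall>\<^sub>F t in at 0 within {0..}. norm (integral {0..t} (\<lambda>s. s\<^sup>2 * \<Phi>1 (y s)) / t\<^sup>2) <= B * t"
       using b1(1)[OF y] by (auto simp: eventually_at intro!: exI[of _ 1])
      show "((\<lambda>t. B * t) \<longlongrightarrow> 0) (at 0 within {0..})"
       by (auto intro!: tendsto_eq_intros)
     qed
     then show ?thesis using True by (simp add: continuous_within)
    next
     case False
     then show ?thesis using ci t
      by (intro continuous_intros) (auto simp: continuous_on_eq_continuous_within)
    qed
   qed
   then show ?thesis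
    unfolding T_def[abs_def]
    by (intro continuous_on_add continuous_on_const continuous_on_Pair continuous_on_integral_halfline c\<Phi> y)
  qed
  show "norm (T z y t - z) <= 2 * B * t" if "continuous_on {0..} y" "0 <= t" for z y t
   by (rule bT[OF that])
  fix z z' C and y y' :: "real => real \<times> real" and t :: real
  assume y: "continuous_on {0..} y" "continuous_on {0..} y'" and t: "0 <= t"
   and C: "!!s. s \<in> {0..t} ==> norm (y s - y' s) <= C * exp (4 * L * s)"
  have "0 <= C" using C[of 0] t order_trans[OF norm_ge_zero[of "y 0 - y' 0"]] by simp
  have LC: "L * norm (y s - y' s) <= L * C * exp (4 * L * s)" if "s \<in> {0..t}" for s
   using C[OF that] L by (simp add: mult.assoc)
  define d1 where "d1 = integral {0..t} (\<lambda>s. s\<^sup>2 * \<Phi>1 (y s)) / t\<^sup>2 - integral {0..t} (\<lambda>s. s\<^sup>2 * \<Phi>1 (y' s)) / t\<^sup>2"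
  define d2 where "d2 = integral {0..t} (\<lambda>s. \<Phi>2 (y s)) - integral {0..t} (\<lambda>s. \<Phi>2 (y' s))"
  have "d1 = integral {0..t} (\<lambda>s. s\<^sup>2 * \<Phi>1 (y s) - s\<^sup>2 * \<Phi>1 (y' s)) / t\<^sup>2"
   unfolding d1_def diff_divide_distrib[symmetric]
   by (subst integral_diff) (auto intro!: integrable_continuous_interval c1 y)
  also have "\<dots> = integral {0..t} (\<lambda>s. inverse (t\<^sup>2) * (s\<^sup>2 * \<Phi>1 (y s) - s\<^sup>2 * \<Phi>1 (y' s)))"
   unfolding integral_mult_right by (simp add: divide_inverse mult.commute)
  \<comment> \<open>The weight \<open>(s / t)^2\<close> is at most 1, also for \<open>t = 0\<close>
    by the convention on division, so the singular component is as Lipschitz as the regular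
    one.\<close>
  also have "\<dots> = integral {0..t} (\<lambda>s. (s / t)\<^sup>2 * (\<Phi>1 (y s) - \<Phi>1 (y' s)))"
   by (rule integral_cong) (simp add: divide_inverse power_mult_distrib power_inverse algebra_simps)
  also have "norm \<dots> <= (L * C) / (4 * L) * exp (4 * L * t)"
  proof (rule integral_exp_bound)
   show "continuous_on {0..t} (\<lambda>s. (s / t)\<^sup>2 * (\<Phi>1 (y s) - \<Phi>1 (y' s)))"
    by (cases "t = 0") (auto intro!: continuous_intros c1(3) y)
   fix s assume s: "s \<in> {0..t}"
   have "(s / t)\<^sup>2 <= 1" using s by (cases "t = 0") (auto simp: power_le_one)
   then have "norm ((s / t)\<^sup>2 * (\<Phi>1 (y s) - \<Phi>1 (y' s))) <= 1 * (L * norm (y s - y' s))"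
    unfolding norm_mult using lipschitz(1)[of "y s" "y' s"] by (intro mult_mono) auto
   then show "norm ((s / t)\<^sup>2 * (\<Phi>1 (y s) - \<Phi>1 (y' s))) <= L * C * exp (4 * L * s)" using LC[OF s] by simp
  qed (use L \<open>0 <= C\<close> t in auto)
  finally have n1: "\<bar>d1\<bar> <= C / 4 * exp (4 * L * t)" using L by simp
  have "d2 = integral {0..t} (\<lambda>s. \<Phi>2 (y s) - \<Phi>2 (y' s))"
   unfolding d2_def by (subst integral_diff) (auto intro!: integrable_continuous_interval c1 y)
  also have "norm \<dots> <= (L * C) / (4 * L) * exp (4 * L * t)"
  proof (rule integral_exp_bound)
   fix s assume s: "s \<in> {0..t}"
   show "norm (\<Phi>2 (y s) - \<Phi>2 (y' s)) <= L * C * exp (4 * L * s)"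
    using lipschitz(2)[of "y s" "y' s"] LC[OF s] by simp
  qed (use L \<open>0 <= C\<close> t in \<open>auto intro!: continuous_intros c1 y\<close>)
  finally have n2: "\<bar>d2\<bar> <= C / 4 * exp (4 * L * t)" using L by simp
  have "T z y t - T z' y' t = (z - z') + (d1, d2)"
   by (simp add: T_def d1_def d2_def)
  then have "norm (T z y t - T z' y' t) <= norm (z - z') + norm (d1, d2)"
   by (simp only: norm_triangle_ineq)
  then show "norm (T z y t - T z' y' t) <= norm (z - z') + C / 2 * exp (4 * L * t)"
   using n1 n2 pair[of d1 d2] by simp
 qed (use L B0 in auto)
 show thesis
 proof (rule that[of "\<lambda>x. Y (0, x)"])
  fix x
  show "Y (0, x) 0 = (0, x)" using Y(2)[of 0 "(0, x)"] by (simp add: T_def)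
  show "norm (Y (0, x) t - (0, x)) <= 2 * B * t" if "0 <= t" for t
   using bT[OF Y(1) that, of "(0, x)" "(0, x)"] Y(2)[OF that] by simp
  fix t :: real assume t: "0 < t"
  define y where "y = Y (0, x)"
  have yc: "continuous_on {0..} y" by (simp add: y_def Y)
  have d1: "DERIV (\<lambda>t. integral {0..t} (\<lambda>s. s\<^sup>2 * \<Phi>1 (y s))) t :> t\<^sup>2 * \<Phi>1 (y t)"
   unfolding has_real_derivative_iff_has_vector_derivative
   by (intro integral_halfline_derivative continuous_intros c\<Phi> yc t)
  have d2: "DERIV (\<lambda>t. integral {0..t} (\<lambda>s. \<Phi>2 (y s))) t :> \<Phi>2 (y t)"
   unfolding has_real_derivative_iff_has_vector_derivative
   by (intro integral_halfline_derivative c\<Phi> yc t)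
  have fst_y: "fst (y t) = integral {0..t} (\<lambda>s. s\<^sup>2 * \<Phi>1 (y s)) / t\<^sup>2"
  proof -
   have "y t = T (0, x) y t" unfolding y_def by (rule Y(2)) (use t in simp)
   from arg_cong[OF this, of fst] show ?thesis by (simp add: T_def)
  qed
  have d3: "DERIV (\<lambda>t. integral {0..t} (\<lambda>s. s\<^sup>2 * \<Phi>1 (y s)) / t\<^sup>2) t :> \<Phi>1 (y t) - 2 * fst (y t) / t"
  proof -
   define N where "N = integral {0..t} (\<lambda>s. s\<^sup>2 * \<Phi>1 (y s))"
   have "DERIV (\<lambda>t. t\<^sup>2) t :> 2 * t" by (auto intro!: derivative_eq_intros)
   from DERIV_divide[OF d1 this] t
   have "DERIV (\<lambda>t. integral {0..t} (\<lambda>s. s\<^sup>2 * \<Phi>1 (y s)) / t\<^sup>2) t :> (t\<^sup>2 * \<Phi>1 (y t) * t\<^sup>2 - N * (2 * t)) / (t\<^sup>2 * t\<^sup>2)"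
    by (simp add: N_def)
   moreover have "(t\<^sup>2 * \<Phi>1 (y t) * t\<^sup>2 - N * (2 * t)) / (t\<^sup>2 * t\<^sup>2) = \<Phi>1 (y t) - 2 * (N / t\<^sup>2) / t"
    using t by (simp add: diff_divide_distrib power2_eq_square mult_ac)
   ultimately show ?thesis unfolding fst_y N_def by simp
  qed
  have "((\<lambda>t. (integral {0..t} (\<lambda>s. s\<^sup>2 * \<Phi>1 (y s)) / t\<^sup>2, integral {0..t} (\<lambda>s. \<Phi>2 (y s))))
    has_vector_derivative (\<Phi>1 (y t) - 2 * fst (y t) / t, \<Phi>2 (y t))) (at t)"
   using d2 d3 by (intro has_vector_derivative_Pair) (simp_all add: has_real_derivative_iff_has_vector_derivative)
  from has_vector_derivative_add[OF has_vector_derivative_const[of "(0, x)"] this]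
  have "(T (0, x) y has_vector_derivative (\<Phi>1 (y t) - 2 * fst (y t) / t, \<Phi>2 (y t))) (at t)"
   by (simp add: T_def[abs_def])
  then have "(y has_vector_derivative (\<Phi>1 (y t) - 2 * fst (y t) / t, \<Phi>2 (y t))) (at t)"
   by (rule has_vector_derivative_transform_within_open[where S="{0<..}"]) (use t Y(2) in \<open>auto simp: y_def\<close>)
  then show "(Y (0, x) has_vector_derivative (\<Phi>1 (Y (0, x) t) - 2 * fst (Y (0, x) t) / t, \<Phi>2 (Y (0, x) t))) (at t)"
   by (simp add: y_def)
 qed (use Y(1) Y(3)[of _ "(0, _)" "(0, _)"] in auto)
qed

text \<open>Bounded and Lipschitz at once: unlike the Lipschitz functions alone, this class is
  closed under products, so global fields can be assembled from clamped pieces.\<close>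

definition blip :: "('a::metric_space => real) => bool" where
 "blip f \<longleftrightarrow> (\<exists>B L. \<forall>x y. \<bar>f x\<bar> <= B \<and> \<bar>f x - f y\<bar> <= L * dist x y)"

lemma blipI: "(!!x. \<bar>f x\<bar> <= B) ==> (!!x y. \<bar>f x - f y\<bar> <= L * dist x y) ==> blip f"
 unfolding blip_def by blast

lemma blipE:
 assumes "blip f"
 obtains B L where "0 < B" "0 < L" "!!x. \<bar>f x\<bar> <= B" "!!x y. \<bar>f x - f y\<bar> <= L * dist x y"
proof -
 obtain B L where BL: "!!x. \<bar>f x\<bar> <= B" "!!x y. \<bar>f x - f y\<bar> <= L * dist x y"
  using assms unfolding blip_def by blast
 show thesis
 proof (rule that[of "max B 1" "max L 1"])
  show "\<bar>f x\<bar> <= max B 1" for x using BL(1)[of x] by simp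
  show "\<bar>f x - f y\<bar> <= max L 1 * dist x y" for x y
   using BL(2)[of x y] mult_right_mono[of L "max L 1" "dist x y"] by simp
 qed auto
qed

lemma blip_const: "blip (\<lambda>_. c)"
 by (rule blipI[of _ "\<bar>c\<bar>" 0]) auto

lemma blip_add: assumes "blip f" "blip g" shows "blip (\<lambda>x. f x + g x)"
proof -
 from blipE[OF assms(1)] obtain B L where 1: "!!x. \<bar>f x\<bar> <= B" "!!x y. \<bar>f x - f y\<bar> <= L * dist x y" by metis
 from blipE[OF assms(2)] obtain B' L' where 2: "!!x. \<bar>g x\<bar> <= B'" "!!x y. \<bar>g x - g y\<bar> <= L' * dist x y" by metis
 show ?thesis
 proof (rule blipI[of _ "B + B'" "L + L'"])
  show "\<bar>f x + g x\<bar> <= B + B'" for x using 1(1)[of x] 2(1)[of x] by linarith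
  show "\<bar>f x + g x - (f y + g y)\<bar> <= (L + L') * dist x y" for x y
   using 1(2)[of x y] 2(2)[of x y] unfolding distrib_right by linarith
 qed
qed

lemma blip_mult: assumes "blip f" "blip g" shows "blip (\<lambda>x. f x * g x)"
proof -
 from blipE[OF assms(1)] obtain B L where 1: "0 < B" "!!x. \<bar>f x\<bar> <= B" "!!x y. \<bar>f x - f y\<bar> <= L * dist x y" by metis
 from blipE[OF assms(2)] obtain B' L' where 2: "0 < B'" "!!x. \<bar>g x\<bar> <= B'" "!!x y. \<bar>g x - g y\<bar> <= L' * dist x y" by metis
 show ?thesis
 proof (rule blipI[of _ "B * B'" "B * L' + L * B'"])
  show "\<bar>f x * g x\<bar> <= B * B'" for x
   unfolding abs_mult using 1 2 by (intro mult_mono) (auto intro: less_imp_le)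
  fix x y
  have "f x * g x - f y * g y = f x * (g x - g y) + (f x - f y) * g y" by (simp add: algebra_simps)
  then have "\<bar>f x * g x - f y * g y\<bar> <= \<bar>f x\<bar> * \<bar>g x - g y\<bar> + \<bar>f x - f y\<bar> * \<bar>g y\<bar>"
   by (metis abs_mult abs_triangle_ineq)
  also have "\<dots> <= B * (L' * dist x y) + (L * dist x y) * B'"
   using 1 2 by (intro add_mono mult_mono) (auto intro: less_imp_le order_trans[OF abs_ge_zero])
  finally show "\<bar>f x * g x - f y * g y\<bar> <= (B * L' + L * B') * dist x y" by (simp add: algebra_simps)
 qed
qed

lemma blip_uminus: "blip f ==> blip (\<lambda>x. - f x)"
 using blip_mult[OF blip_const[of "- 1"]] by simp

lemma blip_diff: "blip f ==> blip g ==> blip (\<lambda>x. f x - g x)"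
 using blip_add[OF _ blip_uminus] by simp

lemma blip_comp:
 assumes "blip (g :: real => real)" "!!x y. \<bar>f x - f y\<bar> <= M * dist x y"
 shows "blip (\<lambda>x. g (f x))"
proof -
 from blipE[OF assms(1)] obtain B L where 1: "0 < L" "!!x. \<bar>g x\<bar> <= B" "!!x y. \<bar>g x - g y\<bar> <= L * dist x y" by metis
 show ?thesis
 proof (rule blipI[of _ B "L * M"])
  fix x y
  have "\<bar>g (f x) - g (f y)\<bar> <= L * \<bar>f x - f y\<bar>" using 1(3)[of "f x" "f y"] by (simp add: dist_real_def)
  also have "\<dots> <= L * (M * dist x y)" using assms(2)[of x y] 1(1) by (intro mult_left_mono) auto
  finally show "\<bar>g (f x) - g (f y)\<bar> <= L * M * dist x y" by (simp add: mult.assoc)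
 qed (use 1 in auto)
qed

definition clamp01 :: "real => real => real => real" where
 "clamp01 lo hi x = max lo (min hi x)"

lemma clamp01_lipschitz: "\<bar>clamp01 lo hi x - clamp01 lo hi y\<bar> <= \<bar>x - y\<bar>"
 by (auto simp: clamp01_def max_def min_def)

lemma clamp01_range: "lo <= hi ==> clamp01 lo hi x \<in> {lo..hi}"
 by (auto simp: clamp01_def)

lemma clamp01_id: "x \<in> {lo..hi} ==> clamp01 lo hi x = x"
 by (auto simp: clamp01_def)

lemma blip_clamp01:
 assumes "lo <= hi" "continuous_on {lo..hi} g"
  and "!!x. lo < x ==> x < hi ==> DERIV g x :> g' x"
  and "!!x. lo < x ==> x < hi ==> \<bar>g' x\<bar> <= L"
 shows "blip (\<lambda>x. g (clamp01 lo hi x))"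
proof -
 have lip1: "\<bar>g x - g y\<bar> <= \<bar>L\<bar> * \<bar>x - y\<bar>" if xy: "x \<in> {lo..hi}" "y \<in> {lo..hi}" "x < y" for x y
 proof -
  have "\<exists>l z. x < z \<and> z < y \<and> DERIV g z :> l \<and> g y - g x = (y - x) * l"
  proof (rule MVT[OF xy(3)])
   show "continuous_on {x..y} g" by (rule continuous_on_subset[OF assms(2)]) (use xy in auto)
   show "g differentiable (at z)" if "x < z" "z < y" for z
    using assms(3)[of z] that xy by (auto simp: real_differentiable_def)
  qed
  then obtain l z where z: "x < z" "z < y" "DERIV g z :> l" "g y - g x = (y - x) * l" by blast
  have "l = g' z" using DERIV_unique[OF z(3) assms(3)[of z]] z xy by auto
  then have "\<bar>l\<bar> <= \<bar>L\<bar>" using assms(4)[of z] z xy by auto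
  then have "\<bar>y - x\<bar> * \<bar>l\<bar> <= \<bar>y - x\<bar> * \<bar>L\<bar>" by (intro mult_left_mono) auto
  moreover have "\<bar>g x - g y\<bar> = \<bar>y - x\<bar> * \<bar>l\<bar>" using z(4) by (metis abs_minus_commute abs_mult)
  ultimately show ?thesis by (simp add: mult.commute abs_minus_commute)
 qed
 have lip: "\<bar>g x - g y\<bar> <= \<bar>L\<bar> * \<bar>x - y\<bar>" if xy: "x \<in> {lo..hi}" "y \<in> {lo..hi}" for x y
  using lip1[OF xy] lip1[OF xy(2,1)] by (cases x y rule: linorder_cases) (auto simp: abs_minus_commute)
 have "bounded (g ` {lo..hi})" by (intro compact_imp_bounded compact_continuous_image assms(2)) auto
 then obtain B where B: "!!x. x \<in> {lo..hi} ==> \<bar>g x\<bar> <= B"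
  unfolding bounded_iff by force
 show ?thesis
 proof (rule blipI[of _ B "\<bar>L\<bar>"])
  show "\<bar>g (clamp01 lo hi x)\<bar> <= B" for x by (rule B[OF clamp01_range[OF assms(1)]])
  fix x y
  have "\<bar>g (clamp01 lo hi x) - g (clamp01 lo hi y)\<bar> <= \<bar>L\<bar> * \<bar>clamp01 lo hi x - clamp01 lo hi y\<bar>"
   by (rule lip[OF clamp01_range clamp01_range]) (rule assms(1))+
  also have "\<dots> <= \<bar>L\<bar> * dist x y"
   unfolding dist_real_def by (intro mult_left_mono clamp01_lipschitz) auto
  finally show "\<bar>g (clamp01 lo hi x) - g (clamp01 lo hi y)\<bar> <= \<bar>L\<bar> * dist x y" .
 qed
qed

lemma blip_clamp01_id: "lo <= hi ==> blip (clamp01 lo hi)"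
 by (rule blip_clamp01[of lo hi "\<lambda>x. x" "\<lambda>_. 1" 1]) auto

lemma blip_sin: "blip (sin :: real => real)" and blip_cos: "blip (cos :: real => real)"
proof -
 have s: "\<bar>sin x - sin y\<bar> <= \<bar>x - y\<bar>" for x y :: real
 proof -
  have "\<bar>sin x - sin y\<bar> = 2 * (\<bar>sin ((x - y) / 2)\<bar> * \<bar>cos ((x + y) / 2)\<bar>)"
   by (simp add: sin_diff_sin abs_mult)
  also have "\<dots> <= 2 * (\<bar>(x - y) / 2\<bar> * 1)"
   by (intro mult_left_mono mult_mono abs_sin_x_le_abs_x) auto
  finally show ?thesis by simp
 qed
 show "blip (sin :: real => real)"
  by (rule blipI[of _ 1 1]) (use s in \<open>auto simp: dist_real_def\<close>)
 then have "blip (\<lambda>x. sin (pi / 2 - x))"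
  by (rule blip_comp[of _ _ 1]) (auto simp: dist_real_def)
 then show "blip (cos :: real => real)" by (simp add: cos_sin_eq[abs_def])
qed

text \<open>Near \<open>t\<close> a continuous logarithm of \<open>c\<close> coincides with
  \<open>g t + Ln (c s / c t)\<close> for the principal branch, since its imaginary part moves by
  less than \<open>pi\<close>. Continuity alone thus yields the derivative.\<close>

lemma continuous_log_derivative:
 fixes c g :: "real => complex"
 assumes "open U" "t \<in> U" and g: "continuous_on U g" and eq: "!!s. s \<in> U ==> c s = exp (g s)"
  and c: "(c has_vector_derivative c') (at t)"
 shows "(g has_vector_derivative c' / c t) (at t)"
proof -
 have ct: "c t \<noteq> 0" using eq[OF assms(2)] by simp
 have d1: "((\<lambda>s. c s / c t) has_vector_derivative c' / c t) (at t)"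
  by (rule has_vector_derivative_divide[OF c])
 have "(Ln has_field_derivative inverse (c t / c t)) (at (c t / c t))"
  by (rule has_field_derivative_Ln) (use ct in simp)
 then have "(Ln has_field_derivative 1) (at (c t / c t))" using ct by simp
 from field_vector_diff_chain_at[OF d1 this]
 have "((\<lambda>s. Ln (c s / c t)) has_vector_derivative c' / c t) (at t)" by (simp add: o_def)
 from has_vector_derivative_add[OF has_vector_derivative_const this]
 have d2: "((\<lambda>s. g t + Ln (c s / c t)) has_vector_derivative c' / c t) (at t)" by simp
 define V where "V = U \<inter> g -` ball (g t) pi"
 have V: "open V" "t \<in> V"
  unfolding V_def using continuous_open_preimage[OF g assms(1) open_ball] assms(2) by auto
 have "g s = g t + Ln (c s / c t)" if "s \<in> V" for s
 proof -
  have "\<bar>Im (g s - g t)\<bar> < pi"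
   using that abs_Im_le_cmod[of "g s - g t"] by (simp add: V_def dist_norm norm_minus_commute)
  then have "Ln (exp (g s - g t)) = g s - g t" by (intro Ln_exp) auto
  moreover have "exp (g s - g t) = c s / c t" using eq that assms(2) by (simp add: V_def exp_diff)
  ultimately show ?thesis by simp
 qed
 then show ?thesis
  by (intro has_vector_derivative_transform_within_open[OF d2 V]) simp
qed

text \<open>The terms with \<open>e\<close> cancel: \<open>F\<close> does not enter the derivative
  of \<open>s\<close>. Hence \<open>s\<close> can be followed across its zeros with bounds uniform
  in \<open>p\<close>, whereas the derivatives of \<open>u\<close> and \<open>v\<close> contain
  \<open>F\<close>.\<close>

lemma DERIV_Gp_exp_cos:
 assumes l: "DERIV l t :> - 2 * (sin (\<phi> t) * (m * f + e) + f * (1 - cos (\<phi> t)) / r)"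
  and \<phi>: "DERIV \<phi> t :> 2 * f * ((\<Omega> - m * cos (\<phi> t)) - sin (\<phi> t) / r) - 2 * e * cos (\<phi> t)"
 shows "DERIV (\<lambda>t. exp (l t) * cos (\<phi> t)) t :> - 2 * f * exp (l t) * (\<Omega> * sin (\<phi> t) - (1 - cos (\<phi> t)) / r)"
proof -
 define R where "R = inverse r"
 have sq: "(sin (\<phi> t))\<^sup>2 + (cos (\<phi> t))\<^sup>2 = 1" by simp
 show ?thesis
  apply (rule derivative_eq_intros l \<phi> refl)+
  unfolding divide_inverse R_def[symmetric]
  using sq by algebra
qed

section \<open>Polar lifts and solutions near the centre\<close>

context frequency
begin

lemma soler_field_eq:
 "soler_field m \<Omega> p r (y, z) = (z * (a - F p (z\<^sup>2 - y\<^sup>2)) - 2 * y / r, - y * (b + F p (z\<^sup>2 - y\<^sup>2)))"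
 by (simp add: soler_field_def a_def b_def algebra_simps)

text \<open>The nowhere vanishing curve \<open>v + i u\<close> has a continuous logarithm on the
  interval \<open>I\<close>; twice its real part is \<open>l\<close> and twice its imaginary part,
  normalised, is the phase. That \<open>s\<close> does not vanish outside \<open>S\<close> lets the
  chain rule apply to \<open>Gp\<close>.\<close>

lemma polar_lift:
 assumes p: "0 < p" "p <= p1" and I: "is_interval I" "I \<subseteq> {0..}" "0 \<in> I" and S: "finite S"
  and w: "continuous_on I w" "!!t. t \<in> I ==> w t \<noteq> 0"
  and dw: "!!t. t \<in> interior I - S ==> (w has_vector_derivative soler_field m \<Omega> p t (w t)) (at t)"
  and s: "!!t. t \<in> interior I - S ==> minkowski (w t) \<noteq> 0"
  and w0: "w 0 = (0, x)" "0 < x"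
 obtains l \<phi> where "orbit m \<Omega> p I S (\<lambda>t. t) (\<lambda>_. 1) (\<lambda>t. F p (minkowski (w t))) l \<phi>"
  "\<phi> 0 = 0" "!!t. t \<in> I ==> w t = (exp (l t / 2) * sin (\<phi> t / 2), exp (l t / 2) * cos (\<phi> t / 2))"
proof -
 define c where "c t = Complex (snd (w t)) (fst (w t))" for t
 have cc: "continuous_on I c"
  unfolding c_def[abs_def] by (intro continuous_on_Complex continuous_intros w)
 have "contractible I" using I(1) convex_imp_contractible is_interval_convex_1 by blast
 moreover have "c t \<noteq> 0" if "t \<in> I" for t
  using w(2)[OF that] by (auto simp: c_def complex_eq_iff prod_eq_iff)
 ultimately obtain g where g: "continuous_on I g" "!!t. t \<in> I ==> c t = exp (g t)"
  using continuous_logarithm_on_contractible[OF cc] by metis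
 define l where "l t = 2 * Re (g t)" for t
 \<comment> \<open>\<open>Im (g 0)\<close> is a multiple of \<open>2 * pi\<close> because
   \<open>w 0\<close> lies on the positive \<open>v\<close>-axis; subtracting it puts the phase at
   the centre to 0 without changing the curve.\<close>
 define \<phi> where "\<phi> t = 2 * (Im (g t) - Im (g 0))" for t
 have "exp (g 0) = complex_of_real x" using g(2)[OF I(3)] w0 by (simp add: c_def complex_eq_iff)
 then have "Im (exp (g 0)) = 0" "Re (exp (g 0)) > 0" using w0(2) by auto
 then have s0: "sin (Im (g 0)) = 0" "0 < cos (Im (g 0))" by (auto simp: Im_exp Re_exp zero_less_mult_iff)
 then have c0: "cos (Im (g 0)) = 1" using sin_cos_squared_add[of "Im (g 0)"] by (simp add: power2_eq_1_iff)
 have polar: "w t = (exp (l t / 2) * sin (\<phi> t / 2), exp (l t / 2) * cos (\<phi> t / 2))" if t: "t \<in> I" for t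
 proof -
  have "snd (w t) = Re (exp (g t))" "fst (w t) = Im (exp (g t))" using g(2)[OF t] by (auto simp: c_def complex_eq_iff)
  moreover have "sin (Im (g t) - Im (g 0)) = sin (Im (g t))" "cos (Im (g t) - Im (g 0)) = cos (Im (g t))"
   by (simp_all add: sin_diff cos_diff s0 c0)
  moreover have "\<phi> t / 2 = Im (g t) - Im (g 0)" "l t / 2 = Re (g t)" by (simp_all add: \<phi>_def l_def)
  ultimately show ?thesis by (simp only: prod_eq_iff fst_conv snd_conv Re_exp Im_exp)
 qed
 have intp: "0 < t" if "t \<in> interior I" for t
  using that interior_mono[OF I(2)] by auto
 have mink: "minkowski (w t) = exp (l t) * cos (\<phi> t)" if t: "t \<in> I" for t
 proof -
  have "cos (\<phi> t) = (cos (\<phi> t / 2))\<^sup>2 - (sin (\<phi> t / 2))\<^sup>2" using cos_double[of "\<phi> t / 2"] by simp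
  moreover have "exp (l t) = (exp (l t / 2))\<^sup>2" by (simp flip: exp_double)
  ultimately show ?thesis by (simp add: polar[OF t] minkowski_def power_mult_distrib right_diff_distrib)
 qed
 have der: "DERIV l t :> - 2 * (sin (\<phi> t) * (m * 1 + F p (minkowski (w t))) + 1 * (1 - cos (\<phi> t)) / t)"
  "DERIV \<phi> t :> 2 * 1 * (wt (\<phi> t) - sin (\<phi> t) / t) - 2 * F p (minkowski (w t)) * cos (\<phi> t)"
  if t: "t \<in> interior I - S" for t
 proof -
  have tI: "t \<in> I" using t interior_subset by blast
  have t0: "0 < t" using t intp by blast
  define Ft where "Ft = F p (minkowski (w t))"
  define y where "y = fst (w t)"
  define z where "z = snd (w t)"
  define R where "R = inverse t"
  have wyz: "w t = (y, z)" by (simp add: y_def z_def)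
  have field: "soler_field m \<Omega> p t (w t) = (z * (a - Ft) - 2 * y * R, - y * (b + Ft))"
   unfolding wyz soler_field_eq Ft_def by (simp add: minkowski_def R_def divide_inverse)
  have dy: "DERIV (\<lambda>t. fst (w t)) t :> z * (a - Ft) - 2 * y * R"
   using bounded_linear.has_vector_derivative[OF bounded_linear_fst dw[OF t]] field
   by (simp add: has_real_derivative_iff_has_vector_derivative)
  have dz: "DERIV (\<lambda>t. snd (w t)) t :> - y * (b + Ft)"
   using bounded_linear.has_vector_derivative[OF bounded_linear_snd dw[OF t]] field
   by (simp add: has_real_derivative_iff_has_vector_derivative)
  define c' where "c' = Complex (- y * (b + Ft)) (z * (a - Ft) - 2 * y * R)"
  have "(c has_vector_derivative c') (at t)"
   unfolding has_vector_derivative_complex_iff c_def c'_def using dy dz by simp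
  from continuous_log_derivative[OF open_interior _ continuous_on_subset[OF g(1) interior_subset] _ this]
  have dg: "(g has_vector_derivative c' / c t) (at t)"
   using t g(2) interior_subset by (metis Diff_iff subsetD)
  define E where "E = z\<^sup>2 + y\<^sup>2"
  have E: "E \<noteq> 0" using w(2)[OF tI] wyz by (auto simp: E_def sum_power2_eq_zero_iff zero_prod_def)
  have quot: "Re (c' / c t) * E = - y * (b + Ft) * z + (z * (a - Ft) - 2 * y * R) * y"
   "Im (c' / c t) * E = (z * (a - Ft) - 2 * y * R) * z + y * (b + Ft) * y"
   using E unfolding c'_def c_def y_def[symmetric] z_def[symmetric]
   by (simp_all add: Re_divide Im_divide E_def power2_eq_square)
  have Ez: "y = exp (l t / 2) * sin (\<phi> t / 2)" "z = exp (l t / 2) * cos (\<phi> t / 2)"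
   using polar[OF tI] wyz by auto
  have sc: "(sin (\<phi> t / 2))\<^sup>2 + (cos (\<phi> t / 2))\<^sup>2 = 1" by simp
  have Ee: "E = exp (l t / 2) * exp (l t / 2)" unfolding E_def Ez using sc by algebra
  have Es: "E * sin (\<phi> t) = 2 * y * z" unfolding Ee Ez using sin_double[of "\<phi> t / 2"] by simp
  have Ec: "E * cos (\<phi> t) = z\<^sup>2 - y\<^sup>2" 
  proof -
   have "cos (\<phi> t) = (cos (\<phi> t / 2))\<^sup>2 - (sin (\<phi> t / 2))\<^sup>2" using cos_double[of "\<phi> t / 2"] by simp
   then show ?thesis unfolding Ee Ez by algebra
  qed
  have 1: "E * (2 * Re (c' / c t)) = E * (- 2 * (sin (\<phi> t) * (m + Ft) + (1 - cos (\<phi> t)) * R))"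
   using quot(1) Es Ec E_def a_def b_def by algebra
  have 2: "E * (2 * Im (c' / c t)) = E * (2 * (\<Omega> - m * cos (\<phi> t) - sin (\<phi> t) * R) - 2 * Ft * cos (\<phi> t))"
   using quot(2) Es Ec E_def a_def b_def by algebra
  have "DERIV l t :> 2 * Re (c' / c t)"
   unfolding l_def[abs_def] by (intro DERIV_cmult has_field_derivative_Re dg)
  then show "DERIV l t :> - 2 * (sin (\<phi> t) * (m * 1 + F p (minkowski (w t))) + 1 * (1 - cos (\<phi> t)) / t)"
   using 1 E by (simp add: Ft_def R_def divide_inverse)
  have "DERIV (\<lambda>t. Im (g t)) t :> Im (c' / c t)"
   using dg unfolding has_vector_derivative_complex_iff by simp
  from DERIV_cmult[OF DERIV_diff[OF this DERIV_const[of "Im (g 0)"]], of 2]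
  have "DERIV \<phi> t :> 2 * Im (c' / c t)"
   unfolding \<phi>_def[abs_def] by (simp only: diff_zero)
  then show "DERIV \<phi> t :> 2 * 1 * (wt (\<phi> t) - sin (\<phi> t) / t) - 2 * F p (minkowski (w t)) * cos (\<phi> t)"
   using 2 E by (simp add: Ft_def R_def divide_inverse wt_def)
 qed
 have "orbit m \<Omega> p I S (\<lambda>t. t) (\<lambda>_. 1) (\<lambda>t. F p (minkowski (w t))) l \<phi>"
 proof unfold_locales
  show "0 < p" "p <= p1" "is_interval I" "finite S" by fact+
  show "continuous_on I (\<lambda>t. t)" by simp
  show "continuous_on I l" unfolding l_def[abs_def] by (intro continuous_intros g)
  show "continuous_on I \<phi>" unfolding \<phi>_def[abs_def] by (intro continuous_intros g)
  show "0 <= t" if "t \<in> I" for t using that I(2) by auto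
  fix t assume t: "t \<in> interior I - S"
  then have tI: "t \<in> I" using interior_subset by blast
  show "0 < t" using t intp by blast
  show "(0::real) <= 1" by simp
  show "0 <= F p (minkowski (w t))" using p by (simp add: F_def)
  show "F p (minkowski (w t)) * (exp (l t) * cos (\<phi> t)) = p * Gp p (exp (l t) * cos (\<phi> t)) * 1"
   unfolding mink[OF tI] by (simp add: F_mult_eq_Gp)
  show "DERIV (\<lambda>t. t) t :> 1" by simp
  show "DERIV l t :> - 2 * (sin (\<phi> t) * (m * 1 + F p (minkowski (w t))) + 1 * (1 - cos (\<phi> t)) / t)"
   "DERIV \<phi> t :> 2 * 1 * (wt (\<phi> t) - sin (\<phi> t) / t) - 2 * F p (minkowski (w t)) * cos (\<phi> t)"
   by (rule der[OF t])+
  have nz: "exp (l t) * cos (\<phi> t) \<noteq> 0" using s[OF t] mink[OF tI] by simp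
  from DERIV_chain2[OF DERIV_Gp[OF nz] DERIV_Gp_exp_cos[OF der(1)[OF t] der(2)[OF t, unfolded wt_def]]]
  show "DERIV (\<lambda>t. Gp p (exp (l t) * cos (\<phi> t))) t :> - 2 * F p (minkowski (w t)) * exp (l t) * (\<Omega> * sin (\<phi> t) - (1 - cos (\<phi> t)) / t)"
   unfolding mink[OF tI] by (simp add: mult_ac)
 qed
 moreover have "\<phi> 0 = 0" by (simp add: \<phi>_def)
 ultimately show thesis using that polar by blast
qed

text \<open>Near \<open>r = 0\<close> the solution stays in a region where \<open>s\<close> is bounded below; clamping the arguments to it makes the field Lipschitz.\<close>

lemma initial_solutions:
 assumes p: "0 < p" "p < 1" and xl: "0 < xl" "xl <= xh"
 obtains r1 C and W :: "real => real => real \<times> real" where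
  "0 < r1" "r1 <= r0"
  "!!x. continuous_on {0..} (W x)" "!!x. W x 0 = (0, x)"
  "!!x t. x \<in> {xl..xh} ==> t \<in> {0<..r1} ==> (W x has_vector_derivative soler_field m \<Omega> p t (W x t)) (at t)"
  "!!x t. x \<in> {xl..xh} ==> t \<in> {0..r1} ==> 0 < snd (W x t) \<and> \<bar>fst (W x t)\<bar> < snd (W x t)"
  "!!x x'. norm (W x r1 - W x' r1) <= C * \<bar>x - x'\<bar>"
proof -
 \<comment> \<open>From \<open>v >= xl / 2\<close> and \<open>|u| <= xl / 4\<close> follows
   \<open>s >= 3 / 16 * xl^2\<close>, and \<open>v <= 2 * xh\<close> gives the upper end
   \<open>hi\<close>.\<close>
 define \<sigma> where "\<sigma> = 3 * xl\<^sup>2 / 16"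
 define hi where "hi = 4 * xh\<^sup>2"
 have \<sigma>: "0 < \<sigma>" using xl by (simp add: \<sigma>_def)
 have "xl\<^sup>2 <= xh\<^sup>2" using xl by (intro power_mono) auto
 then have \<sigma>hi: "\<sigma> <= hi" using xl zero_le_power2[of "xl"] unfolding \<sigma>_def hi_def by linarith
 define Fc where "Fc s = p * (clamp01 \<sigma> hi s) powr (p - 1)" for s
 have "blip (\<lambda>s. p * (clamp01 \<sigma> hi s) powr (p - 1))"
 proof (rule blip_clamp01[where g = "\<lambda>s. p * s powr (p - 1)" and g' = "\<lambda>s. p * ((p - 1) * s powr (p - 2))"
   and L = "p * ((1 - p) * \<sigma> powr (p - 2))", OF \<sigma>hi])
  show "continuous_on {\<sigma>..hi} (\<lambda>s. p * s powr (p - 1))"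
   using \<sigma> by (intro continuous_intros) auto
  fix s assume s: "\<sigma> < s" "s < hi"
  have "DERIV (\<lambda>s. s powr (p - 1)) s :> (p - 1) * s powr (p - 1 - 1)"
   using has_real_derivative_powr[of s "p - 1"] s \<sigma> by simp
  from DERIV_cmult[OF this, of p]
  show "DERIV (\<lambda>s. p * s powr (p - 1)) s :> p * ((p - 1) * s powr (p - 2))" by simp
  have "s powr (p - 2) <= \<sigma> powr (p - 2)" using s \<sigma> p by (intro powr_mono2') auto
  then have "p * ((1 - p) * s powr (p - 2)) <= p * ((1 - p) * \<sigma> powr (p - 2))"
   using p by (intro mult_left_mono) auto
  moreover have "\<bar>p * ((p - 1) * s powr (p - 2))\<bar> = p * ((1 - p) * s powr (p - 2))"
   using p by (simp add: abs_mult)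
  ultimately show "\<bar>p * ((p - 1) * s powr (p - 2))\<bar> <= p * ((1 - p) * \<sigma> powr (p - 2))" by simp
 qed
 then have bF: "blip Fc" by (simp add: Fc_def[abs_def])
 define cu where "cu z = clamp01 (- xl / 4) (xl / 4) (fst z)" for z :: "real \<times> real"
 define cv where "cv z = clamp01 (xl / 2) (2 * xh) (snd z)" for z :: "real \<times> real"
 have bu: "blip cu"
  unfolding cu_def[abs_def]
  by (rule blip_comp[OF blip_clamp01_id, where M=1]) (use xl dist_fst_le in \<open>auto simp flip: dist_real_def\<close>)
 have bv: "blip cv"
  unfolding cv_def[abs_def]
  by (rule blip_comp[OF blip_clamp01_id, where M=1]) (use xl dist_snd_le in \<open>auto simp flip: dist_real_def\<close>)
 define Q where "Q z = cv z * cv z - cu z * cu z" for z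
 have bQ: "blip Q" unfolding Q_def[abs_def] by (intro blip_diff blip_mult bu bv)
 obtain LQ where "!!x y. \<bar>Q x - Q y\<bar> <= LQ * dist x y" using blipE[OF bQ] by metis
 then have bFQ: "blip (\<lambda>z. Fc (Q z))" by (rule blip_comp[OF bF])
 define \<Phi>1 where "\<Phi>1 z = cv z * (a - Fc (Q z))" for z
 define \<Phi>2 where "\<Phi>2 z = - cu z * (b + Fc (Q z))" for z
 have "blip \<Phi>1" unfolding \<Phi>1_def[abs_def] by (intro blip_diff blip_mult blip_const bv bFQ)
 then obtain B1 L1 where 1: "0 < B1" "0 < L1" "!!x. \<bar>\<Phi>1 x\<bar> <= B1" "!!x y. \<bar>\<Phi>1 x - \<Phi>1 y\<bar> <= L1 * dist x y"
  by (rule blipE) blast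
 have "blip \<Phi>2" unfolding \<Phi>2_def[abs_def] by (intro blip_add blip_mult blip_uminus blip_const bu bFQ)
 then obtain B2 L2 where 2: "0 < B2" "0 < L2" "!!x. \<bar>\<Phi>2 x\<bar> <= B2" "!!x y. \<bar>\<Phi>2 x - \<Phi>2 y\<bar> <= L2 * dist x y"
  by (rule blipE) blast
 define B where "B = B1 + B2"
 define L where "L = L1 + L2"
 have B: "0 < B" "\<bar>\<Phi>1 x\<bar> <= B" "\<bar>\<Phi>2 x\<bar> <= B" for x
  using 1(1) 2(1) 1(3)[of x] 2(3)[of x] by (auto simp: B_def)
 have L: "0 < L" "\<bar>\<Phi>1 x - \<Phi>1 y\<bar> <= L * norm (x - y)" "\<bar>\<Phi>2 x - \<Phi>2 y\<bar> <= L * norm (x - y)" for x y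
  using 1(2) 2(2) 1(4)[of x y] 2(4)[of x y] mult_nonneg_nonneg[of L1 "norm (x - y)"] mult_nonneg_nonneg[of L2 "norm (x - y)"]
  by (auto simp: L_def dist_norm distrib_right)
 obtain W :: "real => real => real \<times> real" where W: "!!x. continuous_on {0..} (W x)" "!!x. W x 0 = (0, x)"
  "!!x t. 0 < t ==> (W x has_vector_derivative (\<Phi>1 (W x t) - 2 * fst (W x t) / t, \<Phi>2 (W x t))) (at t)"
  "!!x x' t. 0 <= t ==> norm (W x t - W x' t) <= 2 * \<bar>x - x'\<bar> * exp (4 * L * t)"
  "!!x t. 0 <= t ==> norm (W x t - (0, x)) <= 2 * B * t"
  using bounded_lipschitz_radial[OF L(1) B(2,3) L(2,3)] by metis
 \<comment> \<open>The solution moves at most by \<open>2 * B * t\<close> away from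
   \<open>(0, x)\<close>. Up to this radius both components therefore stay within
   \<open>xl / 4\<close> of their start, where the clamps act as the identity.\<close>
 define r1 where "r1 = min r0 (xl / (8 * B))"
 have r1: "0 < r1" "r1 <= r0" using r0_pos xl B by (auto simp: r1_def)
 have Br: "2 * B * t <= xl / 4" if "t \<in> {0..r1}" for t
 proof -
  have "2 * B * t <= 2 * B * (xl / (8 * B))" using that B(1) by (intro mult_left_mono) (auto simp: r1_def)
  then show ?thesis using B(1) by simp
 qed
 have near: "\<bar>fst (W x t)\<bar> <= xl / 4" "\<bar>snd (W x t) - x\<bar> <= xl / 4" if "t \<in> {0..r1}" for x t
 proof -
  have n: "norm (W x t - (0, x)) <= xl / 4" using W(5)[of t x] Br[OF that] that by simp
  have "W x t - (0, x) = (fst (W x t), snd (W x t) - x)" by (simp add: prod_eq_iff)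
  with n have n: "norm (fst (W x t), snd (W x t) - x) <= xl / 4" by simp
  show "\<bar>fst (W x t)\<bar> <= xl / 4" using norm_fst_le[of "fst (W x t)" "snd (W x t) - x"] n by simp
  show "\<bar>snd (W x t) - x\<bar> <= xl / 4" using norm_snd_le[of "snd (W x t) - x" "fst (W x t)"] n by simp
 qed
 show thesis
 proof (rule that[OF r1 W(1,2)])
  fix x t assume x: "x \<in> {xl..xh}"
  show "0 < snd (W x t) \<and> \<bar>fst (W x t)\<bar> < snd (W x t)" if "t \<in> {0..r1}"
  proof -
   have "xl <= x" "\<bar>fst (W x t)\<bar> <= xl / 4" "\<bar>snd (W x t) - x\<bar> <= xl / 4" using near[OF that, of x] x by auto
   then show ?thesis using xl(1) by linarith
  qed
  assume t: "t \<in> {0<..r1}"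
  define y where "y = fst (W x t)"
  define z where "z = snd (W x t)"
  have yz: "\<bar>y\<bar> <= xl / 4" "\<bar>z - x\<bar> <= xl / 4" using near[of t x] t by (auto simp: y_def z_def)
  have zb: "xl / 2 <= z" "z <= 2 * xh"
  proof -
   have "xl <= x" "x <= xh" using x by auto
   with yz(2) xl show "xl / 2 <= z" "z <= 2 * xh" by linarith+
  qed
  have c: "cu (W x t) = y" "cv (W x t) = z"
   unfolding cu_def cv_def y_def[symmetric] z_def[symmetric]
   using yz zb by (auto intro!: clamp01_id simp: abs_le_iff)
  have "\<bar>y\<bar>\<^sup>2 <= (xl / 4)\<^sup>2" "(xl / 2)\<^sup>2 <= z\<^sup>2" "z\<^sup>2 <= (2 * xh)\<^sup>2"
   using yz(1) zb xl by (intro power_mono; simp)+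
  then have "y\<^sup>2 <= xl\<^sup>2 / 16" "xl\<^sup>2 / 4 <= z\<^sup>2" "z\<^sup>2 <= 4 * xh\<^sup>2"
   by (simp_all add: power_divide power_mult_distrib)
  then have s: "\<sigma> <= z\<^sup>2 - y\<^sup>2" "z\<^sup>2 - y\<^sup>2 <= hi"
   using zero_le_power2[of y] unfolding \<sigma>_def hi_def by linarith+
  have "Fc (Q (W x t)) = F p (z\<^sup>2 - y\<^sup>2)"
   using s \<sigma> by (simp add: Fc_def Q_def c clamp01_id F_def power2_eq_square)
  then have "(\<Phi>1 (W x t) - 2 * fst (W x t) / t, \<Phi>2 (W x t)) = soler_field m \<Omega> p t (y, z)"
   unfolding soler_field_eq \<Phi>1_def \<Phi>2_def c by (simp add: y_def)
  moreover have "(y, z) = W x t" by (simp add: y_def z_def)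
  ultimately show "(W x has_vector_derivative soler_field m \<Omega> p t (W x t)) (at t)"
   using W(3)[of t x] t by simp
 next
  fix x x'
  show "norm (W x r1 - W x' r1) <= (2 * exp (4 * L * r1)) * \<bar>x - x'\<bar>"
   using W(4)[of "r1" x x'] r1 by (simp add: mult_ac)
 qed
qed

end

section \<open>The regularised flow\<close>

lemma DERIV_Gp_gt_1:
 assumes "1 < q"
 shows "DERIV (Gp q) s :> F q s"
proof (cases "s = 0")
 case False
 then show ?thesis by (rule DERIV_Gp)
next
 case True
 have "isCont (Gp (q - 1)) 0"
  using continuous_on_Gp[of "q - 1"] assms by (simp add: continuous_on_eq_continuous_at)
 then have "((\<lambda>h. \<bar>Gp (q - 1) h\<bar>) \<longlongrightarrow> 0) (at 0)"
  by (auto simp: isCont_def intro: tendsto_rabs_zero)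
 then have "((\<lambda>h. Gp q h / h) \<longlongrightarrow> 0) (at 0)"
 proof (rule Lim_null_comparison[rotated])
  have "norm (Gp q h / h) <= \<bar>Gp (q - 1) h\<bar>" for h
   by (cases "h = 0") (auto simp: Gp_def abs_mult abs_sgn_eq powr_diff)
  then show "\<forall>\<^sub>F h in at 0. norm (Gp q h / h) <= \<bar>Gp (q - 1) h\<bar>" by simp
 qed
 then show ?thesis using True by (simp add: DERIV_def F_def)
qed

lemma Gp_inverse:
 assumes "0 < p"
 shows "Gp p (Gp (1 / p) x) = x" "Gp (1 / p) (Gp p x) = x"
proof -
 show "Gp p (Gp (1 / p) x) = x" using assms
  by (cases x "0::real" rule: linorder_cases) (auto simp: Gp_def powr_powr sgn_mult)
 show "Gp (1 / p) (Gp p x) = x" using assms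
  by (cases x "0::real" rule: linorder_cases) (auto simp: Gp_def powr_powr sgn_mult)
qed

lemma blip_tuple4:
 fixes f1 f2 f3 f4 :: "'a::real_normed_vector => real"
 assumes "blip f1" "blip f2" "blip f3" "blip f4"
 obtains B L where "0 < L" "!!x. norm (f1 x, f2 x, f3 x, f4 x) <= B"
  "!!x y. norm ((f1 x, f2 x, f3 x, f4 x) - (f1 y, f2 y, f3 y, f4 y)) <= L * norm (x - y)"
proof -
 have n: "norm (p, q, r, s) <= \<bar>p\<bar> + \<bar>q\<bar> + \<bar>r\<bar> + \<bar>s\<bar>" for p q r s :: real
  using norm_Pair_le[of p "(q, r, s)"] norm_Pair_le[of q "(r, s)"] norm_Pair_le[of r s] by simp
 from blipE[OF assms(1)] obtain B1 L1 where 1: "0 < L1" "!!x. \<bar>f1 x\<bar> <= B1" "!!x y. \<bar>f1 x - f1 y\<bar> <= L1 * dist x y" by metis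
 from blipE[OF assms(2)] obtain B2 L2 where 2: "0 < L2" "!!x. \<bar>f2 x\<bar> <= B2" "!!x y. \<bar>f2 x - f2 y\<bar> <= L2 * dist x y" by metis
 from blipE[OF assms(3)] obtain B3 L3 where 3: "0 < L3" "!!x. \<bar>f3 x\<bar> <= B3" "!!x y. \<bar>f3 x - f3 y\<bar> <= L3 * dist x y" by metis
 from blipE[OF assms(4)] obtain B4 L4 where 4: "0 < L4" "!!x. \<bar>f4 x\<bar> <= B4" "!!x y. \<bar>f4 x - f4 y\<bar> <= L4 * dist x y" by metis
 show thesis
 proof (rule that[of "L1 + L2 + L3 + L4" "B1 + B2 + B3 + B4"])
  show "0 < L1 + L2 + L3 + L4" using 1 2 3 4 by simp
  show "norm (f1 x, f2 x, f3 x, f4 x) <= B1 + B2 + B3 + B4" for x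
   using n[of "f1 x" "f2 x" "f3 x" "f4 x"] 1(2)[of x] 2(2)[of x] 3(2)[of x] 4(2)[of x] by linarith
  show "norm ((f1 x, f2 x, f3 x, f4 x) - (f1 y, f2 y, f3 y, f4 y)) <= (L1 + L2 + L3 + L4) * norm (x - y)" for x y
   using n[of "f1 x - f1 y" "f2 x - f2 y" "f3 x - f3 y" "f4 x - f4 y"]
    1(3)[of x y] 2(3)[of x y] 3(3)[of x y] 4(3)[of x y]
   unfolding dist_norm diff_Pair distrib_right by linarith
 qed
qed

lemma blip_exp_min: "blip (\<lambda>x. exp (min x M) :: real)"
proof (rule blipI[of _ "exp M" "exp M"])
 show "\<bar>exp (min x M)\<bar> <= exp M" for x by simp
 have le: "exp z - exp y <= exp M * (z - y)" if "y <= z" "z <= M" for y z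
 proof -
  have "exp z - exp y = exp z * (1 - exp (y - z))" by (simp add: right_diff_distrib flip: exp_add)
  also have "\<dots> <= exp z * (z - y)"
  proof -
   have "1 - exp (y - z) <= z - y" using exp_ge_add_one_self[of "y - z"] by linarith
   then show ?thesis by (simp add: mult_left_mono)
  qed
  also have "\<dots> <= exp M * (z - y)" using that by (intro mult_right_mono) auto
  finally show ?thesis .
 qed
 show "\<bar>exp (min x M) - exp (min y M)\<bar> <= exp M * dist x y" for x y
 proof -
  have "\<bar>exp (min x M) - exp (min y M)\<bar> <= exp M * \<bar>min x M - min y M\<bar>"
  proof (cases "min x M <= min y M")
   case True
   then have "\<bar>min x M - min y M\<bar> = min y M - min x M" "exp (min x M) <= exp (min y M)" by simp_all
   then show ?thesis using le[OF True] by simp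
  next
   case False
   then have F: "min y M <= min x M" by linarith
   then have "\<bar>min x M - min y M\<bar> = min x M - min y M" "exp (min y M) <= exp (min x M)" by simp_all
   then show ?thesis using le[OF F] by simp
  qed
  also have "\<dots> <= exp M * dist x y" by (intro mult_left_mono) (auto simp: dist_real_def)
  finally show ?thesis .
 qed
qed

lemma blip_inverse_max:
 assumes "0 < c" shows "blip (\<lambda>x::real. 1 / max c x)"
proof (rule blipI[of _ "1 / c" "1 / c\<^sup>2"])
 show "\<bar>1 / max c x\<bar> <= 1 / c" for x using assms by (simp add: frac_le)
 show "\<bar>1 / max c x - 1 / max c y\<bar> <= 1 / c\<^sup>2 * dist x y" for x y
 proof -
  have "\<bar>1 / max c x - 1 / max c y\<bar> = \<bar>max c y - max c x\<bar> / (max c x * max c y)"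
   using assms by (simp add: diff_frac_eq abs_divide abs_mult)
  also have "\<dots> <= \<bar>x - y\<bar> / (c * c)"
   using assms by (intro frac_le mult_mono) auto
  finally show ?thesis by (simp add: dist_real_def power2_eq_square)
 qed
qed

lemma dist_snd_snd_le:
 fixes x y :: "real \<times> real \<times> real \<times> real"
 shows "\<bar>fst x - fst y\<bar> <= 1 * dist x y" "\<bar>fst (snd x) - fst (snd y)\<bar> <= 1 * dist x y"
  "\<bar>fst (snd (snd x)) - fst (snd (snd y))\<bar> <= 1 * dist x y"
  "\<bar>snd (snd (snd x)) - snd (snd (snd y))\<bar> <= 1 * dist x y"
 using dist_fst_le[of x y] dist_snd_le[of x y] dist_fst_le[of "snd x" "snd y"] dist_snd_le[of "snd x" "snd y"]
  dist_fst_le[of "snd (snd x)" "snd (snd y)"] dist_snd_le[of "snd (snd x)" "snd (snd y)"]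
 by (simp_all add: dist_real_def)

definition cutoff :: "real => real => real => real => real" where
 "cutoff MG Ml G l = clamp01 0 1 (MG - \<bar>G\<bar>) * clamp01 0 1 (Ml - l)"

lemma cutoff_bounds: "0 <= cutoff MG Ml G l"
 by (simp add: cutoff_def clamp01_def)

lemma cutoff_nonzero: "cutoff MG Ml G l \<noteq> 0 ==> \<bar>G\<bar> < MG \<and> l < Ml"
 by (auto simp: cutoff_def clamp01_def max_def min_def split: if_splits)

lemma cutoff_one: "\<bar>G\<bar> <= MG - 1 ==> l <= Ml - 1 ==> cutoff MG Ml G l = 1"
 by (simp add: cutoff_def clamp01_def)

context frequency
begin

text \<open>The state is \<open>(r, G, l, \<phi>)\<close>. Since \<open>1/Fp(s) = |G|\<^bsup>1/p-1\<^esup>/p\<close> is a smooth function of \<open>G\<close>, using \<open>\<integral>F dr\<close> as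
 parameter makes the system Lipschitz on bounded sets; the cutoff makes it so globally and only
 changes the speed.\<close>

lemma regularised_flow:
 assumes p: "0 < p" "p <= p1" and r1: "0 < r1" and MG: "0 < MG"
 obtains L and Y :: "real \<times> real \<times> real \<times> real => real => real \<times> real \<times> real \<times> real" where
  "!!y. continuous_on {0..} (Y y)" "!!y. Y y 0 = y"
  "!!y y' t. 0 <= t ==> norm (Y y t - Y y' t) <= 2 * norm (y - y') * exp (L * t)"
  "!!l \<phi> y. y = (r1, Gp p (exp l * cos \<phi>), l, \<phi>) ==>
   orbit m \<Omega> p {0..} {} (\<lambda>t. fst (Y y t))
   (\<lambda>t. cutoff MG Ml (fst (snd (Y y t))) (fst (snd (snd (Y y t)))) * F (1 / p) (fst (snd (Y y t))))
   (\<lambda>t. cutoff MG Ml (fst (snd (Y y t))) (fst (snd (snd (Y y t)))))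
   (\<lambda>t. fst (snd (snd (Y y t)))) (\<lambda>t. snd (snd (snd (Y y t)))) \<and>
   (\<forall>t\<ge>0. fst (snd (Y y t)) = Gp p (exp (fst (snd (snd (Y y t)))) * cos (snd (snd (snd (Y y t))))))"
proof -
 have p1': "p <= 1" using p by (simp add: p1_def)
 have p10: "10 <= 1 / p" using p by (simp add: p1_def field_simps)
 define cut where "cut z = cutoff MG Ml (fst (snd z)) (fst (snd (snd z)))" for z :: "real \<times> real \<times> real \<times> real"
 define reg where "reg z = 1 / p * (clamp01 0 MG \<bar>fst (snd z)\<bar>) powr (1 / p - 1)" for z :: "real \<times> real \<times> real \<times> real"
 define ex where "ex z = exp (min (fst (snd (snd z))) Ml)" for z :: "real \<times> real \<times> real \<times> real"
 define ir where "ir z = 1 / max r1 (fst z)" for z :: "real \<times> real \<times> real \<times> real"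
 define si where "si z = sin (snd (snd (snd z)))" for z :: "real \<times> real \<times> real \<times> real"
 define co where "co z = cos (snd (snd (snd z)))" for z :: "real \<times> real \<times> real \<times> real"
 note c = dist_snd_snd_le
 have b_si: "blip si" unfolding si_def[abs_def] by (rule blip_comp[OF blip_sin c(4)])
 have b_co: "blip co" unfolding co_def[abs_def] by (rule blip_comp[OF blip_cos c(4)])
 have b_ir: "blip ir" unfolding ir_def[abs_def] by (rule blip_comp[OF blip_inverse_max[OF r1] c(1)])
 have b_ex: "blip ex" unfolding ex_def[abs_def] by (rule blip_comp[OF blip_exp_min c(3)])
 have aG: "\<bar>\<bar>fst (snd x)\<bar> - \<bar>fst (snd y)\<bar>\<bar> <= 1 * dist x y" for x y :: "real \<times> real \<times> real \<times> real"
  using c(2)[of x y] by linarith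
 have b_reg: "blip reg" unfolding reg_def[abs_def]
 proof (rule blip_comp[where g = "\<lambda>G. 1 / p * (clamp01 0 MG G) powr (1 / p - 1)", OF _ aG])
  show "blip (\<lambda>G. 1 / p * (clamp01 0 MG G) powr (1 / p - 1))"
  proof (rule blip_clamp01[where g = "\<lambda>G. 1 / p * G powr (1 / p - 1)"
    and g' = "\<lambda>G. 1 / p * ((1 / p - 1) * G powr (1 / p - 1 - 1))" and L = "1 / p * ((1 / p - 1) * MG powr (1 / p - 1 - 1))"])
   show "0 <= MG" using MG by simp
   show "continuous_on {0..MG} (\<lambda>G. 1 / p * G powr (1 / p - 1))"
    using p10 by (intro continuous_intros continuous_on_powr') auto
   fix G :: real assume G: "0 < G" "G < MG"
   show "DERIV (\<lambda>G. 1 / p * G powr (1 / p - 1)) G :> 1 / p * ((1 / p - 1) * G powr (1 / p - 1 - 1))"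
    by (intro DERIV_cmult has_real_derivative_powr G)
   have "G powr (1 / p - 1 - 1) <= MG powr (1 / p - 1 - 1)" using G p10 by (intro powr_mono2) auto
   then show "\<bar>1 / p * ((1 / p - 1) * G powr (1 / p - 1 - 1))\<bar> <= 1 / p * ((1 / p - 1) * MG powr (1 / p - 1 - 1))"
    using p p10 p1' unfolding abs_mult by (intro mult_mono) auto
  qed
 qed
 have b_cut: "blip cut" unfolding cut_def[abs_def] cutoff_def
 proof (rule blip_mult)
  show "blip (\<lambda>x::real \<times> real \<times> real \<times> real. clamp01 0 1 (MG - \<bar>fst (snd x)\<bar>))"
   by (rule blip_comp[OF blip_clamp01_id, where M = 1]) (use aG in \<open>force simp: abs_minus_commute\<close>)+
  show "blip (\<lambda>x::real \<times> real \<times> real \<times> real. clamp01 0 1 (Ml - fst (snd (snd x))))"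
   by (rule blip_comp[OF blip_clamp01_id, where M = 1]) (use c(3) in \<open>force simp: abs_minus_commute\<close>)+
 qed
 define \<Phi>1 where "\<Phi>1 z = cut z * reg z" for z
 define \<Phi>2 where "\<Phi>2 z = - 2 * (cut z * ex z) * (\<Omega> * si z - (1 - co z) * ir z)" for z
 define \<Phi>3 where "\<Phi>3 z = - 2 * (si z * (m * (cut z * reg z) + cut z) + cut z * reg z * ((1 - co z) * ir z))" for z
 define \<Phi>4 where "\<Phi>4 z = 2 * (cut z * reg z) * (\<Omega> - m * co z - si z * ir z) - 2 * cut z * co z" for z
 have bl: "blip \<Phi>1" "blip \<Phi>2" "blip \<Phi>3" "blip \<Phi>4"
  unfolding \<Phi>1_def[abs_def] \<Phi>2_def[abs_def] \<Phi>3_def[abs_def] \<Phi>4_def[abs_def]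
  by (intro blip_mult blip_add blip_diff blip_uminus blip_const b_si b_co b_ir b_ex b_reg b_cut)+
 obtain B L where BL: "0 < L" "!!x. norm (\<Phi>1 x, \<Phi>2 x, \<Phi>3 x, \<Phi>4 x) <= B"
  "!!x y. norm ((\<Phi>1 x, \<Phi>2 x, \<Phi>3 x, \<Phi>4 x) - (\<Phi>1 y, \<Phi>2 y, \<Phi>3 y, \<Phi>4 y)) <= L * norm (x - y)"
  by (rule blip_tuple4[OF bl]) blast
 obtain Y where Y: "!!y. continuous_on {0..} (Y y)" "!!y. Y y 0 = y"
  "!!y t. 0 < t ==> (Y y has_vector_derivative (\<Phi>1 (Y y t), \<Phi>2 (Y y t), \<Phi>3 (Y y t), \<Phi>4 (Y y t))) (at t)"
  "!!y y' t. 0 <= t ==> norm (Y y t - Y y' t) <= 2 * norm (y - y') * exp (2 * L * t)"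
  using bounded_lipschitz_flow[OF BL] by metis
 show thesis
 proof (rule that[of Y "2 * L", OF Y(1,2,4)])
  fix l0 \<phi>0 y assume y: "y = (r1, Gp p (exp l0 * cos \<phi>0), l0, \<phi>0)"
  define r where "r t = fst (Y y t)" for t
  define G where "G t = fst (snd (Y y t))" for t
  define l where "l t = fst (snd (snd (Y y t)))" for t
  define \<phi> where "\<phi> t = snd (snd (snd (Y y t)))" for t
  define e where "e t = cutoff MG Ml (G t) (l t)" for t
  define f where "f t = e t * F (1 / p) (G t)" for t
  have cont: "continuous_on {0..} r" "continuous_on {0..} G" "continuous_on {0..} l" "continuous_on {0..} \<phi>"
   unfolding r_def[abs_def] G_def[abs_def] l_def[abs_def] \<phi>_def[abs_def] by (intro continuous_intros Y(1))+
  have comp: "DERIV r t :> \<Phi>1 (Y y t)" "DERIV G t :> \<Phi>2 (Y y t)"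
   "DERIV l t :> \<Phi>3 (Y y t)" "DERIV \<phi> t :> \<Phi>4 (Y y t)" if "0 < t" for t
  proof -
   note d = Y(3)[OF that, of y]
   note ds = bounded_linear.has_vector_derivative[OF bounded_linear_snd d]
   note dss = bounded_linear.has_vector_derivative[OF bounded_linear_snd ds]
   show "DERIV r t :> \<Phi>1 (Y y t)" "DERIV G t :> \<Phi>2 (Y y t)"
    "DERIV l t :> \<Phi>3 (Y y t)" "DERIV \<phi> t :> \<Phi>4 (Y y t)"
    using bounded_linear.has_vector_derivative[OF bounded_linear_fst d]
     bounded_linear.has_vector_derivative[OF bounded_linear_fst ds]
     bounded_linear.has_vector_derivative[OF bounded_linear_fst dss]
     bounded_linear.has_vector_derivative[OF bounded_linear_snd dss]
    unfolding r_def[abs_def] G_def[abs_def] l_def[abs_def] \<phi>_def[abs_def] has_real_derivative_iff_has_vector_derivative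
    by simp_all
  qed
  have cut: "cut (Y y t) = e t" for t by (simp add: cut_def e_def G_def l_def)
  have creg: "cut (Y y t) * reg (Y y t) = f t" for t
  proof (cases "e t = 0")
   case False
   then have "\<bar>G t\<bar> < MG" unfolding e_def by (rule cutoff_nonzero[THEN conjunct1])
   then show ?thesis unfolding cut f_def reg_def G_def[symmetric]
    using p10 by (simp add: F_def clamp01_id)
  qed (simp add: cut f_def)
  have cex: "cut (Y y t) * ex (Y y t) = e t * exp (l t)" for t
  proof (cases "e t = 0")
   case False
   then have "l t < Ml" unfolding e_def by (rule cutoff_nonzero[THEN conjunct2])
   then show ?thesis unfolding cut ex_def l_def[symmetric] by simp
  qed (simp add: cut)
  have e0: "0 <= e t" for t unfolding e_def by (rule cutoff_bounds)
  have f0: "0 <= f t" for t using e0[of t] p by (simp add: f_def F_def)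
  \<comment> \<open>The radius never decreases, so the safeguard \<open>max r1\<close> in
    \<open>ir\<close> returns the radius itself along the flow.\<close>
  have rge: "r1 <= r t" if t: "0 <= t" for t
  proof -
   have "r 0 <= r t"
    by (rule nondecreasing_off_finite[of "{}" 0 t r "\<lambda>t. \<Phi>1 (Y y t)"])
     (use t comp(1) f0 creg in \<open>auto simp: \<Phi>1_def intro: continuous_on_subset[OF cont(1)]\<close>)
   then show ?thesis by (simp add: r_def Y(2) y)
  qed
  have irr: "ir (Y y t) = inverse (r t)" if "0 <= t" for t
   using rge[OF that] by (simp add: ir_def r_def divide_inverse max_def)
  have sico: "si (Y y t) = sin (\<phi> t)" "co (Y y t) = cos (\<phi> t)" for t by (simp_all add: si_def co_def \<phi>_def)
  have dr: "DERIV r t :> f t" if "0 < t" for t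
   using comp(1)[OF that] by (simp add: \<Phi>1_def creg)
  have dG: "DERIV G t :> - 2 * e t * exp (l t) * (\<Omega> * sin (\<phi> t) - (1 - cos (\<phi> t)) / r t)" if "0 < t" for t
   using comp(2)[OF that] irr[of t] that unfolding \<Phi>2_def cex sico by (simp add: divide_inverse mult.assoc)
  have dl: "DERIV l t :> - 2 * (sin (\<phi> t) * (m * f t + e t) + f t * (1 - cos (\<phi> t)) / r t)" if "0 < t" for t
   using comp(3)[OF that] irr[of t] that unfolding \<Phi>3_def creg unfolding sico cut by (simp add: divide_inverse mult.assoc)
  have dphi: "DERIV \<phi> t :> 2 * f t * (wt (\<phi> t) - sin (\<phi> t) / r t) - 2 * e t * cos (\<phi> t)" if "0 < t" for t
   using comp(4)[OF that] irr[of t] that unfolding \<Phi>4_def creg unfolding sico cut by (simp add: divide_inverse wt_def)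
  \<comment> \<open>\<open>G\<close> is carried along as an independent variable. That it remains
    equal to \<open>Gp p s\<close> is a conservation law: \<open>Gp (1 / p) G\<close> and
    \<open>s\<close> have the same derivative along the flow.\<close>
  have inv: "Gp (1 / p) (G t) = exp (l t) * cos (\<phi> t)" if t: "0 <= t" for t
  proof -
   define D where "D t = Gp (1 / p) (G t) - exp (l t) * cos (\<phi> t)" for t
   have cD: "continuous_on {0..t} D"
   proof -
    have "continuous_on {0..} (\<lambda>t. Gp (1 / p) (G t))"
     by (rule continuous_on_compose2[OF continuous_on_Gp cont(2)]) (use p in auto)
    then have "continuous_on {0..} D" unfolding D_def[abs_def] by (intro continuous_intros cont)
    then show ?thesis by (rule continuous_on_subset) auto
   qed
   have dD: "DERIV D s :> 0" if s: "0 < s" for s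
   proof -
    have 1: "DERIV (\<lambda>t. Gp (1 / p) (G t)) s :> F (1 / p) (G s) *
      (- 2 * e s * exp (l s) * (\<Omega> * sin (\<phi> s) - (1 - cos (\<phi> s)) / r s))"
     by (rule DERIV_chain2[OF DERIV_Gp_gt_1 dG[OF s]]) (use p10 in simp)
    note 2 = DERIV_Gp_exp_cos[OF dl[OF s] dphi[OF s, unfolded wt_def]]
    from DERIV_diff[OF 1 2] show ?thesis unfolding D_def[abs_def] f_def by (simp add: mult_ac)
   qed
   have "D 0 <= D t" by (rule nondecreasing_off_finite[of "{}" 0 t D "\<lambda>_. 0"]) (use t cD dD in auto)
   moreover have "- D 0 <= - D t"
    by (rule nondecreasing_off_finite[of "{}" 0 t "\<lambda>t. - D t" "\<lambda>_. 0"])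
     (use t cD DERIV_minus[OF dD] in \<open>auto intro: continuous_on_minus\<close>)
   moreover have "D 0 = 0" using Gp_inverse(2)[OF p(1)] by (simp add: D_def G_def l_def \<phi>_def Y(2) y)
   ultimately show ?thesis by (simp add: D_def)
  qed
  have GG: "G t = Gp p (exp (l t) * cos (\<phi> t))" if "0 <= t" for t
   using Gp_inverse(1)[OF p(1), of "G t"] inv[OF that] by simp
  have "orbit m \<Omega> p {0..} {} r f e l \<phi>"
  proof unfold_locales
   show "is_interval {0::real..}" by (simp add: is_interval_convex_1)
   show "0 <= r t" if "t \<in> {0..}" for t using rge[of t] that r1 by simp
   fix t :: real assume "t \<in> interior {0..} - {}"
   then have t: "0 < t" by simp
   show "0 < r t" using rge[of t] t r1 by simp
   show "0 <= f t" "0 <= e t" by (rule f0 e0)+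
   show "e t * (exp (l t) * cos (\<phi> t)) = p * Gp p (exp (l t) * cos (\<phi> t)) * f t"
   proof -
    have "F (1 / p) (G t) * G t = 1 / p * Gp (1 / p) (G t)" by (rule F_mult_eq_Gp)
    then have "Gp (1 / p) (G t) = p * G t * F (1 / p) (G t)" using p by (simp add: field_simps)
    then show ?thesis using inv[of t] GG[of t] t by (simp add: f_def)
   qed
   show "DERIV r t :> f t"
    "DERIV l t :> - 2 * (sin (\<phi> t) * (m * f t + e t) + f t * (1 - cos (\<phi> t)) / r t)"
    "DERIV \<phi> t :> 2 * f t * (wt (\<phi> t) - sin (\<phi> t) / r t) - 2 * e t * cos (\<phi> t)"
    by (rule dr[OF t] dl[OF t] dphi[OF t])+
   show "DERIV (\<lambda>t. Gp p (exp (l t) * cos (\<phi> t))) t :> - 2 * e t * exp (l t) * (\<Omega> * sin (\<phi> t) - (1 - cos (\<phi> t)) / r t)"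
    by (rule has_field_derivative_transform_within_open[OF dG[OF t], of "{0<..}"]) (use t GG in auto)
  qed (use p cont in auto)
  with GG show "orbit m \<Omega> p {0..} {} (\<lambda>t. fst (Y y t))
   (\<lambda>t. cutoff MG Ml (fst (snd (Y y t))) (fst (snd (snd (Y y t)))) * F (1 / p) (fst (snd (Y y t))))
   (\<lambda>t. cutoff MG Ml (fst (snd (Y y t))) (fst (snd (snd (Y y t)))))
   (\<lambda>t. fst (snd (snd (Y y t)))) (\<lambda>t. snd (snd (snd (Y y t)))) \<and>
   (\<forall>t\<ge>0. fst (snd (Y y t)) = Gp p (exp (fst (snd (snd (Y y t)))) * cos (snd (snd (snd (Y y t))))))"
   unfolding r_def[abs_def] f_def[abs_def] e_def[abs_def] l_def[abs_def] \<phi>_def[abs_def] G_def[abs_def] by simp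
 qed
qed

end

context orbit
begin

lemma du:
 assumes "t \<in> interior I - S"
 shows "DERIV u t :> v t * (a * f t - e t) - 2 * u t * f t / r t"
proof -
 define L where "L = - 2 * (sin (\<phi> t) * (m * f t + e t) + f t * (1 - cos (\<phi> t)) * inverse (r t))"
 define P where "P = 2 * f t * (wt (\<phi> t) - sin (\<phi> t) * inverse (r t)) - 2 * e t * cos (\<phi> t)"
 define c where "c = cos (\<phi> t / 2)"
 define s where "s = sin (\<phi> t / 2)"
 have "DERIV l t :> L" unfolding L_def using dl[OF assms] by (simp add: divide_inverse)
 from DERIV_chain2[OF DERIV_exp DERIV_cdivide[OF this, of 2]]
 have 1: "DERIV (\<lambda>t. exp (l t / 2)) t :> exp (l t / 2) * (L / 2)" .
 have "DERIV \<phi> t :> P" unfolding P_def using dphi[OF assms] by (simp add: divide_inverse)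
 from DERIV_chain2[OF DERIV_sin DERIV_cdivide[OF this, of 2]]
 have "DERIV (\<lambda>t. sin (\<phi> t / 2)) t :> c * (P / 2)" unfolding c_def .
 from DERIV_mult[OF 1 this]
 have 2: "DERIV u t :> exp (l t / 2) * (s * (L / 2) + c * (P / 2))"
  unfolding u_def[abs_def] s_def by (simp add: algebra_simps)
 have cs: "s\<^sup>2 + c\<^sup>2 = 1" by (simp add: s_def c_def)
 have C: "cos (\<phi> t) = c\<^sup>2 - s\<^sup>2" using cos_double[of "\<phi> t / 2"] by (simp add: s_def c_def)
 have S: "sin (\<phi> t) = 2 * s * c" using sin_double[of "\<phi> t / 2"] by (simp add: s_def c_def)
 have L2: "L / 2 = - (2 * s * c * (m * f t + e t) + f t * (1 - (c\<^sup>2 - s\<^sup>2)) * inverse (r t))"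
  unfolding L_def C S by simp
 have P2: "P / 2 = f t * (\<Omega> - m * (c\<^sup>2 - s\<^sup>2) - 2 * s * c * inverse (r t)) - e t * (c\<^sup>2 - s\<^sup>2)"
  unfolding P_def wt_def C S by (simp add: diff_divide_distrib mult.assoc)
 have "s * (L / 2) + c * (P / 2) = c * ((\<Omega> - m) * f t - e t) - 2 * s * f t * inverse (r t)"
  unfolding L2 P2 using cs by algebra
 moreover have "X * (c * A - 2 * s * f t * R) = X * c * A - 2 * (X * s) * f t * R" for X A R
  by (simp add: algebra_simps)
 ultimately show ?thesis
  using 2 unfolding u_def[of t] v_def[of t] a_def s_def[symmetric] c_def[symmetric] divide_inverse[of _ "r t"]
  by simp
qed

lemma cos_initial:
 assumes "0 <= \<phi> t" "\<phi> t < pi / 2" "0 <= q t" "q t < q1"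
 shows "1 / 3 <= cos (\<phi> t)"
proof -
 have "(q t)\<^sup>2 <= q1\<^sup>2" using assms by (intro power_mono) auto
 then have q2: "2 * (q t)\<^sup>2 <= 1" using q1_bounds(5) by linarith
 have ph: "\<bar>\<phi> t\<bar> < pi" using assms(1,2) pi_gt_zero by simp
 have "cos (\<phi> t) * (1 + (q t)\<^sup>2) <= cos (\<phi> t) * (3 / 2)"
  using q2 assms by (intro mult_left_mono) (auto intro: cos_ge_zero)
 then show ?thesis using half_angle(1)[OF ph, folded q_def] q2 by simp
qed

lemma orbit_cong:
 assumes "!!t. t \<in> interior I - S ==> f' t = f t" "!!t. t \<in> interior I - S ==> e' t = e t"
 shows "orbit m \<Omega> p I S r f' e' l \<phi>"
 by unfold_locales (use p_pos p_le I S cont_r cont_l cont_phi r_nonneg r_pos f_nonneg e_nonneg rel dr dl dphi dG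
  in \<open>auto simp: assms\<close>)

end

section \<open>Shooting\<close>

text \<open>The regular flow starts at a radius \<open>r1 > 0\<close>, where the solutions with
  central value \<open>x\<close> arrive. By \<open>low\<close> the smallest datum already has
  negative energy there; by \<open>high\<close> the largest one has so much amplitude that at least
  \<open>4 / a\<close> is left up to the (k + 1)st zero of \<open>v\<close>.\<close>

locale shooting = frequency +
 fixes p :: real and k :: nat and xl xh r1 :: real and r l \<phi> :: "real => real => real"
 assumes p: "0 < p" "p <= p1" and x: "xl <= xh" and r1: "0 < r1" "r1 <= r0"
  and orb: "!!x. x \<in> {xl..xh} ==> orbit m \<Omega> p {0..} {} (r x)
   (\<lambda>t. F (1 / p) (Gp p (exp (l x t) * cos (\<phi> x t)))) (\<lambda>t. 1) (l x) (\<phi> x)"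
  and r_0: "!!x. x \<in> {xl..xh} ==> r x 0 = r1"
  and init_phi: "!!x. x \<in> {xl..xh} ==> \<bar>\<phi> x 0\<bar> < pi / 2"
  and init_q: "!!x. x \<in> {xl..xh} ==> 0 <= exp (l x 0) * wt (\<phi> x 0) - Gp p (exp (l x 0) * cos (\<phi> x 0)) ==>
   0 <= tan (\<phi> x 0 / 2) \<and> tan (\<phi> x 0 / 2) <= a / 2 * r1"
  and cont_l: "!!X x T t. [|!!n. X n \<in> {xl..xh}; x \<in> {xl..xh}; X \<longlonglongrightarrow> x; !!n. 0 <= T n; T \<longlonglongrightarrow> t|]
   ==> (\<lambda>n. l (X n) (T n)) \<longlonglongrightarrow> l x t"
  and cont_phi: "!!X x T t. [|!!n. X n \<in> {xl..xh}; x \<in> {xl..xh}; X \<longlonglongrightarrow> x; !!n. 0 <= T n; T \<longlonglongrightarrow> t|]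
   ==> (\<lambda>n. \<phi> (X n) (T n)) \<longlonglongrightarrow> \<phi> x t"
  and low: "exp (l xl 0) * wt (\<phi> xl 0) - Gp p (exp (l xl 0) * cos (\<phi> xl 0)) < 0"
  and high: "0 <= exp (l xh 0) * wt (\<phi> xh 0) - Gp p (exp (l xh 0) * cos (\<phi> xh 0))"
   "4 / a <= \<gamma> ^ (3 * k + 2) * (exp (- (2 * (m + b + a) * r0)) * exp (l xh 0)) - 2 * Cg * (3 * k + 2)"
begin

definition "H x t = exp (l x t) * wt (\<phi> x t) - Gp p (exp (l x t) * cos (\<phi> x t))"
text \<open>The phase at which \<open>v\<close> vanishes for the (k + 1)st time.\<close>

definition "\<Theta> = real k * (2 * pi) + pi"

lemma Theta_ge: "pi <= \<Theta>"
 by (simp add: \<Theta>_def)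

lemma H_eq: "x \<in> {xl..xh} ==> orbit.h m \<Omega> p (l x) (\<phi> x) t = H x t"
 using orbit.h_def[OF orb] orbit.E_def[OF orb] orbit.G_def[OF orb] by (simp add: H_def)

lemma tend_H:
 assumes "!!n. X n \<in> {xl..xh}" "x \<in> {xl..xh}" "X \<longlonglongrightarrow> x" "!!n. 0 <= T n" "T \<longlonglongrightarrow> t"
 shows "(\<lambda>n. H (X n) (T n)) \<longlonglongrightarrow> H x t"
proof -
 note l = cont_l[OF assms] and ph = cont_phi[OF assms]
 have "isCont (Gp p) y" for y
  using continuous_on_Gp[OF p(1)] by (simp add: continuous_on_eq_continuous_at)
 then have "(\<lambda>n. Gp p (exp (l (X n) (T n)) * cos (\<phi> (X n) (T n)))) \<longlonglongrightarrow> Gp p (exp (l x t) * cos (\<phi> x t))"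
  by (rule isCont_tendsto_compose) (intro tendsto_intros l ph)
 then show ?thesis unfolding H_def wt_def by (intro tendsto_intros l ph)
qed

lemma H_mono: "x \<in> {xl..xh} ==> 0 <= s ==> s <= t ==> H x t <= H x s"
 using orbit.h_antimono[OF orb, of x s t] H_eq by simp

lemma r_mono: "x \<in> {xl..xh} ==> 0 <= s ==> s <= t ==> r x s <= r x t"
 using orbit.r_mono[OF orb, of x s t] by simp

lemma r_ge: "x \<in> {xl..xh} ==> 0 <= t ==> r1 <= r x t"
 using r_mono[of x 0 t] r_0[of x] by simp

lemma initial:
 assumes x: "x \<in> {xl..xh}" "0 <= t" "0 <= H x t" "r x t <= r0"
 shows "0 <= \<phi> x t" "\<phi> x t < pi / 2" "1 / 3 <= cos (\<phi> x t)"
  "exp (- (2 * (m + b + a) * r0)) * exp (l x 0) <= exp (l x t)"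
proof -
 interpret orbit m \<Omega> p "{0..}" "{}" "r x" "\<lambda>t. F (1 / p) (Gp p (exp (l x t) * cos (\<phi> x t)))" "\<lambda>t. 1" "l x" "\<phi> x"
  by (rule orb[OF x(1)])
 have H0: "0 <= H x 0" using H_mono[OF x(1), of 0 t] x by simp
 have i: "0 <= q 0" "q 0 <= a / 2 * r x 0" "\<bar>\<phi> x 0\<bar> < pi"
  using init_q[OF x(1)] H0 init_phi[OF x(1)] r_0[OF x(1)] pi_gt_zero by (auto simp: q_def H_def)
 have h: "0 <= h t" using x(3) H_eq[OF x(1)] by simp
 have tI: "0 \<in> {0::real..}" "t \<in> {0..}" using x(2) by auto
 note j = initial_phase[OF tI x(2) h x(4) i(3,1,2)]
 show "0 <= \<phi> x t" "\<phi> x t < pi / 2" by fact+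
 show "1 / 3 <= cos (\<phi> x t)" by (rule cos_initial) fact+
 show "exp (- (2 * (m + b + a) * r0)) * exp (l x 0) <= exp (l x t)"
  using E_initial[OF tI x(2) h x(4) i(3,1,2)] by (simp add: E_def)
qed

lemma r_ge_r0: "x \<in> {xl..xh} ==> 0 <= t ==> 0 <= H x t ==> pi / 2 <= \<phi> x t ==> r0 <= r x t"
 using initial(2)[of x t] by fastforce

lemma phi_increase:
 assumes "x \<in> {xl..xh}" "0 <= s" "s <= t" "0 <= H x t" "r0 <= r x s"
 shows "a / 4 * (r x t - r x s) <= \<phi> x t - \<phi> x s" "\<phi> x s <= \<phi> x t"
 using orbit.phi_increase[OF orb[OF assms(1)], of s t] orbit.phi_mono[OF orb[OF assms(1)], of s t] assms H_eq
 by auto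

lemma cont: "x \<in> {xl..xh} ==> continuous_on {0..} (r x)" "x \<in> {xl..xh} ==> continuous_on {0..} (l x)"
 "x \<in> {xl..xh} ==> continuous_on {0..} (\<phi> x)" "x \<in> {xl..xh} ==> continuous_on {0..} (H x)"
 using orbit.cont_r[OF orb, of x] orbit.cont_l[OF orb, of x] orbit.cont_phi[OF orb, of x]
  orbit.cont_h[OF orb, of x] H_eq[of x] by (auto cong: continuous_on_cong)

lemma r_le:
 assumes x: "x \<in> {xl..xh}" "0 <= t" "0 <= H x t" "\<phi> x t <= \<Theta>"
 shows "r x t <= r0 + 4 * \<Theta> / a"
proof (cases "r x t <= r0")
 case True
 have "0 <= \<Theta>" using Theta_ge pi_gt_zero by linarith
 then have "0 <= 4 * \<Theta> / a" using a_pos by simp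
 with True show ?thesis by linarith
next
 case False
 then obtain y where y: "0 <= y" "y <= t" "r x y = r0"
  using IVT'[of "r x" 0 "r0" t] r_0[OF x(1)] r1 x continuous_on_subset[OF cont(1)[OF x(1)], of "{0..t}"] by auto
 have "0 <= H x y" using H_mono[OF x(1) y(1,2)] x(3) by simp
 then have "0 <= \<phi> x y" using initial(1)[OF x(1) y(1)] y(3) by simp
 moreover have "a / 4 * (r x t - r0) <= \<phi> x t - \<phi> x y"
  using phi_increase(1)[OF x(1) y(1,2) x(3)] y(3) by simp
 ultimately have "a / 4 * (r x t - r0) <= \<Theta>" using x(4) by linarith
 then show ?thesis using a_pos by (simp add: field_simps)
qed

text \<open>Strict inequalities make this an open condition on the datum. By \<open>reach\<close>
  the weak inequalities already imply it, so on bounded parameter intervals it also survives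
  limits.\<close>

definition "A = {x \<in> {xl..xh}. \<exists>t\<ge>0. 0 < H x t \<and> \<Theta> < \<phi> x t}"

text \<open>Where \<open>v\<close> vanishes, cos phi is -1 and the regular parametrisation gives a
  phase speed of at least 2: the orbit goes through such a point and cannot merely touch it.\<close>

lemma passes:
 assumes x: "x \<in> {xl..xh}" and t: "0 < t" "cos (\<phi> x t) = - 1"
 obtains d where "0 < d" "!!s. 0 < s ==> s < d ==> \<phi> x t < \<phi> x (t + s)"
proof -
 interpret orbit m \<Omega> p "{0..}" "{}" "r x" "\<lambda>t. F (1 / p) (Gp p (exp (l x t) * cos (\<phi> x t)))" "\<lambda>t. 1" "l x" "\<phi> x"
  by (rule orb[OF x])
 have i: "t \<in> interior {0..} - {}" using t by simp
 have s0: "sin (\<phi> x t) = 0" using t(2) sin_cos_squared_add[of "\<phi> x t"] by simp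
 have "DERIV (\<phi> x) t :> 2 * F (1 / p) (Gp p (exp (l x t) * cos (\<phi> x t))) * wt (\<phi> x t) + 2"
  using dphi[OF i] s0 t(2) by simp
 moreover have "0 < 2 * F (1 / p) (Gp p (exp (l x t) * cos (\<phi> x t))) * wt (\<phi> x t) + 2"
  using f_nonneg[OF i] wt_bounds(3)[of "\<phi> x t"] by (smt (verit) mult_nonneg_nonneg)
 ultimately show thesis using DERIV_pos_inc_right that by blast
qed

text \<open>At phase \<open>\<Theta>\<close> the value of \<open>s\<close> is negative, so the
  energy is automatically positive there, and by \<open>passes\<close> the phase goes strictly
  beyond.\<close>

lemma reach:
 assumes x: "x \<in> {xl..xh}" "0 <= t" "0 <= H x t" "\<Theta> <= \<phi> x t"
 shows "x \<in> A"
proof -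
 have p0: "\<phi> x 0 < \<Theta>" using init_phi[OF x(1)] Theta_ge pi_gt_zero by linarith
 obtain y where y: "0 <= y" "y <= t" "\<phi> x y = \<Theta>"
  using IVT'[of "\<phi> x" 0 \<Theta> t] p0 x continuous_on_subset[OF cont(3)[OF x(1)], of "{0..t}"] by auto
 have y0: "0 < y" using y p0 by (cases "y = 0") auto
 have c: "cos (\<phi> x y) = - 1"
  unfolding y(3) \<Theta>_def using cos.plus_of_nat[of pi k] by (simp add: add.commute)
 have "0 < H x y"
 proof -
  have "Gp p (exp (l x y) * cos (\<phi> x y)) <= 0" unfolding c by (intro Gp_nonpos) simp
  moreover have "0 < exp (l x y) * wt (\<phi> x y)" using wt_bounds(3) by simp
  ultimately show ?thesis by (simp add: H_def)
 qed
 moreover have "isCont (H x) y"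
  using continuous_on_interior[OF cont(4)[OF x(1)]] y0 by simp
 ultimately have "eventually (\<lambda>s. 0 < H x s) (at y)"
  unfolding isCont_def by (rule order_tendstoD(1)[rotated])
 then obtain d' where d': "0 < d'" "!!s. s \<noteq> y ==> dist s y < d' ==> 0 < H x s"
  unfolding eventually_at by auto
 obtain d where d: "0 < d" "!!s. 0 < s ==> s < d ==> \<phi> x y < \<phi> x (y + s)"
  by (rule passes[OF x(1) y0 c]) blast
 define s where "s = min d d' / 2"
 have s: "0 < s" "s < d" "s < d'" using d(1) d'(1) by (auto simp: s_def)
 have "0 < H x (y + s)" using d'(2)[of "y + s"] s by (simp add: dist_real_def)
 moreover have "\<Theta> < \<phi> x (y + s)" using d(2)[OF s(1,2)] y(3) by simp
 ultimately show ?thesis using x(1) y0 s(1) unfolding A_def by (auto intro!: exI[of _ "y + s"])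
qed

lemma xl_notin: "xl \<notin> A"
proof
 assume "xl \<in> A"
 then obtain t where t: "0 <= t" "0 < H xl t" by (auto simp: A_def)
 have "H xl t <= H xl 0" by (rule H_mono) (use x t in auto)
 with t low show False by (simp add: H_def)
qed

lemma E_bound: "x \<in> {xl..xh} ==> 0 <= t ==> exp (l x t) <= 2 * (H x 0 + 1) / a"
 using orbit.E_upper[OF orb, of x t] H_eq[of x] H_mono[of x 0 t] orbit.E_def[OF orb, of x] a_pos
 by (simp add: field_simps)

text \<open>With \<open>e = 1\<close> the derivative of \<open>G\<close> is bounded. This uniform
  continuity is what the argument of Barbalat type in \<open>collapse\<close> needs.\<close>

lemma G_lipschitz:
 assumes x: "x \<in> {xl..xh}" and st: "0 <= s" "s <= t"
  and K: "K = 2 * (2 * (H x 0 + 1) / a) * (\<Omega> + 2 / r1)"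
 shows "\<bar>Gp p (exp (l x t) * cos (\<phi> x t)) - Gp p (exp (l x s) * cos (\<phi> x s))\<bar> <= K * (t - s)"
proof -
 interpret orbit m \<Omega> p "{0..}" "{}" "r x" "\<lambda>t. F (1 / p) (Gp p (exp (l x t) * cos (\<phi> x t)))" "\<lambda>t. 1" "l x" "\<phi> x"
  by (rule orb[OF x])
 define g where "g y = Gp p (exp (l x y) * cos (\<phi> x y))" for y
 define D where "D y = - 2 * 1 * exp (l x y) * (\<Omega> * sin (\<phi> x y) - (1 - cos (\<phi> x y)) / r x y)" for y
 have cg: "continuous_on {s..t} g"
  using continuous_on_subset[OF cont_G, of "{s..t}"] st unfolding G_def[abs_def] g_def[abs_def] by auto
 have dg: "DERIV g y :> D y" if "y \<in> {s<..<t}" for y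
  using dG[of y] that st unfolding g_def[abs_def] D_def by simp
 have bd: "\<bar>D y\<bar> <= K" if "y \<in> {s<..<t}" for y
 proof -
  have y: "0 <= y" using that st by simp
  have rr: "r1 <= r x y" by (rule r_ge[OF x y])
  have "\<bar>(1 - cos (\<phi> x y)) / r x y\<bar> <= 2 / r1"
   using rr r1 cos_ge_minus_one[of "\<phi> x y"] by (auto simp: abs_divide intro!: frac_le)
  moreover have "\<bar>\<Omega> * sin (\<phi> x y)\<bar> <= \<Omega> * 1" unfolding abs_mult using Om_pos by (intro mult_mono) auto
  ultimately have "\<bar>\<Omega> * sin (\<phi> x y) - (1 - cos (\<phi> x y)) / r x y\<bar> <= \<Omega> + 2 / r1" by linarith
  then have "exp (l x y) * \<bar>\<Omega> * sin (\<phi> x y) - (1 - cos (\<phi> x y)) / r x y\<bar> <= (2 * (H x 0 + 1) / a) * (\<Omega> + 2 / r1)"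
   using E_bound[OF x y] by (intro mult_mono) (auto intro: order_trans[OF less_imp_le[OF exp_gt_zero]])
  then have "2 * (exp (l x y) * \<bar>\<Omega> * sin (\<phi> x y) - (1 - cos (\<phi> x y)) / r x y\<bar>)
    <= 2 * ((2 * (H x 0 + 1) / a) * (\<Omega> + 2 / r1))" by (rule mult_left_mono) simp
  also have "\<dots> = K" unfolding K by (simp only: mult.assoc)
  finally show ?thesis unfolding D_def abs_mult by (simp only: mult.assoc) simp
 qed
 have "K * s - g s <= K * t - g t"
 proof (rule nondecreasing_off_finite[of "{}" s t "\<lambda>y. K * y - g y" "\<lambda>y. K - D y"])
  show "continuous_on {s..t} (\<lambda>y. K * y - g y)" by (intro continuous_intros cg)
  fix y assume y: "y \<in> {s<..<t} - {}"
  show "DERIV (\<lambda>y. K * y - g y) y :> K - D y"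
   using DERIV_diff[OF DERIV_cmult[OF DERIV_ident, of K] dg[of y]] y by simp
  show "0 <= K - D y" using bd[of y] y by auto
 qed (use st in auto)
 moreover have "K * s + g s <= K * t + g t"
 proof (rule nondecreasing_off_finite[of "{}" s t "\<lambda>y. K * y + g y" "\<lambda>y. K + D y"])
  show "continuous_on {s..t} (\<lambda>y. K * y + g y)" by (intro continuous_intros cg)
  fix y assume y: "y \<in> {s<..<t} - {}"
  show "DERIV (\<lambda>y. K * y + g y) y :> K + D y"
   using DERIV_add[OF DERIV_cmult[OF DERIV_ident, of K] dg[of y]] y by simp
  show "0 <= K + D y" using bd[of y] y by auto
 qed (use st in auto)
 ultimately show ?thesis unfolding g_def[symmetric] by (simp add: abs_le_iff right_diff_distrib)
qed

text \<open>An orbit that neither loses its energy nor completes \<open>k + 1\<close> half turns runs into the origin.\<close>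

lemma collapse:
 assumes x: "x \<in> {xl..xh}" and H: "!!t. 0 <= t ==> 0 <= H x t" and P: "!!t. 0 <= t ==> \<phi> x t <= \<Theta>"
 shows "((\<lambda>t. exp (l x t)) \<longlongrightarrow> 0) at_top" "(H x \<longlongrightarrow> 0) at_top" "\<exists>t\<ge>0. r0 < r x t"
proof -
 interpret O: orbit m \<Omega> p "{0..}" "{}" "r x" "\<lambda>t. F (1 / p) (Gp p (exp (l x t) * cos (\<phi> x t)))" "\<lambda>t. 1" "l x" "\<phi> x"
  by (rule orb[OF x])
 define g where "g y = Gp p (exp (l x y) * cos (\<phi> x y))" for y
 define \<rho> where "\<rho> = r0 + 4 * \<Theta> / a"
 define K where "K = 2 * (2 * (H x 0 + 1) / a) * (\<Omega> + 2 / r1)"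
 have K: "0 < K"
 proof -
  have "0 < H x 0 + 1" using H[of 0] by simp
  then have "0 < 2 * (H x 0 + 1) / a" using a_pos by simp
  moreover have "0 < \<Omega> + 2 / r1" using Om_pos r1 by (simp add: add_pos_pos)
  ultimately show ?thesis unfolding K_def by (rule mult_pos_pos[OF mult_pos_pos[OF zero_less_numeral]])
 qed
 have rb: "r x t <= \<rho>" if "0 <= t" for t unfolding \<rho>_def by (rule r_le[OF x that H[OF that] P[OF that]])
 obtain R where R: "(r x \<longlongrightarrow> R) at_top"
 proof -
  have "(r x \<longlongrightarrow> (SUP t\<in>{0..}. r x t)) at_top"
  proof (rule order_tendstoI)
   have bdd: "bdd_above (r x ` {0..})" by (intro bdd_aboveI2[of _ _ \<rho>]) (use rb in auto)
   show "eventually (\<lambda>s. y < r x s) at_top" if y: "y < (SUP t\<in>{0..}. r x t)" for y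
   proof -
    obtain t where t: "0 <= t" "y < r x t" using less_cSUP_iff[of "{0..}" "r x" y] bdd y by auto
    then show ?thesis
     using r_mono[OF x t(1)] unfolding eventually_at_top_linorder by (auto intro: less_le_trans)
   qed
   show "eventually (\<lambda>s. r x s < y) at_top" if "(SUP t\<in>{0..}. r x t) < y" for y
    using that cSUP_upper[OF _ bdd] unfolding eventually_at_top_linorder by (auto intro!: exI[of _ 0] intro: le_less_trans)
  qed
  then show thesis by (rule that)
 qed
 \<comment> \<open>The radius converges. If \<open>g\<close> had size \<open>\<epsilon>\<close> at a
   late time, it would stay above \<open>\<epsilon> / 2\<close> during a time
   \<open>\<delta>\<close> by the Lipschitz bound, and the radius would grow by
   \<open>c * \<delta>\<close> meanwhile.\<close>
 have g0: "(g \<longlongrightarrow> 0) at_top"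
 proof (rule tendstoI)
  fix \<epsilon> :: real assume \<epsilon>: "0 < \<epsilon>"
  define \<delta> where "\<delta> = \<epsilon> / (2 * K)"
  have \<delta>: "0 < \<delta>" using \<epsilon> K by (simp add: \<delta>_def)
  define c where "c = 1 / p * (\<epsilon> / 2) powr (1 / p - 1)"
  have c: "0 < c" using p \<epsilon> by (simp add: c_def)
  have "filterlim (\<lambda>t. t + \<delta>) at_top at_top" 
   using filterlim_tendsto_add_at_top[OF tendsto_const filterlim_ident, of \<delta>] by (simp add: add.commute)
  from filterlim_compose[OF R this] R
  have "((\<lambda>t. r x (t + \<delta>) - r x t) \<longlongrightarrow> R - R) at_top" by (intro tendsto_intros)
  then have "eventually (\<lambda>t. r x (t + \<delta>) - r x t < c * \<delta>) at_top"
   using order_tendstoD(2)[of _ "R - R" at_top "c * \<delta>"] c \<delta> by simp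
  then show "eventually (\<lambda>t. dist (g t) 0 < \<epsilon>) at_top"
   using eventually_ge_at_top[of 0]
  proof eventually_elim
   case (elim t)
   show ?case
   proof (rule ccontr)
    assume "\<not> dist (g t) 0 < \<epsilon>"
    then have gt: "\<epsilon> <= \<bar>g t\<bar>" by simp
    have "r x t - c * t <= r x (t + \<delta>) - c * (t + \<delta>)"
    proof (rule O.nondecreasing[where g = "\<lambda>y. r x y - c * y" and g' = "\<lambda>y. F (1 / p) (Gp p (exp (l x y) * cos (\<phi> x y))) - c"])
     show "continuous_on {t..t + \<delta>} (\<lambda>y. r x y - c * y)"
      using elim(2) by (intro continuous_intros continuous_on_subset[OF cont(1)[OF x]]) auto
     fix y assume y: "y \<in> {t<..<t + \<delta>} - {}"
     have i: "y \<in> interior {0..} - {}" using y elim(2) by simp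
     show "DERIV (\<lambda>y. r x y - c * y) y :> F (1 / p) (Gp p (exp (l x y) * cos (\<phi> x y))) - c"
      using DERIV_diff[OF O.dr[OF i] DERIV_cmult[OF DERIV_ident, of c]] by simp
     have "\<bar>g y - g t\<bar> <= K * (y - t)"
      unfolding g_def using G_lipschitz[OF x elim(2) _ K_def, of y] y by simp
     also have "\<dots> <= K * \<delta>" using y K by (intro mult_left_mono) auto
     also have "\<dots> = \<epsilon> / 2" using K by (simp add: \<delta>_def)
     finally have gy: "\<epsilon> / 2 <= \<bar>g y\<bar>" using gt by linarith
     then have "(\<epsilon> / 2) powr (1 / p - 1) <= \<bar>g y\<bar> powr (1 / p - 1)"
      using \<epsilon> p O.p_bounds by (intro powr_mono2) (auto simp: field_simps)
     then have "c <= 1 / p * \<bar>g y\<bar> powr (1 / p - 1)" unfolding c_def using p by (intro mult_left_mono) auto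
     also have "\<dots> = F (1 / p) (g y)" using gy \<epsilon> by (simp add: F_def)
     finally show "0 <= F (1 / p) (Gp p (exp (l x y) * cos (\<phi> x y))) - c" by (simp add: g_def)
    qed (use elim(2) \<delta> in auto)
    with elim(1) show False by (simp add: distrib_left)
   qed
  qed
 qed
 have s_eq': "exp (l x t) * cos (\<phi> x t) = Gp (1 / p) (g t)" for t
  using Gp_inverse(2)[OF p(1)] by (simp add: g_def)
 have "isCont (Gp (1 / p)) 0"
  using continuous_on_Gp[of "1 / p"] p by (simp add: continuous_on_eq_continuous_at)
 from isCont_tendsto_compose[OF this g0]
 have s0: "((\<lambda>t. exp (l x t) * cos (\<phi> x t)) \<longlongrightarrow> 0) at_top" by (simp add: s_eq')
 \<comment> \<open>Up to \<open>r0\<close> cos phi is at least 1/3 and the amplitude is bounded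
   below, which is incompatible with \<open>s\<close> tending to 0.\<close>
 show ex: "\<exists>t\<ge>0. r0 < r x t"
 proof (rule ccontr)
  assume "\<not> (\<exists>t\<ge>0. r0 < r x t)"
  then have le: "r x t <= r0" if "0 <= t" for t using that by force
  define c where "c = exp (- (2 * (m + b + a) * r0)) * exp (l x 0)"
  have "c * (1 / 3) <= exp (l x t) * cos (\<phi> x t)" if "0 <= t" for t
   using initial(3,4)[OF x that H[OF that] le[OF that]] unfolding c_def by (intro mult_mono) auto
  then have "eventually (\<lambda>t. c * (1 / 3) <= exp (l x t) * cos (\<phi> x t)) at_top"
   unfolding eventually_at_top_linorder by (auto intro!: exI[of _ 0])
  from tendsto_lowerbound[OF s0 this] have "c * (1 / 3) <= 0" by simp
  moreover have "0 < c" by (simp add: c_def)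
  ultimately show False by linarith
 qed
 then obtain t0 where t0: "0 <= t0" "r0 < r x t0" by blast
 have pm: "\<phi> x s <= \<phi> x t" if "t0 <= s" "s <= t" for s t
  using phi_increase(2)[OF x _ that(2)] H[of t] r_mono[OF x t0(1) that(1)] t0 that by simp
 obtain \<phi>' where \<phi>': "(\<phi> x \<longlongrightarrow> \<phi>') at_top"
 proof -
  have "(\<phi> x \<longlongrightarrow> (SUP t\<in>{t0..}. \<phi> x t)) at_top"
  proof (rule order_tendstoI)
   have bdd: "bdd_above (\<phi> x ` {t0..})" by (intro bdd_aboveI2[of _ _ \<Theta>]) (use P t0 in auto)
   show "eventually (\<lambda>s. y < \<phi> x s) at_top" if y: "y < (SUP t\<in>{t0..}. \<phi> x t)" for y
   proof -
    obtain t where t: "t0 <= t" "y < \<phi> x t" using less_cSUP_iff[of "{t0..}" "\<phi> x" y] bdd y by auto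
    then show ?thesis
     using pm[OF t(1)] unfolding eventually_at_top_linorder by (auto intro: less_le_trans)
   qed
   show "eventually (\<lambda>s. \<phi> x s < y) at_top" if "(SUP t\<in>{t0..}. \<phi> x t) < y" for y
    using that cSUP_upper[OF _ bdd] unfolding eventually_at_top_linorder by (auto intro!: exI[of _ "t0"] intro: le_less_trans)
  qed
  then show thesis by (rule that)
 qed
 have ctend: "((\<lambda>t. cos (\<phi> x t)) \<longlongrightarrow> cos \<phi>') at_top" "((\<lambda>t. sin (\<phi> x t)) \<longlongrightarrow> sin \<phi>') at_top"
  by (intro tendsto_intros \<phi>')+
 have f0: "((\<lambda>t. F (1 / p) (g t)) \<longlongrightarrow> 0) at_top"
 proof -
  have "isCont (Gp (1 / p - 1)) 0"
   using continuous_on_Gp[of "1 / p - 1"] p O.p_bounds by (simp add: continuous_on_eq_continuous_at)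
  from tendsto_rabs_zero[OF isCont_tendsto_compose[OF this g0, simplified]]
  have "((\<lambda>t. 1 / p * \<bar>Gp (1 / p - 1) (g t)\<bar>) \<longlongrightarrow> 1 / p * 0) at_top" by (intro tendsto_intros)
  moreover have "1 / p * \<bar>Gp (1 / p - 1) y\<bar> = F (1 / p) y" for y by (simp add: Gp_def F_def abs_mult abs_sgn_eq)
  ultimately show ?thesis by simp
 qed
 define D where "D t = - 2 * (sin (\<phi> x t) * (m * F (1 / p) (g t) + 1) + F (1 / p) (g t) * (1 - cos (\<phi> x t)) / r x t)" for t
 have dlx: "DERIV (l x) t :> D t" if "0 < t" for t
  using O.dl[of t] that unfolding D_def g_def by simp
 have R0: "R \<noteq> 0"
 proof -
  have "r1 <= R" by (rule tendsto_lowerbound[OF R])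
    (use r_ge[OF x] in \<open>auto simp: eventually_at_top_linorder intro!: exI[of _ 0]\<close>)
  then show ?thesis using r1 by simp
 qed
 have Dlim: "(D \<longlongrightarrow> - 2 * (sin \<phi>' * (m * 0 + 1) + 0 * (1 - cos \<phi>') / R)) at_top"
  unfolding D_def[abs_def] by (intro tendsto_intros ctend f0 R R0)
 show E0: "((\<lambda>t. exp (l x t)) \<longlongrightarrow> 0) at_top"
 \<comment> \<open>If the limit phase is off the light cone, the decay of \<open>s\<close> is that
   of the amplitude. On it the derivative of \<open>l\<close> tends to
   \<open>- 2 * sin \<phi>'\<close>: for the value 1 of the sine the amplitude decays exponentially,
   for -1 it would outgrow its bound.\<close>
 proof (cases "cos \<phi>' = 0")
  case False
  have lim: "((\<lambda>t. exp (l x t) * cos (\<phi> x t) / cos (\<phi> x t)) \<longlongrightarrow> 0 / cos \<phi>') at_top"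
   by (intro tendsto_divide s0 ctend False)
  have "eventually (\<lambda>t. cos (\<phi> x t) \<noteq> 0) at_top"
   using tendsto_imp_eventually_ne[OF ctend(1) False] .
  then have "eventually (\<lambda>t. exp (l x t) * cos (\<phi> x t) / cos (\<phi> x t) = exp (l x t)) at_top"
   by eventually_elim simp
  from Lim_transform_eventually[OF lim this] show ?thesis by simp
 next
  case True
  then have "(sin \<phi>')\<^sup>2 = 1" using sin_cos_squared_add[of \<phi>'] by simp
  then consider "sin \<phi>' = 1" | "sin \<phi>' = - 1" by (auto simp: power2_eq_1_iff)
  then show ?thesis
  proof cases
   case 1
   then have "(D \<longlongrightarrow> - 2) at_top" using Dlim by simp
   then have "eventually (\<lambda>t. D t < - 1) at_top" by (rule order_tendstoD(2)) simp
   then obtain T where T: "!!t. T <= t ==> D t < - 1" unfolding eventually_at_top_linorder by blast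
   define T' where "T' = max T 1"
   have "l x t <= l x T' + T' - t" if t: "T' <= t" for t
   proof -
    have "- T' - l x T' <= - t - l x t"
    proof (rule nondecreasing_off_finite[of "{}" T' t "\<lambda>t. - t - l x t" "\<lambda>t. - 1 - D t"])
     show "continuous_on {T'..t} (\<lambda>t. - t - l x t)"
      by (intro continuous_intros continuous_on_subset[OF cont(2)[OF x]]) (auto simp: T'_def)
     fix y assume y: "y \<in> {T'<..<t} - {}"
     show "DERIV (\<lambda>t. - t - l x t) y :> - 1 - D y"
      using y by (intro DERIV_diff DERIV_minus DERIV_ident dlx) (auto simp: T'_def)
     show "0 <= - 1 - D y" using T[of y] y by (auto simp: T'_def)
    qed (use t in auto)
    then show ?thesis by simp
   qed
   then have "eventually (\<lambda>t. norm (exp (l x t)) <= exp (l x T' + T' - t)) at_top"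
    unfolding eventually_at_top_linorder by auto
   moreover have "((\<lambda>t. exp (l x T' + T' - t)) \<longlongrightarrow> 0) at_top"
   proof (rule filterlim_compose[OF exp_at_bot])
    show "filterlim (\<lambda>t. l x T' + T' - t) at_bot at_top"
     using filterlim_tendsto_add_at_top[OF tendsto_const filterlim_ident, of "- (l x T' + T')"]
     by (simp add: filterlim_uminus_at_bot algebra_simps)
   qed
   ultimately show ?thesis by (rule Lim_null_comparison)
  next
   case 2
   then have "(D \<longlongrightarrow> 2) at_top" using Dlim by simp
   then have "eventually (\<lambda>t. 1 < D t) at_top" by (rule order_tendstoD(1)) simp
   then obtain T where T: "!!t. T <= t ==> 1 < D t" unfolding eventually_at_top_linorder by blast
   define T' where "T' = max T 1"
   define t where "t = T' + \<bar>l x T'\<bar> + \<bar>ln (2 * (H x 0 + 1) / a)\<bar> + 1"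
   have t: "T' <= t" by (simp add: t_def)
   have "l x T' - T' <= l x t - t"
   proof (rule nondecreasing_off_finite[of "{}" T' t "\<lambda>t. l x t - t" "\<lambda>t. D t - 1"])
    show "continuous_on {T'..t} (\<lambda>t. l x t - t)"
     by (intro continuous_intros continuous_on_subset[OF cont(2)[OF x]]) (auto simp: T'_def)
    fix y assume y: "y \<in> {T'<..<t} - {}"
    show "DERIV (\<lambda>t. l x t - t) y :> D y - 1"
     using y by (intro DERIV_diff DERIV_ident dlx) (auto simp: T'_def)
    show "0 <= D y - 1" using T[of y] y by (auto simp: T'_def)
   qed (use t in auto)
   then have "ln (2 * (H x 0 + 1) / a) < l x t" by (simp add: t_def)
   then have "exp (ln (2 * (H x 0 + 1) / a)) < exp (l x t)" by simp
   moreover have "0 < 2 * (H x 0 + 1) / a"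
   proof -
    have "0 < H x 0 + 1" using H[of 0] by simp
    then show ?thesis using a_pos by simp
   qed
   ultimately have "2 * (H x 0 + 1) / a < exp (l x t)" by (simp only: exp_ln)
   moreover have "0 <= t" using t by (simp add: T'_def)
   ultimately show ?thesis using E_bound[OF x, of t] by simp
  qed
 qed
 show "(H x \<longlongrightarrow> 0) at_top"
 proof -
  have "((\<lambda>t. exp (l x t) * (\<Omega> - m * cos (\<phi> x t)) - g t) \<longlongrightarrow> 0 * (\<Omega> - m * cos \<phi>') - 0) at_top"
   by (intro tendsto_intros E0 ctend g0)
  then show ?thesis by (simp add: H_def[abs_def] wt_def g_def)
 qed
qed

end

section \<open>The threshold orbit\<close>

context shooting
begin

text \<open>There is room on the left because \<open>xl\<close> is not in \<open>A\<close>, and the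
  conditions of \<open>A\<close> are open. An infimum of \<open>A\<close> can therefore not belong
  to \<open>A\<close>.\<close>

lemma open_left: assumes "x \<in> A" obtains y where "y \<in> A" "y < x"
proof -
 have x: "x \<in> {xl..xh}" using assms by (simp add: A_def)
 have lt: "xl < x" using x xl_notin assms by (cases "x = xl") auto
 obtain t where t: "0 <= t" "0 < H x t" "\<Theta> < \<phi> x t" using assms by (auto simp: A_def)
 define X where "X n = x - (x - xl) * inverse (real (Suc n))" for n
 have Xin: "X n \<in> {xl..xh}" for n
 proof -
  have "(x - xl) * inverse (real (Suc n)) <= (x - xl) * 1"
   using lt by (intro mult_left_mono) (auto simp: field_simps)
  moreover have "0 <= (x - xl) * inverse (real (Suc n))" using lt by simp
  ultimately show ?thesis using x by (simp add: X_def)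
 qed
 have "(\<lambda>n. x - (x - xl) * inverse (real (Suc n))) \<longlonglongrightarrow> x - (x - xl) * 0"
  by (intro tendsto_intros LIMSEQ_inverse_real_of_nat)
 then have Xlim: "X \<longlonglongrightarrow> x" by (simp add: X_def[abs_def])
 have "eventually (\<lambda>n. 0 < H (X n) t) sequentially"
  by (rule order_tendstoD(1)[OF tend_H[OF Xin x Xlim, of "\<lambda>_. t" t]]) (use t in auto)
 moreover have "eventually (\<lambda>n. \<Theta> < \<phi> (X n) t) sequentially"
  by (rule order_tendstoD(1)[OF cont_phi[OF Xin x Xlim, of "\<lambda>_. t" t]]) (use t in auto)
 ultimately have "eventually (\<lambda>n. X n \<in> A) sequentially"
  by eventually_elim (use Xin t(1) in \<open>auto simp: A_def\<close>)
 then obtain n where "X n \<in> A" unfolding eventually_sequentially by blast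
 moreover have "X n < x" using lt by (simp add: X_def)
 ultimately show thesis by (rule that)
qed

text \<open>Otherwise the passing parameters would accumulate, and at a limit point the orbit of
  \<open>x\<close> would reach \<open>\<Theta>\<close> with nonnegative energy, hence lie in
  \<open>A\<close> by \<open>reach\<close>. The orbits of \<open>A\<close> thus follow that of
  \<open>x\<close> for longer and longer.\<close>

lemma escape:
 assumes X: "!!n. X n \<in> A" "X \<longlonglongrightarrow> x" and x: "x \<in> {xl..xh}" "x \<notin> A"
 shows "eventually (\<lambda>n. \<forall>\<tau>\<in>{0..T}. \<not> (0 <= H (X n) \<tau> \<and> \<Theta> <= \<phi> (X n) \<tau>)) sequentially"
proof (rule ccontr)
 assume "\<not> ?thesis"
 then have "\<exists>n\<ge>N. \<exists>\<tau>\<in>{0..T}. 0 <= H (X n) \<tau> \<and> \<Theta> <= \<phi> (X n) \<tau>" for N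
  unfolding eventually_sequentially by blast
 then obtain \<nu> \<tau> where nt: "!!N. N <= \<nu> N" "!!N. \<tau> N \<in> {0..T}" "!!N. 0 <= H (X (\<nu> N)) (\<tau> N) \<and> \<Theta> <= \<phi> (X (\<nu> N)) (\<tau> N)"
  by metis
 obtain t \<sigma> where t: "t \<in> {0..T}" "strict_mono \<sigma>" "(\<tau> \<circ> \<sigma>) \<longlonglongrightarrow> t"
  using compact_Icc[of 0 T] nt(2) unfolding compact_def by metis
 have Xin: "X n \<in> {xl..xh}" for n using X(1)[of n] by (simp add: A_def)
 have nulim: "filterlim (\<lambda>n. \<nu> (\<sigma> n)) sequentially sequentially"
 proof (rule filterlim_at_top_mono[OF filterlim_subseq[OF t(2)]])
  show "eventually (\<lambda>n. \<sigma> n <= \<nu> (\<sigma> n)) sequentially" using nt(1) by simp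
 qed
 have Xl: "(\<lambda>n. X (\<nu> (\<sigma> n))) \<longlonglongrightarrow> x" by (rule filterlim_compose[OF X(2) nulim])
 have tl: "(\<lambda>n. \<tau> (\<sigma> n)) \<longlonglongrightarrow> t" using t(3) by (simp add: o_def)
 have "0 <= H x t"
  by (rule LIMSEQ_le_const[OF tend_H[OF Xin x(1) Xl _ tl]]) (use nt in auto)
 moreover have "\<Theta> <= \<phi> x t"
  by (rule LIMSEQ_le_const[OF cont_phi[OF Xin x(1) Xl _ tl]]) (use nt in auto)
 ultimately show False using reach[OF x(1), of t] t(1) x(2) by auto
qed

lemma E_large:
 assumes t: "0 <= t" "0 <= H xh t" "\<phi> xh t <= \<Theta>"
 shows "4 / a <= exp (l xh t)"
proof -
 have xh: "xh \<in> {xl..xh}" using x by simp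
 interpret O: orbit m \<Omega> p "{0..}" "{}" "r xh" "\<lambda>t. F (1 / p) (Gp p (exp (l xh t) * cos (\<phi> xh t)))" "\<lambda>t. 1" "l xh" "\<phi> xh"
  by (rule orb[OF xh])
 have i: "0 <= O.q 0" "O.q 0 <= a / 2 * r xh 0" "\<bar>\<phi> xh 0\<bar> < pi"
  using init_q[OF xh high(1)] init_phi[OF xh] r_0[OF xh] pi_gt_zero by (auto simp: O.q_def)
 have "\<gamma> ^ (3 * k + 2) * (exp (- (2 * (m + b + a) * r0)) * O.E 0) - 2 * Cg * (3 * k + 2) <= O.E t"
  by (rule O.E_lower) (use t i r_0[OF xh] r1 H_eq[OF xh] in \<open>auto simp: \<Theta>_def\<close>)
 with high(2) show ?thesis by (simp add: O.E_def)
qed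

text \<open>Before \<open>\<Theta>\<close> the energy of this orbit is at least 1 whenever it is
  nonnegative, so by continuity it never reaches 0. If the orbit did not pass
  \<open>\<Theta>\<close> it would run into the origin, against the lower bound of its
  amplitude.\<close>

lemma xh_in: "xh \<in> A"
proof (rule ccontr)
 assume notin: "xh \<notin> A"
 have xh: "xh \<in> {xl..xh}" using x by simp
 interpret O: orbit m \<Omega> p "{0..}" "{}" "r xh" "\<lambda>t. F (1 / p) (Gp p (exp (l xh t) * cos (\<phi> xh t)))" "\<lambda>t. 1" "l xh" "\<phi> xh"
  by (rule orb[OF xh])
 have lt: "\<phi> xh t < \<Theta>" if "0 <= t" "0 <= H xh t" for t
  using reach[OF xh that] notin by force
 have H1: "1 <= H xh t" if t: "0 <= t" "0 <= H xh t" for t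
 proof -
  have "4 / a <= O.E t" using E_large[OF t] lt[OF t] by (simp add: O.E_def)
  then have "a / 2 * (4 / a) <= a / 2 * O.E t" using a_pos by (intro mult_left_mono) auto
  then have "2 <= a / 2 * O.E t" using a_pos by simp
  then show ?thesis using O.h_lower[of t] H_eq[OF xh] by simp
 qed
 have Hpos: "0 <= H xh t" if t: "0 <= t" for t
 proof (rule ccontr)
  assume "\<not> 0 <= H xh t"
  then obtain y where y: "0 <= y" "y <= t" "H xh y = 0"
   using IVT2'[of "H xh" t 0 0] high(1) t continuous_on_subset[OF cont(4)[OF xh], of "{0..t}"]
   by (auto simp: H_def)
  then show False using H1[of y] by simp
 qed
 have "((\<lambda>t. exp (l xh t)) \<longlongrightarrow> 0) at_top"
  by (rule collapse(1)[OF xh Hpos]) (use lt Hpos in \<open>auto intro: less_imp_le\<close>)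
 moreover have "eventually (\<lambda>t. 4 / a <= exp (l xh t)) at_top"
  unfolding eventually_at_top_linorder using E_large Hpos lt by (auto intro!: exI[of _ 0] simp: less_imp_le)
 ultimately have "4 / a <= 0" by (intro tendsto_lowerbound[of _ 0 at_top]) auto
 then show False using a_pos by simp
qed

text \<open>At any fixed parameter the energy of the infimum is a limit of energies of orbits of
  \<open>A\<close> that have not yet passed \<open>\<Theta>\<close>, and these are positive.\<close>

lemma shot:
 obtains x where "x \<in> {xl..xh}" "!!t. 0 <= t ==> 0 <= H x t" "!!t. 0 <= t ==> \<phi> x t < \<Theta>"
  "0 < k ==> \<exists>t\<ge>0. \<Theta> - 2 * pi < \<phi> x t"
proof -
 define x where "x = Inf A"
 have bdd: "bdd_below A" by (auto simp: A_def intro!: bdd_belowI[of _ xl])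
 have ne: "A \<noteq> {}" using xh_in by auto
 have "xl <= x" unfolding x_def by (rule cInf_greatest[OF ne]) (auto simp: A_def)
 moreover have "x <= xh" unfolding x_def by (rule cInf_lower[OF xh_in bdd])
 ultimately have xin: "x \<in> {xl..xh}" by simp
 have notin: "x \<notin> A"
 proof
  assume "x \<in> A"
  then obtain y where "y \<in> A" "y < x" by (rule open_left)
  then show False using cInf_lower[OF _ bdd, of y] by (simp add: x_def)
 qed
 have "\<exists>y\<in>A. y < x + inverse (real (Suc n))" for n
  using cInf_less_iff[OF ne bdd, of "x + inverse (real (Suc n))"] by (simp add: x_def)
 then obtain X where X: "!!n. X n \<in> A" "!!n. X n < x + inverse (real (Suc n))" by metis
 have Xin: "X n \<in> {xl..xh}" for n using X(1)[of n] by (simp add: A_def)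
 have Xlim: "X \<longlonglongrightarrow> x"
 proof (rule real_tendsto_sandwich[of "\<lambda>_. x" X _ "\<lambda>n. x + inverse (real (Suc n))"])
  show "eventually (\<lambda>n. x <= X n) sequentially" using cInf_lower[OF X(1) bdd] by (simp add: x_def)
  show "eventually (\<lambda>n. X n <= x + inverse (real (Suc n))) sequentially" using X(2) by (simp add: less_imp_le)
  show "(\<lambda>n. x + inverse (real (Suc n))) \<longlonglongrightarrow> x"
   using tendsto_add[OF tendsto_const LIMSEQ_inverse_real_of_nat, of x] by simp
 qed simp
 obtain \<tau> where \<tau>: "!!n. 0 <= \<tau> n" "!!n. 0 < H (X n) (\<tau> n)" "!!n. \<Theta> < \<phi> (X n) (\<tau> n)"
  using X(1) unfolding A_def by (auto simp: choice_iff Bex_def) metis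
 have late: "eventually (\<lambda>n. T < \<tau> n) sequentially" for T
  using escape[OF X(1) Xlim xin notin, of T]
 proof eventually_elim
  case (elim n)
  show ?case
  proof (rule ccontr)
   assume "\<not> T < \<tau> n"
   then have "\<tau> n \<in> {0..T}" using \<tau>(1)[of n] by simp
   with elim \<tau>(2,3)[of n] show False by fastforce
  qed
 qed
 have Hpos: "0 <= H x t" if t: "0 <= t" for t
 proof (rule ccontr)
  assume "\<not> 0 <= H x t"
  then have "eventually (\<lambda>n. H (X n) t < 0) sequentially"
   by (intro order_tendstoD(2)[OF tend_H[OF Xin xin Xlim, of "\<lambda>_. t" t]]) (use t in auto)
  then have "eventually (\<lambda>n. False) sequentially"
   using late[of t]
  proof eventually_elim
   case (elim n)
   have "H (X n) (\<tau> n) <= H (X n) t" by (rule H_mono[OF Xin]) (use t elim in auto)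
   with elim \<tau>(2)[of n] show False by simp
  qed
  then show False by simp
 qed
 have lt: "\<phi> x t < \<Theta>" if "0 <= t" for t
  using reach[OF xin that Hpos[OF that]] notin by force
 \<comment> \<open>If the threshold orbit stopped short of the previous zero of \<open>v\<close>,
   its energy would fall below \<open>loss\<close>. So would that of nearby orbits of
   \<open>A\<close>, while these still have the half turn from \<open>\<Theta> - 2 * pi\<close> to
   \<open>\<Theta> - pi\<close> ahead of them, which costs at least \<open>loss\<close>.\<close>
 have "\<exists>t\<ge>0. \<Theta> - 2 * pi < \<phi> x t" if k: "0 < k"
 proof (rule ccontr)
  assume "\<not> (\<exists>t\<ge>0. \<Theta> - 2 * pi < \<phi> x t)"
  then have le: "\<phi> x t <= \<Theta> - 2 * pi" if "0 <= t" for t using that by force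
  have Tk: "\<Theta> - 2 * pi = real (k - 1) * (2 * pi) + pi"
   using k by (simp add: \<Theta>_def of_nat_diff algebra_simps)
  have T1: "pi <= \<Theta> - 2 * pi" unfolding Tk by simp
  have c: "cos (\<Theta> - 2 * pi) = - 1" unfolding Tk using cos.plus_of_nat[of pi "k - 1"] by (simp add: add.commute)
  have strict: "\<phi> x t < \<Theta> - 2 * pi" if t: "0 <= t" for t
  proof (rule ccontr)
   assume "\<not> ?thesis"
   then have eq: "\<phi> x t = \<Theta> - 2 * pi" using le[OF t] by simp
   have "0 < t" using t eq init_phi[OF xin] T1 pi_gt_zero by (cases "t = 0") auto
   from passes[OF xin this] eq c obtain d where "0 < d" "!!s. 0 < s ==> s < d ==> \<phi> x t < \<phi> x (t + s)" by metis
   from this(1) this(2)[of "d / 2"] le[of "t + d / 2"] eq t show False by simp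
  qed
  define \<rho> where "\<rho> = r0 + 4 * \<Theta> / a"
  have "0 <= \<Theta>" using Theta_ge pi_gt_zero by linarith
  then have \<rho>: "0 < \<rho>" unfolding \<rho>_def using r0_pos a_pos by (intro add_pos_nonneg divide_nonneg_pos) auto
  have "(H x \<longlongrightarrow> 0) at_top" by (rule collapse(2)[OF xin Hpos]) (use lt in \<open>auto intro: less_imp_le\<close>)
  from order_tendstoD(2)[OF this loss_pos[OF \<rho>, of p]]
  obtain t1' where t1': "!!t. t1' <= t ==> H x t < loss p \<rho>" unfolding eventually_at_top_linorder by blast
  define t1 where "t1 = max t1' 0"
  have t1: "0 <= t1" "H x t1 < loss p \<rho>" using t1' by (auto simp: t1_def)
  have "eventually (\<lambda>n. H (X n) t1 < loss p \<rho>) sequentially"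
   by (rule order_tendstoD(2)[OF tend_H[OF Xin xin Xlim, of "\<lambda>_. t1" t1]]) (use t1 in auto)
  moreover have "eventually (\<lambda>n. \<phi> (X n) t1 < \<Theta> - 2 * pi) sequentially"
   by (rule order_tendstoD(2)[OF cont_phi[OF Xin xin Xlim, of "\<lambda>_. t1" t1]]) (use t1 strict in auto)
  ultimately have "eventually (\<lambda>n. False) sequentially" using late[of "t1"]
  proof eventually_elim
   case (elim n)
   define y where "y = X n"
   have y: "y \<in> {xl..xh}" using Xin by (simp add: y_def)
   have t1n: "t1 <= \<tau> n" "0 <= \<tau> n" using elim \<tau>(1)[of n] by auto
   have up: "\<Theta> - 2 * pi <= \<phi> y (\<tau> n)" "\<Theta> - pi <= \<phi> y (\<tau> n)" "\<Theta> - 2 * pi <= \<Theta> - pi"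
    using \<tau>(3)[of n] pi_gt_zero unfolding y_def by linarith+
   have dn: "\<phi> y t1 <= \<Theta> - 2 * pi" using elim by (simp add: y_def)
   obtain s where s: "t1 <= s" "s <= \<tau> n" "\<phi> y s = \<Theta> - 2 * pi"
    using IVT'[OF dn up(1) t1n(1)] t1(1) continuous_on_subset[OF cont(3)[OF y], of "{t1..\<tau> n}"] by auto
   obtain t where t: "s <= t" "t <= \<tau> n" "\<phi> y t = \<Theta> - pi"
    using IVT'[of "\<phi> y" s "\<Theta> - pi" "\<tau> n"] s up t1(1)
     continuous_on_subset[OF cont(3)[OF y], of "{s..\<tau> n}"] by auto
   have s0: "0 <= s" and t0: "0 <= t" using s t t1 by auto
   have Hs: "0 <= H y z" if "0 <= z" "z <= \<tau> n" for z
    using H_mono[OF y that] \<tau>(2)[of n] by (simp add: y_def)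
   have rs: "r0 <= r y s" using r_ge_r0[OF y s0] Hs[OF s0] s T1 pi_gt_zero by simp
   define \<psi> where "\<psi> z = \<phi> y z - of_nat k * (2 * pi)" for z
   interpret O: orbit m \<Omega> p "{0..}" "{}" "r y" "\<lambda>t. F (1 / p) (Gp p (exp (l y t) * cos (\<phi> y t)))" "\<lambda>t. 1" "l y" "\<psi>"
    unfolding \<psi>_def[abs_def] by (rule orbit.orbit_shift[OF orb[OF y]])
   have Oh: "O.h z = H y z" for z
   proof -
    have "cos (\<psi> z) = cos (\<phi> y z)" using cos.minus_of_nat[of "\<phi> y z" k] by (simp add: \<psi>_def)
    then show ?thesis by (simp only: O.h_def O.E_def O.G_def H_def wt_def)
   qed
   have "O.h t + loss p \<rho> <= O.h s"
   proof (rule O.energy_loss)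
    show "\<psi> s = - pi" "\<psi> t = 0" using s(3) t(3) by (simp_all add: \<psi>_def \<Theta>_def)
    show "- pi <= \<psi> z \<and> \<psi> z <= 0" if z: "z \<in> {s..t}" for z
    proof -
     have "\<phi> y s <= \<phi> y z" "\<phi> y z <= \<phi> y t"
      using phi_increase(2)[OF y s0 _ _ rs, of z] phi_increase(2)[OF y _ _ Hs[OF t0], of z] z t s0
       Hs[of z] r_mono[OF y s0, of z] rs by auto
     then show ?thesis using \<open>\<psi> s = - pi\<close> \<open>\<psi> t = 0\<close> by (simp add: \<psi>_def)
    qed
    show "r y t <= \<rho>" unfolding \<rho>_def by (rule r_le[OF y t0 Hs[OF t0 t(2)]]) (use t(3) pi_gt_zero in simp)
   qed (use s0 t t0 Hs Oh \<rho> in auto)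
   then have "H y t + loss p \<rho> <= H y s" unfolding Oh .
   moreover have "H y s <= H y t1" by (rule H_mono[OF y t1(1) s(1)])
   moreover have "H y t1 < loss p \<rho>" using elim by (simp add: y_def)
   ultimately show False using Hs[OF t0 t(2)] by linarith
  qed
  then show False by simp
 qed
 with that xin Hpos lt show thesis by blast
qed

text \<open>Needed for using the radius as parameter again. If it paused, \<open>f\<close> would
  vanish and the orbit would stay on the light cone; the derivative of \<open>s\<close> then forces
  sin phi = 1 and the radius \<open>1 / \<Omega>\<close>, which is below \<open>r0\<close>, where
  cos phi is at least 1/3.\<close>

lemma r_strict:
 assumes x: "x \<in> {xl..xh}" and H: "!!t. 0 <= t ==> 0 <= H x t" and st: "0 <= s" "s < t"
 shows "r x s < r x t"
proof (rule ccontr)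
 assume "\<not> r x s < r x t"
 interpret O: orbit m \<Omega> p "{0..}" "{}" "r x" "\<lambda>t. F (1 / p) (Gp p (exp (l x t) * cos (\<phi> x t)))" "\<lambda>t. 1" "l x" "\<phi> x"
  by (rule orb[OF x])
 have const: "r x y = r x s" if "y \<in> {s..t}" for y
  using r_mono[OF x, of s y] r_mono[OF x, of y t] that st \<open>\<not> r x s < r x t\<close> by auto
 have c0: "cos (\<phi> x y) = 0" if y: "y \<in> {s<..<t}" for y
 proof -
  have i: "y \<in> interior {0..} - {}" using y st by simp
  have "DERIV (\<lambda>_. r x s) y :> F (1 / p) (Gp p (exp (l x y) * cos (\<phi> x y)))"
  proof (rule has_field_derivative_transform_within_open[OF O.dr[OF i], of "{s<..<t}"])
   show "r x z = r x s" if "z \<in> {s<..<t}" for z by (rule const) (use that in auto)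
  qed (use y in auto)
  then have "F (1 / p) (Gp p (exp (l x y) * cos (\<phi> x y))) = 0"
   using DERIV_unique DERIV_const by blast
  then have "Gp p (exp (l x y) * cos (\<phi> x y)) = 0" using p by (auto simp: F_def split: if_splits)
  then show ?thesis using Gp_inverse(2)[OF p(1), of "exp (l x y) * cos (\<phi> x y)"] by simp
 qed
 define y where "y = (s + t) / 2"
 have y: "y \<in> {s<..<t}" using st by (simp add: y_def)
 have i: "y \<in> interior {0..} - {}" using y st by simp
 have "DERIV (\<lambda>_. 0) y :> - 2 * 1 * exp (l x y) * (\<Omega> * sin (\<phi> x y) - (1 - cos (\<phi> x y)) / r x y)"
  by (rule has_field_derivative_transform_within_open[OF O.dG[OF i], of "{s<..<t}"]) (use y c0 in auto)
 then have "- 2 * 1 * exp (l x y) * (\<Omega> * sin (\<phi> x y) - (1 - cos (\<phi> x y)) / r x y) = 0"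
  using DERIV_unique DERIV_const by blast
 then have eq: "\<Omega> * sin (\<phi> x y) = 1 / r x y" using c0[OF y] by simp
 have ry: "0 < r x y" using r_ge[OF x, of y] y st r1 by simp
 have "1 / r x y <= \<Omega> * 1" unfolding eq[symmetric] using Om_pos by (intro mult_left_mono) auto
 have "(sin (\<phi> x y))\<^sup>2 = 1" using sin_cos_squared_add[of "\<phi> x y"] c0[OF y] by simp
 then have "sin (\<phi> x y) = 1"
  using eq ry Om_pos by (auto simp: power2_eq_1_iff) (smt (verit) zero_less_divide_1_iff)
 then have "r x y = 1 / \<Omega>" using eq ry Om_pos by (simp add: field_simps)
 also have "\<dots> <= r0" using kappa_le kappa_pos Om_pos unfolding r0_def by (simp add: frac_le field_simps)
 finally have "1 / 3 <= cos (\<phi> x y)" using initial(3)[OF x _ H[of y]] y st by simp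
 then show False using c0[OF y] by simp
qed

end

section \<open>Counting nodes\<close>

text \<open>The part of a solution between a radius \<open>\<alpha>\<close> beyond the centre and
  the radius \<open>R\<close> where it reaches the origin. It serves both to count the nodes of the
  constructed solution and to read off the phase of a given one.\<close>

locale polar_tail =
 fixes w :: "real => real \<times> real" and lam \<psi> :: "real => real" and \<alpha> R :: real
 assumes \<alpha>: "0 < \<alpha>" "\<alpha> < R"
  and polar: "!!r. r \<in> {\<alpha>..<R} ==> w r = (exp (lam r / 2) * sin (\<psi> r / 2), exp (lam r / 2) * cos (\<psi> r / 2))"
  and cont: "continuous_on {\<alpha>..<R} \<psi>"
  and strict: "!!r r'. \<alpha> <= r ==> r < r' ==> r' < R ==> \<psi> r < \<psi> r'"
  and start: "0 <= \<psi> \<alpha>" "\<psi> \<alpha> < pi"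
  and before: "!!r. 0 < r ==> r <= \<alpha> ==> 0 < snd (w r)"
  and after: "!!r. R <= r ==> snd (w r) = 0 ==> fst (w r) = 0"
begin

lemma crossings_eq: "crossings w = {r \<in> {\<alpha><..<R}. \<exists>j::nat. \<psi> r = real j * (2 * pi) + pi}"
proof (intro equalityI subsetI)
 fix r assume "r \<in> crossings w"
 then have r: "0 < r" "fst (w r) \<noteq> 0" "snd (w r) = 0" by (auto simp: crossings_def)
 then have r\<alpha>: "\<alpha> < r" "r < R" using before[of r] after[of r] by force+
 then have "cos (\<psi> r / 2) = 0" using polar[of r] r(3) by simp
 then obtain i :: int where i: "odd i" "\<psi> r / 2 = of_int i * (pi / 2)" by (auto simp: cos_zero_iff_int)
 have "0 < \<psi> r" using strict[of \<alpha> r] r\<alpha> start by simp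
 then have "of_int 0 * (pi / 2) < of_int i * (pi / 2)" using i(2) by simp
 then have "0 < i" by (simp only: mult_less_cancel_right_pos[OF pi_half_gt_zero] of_int_less_iff)
 obtain c where c: "i = 2 * c + 1" using i(1) by (elim oddE)
 then have "0 <= c" using \<open>0 < i\<close> by linarith
 then have "\<psi> r = real (nat c) * (2 * pi) + pi" using i(2) c by (simp add: field_simps)
 then show "r \<in> {r \<in> {\<alpha><..<R}. \<exists>j::nat. \<psi> r = real j * (2 * pi) + pi}" using r\<alpha> by auto
next
 fix r assume "r \<in> {r \<in> {\<alpha><..<R}. \<exists>j::nat. \<psi> r = real j * (2 * pi) + pi}"
 then obtain j :: nat where r: "\<alpha> < r" "r < R" and j: "\<psi> r = real j * (2 * pi) + pi" by auto
 have half: "\<psi> r / 2 = real j * pi + pi / 2" using j by (simp add: field_simps)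
 have c0: "cos (\<psi> r / 2) = 0" unfolding half by (simp add: cos_add)
 have s1: "(sin (\<psi> r / 2))\<^sup>2 = 1" using c0 sin_cos_squared_add[of "\<psi> r / 2"] by simp
 have wr: "w r = (exp (lam r / 2) * sin (\<psi> r / 2), 0)" using polar[of r] r c0 by simp
 have "isCont \<psi> r"
 proof -
  have "{\<alpha><..<R} \<subseteq> {\<alpha>..<R}" by auto
  from continuous_on_subset[OF cont this] r show ?thesis by (simp add: continuous_on_eq_continuous_at)
 qed
 then obtain d where d: "0 < d" "!!y. dist y r < d ==> dist (\<psi> y) (\<psi> r) < 2 * pi"
  using pi_gt_zero unfolding isCont_def LIM_def by (metis dist_self mult_pos_pos zero_less_numeral)
 define \<epsilon> where "\<epsilon> = min d (min (r - \<alpha>) (R - r))"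
 have "snd (w (r - t)) * snd (w (r + t)) < 0" if t: "t \<in> {0<..<\<epsilon>}" for t
 proof -
  have rt: "\<alpha> < r - t" "r + t < R" "0 < t" "t < d" using t by (auto simp: \<epsilon>_def)
  define d1 where "d1 = \<psi> (r - t) - \<psi> r"
  define d2 where "d2 = \<psi> (r + t) - \<psi> r"
  have "d1 < 0" "0 < d2" using strict[of "r - t" r] strict[of r "r + t"] rt r by (auto simp: d1_def d2_def)
  moreover have "- (2 * pi) < d1" "d2 < 2 * pi"
   using d(2)[of "r - t"] d(2)[of "r + t"] rt by (auto simp: d1_def d2_def dist_real_def abs_less_iff)
  ultimately have sn: "0 < sin (- (d1 / 2))" "0 < sin (d2 / 2)"
   by - (rule sin_gt_zero; linarith)+
  have e: "\<psi> (r - t) / 2 = \<psi> r / 2 + d1 / 2" "\<psi> (r + t) / 2 = \<psi> r / 2 + d2 / 2"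
   by (simp_all add: d1_def d2_def field_simps)
  have k: "cos (\<psi> (r - t) / 2) = - (sin (\<psi> r / 2) * sin (d1 / 2))"
   "cos (\<psi> (r + t) / 2) = - (sin (\<psi> r / 2) * sin (d2 / 2))"
   unfolding e cos_add c0 by simp_all
  have "snd (w (r - t)) = exp (lam (r - t) / 2) * cos (\<psi> (r - t) / 2)"
   "snd (w (r + t)) = exp (lam (r + t) / 2) * cos (\<psi> (r + t) / 2)"
   using polar[of "r - t"] polar[of "r + t"] rt r by simp_all
  then have "snd (w (r - t)) * snd (w (r + t))
    = (exp (lam (r - t) / 2) * exp (lam (r + t) / 2)) * ((sin (\<psi> r / 2))\<^sup>2 * (sin (d1 / 2) * sin (d2 / 2)))"
   unfolding k by (simp only: power2_eq_square mult_minus_left mult_minus_right minus_minus mult_ac)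
  also have "\<dots> = - ((exp (lam (r - t) / 2) * exp (lam (r + t) / 2)) * (sin (- (d1 / 2)) * sin (d2 / 2)))"
   unfolding s1 by simp
  also have "\<dots> < 0" using sn by (simp only: neg_less_0_iff_less) (intro mult_pos_pos; simp)
  finally show ?thesis .
 qed
 moreover have "0 < \<epsilon>" using d r by (simp add: \<epsilon>_def)
 moreover have "sin (\<psi> r / 2) \<noteq> 0" using s1 by auto
 ultimately show "r \<in> crossings w" unfolding crossings_def using wr r \<alpha> by auto
qed

text \<open>The indices of the node phases that are reached. This is an initial segment of the
  naturals in bijection with the crossings, so the number of crossings determines it.\<close>

definition "N = {j::nat. \<exists>r\<in>{\<alpha>..<R}. real j * (2 * pi) + pi <= \<psi> r}"

lemma N_attained:
 assumes "j \<in> N" shows "\<exists>r\<in>{\<alpha><..<R}. \<psi> r = real j * (2 * pi) + pi"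
proof -
 obtain r where r: "\<alpha> <= r" "r < R" "real j * (2 * pi) + pi <= \<psi> r" using assms by (auto simp: N_def)
 have nn: "0 <= real j * (2 * pi)" by simp
 then have lt: "\<psi> \<alpha> < real j * (2 * pi) + pi" using start(2) by linarith
 have c: "continuous_on {\<alpha>..r} \<psi>" by (rule continuous_on_subset[OF cont]) (use r in auto)
 obtain y where y: "\<alpha> <= y" "y <= r" "\<psi> y = real j * (2 * pi) + pi"
  using IVT'[OF less_imp_le[OF lt] r(3,1)] c by blast
 moreover have "y \<noteq> \<alpha>" using y(3) lt by auto
 ultimately show ?thesis using r by (intro bexI[of _ y]) auto
qed

lemma psi_inj: "inj_on \<psi> {\<alpha>..<R}"
 using strict by (intro linorder_inj_onI') force

lemma crossings_bij:
 obtains c where "bij_betw c N (crossings w)"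
proof -
 obtain c where c: "!!j. j \<in> N ==> c j \<in> {\<alpha><..<R} \<and> \<psi> (c j) = real j * (2 * pi) + pi"
  using N_attained by metis
 have "bij_betw c N (crossings w)"
 proof (rule bij_betwI')
  show "(c i = c j) = (i = j)" if "i \<in> N" "j \<in> N" for i j
  proof
   assume eq: "c i = c j"
   have "real i * (2 * pi) + pi = \<psi> (c i)" using c[OF that(1)] by simp
   also have "\<dots> = real j * (2 * pi) + pi" unfolding eq using c[OF that(2)] by simp
   finally show "i = j" by simp
  qed simp
  show "c j \<in> crossings w" if "j \<in> N" for j unfolding crossings_eq using c[OF that] by blast
  show "\<exists>j\<in>N. r = c j" if r: "r \<in> crossings w" for r
  proof -
   obtain j where j: "r \<in> {\<alpha><..<R}" "\<psi> r = real j * (2 * pi) + pi" using r unfolding crossings_eq by blast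
   then have jN: "j \<in> N" unfolding N_def by (intro CollectI bexI[of _ r]) auto
   have "r = c j" 
   proof (rule inj_onD[OF psi_inj])
    show "\<psi> r = \<psi> (c j)" using c[OF jN] j(2) by simp
   qed (use c[OF jN] j(1) in auto)
   then show ?thesis using jN by blast
  qed
 qed
 then show thesis by (rule that)
qed

lemma N_down: "j \<in> N ==> i <= j ==> i \<in> N"
proof -
 assume "j \<in> N" "i <= j"
 then obtain r where r: "r \<in> {\<alpha>..<R}" "real j * (2 * pi) + pi <= \<psi> r" by (auto simp: N_def)
 have "real i * (2 * pi) <= real j * (2 * pi)" using \<open>i <= j\<close> by (intro mult_right_mono) auto
 with r(2) have "real i * (2 * pi) + pi <= \<psi> r" by linarith
 with r(1) show "i \<in> N" unfolding N_def by blast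
qed

lemma card_crossings:
 assumes up: "!!r. r \<in> {\<alpha>..<R} ==> \<psi> r < real k * (2 * pi) + pi"
  and dn: "0 < k ==> \<exists>r\<in>{\<alpha>..<R}. real k * (2 * pi) - pi < \<psi> r"
 shows "finite (crossings w)" "card (crossings w) = k"
proof -
 have "N = {..<k}"
 proof (intro equalityI subsetI)
  fix j assume "j \<in> N"
  show "j \<in> {..<k}"
  proof (rule ccontr)
   assume "j \<notin> {..<k}"
   then have "k \<in> N" using N_down[OF \<open>j \<in> N\<close>] by simp
   then show False using up unfolding N_def by fastforce
  qed
 next
  fix j assume j: "j \<in> {..<k}"
  then obtain r where r: "r \<in> {\<alpha>..<R}" "real k * (2 * pi) - pi < \<psi> r" using dn by auto
  have "real (Suc j) * (2 * pi) <= real k * (2 * pi)" using j by (intro mult_right_mono) auto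
  then have "real j * (2 * pi) + pi <= \<psi> r" using r(2) by (simp add: distrib_right)
  then show "j \<in> N" using r(1) by (auto simp: N_def)
 qed
 moreover obtain c where c: "bij_betw c N (crossings w)" by (rule crossings_bij)
 ultimately show "finite (crossings w)" "card (crossings w) = k"
  using bij_betw_finite[OF c] bij_betw_same_card[OF c] by simp_all
qed

lemma card_crossingsD:
 assumes "finite (crossings w)" "card (crossings w) = k"
 shows "r \<in> {\<alpha>..<R} ==> \<psi> r < real k * (2 * pi) + pi"
  and "0 < k ==> \<exists>r\<in>{\<alpha>..<R}. real k * (2 * pi) - pi < \<psi> r"
proof -
 obtain c where c: "bij_betw c N (crossings w)" by (rule crossings_bij)
 have fN: "finite N" "card N = k" using assms bij_betw_finite[OF c] bij_betw_same_card[OF c] by auto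
 have kN: "k \<notin> N"
 proof
  assume "k \<in> N"
  then have "{..k} \<subseteq> N" using N_down by auto
  from card_mono[OF fN(1) this] fN(2) show False by simp
 qed
 then have "N \<subseteq> {..<k}" using N_down by (metis lessThan_iff not_le subsetI)
 then have Nk: "N = {..<k}" using fN by (intro card_subset_eq) auto
 show "\<psi> r < real k * (2 * pi) + pi" if "r \<in> {\<alpha>..<R}" for r
  using kN that unfolding N_def by force
 assume "0 < k"
 then have "k - 1 \<in> N" using Nk by simp
 then obtain r where r: "r \<in> {\<alpha><..<R}" "\<psi> r = real (k - 1) * (2 * pi) + pi" using N_attained by blast
 have eq: "real (k - 1) * (2 * pi) + pi = real k * (2 * pi) - pi"
  using \<open>0 < k\<close> by (simp add: of_nat_diff algebra_simps)
 define r' where "r' = (r + R) / 2"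
 have r': "r < r'" "r' < R" using r(1) by (auto simp: r'_def)
 then have "\<psi> r < \<psi> r'" using strict[of r r'] r(1) by simp
 then show "\<exists>r\<in>{\<alpha>..<R}. real k * (2 * pi) - pi < \<psi> r" using r' r eq by (intro bexI[of _ r']) auto
qed

end

lemma isCont_F: "s \<noteq> 0 ==> isCont (F p) s"
proof -
 assume s: "s \<noteq> 0"
 have "isCont (\<lambda>s. p * \<bar>s\<bar> powr (p - 1)) s" using s by (intro continuous_intros) auto
 moreover have "eventually (\<lambda>x. F p x = p * \<bar>x\<bar> powr (p - 1)) (nhds s)"
  using t1_space_nhds[OF s] by eventually_elim (simp add: F_def)
 ultimately show ?thesis by (rule isCont_cong[THEN iffD2, rotated])
qed

lemma continuous_on_soler_field:
 assumes w: "continuous_on U w" and "!!r. r \<in> U ==> r \<noteq> 0" "!!r. r \<in> U ==> minkowski (w r) \<noteq> 0"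
 shows "continuous_on U (\<lambda>r. soler_field m \<Omega> p r (w r))"
proof -
 have cF: "continuous_on U (\<lambda>r. F p (minkowski (w r)))"
 proof (rule continuous_on_compose2[of "- {0}" "F p"])
  show "continuous_on (- {0}) (F p)"
   by (intro continuous_at_imp_continuous_on ballI isCont_F) auto
  show "continuous_on U (\<lambda>r. minkowski (w r))"
   unfolding minkowski_def case_prod_beta by (intro continuous_intros w)
 qed (use assms(3) in auto)
 have "continuous_on U (\<lambda>r. (snd (w r) * (- F p (minkowski (w r)) - (m - \<Omega>)) - 2 * fst (w r) / r,
   fst (w r) * (- F p (minkowski (w r)) - (m + \<Omega>))))"
  by (intro continuous_intros w cF) (use assms(2) in auto)
 then show ?thesis by (simp add: soler_field_def minkowski_def case_prod_beta)
qed

section \<open>From the threshold orbit back to a solution in the radius\<close>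

context shooting
begin

text \<open>The orbit is reparametrised by its radius, glued to \<open>W\<close> at
  \<open>r1\<close> and continued by 0 beyond the supremum \<open>R\<close> of its radii. The
  exceptional points are \<open>r1\<close>, \<open>R\<close> and the finitely many crossings of the
  light cone.\<close>

lemma shot_solution:
 assumes x: "x \<in> {xl..xh}" and H: "!!t. 0 <= t ==> 0 <= H x t" and lt: "!!t. 0 <= t ==> \<phi> x t < \<Theta>"
  and node: "0 < k ==> \<exists>t\<ge>0. \<Theta> - 2 * pi < \<phi> x t"
  and W: "continuous_on {0..r1} W" "W 0 = (0, x0)" "0 < x0"
   "!!t. t \<in> {0<..<r1} ==> (W has_vector_derivative soler_field m \<Omega> p t (W t)) (at t)"
   "!!t. t \<in> {0..r1} ==> 0 < snd (W t) \<and> \<bar>fst (W t)\<bar> < snd (W t)"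
   "W r1 = (exp (l x 0 / 2) * sin (\<phi> x 0 / 2), exp (l x 0 / 2) * cos (\<phi> x 0 / 2))"
 shows "\<exists>w. nodal_solution m \<Omega> k p w"
proof -
 interpret O: orbit m \<Omega> p "{0..}" "{}" "r x" "\<lambda>t. F (1 / p) (Gp p (exp (l x t) * cos (\<phi> x t)))" "\<lambda>t. 1" "l x" "\<phi> x"
  by (rule orb[OF x])
 define f where "f t = F (1 / p) (Gp p (exp (l x t) * cos (\<phi> x t)))" for t
 note le = less_imp_le[OF lt]
 note coll = collapse[OF x H le]
 define \<rho> where "\<rho> = r x"
 have mono: "\<rho> s < \<rho> t" if "0 <= s" "s < t" for s t unfolding \<rho>_def by (rule r_strict[OF x H that])
 have inj: "inj_on \<rho> {0..}" by (rule linorder_inj_onI') (use mono in force)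
 have \<rho>0: "\<rho> 0 = r1" using r_0[OF x] by (simp add: \<rho>_def)
 have bdd: "bdd_above (\<rho> ` {0..})"
  by (rule bdd_aboveI2[of _ _ "r0 + 4 * \<Theta> / a"]) (use r_le[OF x] H le in \<open>auto simp: \<rho>_def\<close>)
 define R where "R = (SUP t\<in>{0..}. \<rho> t)"
 have below: "\<rho> t < R" if t: "0 <= t" for t
 proof -
  have "\<rho> t < \<rho> (t + 1)" by (rule mono) (use t in auto)
  also have "\<dots> <= R" unfolding R_def by (rule cSUP_upper[OF _ bdd]) (use t in auto)
  finally show ?thesis .
 qed
 have above: "\<exists>b\<ge>0. s < \<rho> b" if "s < R" for s
  using less_cSUP_iff[of "{0..}" \<rho> s] bdd that by (auto simp: R_def)
 have c\<rho>: "continuous_on {0..} \<rho>" unfolding \<rho>_def by (rule cont(1)[OF x])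
 have img: "\<rho> ` {0..b} = {r1..\<rho> b}" if b: "0 <= b" for b
 proof (intro equalityI subsetI)
  fix s assume "s \<in> \<rho> ` {0..b}"
  then obtain t where "t \<in> {0..b}" "s = \<rho> t" by auto
  then show "s \<in> {r1..\<rho> b}" using r_mono[OF x, of 0 t] r_mono[OF x, of t b] \<rho>0 by (auto simp: \<rho>_def)
 next
  fix s assume "s \<in> {r1..\<rho> b}"
  then show "s \<in> \<rho> ` {0..b}"
   using IVT'[of \<rho> 0 s b] b \<rho>0 continuous_on_subset[OF c\<rho>, of "{0..b}"] by force
 qed
 define T where "T = the_inv_into {0..} \<rho>"
 have T\<rho>: "T (\<rho> t) = t" if "0 <= t" for t unfolding T_def by (rule the_inv_into_f_f[OF inj]) (use that in simp)
 have \<rho>T: "\<rho> (T s) = s" "0 <= T s" if s: "r1 <= s" "s < R" for s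
 proof -
  obtain b where b: "0 <= b" "s < \<rho> b" using above[OF s(2)] by blast
  then obtain t where "t \<in> {0..b}" "s = \<rho> t" using img[OF b(1)] s by (metis atLeastAtMost_iff imageE less_imp_le)
  then show "\<rho> (T s) = s" "0 <= T s" using T\<rho> by auto
 qed
 have Tmono: "T s < T s'" if "r1 <= s" "s < s'" "s' < R" for s s'
 proof (rule ccontr)
  assume "\<not> T s < T s'"
  then have "\<rho> (T s') <= \<rho> (T s)" using mono[of "T s'" "T s"] \<rho>T[of s'] that by (cases "T s' = T s") auto
  then show False using \<rho>T(1)[of s] \<rho>T(1)[of s'] that by simp
 qed
 have cT: "continuous_on {r1..\<rho> b} T" if b: "0 <= b" for b
  using continuous_on_inv[OF continuous_on_subset[OF c\<rho>] compact_Icc, of 0 b T] T\<rho> img[OF b] by auto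
 define U where "U t = (exp (l x t / 2) * sin (\<phi> x t / 2), exp (l x t / 2) * cos (\<phi> x t / 2))" for t
 have cU: "continuous_on {0..} U" unfolding U_def[abs_def] by (intro continuous_intros cont[OF x]; simp)
 have UE: "norm (U t) ^ 2 = exp (l x t)" for t
  using O.E_eq[of t] by (simp add: U_def norm_Pair O.E_def O.u_def O.v_def)
 define w where "w s = (if s <= r1 then W s else if s < R then U (T s) else 0)" for s
 have wT: "w s = U (T s)" if "r1 <= s" "s < R" for s
  using that W(6) T\<rho>[of 0] \<rho>0 by (cases "s = r1") (auto simp: w_def U_def)
 have r1R: "r1 < R" using below[of 0] \<rho>0 by simp
 have cw: "continuous_on {0..\<rho> b} w" if b: "0 <= b" for b
 proof -
  have "continuous_on ({0..r1} \<union> {r1..\<rho> b}) w"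
  proof (rule continuous_on_closed_Un)
   show "continuous_on {0..r1} w" by (rule continuous_on_eq[OF W(1)]) (auto simp: w_def)
   have "continuous_on {r1..\<rho> b} (\<lambda>s. U (T s))"
    by (rule continuous_on_compose2[OF cU cT[OF b]]) (use \<rho>T below[OF b] in auto)
   then show "continuous_on {r1..\<rho> b} w" by (rule continuous_on_eq) (use wT below[OF b] in auto)
  qed auto
  moreover have "{0..r1} \<union> {r1..\<rho> b} = {0..\<rho> b}" using r1 r_ge[OF x b] by (auto simp: \<rho>_def)
  ultimately show ?thesis by simp
 qed
 have wR: "continuous (at R within {0..}) w"
  unfolding continuous_within
 proof (rule tendstoI)
  fix \<epsilon> :: real assume \<epsilon>: "0 < \<epsilon>"
  have "eventually (\<lambda>t. exp (l x t) < \<epsilon>\<^sup>2) at_top" by (rule order_tendstoD(2)[OF coll(1)]) (use \<epsilon> in auto)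
  then obtain t0 where t0: "!!t. t0 <= t ==> exp (l x t) < \<epsilon>\<^sup>2" unfolding eventually_at_top_linorder by blast
  define b where "b = max t0 0"
  have b: "0 <= b" "!!t. b <= t ==> exp (l x t) < \<epsilon>\<^sup>2" using t0 by (auto simp: b_def)
  have "norm (w s) < \<epsilon>" if s: "\<rho> b < s" for s
  proof (cases "s < R")
   case True
   have sr: "r1 <= s" using r_ge[OF x b(1)] s by (simp add: \<rho>_def)
   have "b <= T s" using Tmono[of "\<rho> b" s] T\<rho>[OF b(1)] r_ge[OF x b(1)] s True by (simp add: \<rho>_def)
   from b(2)[OF this] have "norm (w s) ^ 2 < \<epsilon>\<^sup>2" using UE[of "T s"] wT[OF sr True] by simp
   then show ?thesis using \<epsilon> by (simp add: power_less_imp_less_base)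
  next
   case False
   then show ?thesis using \<epsilon> r1R by (simp add: w_def)
  qed
  moreover have "w R = 0" using r1R by (simp add: w_def)
  ultimately have "\<forall>s\<in>{0..}. s \<noteq> R \<and> dist s R < R - \<rho> b \<longrightarrow> dist (w s) (w R) < \<epsilon>"
   by (auto simp: dist_real_def)
  then show "eventually (\<lambda>s. dist (w s) (w R) < \<epsilon>) (at R within {0..})"
   unfolding eventually_at using below[OF b(1)] by (intro exI[of _ "R - \<rho> b"]) auto
 qed
 have wcont: "continuous_on {0..} w"
  unfolding continuous_on_eq_continuous_within
 proof
  fix s :: real assume s: "s \<in> {0..}"
  consider "s < R" | "s = R" | "R < s" by linarith
  then show "continuous (at s within {0..}) w"
  proof cases
   case 1
   then obtain b where b: "0 <= b" "s < \<rho> b" using above by blast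
   have "at s within {0..} = at s within {0..\<rho> b}"
    by (rule at_within_nhd[of _ "{..<\<rho> b}"]) (use b in auto)
   then show ?thesis using cw[OF b(1)] s b by (auto simp: continuous_on_eq_continuous_within)
  next
   case 2
   then show ?thesis using wR by simp
  next
   case 3
   have "isCont w s"
    by (rule iffD2[OF isCont_cong[of _ "\<lambda>_. 0"]])
     (use eventually_nhds_in_open[of "{R<..}" s] 3 r1R in \<open>auto simp: w_def elim!: eventually_mono\<close>)
   then show ?thesis by (rule continuous_at_imp_continuous_at_within)
  qed
 qed
 have phiinc: "\<phi> x s < \<phi> x t" if "0 <= s" "s < t" "r0 <= \<rho> s" for s t
 proof -
  have "0 < a / 4 * (r x t - r x s)" using mono[OF that(1,2)] a_pos by (simp add: \<rho>_def)
  then show ?thesis using phi_increase(1)[OF x that(1) _ H, of t] that by (simp add: \<rho>_def)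
 qed
 \<comment> \<open>The parameters of the crossings of the light cone. The phase is strictly
   increasing there and bounded by \<open>\<Theta>\<close>, so it meets only finitely many zeros of
   the cosine.\<close>
 define Z where "Z = {t. 0 <= t \<and> cos (\<phi> x t) = 0}"
 have Zr: "r0 < \<rho> t" if "t \<in> Z" for t
  using initial(3)[OF x, of t] that H[of t] by (force simp: Z_def \<rho>_def)
 have fZ: "finite Z"
 proof (rule inj_on_finite)
  show "inj_on (\<phi> x) Z"
   by (rule linorder_inj_onI') (use phiinc Zr in \<open>force simp: Z_def intro: less_imp_le\<close>)
  show "\<phi> x ` Z \<subseteq> (\<lambda>i. of_int i * (pi / 2)) ` {0..4 * int k + 2}"
  proof
   fix y assume "y \<in> \<phi> x ` Z"
   then obtain t where t: "0 <= t" "cos (\<phi> x t) = 0" "y = \<phi> x t" by (auto simp: Z_def)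
   then obtain i :: int where i: "\<phi> x t = of_int i * (pi / 2)" by (auto simp: cos_zero_iff_int)
   have "0 <= \<phi> x t"
   proof -
    obtain y where y: "0 <= y" "r x y = r0" "y <= t"
     using IVT'[of "r x" 0 "r0" t] r_0[OF x] r1 t Zr[of t] continuous_on_subset[OF cont(1)[OF x], of "{0..t}"]
     by (auto simp: Z_def \<rho>_def)
    then show ?thesis using initial(1)[OF x y(1) H[OF y(1)]] phi_increase(2)[OF x y(1,3) H[OF t(1)]] by simp
   qed
   then have "0 <= of_int i * (pi / 2)" using i by simp
   then have "of_int 0 * (pi / 2) <= of_int i * (pi / 2)" by simp
   then have "0 <= i" by (simp only: mult_le_cancel_right_pos[OF pi_half_gt_zero] of_int_le_iff)
   moreover have "of_int i * (pi / 2) < of_int (4 * int k + 2) * (pi / 2)"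
    using lt[OF t(1)] i by (simp add: \<Theta>_def algebra_simps)
   then have "i < 4 * int k + 2" by (simp only: mult_less_cancel_right_pos pi_half_gt_zero of_int_less_iff)
   ultimately show "y \<in> (\<lambda>i. of_int i * (pi / 2)) ` {0..4 * int k + 2}" using i t by auto
  qed
 qed simp
 define S where "S = insert r1 (insert R (\<rho> ` Z))"
 have fS: "finite S" using fZ by (simp add: S_def)
 have inner: "(w has_vector_derivative soler_field m \<Omega> p s (w s)) (at s) \<and> minkowski (w s) \<noteq> 0"
  if s: "0 < s" "s < R" "s \<notin> S" for s
 proof (cases "s < r1")
  case True
  have "(w has_vector_derivative soler_field m \<Omega> p s (W s)) (at s)"
   by (rule has_vector_derivative_transform_within_open[OF W(4), of _ "{0<..<r1}"])
    (use s True in \<open>auto simp: w_def\<close>)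
  moreover have "minkowski (W s) \<noteq> 0"
  proof -
   have "0 < snd (W s)" "\<bar>fst (W s)\<bar> < snd (W s)" using W(5)[of s] s True by auto
   then have "\<bar>fst (W s)\<bar>\<^sup>2 < (snd (W s))\<^sup>2" by (intro power_strict_mono) auto
   then show ?thesis by (simp add: minkowski_def case_prod_beta)
  qed
  ultimately show ?thesis using True by (simp add: w_def)
 next
  case False
  then have sr: "r1 < s" using s(3) by (simp add: S_def)
  define t where "t = T s"
  have st: "\<rho> t = s" "0 <= t" using \<rho>T[of s] sr s by (auto simp: t_def)
  have t0: "0 < t" using st \<rho>0 sr by (cases "t = 0") auto
  have i: "t \<in> interior {0..} - {}" using t0 by simp
  have ct: "cos (\<phi> x t) \<noteq> 0" using s(3) st by (auto simp: S_def Z_def)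
  define Es where "Es = exp (l x t) * cos (\<phi> x t)"
  have Es: "Es \<noteq> 0" using ct by (simp add: Es_def)
  \<comment> \<open>The speed of the radius in the regular parametrisation is \<open>1 / F\<close>,
    as \<open>rel\<close> shows off the cone.\<close>
  have ft: "f t \<noteq> 0" and Ff: "F p Es = inverse (f t)"
  proof -
   have 1: "Es = p * Gp p Es * f t" using O.rel[OF i] by (simp add: Es_def f_def)
   then show "f t \<noteq> 0" using Es by auto
   have "F p Es * Es * f t = Es" using F_mult_eq_Gp[of p "Es"] 1 by simp
   then have "F p Es * f t * Es = 1 * Es" by (simp add: mult_ac)
   then have "F p Es * f t = 1" using Es by simp
   then show "F p Es = inverse (f t)" using \<open>f t \<noteq> 0\<close> by (simp add: field_simps)
  qed
  obtain c where c: "0 <= c" "s < \<rho> c" using above[OF s(2)] by blast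
  have "isCont T s" using continuous_on_interior[OF cT[OF c(1)], of s] sr c(2) by simp
  have dT: "DERIV T s :> inverse (f t)"
  proof (rule DERIV_inverse_function[of \<rho> _ T s "r1" R])
   show "(\<rho> has_real_derivative f t) (at (T s))"
    using O.dr[OF i] by (simp add: \<rho>_def t_def f_def)
   show "\<rho> (T y) = y" if "r1 < y" "y < R" for y using \<rho>T(1)[of y] that by simp
  qed (use ft sr s \<open>isCont T s\<close> in auto)
  have du: "DERIV (\<lambda>s. O.u (T s)) s :> (O.v t * (a * f t - 1) - 2 * O.u t * f t / s) * inverse (f t)"
   using DERIV_chain2[OF O.du[OF i, folded t_def, unfolded t_def] dT] st by (simp add: t_def f_def \<rho>_def)
  have dv: "DERIV (\<lambda>s. O.v (T s)) s :> (- O.u t * (b * f t + 1)) * inverse (f t)"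
   using DERIV_chain2[OF O.dv[OF i, unfolded t_def] dT] by (simp add: t_def f_def)
  have e1: "(O.v t * (a * f t - 1) - 2 * O.u t * f t / s) * inverse (f t) = O.v t * (a - inverse (f t)) - 2 * O.u t / s"
   using ft s(1) by (simp add: field_simps)
  have e2: "(- O.u t * (b * f t + 1)) * inverse (f t) = - O.u t * (b + inverse (f t))"
   using ft by (simp add: field_simps)
  have UU: "U y = (O.u y, O.v y)" for y by (simp add: U_def O.u_def O.v_def)
  have wU: "w s = (O.u t, O.v t)" using wT[of s] sr s by (simp add: UU t_def)
  have mk: "(O.v t)\<^sup>2 - (O.u t)\<^sup>2 = Es" using O.s_eq[of t] by (simp add: Es_def O.E_def)
  have "((\<lambda>s. (O.u (T s), O.v (T s))) has_vector_derivative soler_field m \<Omega> p s (w s)) (at s)"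
   unfolding wU soler_field_eq mk Ff using du dv unfolding e1 e2
   by (intro has_vector_derivative_Pair) (simp_all add: has_real_derivative_iff_has_vector_derivative)
  then have "(w has_vector_derivative soler_field m \<Omega> p s (w s)) (at s)"
   by (rule has_vector_derivative_transform_within_open[of _ _ _ "{r1<..<R}"])
    (use s sr wT UU in auto)
  moreover have "minkowski (w s) \<noteq> 0" using mk Es wU by (simp add: minkowski_def)
  ultimately show ?thesis by simp
 qed
 have f0: "soler_field m \<Omega> p s 0 = 0" for s by (simp add: soler_field_def zero_prod_def)
 have outer: "(w has_vector_derivative soler_field m \<Omega> p s (w s)) (at s)" if s: "R < s" for s
 proof -
  have "((\<lambda>_. 0) has_vector_derivative soler_field m \<Omega> p s (w s)) (at s)"
   using s r1R by (simp add: w_def f0)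
  then show ?thesis
   by (rule has_vector_derivative_transform_within_open[of _ _ _ "{R<..}"]) (use s r1R in \<open>auto simp: w_def\<close>)
 qed
 have der: "(w has_vector_derivative soler_field m \<Omega> p s (w s)) (at s)" if s: "s \<in> interior {0..} - S" for s
  using inner[of s] outer[of s] s by (cases s R rule: linorder_cases) (auto simp: S_def)
 have cD: "continuous_on (interior {0..} - S) (\<lambda>s. soler_field m \<Omega> p s (w s))"
 proof -
  have "continuous_on (({0<..<R} - S) \<union> {R<..}) (\<lambda>s. soler_field m \<Omega> p s (w s))"
  proof (rule continuous_on_open_Un)
   show "open ({0<..<R} - S)" by (intro open_Diff finite_imp_closed fS) auto
   show "continuous_on ({0<..<R} - S) (\<lambda>s. soler_field m \<Omega> p s (w s))"
    by (intro continuous_on_soler_field continuous_on_subset[OF wcont]) (use inner in auto)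
   have "continuous_on {R<..} (\<lambda>s. 0)" by simp
   then show "continuous_on {R<..} (\<lambda>s. soler_field m \<Omega> p s (w s))"
    by (rule continuous_on_eq) (use r1R in \<open>auto simp: w_def f0\<close>)
  qed simp
  then show ?thesis by (rule continuous_on_subset) (auto simp: S_def)
 qed
 have "extended_solution (soler_field m \<Omega> p) {0..} w"
  unfolding extended_solution_def C1_differentiable_on_def
  by (intro conjI wcont exI[of _ S] fS exI[of _ "\<lambda>s. soler_field m \<Omega> p s (w s)"] ballI der cD)
 then have cauchy: "cauchy_solution m \<Omega> p x0 w"
  using W(2) r1 by (simp add: cauchy_solution_def w_def)
 have supp: "compactly_supported w"
 proof -
  have "{r. 0 <= r \<and> w r \<noteq> 0} \<subseteq> {0..R}"
   using r1R by (auto simp: w_def split: if_splits)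
  then show ?thesis unfolding compactly_supported_def
   by (intro compact_closure[THEN iffD2] bounded_subset[OF compact_imp_bounded[OF compact_Icc[of 0 R]]])
 qed
 obtain b0 where b0: "0 <= b0" "r0 < \<rho> b0" using coll(3) by (auto simp: \<rho>_def)
 obtain t0 where t0: "0 <= t0" "\<rho> t0 = r0"
 proof -
  have "r0 \<in> \<rho> ` {0..b0}" unfolding img[OF b0(1)] using r1 b0 by simp
  then show thesis using that by auto
 qed
 have r0R: "r0 < R" using below[OF t0(1)] t0(2) by simp
 interpret P: polar_tail w "\<lambda>s. l x (T s)" "\<lambda>s. \<phi> x (T s)" "r0" R
 proof
  show "0 < r0" "r0 < R" by (rule r0_pos r0R)+
  show "w s = (exp (l x (T s) / 2) * sin (\<phi> x (T s) / 2), exp (l x (T s) / 2) * cos (\<phi> x (T s) / 2))"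
   if "s \<in> {r0..<R}" for s using wT[of s] that r1 by (simp add: U_def)
  show "continuous_on {r0..<R} (\<lambda>s. \<phi> x (T s))"
  proof -
   have "continuous_on {r1<..<R} T"
   proof (rule continuous_at_imp_continuous_on, rule ballI)
    fix s assume s: "s \<in> {r1<..<R}"
    then obtain b where b: "0 <= b" "s < \<rho> b" using above[of s] by auto
    show "isCont T s" using continuous_on_interior[OF cT[OF b(1)], of s] s b(2) by simp
   qed
   have "continuous_on {r0..<R} T"
    unfolding continuous_on_eq_continuous_within
   proof
    fix s assume s: "s \<in> {r0..<R}"
    then obtain b where b: "0 <= b" "s < \<rho> b" using above[of s] by auto
    have "continuous (at s within {r1..\<rho> b}) T"
     using cT[OF b(1)] s b r1 by (auto simp: continuous_on_eq_continuous_within)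
    then have 1: "continuous (at s within {r0..<\<rho> b}) T" by (rule continuous_within_subset) (use r1 in auto)
    have "at s within {r0..<R} = at s within {r0..<\<rho> b}"
     by (rule at_within_nhd[of _ "{..<\<rho> b}"]) (use b below[OF b(1)] in auto)
    with 1 show "continuous (at s within {r0..<R}) T" by simp
   qed
   then show ?thesis
    by (rule continuous_on_compose2[OF cont(3)[OF x]]) (use \<rho>T r1 in auto)
  qed
  show "\<phi> x (T s) < \<phi> x (T s')" if "r0 <= s" "s < s'" "s' < R" for s s'
   using phiinc[of "T s" "T s'"] Tmono[of s s'] \<rho>T[of s] that r1 by simp
  have i: "0 <= \<phi> x t0" "\<phi> x t0 < pi / 2" using initial(1,2)[OF x t0(1) H[OF t0(1)]] t0(2) by (auto simp: \<rho>_def)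
  have "T r0 = t0" using T\<rho>[OF t0(1)] t0(2) by simp
  then show "0 <= \<phi> x (T r0)" "\<phi> x (T r0) < pi" using i pi_gt_zero by auto
  show "0 < snd (w s)" if s: "0 < s" "s <= r0" for s
  proof (cases "s <= r1")
   case True
   then show ?thesis using W(5)[of s] s by (simp add: w_def)
  next
   case False
   have T: "\<rho> (T s) = s" "0 <= T s" using \<rho>T[of s] s False r0R by auto
   have "0 <= \<phi> x (T s)" "\<phi> x (T s) < pi / 2"
    using initial(1,2)[OF x T(2) H[OF T(2)]] T(1) s by (auto simp: \<rho>_def)
   then have "0 < cos (\<phi> x (T s) / 2)" by (intro cos_gt_zero_pi) auto
   then show ?thesis using wT[of s] False s r0R by (simp add: U_def)
  qed
  show "fst (w s) = 0" if "R <= s" for s using that r1R by (simp add: w_def)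
 qed
 have "finite (crossings w) \<and> card (crossings w) = k"
 proof (intro conjI P.card_crossings)
  show "\<phi> x (T s) < real k * (2 * pi) + pi" if "s \<in> {r0..<R}" for s
   using lt[of "T s"] \<rho>T[of s] that r1 by (simp add: \<Theta>_def)
  then show "\<phi> x (T s) < real k * (2 * pi) + pi" if "s \<in> {r0..<R}" for s using that by blast
  show "\<exists>s\<in>{r0..<R}. real k * (2 * pi) - pi < \<phi> x (T s)" if k: "0 < k"
  proof -
   obtain t where t: "0 <= t" "\<Theta> - 2 * pi < \<phi> x t" using node[OF k] by blast
   have "pi <= \<Theta> - 2 * pi"
   proof -
    have "1 * (2 * pi) <= real k * (2 * pi)" using k by (intro mult_right_mono) auto
    then show ?thesis by (simp add: \<Theta>_def)
   qed
   then have "r0 <= \<rho> t" unfolding \<rho>_def using r_ge_r0[OF x t(1) H[OF t(1)]] t(2) pi_gt_zero by linarith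
   then show ?thesis using t T\<rho>[OF t(1)] below[OF t(1)]
    by (intro bexI[of _ "\<rho> t"]) (auto simp: \<Theta>_def)
  qed
  then show "\<exists>s\<in>{r0..<R}. real k * (2 * pi) - pi < \<phi> x (T s)" if "0 < k" using that by blast
 qed
 then show ?thesis
  unfolding nodal_solution_def using cauchy W(3) supp by blast
qed

end

section \<open>Existence of nodal solutions\<close>

context frequency
begin

definition "c0 = exp (- (2 * (m + b + a) * r0))"

lemma c0_bounds: "0 < c0" "c0 <= 1"
 using m_pos a_pos b_pos r0_pos by (auto simp: c0_def)

text \<open>The bridge from the centre to the shooting. \<open>l1\<close> and \<open>\<phi>1\<close>
  are explicit continuous functions of \<open>W r1\<close>; they are identified with the values at
  \<open>r1\<close> of the polar lift, to which the estimates of the initial phase apply.\<close>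

lemma initial_data:
 assumes p: "0 < p" "p <= p1" and r1: "0 < r1" "r1 <= r0"
  and W: "continuous_on {0..r1} W" "W 0 = (0, x)" "0 < x"
   "!!t. t \<in> {0<..<r1} ==> (W has_vector_derivative soler_field m \<Omega> p t (W t)) (at t)"
   "!!t. t \<in> {0..r1} ==> 0 < snd (W t) \<and> \<bar>fst (W t)\<bar> < snd (W t)"
  and l: "l1 = ln ((fst (W r1))\<^sup>2 + (snd (W r1))\<^sup>2)" and \<phi>: "\<phi>1 = 2 * arctan (fst (W r1) / snd (W r1))"
  and h: "h1 = exp l1 * wt \<phi>1 - Gp p (exp l1 * cos \<phi>1)"
 shows "W r1 = (exp (l1 / 2) * sin (\<phi>1 / 2), exp (l1 / 2) * cos (\<phi>1 / 2))"
  and "\<bar>\<phi>1\<bar> < pi / 2"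
  and "h1 <= a * x\<^sup>2 - x\<^sup>2 powr p"
  and "0 <= h1 ==> 0 <= tan (\<phi>1 / 2) \<and> tan (\<phi>1 / 2) <= a / 2 * r1"
  and "0 <= h1 ==> c0 * x\<^sup>2 <= exp l1"
  and "4 / a <= c0 * x\<^sup>2 ==> 0 <= h1"
proof -
 have mink: "0 < minkowski (W t)" if "t \<in> {0..r1}" for t
 proof -
  have "\<bar>fst (W t)\<bar>\<^sup>2 < (snd (W t))\<^sup>2" using W(5)[OF that] by (intro power_strict_mono) auto
  then show ?thesis by (simp add: minkowski_def case_prod_beta)
 qed
 obtain l \<phi> where O: "orbit m \<Omega> p {0..r1} {} (\<lambda>t. t) (\<lambda>_. 1) (\<lambda>t. F p (minkowski (W t))) l \<phi>"
  and \<phi>0: "\<phi> 0 = 0"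
  and polar: "!!t. t \<in> {0..r1} ==> W t = (exp (l t / 2) * sin (\<phi> t / 2), exp (l t / 2) * cos (\<phi> t / 2))"
 proof (rule polar_lift[OF p, of "{0..r1}" "{}" W x])
  show "is_interval {0..r1}" by (simp add: is_interval_cc)
  show "W t \<noteq> 0" if "t \<in> {0..r1}" for t using W(5)[OF that] by auto
  show "minkowski (W t) \<noteq> 0" if "t \<in> interior {0..r1} - {}" for t using mink[of t] that by auto
  show "(W has_vector_derivative soler_field m \<Omega> p t (W t)) (at t)" if "t \<in> interior {0..r1} - {}" for t
   using W(4)[of t] that by simp
 qed (use W r1 in auto)
 interpret O: orbit m \<Omega> p "{0..r1}" "{}" "\<lambda>t. t" "\<lambda>_. 1" "\<lambda>t. F p (minkowski (W t))" l \<phi> by (rule O)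
 have ends: "0 \<in> {0..r1}" "r1 \<in> {0..r1}" using r1 by auto
 have uv: "fst (W t) = O.u t" "snd (W t) = O.v t" if "t \<in> {0..r1}" for t
  using polar[OF that] by (simp_all add: O.u_def O.v_def)
 have cpos: "0 < cos (\<phi> t)" if "t \<in> {0..r1}" for t
 proof -
  have "minkowski (W t) = O.E t * cos (\<phi> t)"
   unfolding O.s_eq minkowski_def case_prod_beta uv[OF that] ..
  with mink[OF that] have "0 < O.E t * cos (\<phi> t)" by simp
  then show ?thesis using O.E_pos by (rule zero_less_mult_pos)
 qed
 have small: "\<bar>\<phi> t\<bar> < pi / 2" if t: "t \<in> {0..r1}" for t
 proof (rule ccontr)
  assume "\<not> \<bar>\<phi> t\<bar> < pi / 2"
  moreover have "continuous_on {0..t} (\<lambda>t. \<bar>\<phi> t\<bar>)"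
   using t by (intro continuous_intros continuous_on_subset[OF O.cont_phi]) auto
  ultimately obtain y where y: "0 <= y" "y <= t" "\<bar>\<phi> y\<bar> = pi / 2"
   using IVT'[of "\<lambda>t. \<bar>\<phi> t\<bar>" 0 "pi / 2" t] \<phi>0 t by auto
  then have "cos (\<phi> y) = 0" by (metis cos_abs_real cos_pi_half)
  then show False using cpos[of y] y t by auto
 qed
 have "exp (l r1) = (fst (W r1))\<^sup>2 + (snd (W r1))\<^sup>2"
  using O.E_eq[of "r1"] uv[OF ends(2)] by (simp add: O.E_def)
 then have l1: "l r1 = l1" unfolding l by (metis ln_exp)
 have "fst (W r1) / snd (W r1) = tan (\<phi> r1 / 2)"
  unfolding uv[OF ends(2)] by (simp add: O.u_def O.v_def tan_def)
 moreover have "arctan (tan (\<phi> r1 / 2)) = \<phi> r1 / 2"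
  using small[OF ends(2)] by (intro arctan_tan) auto
 ultimately have \<phi>1: "\<phi> r1 = \<phi>1" unfolding \<phi> by simp
 have h1: "h1 = O.h r1" by (simp add: h O.h_def O.E_def O.G_def l1 \<phi>1)
 show "W r1 = (exp (l1 / 2) * sin (\<phi>1 / 2), exp (l1 / 2) * cos (\<phi>1 / 2))" using polar[OF ends(2)] l1 \<phi>1 by simp
 show "\<bar>\<phi>1\<bar> < pi / 2" using small[OF ends(2)] \<phi>1 by simp
 have E0: "O.E 0 = x\<^sup>2" using O.E_eq[of 0] uv[OF ends(1)] W(2) by simp
 have h0: "O.h 0 = a * x\<^sup>2 - x\<^sup>2 powr p"
  using E0 W(3) by (simp add: O.h_def O.G_def O.E_def wt_def a_def \<phi>0 Gp_pos mult.commute)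
 show "h1 <= a * x\<^sup>2 - x\<^sup>2 powr p" using O.h_antimono[OF ends] r1 h0 h1 by simp
 have q0: "\<bar>\<phi> 0\<bar> < pi" "0 <= O.q 0" "O.q 0 <= a / 2 * 0" by (simp_all add: O.q_def \<phi>0)
 show "0 <= tan (\<phi>1 / 2) \<and> tan (\<phi>1 / 2) <= a / 2 * r1" if "0 <= h1"
  using O.initial_phase(1,2)[OF ends _ _ _ q0] that r1 h1 \<phi>1 by (simp add: O.q_def)
 have Einit: "c0 * x\<^sup>2 <= O.E t" if t: "t \<in> {0..r1}" "0 <= O.h t" for t
  using O.E_initial[OF ends(1) t(1) _ t(2) _ q0] t r1 E0 by (simp add: c0_def)
 show "c0 * x\<^sup>2 <= exp l1" if "0 <= h1" using Einit[OF ends(2)] that h1 l1 by (simp add: O.E_def)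
 \<comment> \<open>The energy cannot pass through 0: at a zero the amplitude would still be at least
   \<open>c0 * x^2 >= 4 / a\<close>, which forces an energy of at least 1.\<close>
 show "0 <= h1" if big: "4 / a <= c0 * x\<^sup>2"
 proof (rule ccontr)
  assume "\<not> 0 <= h1"
  then have neg: "O.h r1 < 0" using h1 by simp
  have pos: "1 <= O.h t" if t: "4 / a <= O.E t" for t
  proof -
   have "a / 2 * (4 / a) <= a / 2 * O.E t" using t a_pos by (intro mult_left_mono) auto
   then show ?thesis using O.h_lower[of t] a_pos by simp
  qed
  have "c0 * x\<^sup>2 <= 1 * x\<^sup>2" using c0_bounds by (intro mult_right_mono) auto
  then have "1 <= O.h 0" using pos[of 0] big E0 by simp
  then obtain y where y: "0 <= y" "y <= r1" "O.h y = 0"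
   using IVT2'[of O.h "r1" 0 0] neg r1 O.cont_h by auto
  then show False using pos[of y] Einit[of y] big by auto
 qed
qed

theorem nodal_solution_exists:
 assumes p: "0 < p" "p <= p1"
 shows "\<exists>w. nodal_solution m \<Omega> k p w"
proof -
 have p1: "p < 1" using p by (simp add: p1_def)
 \<comment> \<open>With this amplitude \<open>E0 powr p\<close> is \<open>2 * a * E0\<close>, so the
   energy at the centre is \<open>- a * E0\<close>, which is negative.\<close>
 define E0 where "E0 = (1 / (2 * a)) powr (1 / (1 - p))"
 have E0: "0 < E0" using a_pos by (simp add: E0_def)
 have "E0 powr (1 - p) = 1 / (2 * a)" using p1 a_pos by (simp add: E0_def powr_powr)
 moreover have "E0 powr (1 - p) * E0 powr p = E0" using E0 by (simp flip: powr_add)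
 ultimately have "1 / (2 * a) * E0 powr p = E0" by simp
 then have E0p: "E0 powr p = 2 * a * E0" using a_pos by (simp add: field_simps)
 define g where "g = \<gamma> ^ (3 * k + 2)"
 have g: "0 < g" using gamma_bounds(1) by (simp add: g_def)
 have g1: "g <= 1" unfolding g_def by (rule power_le_one) (use gamma_bounds in auto)
 note c0 = c0_bounds
 \<comment> \<open>One factor \<open>c0\<close> accounts for the way from the centre to
   \<open>r1\<close>, the other and \<open>g\<close> for the losses in \<open>E_lower\<close>; what
   is left after them is at least \<open>4 / a\<close>.\<close>
 define X where "X = max E0 ((4 / a + 2 * Cg * (3 * k + 2)) / (g * (c0 * c0)))"
 have X: "E0 <= X" "4 / a + 2 * Cg * (3 * k + 2) <= g * (c0 * (c0 * X))"
 proof -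
  have "(4 / a + 2 * Cg * (3 * k + 2)) / (g * (c0 * c0)) <= X" by (simp add: X_def)
  then show "4 / a + 2 * Cg * (3 * k + 2) <= g * (c0 * (c0 * X))"
   using g c0 by (subst (asm) pos_divide_le_eq) (auto simp: mult_ac)
 qed (simp add: X_def)
 have Cnn: "0 <= 2 * Cg * (3 * k + 2)" using Cg_pos by simp
 have cX: "4 / a <= c0 * X"
 proof -
  have "0 <= c0 * X" using E0 X(1) c0 by (intro mult_nonneg_nonneg) linarith+
  then have "(g * c0) * (c0 * X) <= 1 * (c0 * X)"
   using g g1 c0 by (intro mult_right_mono mult_le_one) auto
  moreover have "g * c0 * (c0 * X) = g * (c0 * (c0 * X))" by simp
  ultimately show ?thesis using X(2) Cnn by linarith
 qed
 define xl where "xl = sqrt E0"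
 define xh where "xh = sqrt X"
 have xl: "0 < xl" "xl <= xh" "xl\<^sup>2 = E0" "xh\<^sup>2 = X" using E0 X(1) by (auto simp: xl_def xh_def)
 obtain r1 C and W :: "real => real => real \<times> real" where r1: "0 < r1" "r1 <= r0"
  and W: "!!x. continuous_on {0..} (W x)" "!!x. W x 0 = (0, x)"
  "!!x t. x \<in> {xl..xh} ==> t \<in> {0<..r1} ==> (W x has_vector_derivative soler_field m \<Omega> p t (W x t)) (at t)"
  "!!x t. x \<in> {xl..xh} ==> t \<in> {0..r1} ==> 0 < snd (W x t) \<and> \<bar>fst (W x t)\<bar> < snd (W x t)"
  "!!x x'. norm (W x r1 - W x' r1) <= C * \<bar>x - x'\<bar>"
  using initial_solutions[OF p(1) p1 xl(1,2)] by metis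
 define l1 where "l1 x = ln ((fst (W x r1))\<^sup>2 + (snd (W x r1))\<^sup>2)" for x
 define \<phi>1 where "\<phi>1 x = 2 * arctan (fst (W x r1) / snd (W x r1))" for x
 define h1 where "h1 x = exp (l1 x) * wt (\<phi>1 x) - Gp p (exp (l1 x) * cos (\<phi>1 x))" for x
 have Wc: "continuous_on {0..r1} (W x)" for x by (rule continuous_on_subset[OF W(1)]) auto
 have Wd: "(W x has_vector_derivative soler_field m \<Omega> p t (W x t)) (at t)" if "x \<in> {xl..xh}" "t \<in> {0<..<r1}" for x t
  using W(3)[OF that(1), of t] that(2) by simp
 have x0: "0 < x" if "x \<in> {xl..xh}" for x using that xl(1) by simp
 have init: "W x r1 = (exp (l1 x / 2) * sin (\<phi>1 x / 2), exp (l1 x / 2) * cos (\<phi>1 x / 2))"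
  "\<bar>\<phi>1 x\<bar> < pi / 2"
  "h1 x <= a * x\<^sup>2 - x\<^sup>2 powr p"
  "0 <= h1 x ==> 0 <= tan (\<phi>1 x / 2) \<and> tan (\<phi>1 x / 2) <= a / 2 * r1"
  "0 <= h1 x ==> c0 * x\<^sup>2 <= exp (l1 x)"
  "4 / a <= c0 * x\<^sup>2 ==> 0 <= h1 x"
  if x: "x \<in> {xl..xh}" for x
  by (rule initial_data[OF p r1 Wc W(2) x0[OF x] Wd[OF x] W(4)[OF x] l1_def \<phi>1_def h1_def]; assumption)+
 have Wcont: "continuous_on {xl..xh} (\<lambda>x. W x r1)"
  by (rule lipschitz_on_continuous_on[of "\<bar>C\<bar>"], rule lipschitz_onI)
   (use W(5) in \<open>auto simp: dist_norm intro: order_trans[OF _ mult_right_mono[OF abs_ge_self abs_ge_zero]]\<close>)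
 have pos: "0 < snd (W x r1)" if "x \<in> {xl..xh}" for x using W(4)[OF that, of "r1"] r1 by simp
 have lc: "continuous_on {xl..xh} l1"
 proof -
  have "\<forall>x\<in>{xl..xh}. (fst (W x r1))\<^sup>2 + (snd (W x r1))\<^sup>2 \<noteq> 0"
   using pos by (metis less_irrefl sum_power2_eq_zero_iff)
  then show ?thesis unfolding l1_def[abs_def] by (intro continuous_intros Wcont)
 qed
 have pc: "continuous_on {xl..xh} \<phi>1"
 proof -
  have "\<forall>x\<in>{xl..xh}. snd (W x r1) \<noteq> 0" using pos by (metis less_irrefl)
  then show ?thesis unfolding \<phi>1_def[abs_def] by (intro continuous_intros Wcont)
 qed
 define y where "y x = (r1, Gp p (exp (l1 x) * cos (\<phi>1 x)), l1 x, \<phi>1 x)" for x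
 have yc: "continuous_on {xl..xh} y"
  unfolding y_def[abs_def]
  by (intro continuous_intros lc pc continuous_on_compose2[OF continuous_on_Gp[OF p(1)]]) auto
 \<comment> \<open>A bound for the amplitude along all orbits considered. \<open>MG\<close> and
   \<open>Ml\<close> lie so far above it that the cutoff equals 1 along these orbits.\<close>
 define M where "M = 2 * (a * X + 1) / a"
 have M: "0 < M" using a_pos E0 X(1) by (simp add: M_def add_pos_pos)
 define MG where "MG = M + 2"
 define Ml where "Ml = ln M + 1"
 have MG0: "0 < MG" using M by (simp add: MG_def)
 show ?thesis
 proof (rule regularised_flow[OF p r1(1) MG0, of "Ml"])
 fix L :: real and Y :: "real \<times> real \<times> real \<times> real => real => real \<times> real \<times> real \<times> real"
 assume Y: "!!y. continuous_on {0..} (Y y)" "!!y. Y y 0 = y"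
  "!!y y' t. 0 <= t ==> norm (Y y t - Y y' t) <= 2 * norm (y - y') * exp (L * t)"
  and orb: "!!l \<phi> y. y = (r1, Gp p (exp l * cos \<phi>), l, \<phi>) ==>
   orbit m \<Omega> p {0..} {} (\<lambda>t. fst (Y y t))
   (\<lambda>t. cutoff MG Ml (fst (snd (Y y t))) (fst (snd (snd (Y y t)))) * F (1 / p) (fst (snd (Y y t))))
   (\<lambda>t. cutoff MG Ml (fst (snd (Y y t))) (fst (snd (snd (Y y t)))))
   (\<lambda>t. fst (snd (snd (Y y t)))) (\<lambda>t. snd (snd (snd (Y y t)))) \<and>
   (\<forall>t\<ge>0. fst (snd (Y y t)) = Gp p (exp (fst (snd (snd (Y y t)))) * cos (snd (snd (snd (Y y t))))))"
 define r where "r x t = fst (Y (y x) t)" for x t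
 define G where "G x t = fst (snd (Y (y x) t))" for x t
 define l where "l x t = fst (snd (snd (Y (y x) t)))" for x t
 define \<phi> where "\<phi> x t = snd (snd (snd (Y (y x) t)))" for x t
 have start: "r x 0 = r1" "l x 0 = l1 x" "\<phi> x 0 = \<phi>1 x" for x
  by (simp_all add: r_def l_def \<phi>_def Y(2) y_def)
 have orb': "orbit m \<Omega> p {0..} {} (r x) (\<lambda>t. F (1 / p) (Gp p (exp (l x t) * cos (\<phi> x t)))) (\<lambda>t. 1) (l x) (\<phi> x)"
  if x: "x \<in> {xl..xh}" for x
 proof -
  have o1: "orbit m \<Omega> p {0..} {} (r x) (\<lambda>t. cutoff MG Ml (G x t) (l x t) * F (1 / p) (G x t))
    (\<lambda>t. cutoff MG Ml (G x t) (l x t)) (l x) (\<phi> x)"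
   and o2: "!!t. 0 <= t ==> G x t = Gp p (exp (l x t) * cos (\<phi> x t))"
   using orb[of "y x" "l1 x" "\<phi>1 x"] unfolding r_def[abs_def] G_def[abs_def] l_def[abs_def] \<phi>_def[abs_def]
   by (auto simp: y_def)
  interpret O: orbit m \<Omega> p "{0..}" "{}" "r x" "\<lambda>t. cutoff MG Ml (G x t) (l x t) * F (1 / p) (G x t)"
   "\<lambda>t. cutoff MG Ml (G x t) (l x t)" "l x" "\<phi> x" by (rule o1)
  have "O.h 0 = h1 x" by (simp add: O.h_def O.E_def O.G_def h1_def start)
  also have "\<dots> <= a * x\<^sup>2" using init(3)[OF x] powr_ge_zero[of "x\<^sup>2" p] by linarith
  also have "\<dots> <= a * X"
   using x xl a_pos power_mono[of x "xh" 2] by (intro mult_left_mono) auto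
  finally have h0: "O.h 0 <= a * X" .
  have EM: "O.E t <= M" if t: "0 <= t" for t
  proof -
   have "a / 2 * O.E t <= O.h t + 1" by (rule O.E_upper)
   also have "\<dots> <= a * X + 1" using O.h_antimono[of 0 t] t h0 by simp
   finally show ?thesis using a_pos by (simp add: M_def field_simps)
  qed
  have cut: "cutoff MG Ml (G x t) (l x t) = 1" if t: "0 <= t" for t
  proof (rule cutoff_one)
   have "\<bar>G x t\<bar> <= 1 + p * O.E t" using O.G_abs[of t] o2[OF t] by (simp add: O.G_def)
   also have "\<dots> <= 1 + 1 * M" using EM[OF t] p1 p O.E_pos[of t] by (intro add_left_mono mult_mono) auto
   finally show "\<bar>G x t\<bar> <= MG - 1" by (simp add: MG_def)
   have "ln (O.E t) <= ln M" using EM[OF t] O.E_pos[of t] M by simp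
   then show "l x t <= Ml - 1" by (simp add: Ml_def O.E_def)
  qed
  show ?thesis by (rule O.orbit_cong) (use cut o2 in auto)
 qed
 have Ylim: "(\<lambda>n. Y (y (X n)) (T n)) \<longlonglongrightarrow> Y (y x) t"
  if X: "!!n. X n \<in> {xl..xh}" "x \<in> {xl..xh}" "X \<longlonglongrightarrow> x" and T: "!!n. 0 <= T n" "T \<longlonglongrightarrow> t" for X x T t
 proof -
  have t: "0 <= t" by (rule LIMSEQ_le_const[OF T(2)]) (use T(1) in auto)
  have yl: "(\<lambda>n. y (X n)) \<longlonglongrightarrow> y x"
   by (rule continuous_on_tendsto_compose[OF yc X(3,2)]) (use X(1) in auto)
  have "(\<lambda>n. 2 * norm (y (X n) - y x) * exp (L * T n)) \<longlonglongrightarrow> 2 * norm (y x - y x) * exp (L * t)"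
   by (intro tendsto_intros yl T)
  then have null: "(\<lambda>n. 2 * norm (y (X n) - y x) * exp (L * T n)) \<longlonglongrightarrow> 0" by simp
  have "norm (Y (y (X n)) (T n) - Y (y x) (T n)) <= 2 * norm (y (X n) - y x) * exp (L * T n)" for n
   by (rule Y(3)[OF T(1)])
  then have "(\<lambda>n. Y (y (X n)) (T n) - Y (y x) (T n)) \<longlonglongrightarrow> 0"
   by (intro Lim_null_comparison[OF always_eventually[OF allI] null])
  moreover have "(\<lambda>n. Y (y x) (T n)) \<longlonglongrightarrow> Y (y x) t"
   by (rule continuous_on_tendsto_compose[OF Y(1) T(2)]) (use t T(1) in \<open>simp_all add: always_eventually\<close>)
  ultimately have "(\<lambda>n. (Y (y (X n)) (T n) - Y (y x) (T n)) + Y (y x) (T n)) \<longlonglongrightarrow> 0 + Y (y x) t"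
   by (rule tendsto_add)
  then show ?thesis by simp
 qed
 have xlin: "xl \<in> {xl..xh}" and xhin: "xh \<in> {xl..xh}" using xl by auto
 have hh: "0 <= h1 xh" using init(6)[OF xhin] cX xl(4) by simp
 interpret S: shooting m \<Omega> p k "xl" "xh" "r1" r l \<phi>
 proof (rule shooting.intro[OF frequency_axioms shooting_axioms.intro])
  show "0 < p" "p <= p1" "xl <= xh" "0 < r1" "r1 <= r0" by (rule p xl r1)+
  fix x assume x: "x \<in> {xl..xh}"
  show "orbit m \<Omega> p {0..} {} (r x) (\<lambda>t. F (1 / p) (Gp p (exp (l x t) * cos (\<phi> x t)))) (\<lambda>t. 1) (l x) (\<phi> x)"
   by (rule orb'[OF x])
  show "r x 0 = r1" by (rule start)
  show "\<bar>\<phi> x 0\<bar> < pi / 2" using init(2)[OF x] by (simp add: start)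
  show "0 <= tan (\<phi> x 0 / 2) \<and> tan (\<phi> x 0 / 2) <= a / 2 * r1"
   if "0 <= exp (l x 0) * wt (\<phi> x 0) - Gp p (exp (l x 0) * cos (\<phi> x 0))"
   using init(4)[OF x] that by (simp add: start h1_def)
 next
  fix X x T t assume "!!n. X n \<in> {xl..xh}" "x \<in> {xl..xh}" "X \<longlonglongrightarrow> x" "!!n. 0 <= T n" "T \<longlonglongrightarrow> (t::real)"
  from Ylim[OF this] show "(\<lambda>n. l (X n) (T n)) \<longlonglongrightarrow> l x t" "(\<lambda>n. \<phi> (X n) (T n)) \<longlonglongrightarrow> \<phi> x t"
   unfolding l_def \<phi>_def by (intro tendsto_fst tendsto_snd; assumption)+
 next
  have "h1 xl <= a * E0 - 2 * a * E0" using init(3)[OF xlin] xl(3) E0p by simp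
  also have "\<dots> < 0" using a_pos E0 by simp
  finally show "exp (l xl 0) * wt (\<phi> xl 0) - Gp p (exp (l xl 0) * cos (\<phi> xl 0)) < 0"
   by (simp add: start h1_def)
  show "0 <= exp (l xh 0) * wt (\<phi> xh 0) - Gp p (exp (l xh 0) * cos (\<phi> xh 0))"
   using hh by (simp add: start h1_def)
  have "g * (c0 * (c0 * X)) <= g * (c0 * exp (l1 xh))"
   using init(5)[OF xhin hh] xl(4) g c0 by (intro mult_left_mono) auto
  then have "4 / a <= g * (c0 * exp (l1 xh)) - 2 * Cg * (3 * k + 2)" using X(2) by linarith
  then show "4 / a <= \<gamma> ^ (3 * k + 2) * (exp (- (2 * (m + b + a) * r0)) * exp (l xh 0)) - 2 * Cg * (3 * k + 2)"
   unfolding start g_def c0_def .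
 qed
 obtain x where x: "x \<in> {xl..xh}" and sh: "!!t. 0 <= t ==> 0 <= S.H x t" "!!t. 0 <= t ==> \<phi> x t < S.\<Theta>"
  "0 < k ==> \<exists>t\<ge>0. S.\<Theta> - 2 * pi < \<phi> x t" using S.shot by metis
 show ?thesis
  by (rule S.shot_solution[OF x sh Wc W(2) x0[OF x] Wd[OF x] W(4)[OF x]])
   (use init(1)[OF x] in \<open>auto simp: start\<close>)
 qed
qed

end

section \<open>The phase of a nodal solution\<close>

lemma F_nonneg: "0 < p ==> 0 <= F p s"
 by (simp add: F_def)

lemma F_ge_1:
 assumes p: "0 < p" "p < 1" and s: "s \<noteq> 0" "\<bar>s\<bar> <= p powr (1 / (1 - p))"
 shows "1 <= F p s"
proof -
 have "1 / (1 - p) * (p - 1) = - 1" using p by (simp add: field_simps)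
 then have "(p powr (1 / (1 - p))) powr (p - 1) = 1 / p"
  using p by (simp add: powr_powr powr_minus divide_inverse)
 moreover have "(p powr (1 / (1 - p))) powr (p - 1) <= \<bar>s\<bar> powr (p - 1)"
  using p s by (intro powr_mono2') auto
 ultimately have "p * (1 / p) <= p * \<bar>s\<bar> powr (p - 1)" using p by (intro mult_left_mono) auto
 then show ?thesis using p s by (simp add: F_def)
qed

context frequency
begin

text \<open>The energy in Cartesian form. Unlike \<open>orbit.h\<close> it makes sense where the
  solution vanishes, which matters at and beyond the radius where the origin is reached.\<close>

definition hamiltonian :: "real => real \<times> real => real" where
 "hamiltonian p z = b * (fst z)\<^sup>2 + a * (snd z)\<^sup>2 - Gp p (minkowski z)"

lemma continuous_on_minkowski: "continuous_on U w ==> continuous_on U (\<lambda>r. minkowski (w r))"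
 unfolding minkowski_def case_prod_beta by (intro continuous_intros)

lemma continuous_on_hamiltonian:
 assumes "0 < p" "continuous_on U w" shows "continuous_on U (\<lambda>r. hamiltonian p (w r))"
proof -
 have "continuous_on U (\<lambda>r. Gp p (minkowski (w r)))"
  by (rule continuous_on_compose2[OF continuous_on_Gp[OF assms(1)] continuous_on_minkowski[OF assms(2)]]) auto
 then show ?thesis unfolding hamiltonian_def by (intro continuous_intros assms(2))
qed

lemma soler_derivatives:
 assumes "(w has_vector_derivative soler_field m \<Omega> p t (w t)) (at t)"
 shows "DERIV (\<lambda>t. fst (w t)) t :> snd (w t) * (a - F p (minkowski (w t))) - 2 * fst (w t) / t"
  and "DERIV (\<lambda>t. snd (w t)) t :> - fst (w t) * (b + F p (minkowski (w t)))"
proof -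
 have eq: "soler_field m \<Omega> p t (w t) = (snd (w t) * (a - F p (minkowski (w t))) - 2 * fst (w t) / t,
  - fst (w t) * (b + F p (minkowski (w t))))"
  using soler_field_eq[of p t "fst (w t)" "snd (w t)"] by (simp add: minkowski_def case_prod_beta)
 show "DERIV (\<lambda>t. fst (w t)) t :> snd (w t) * (a - F p (minkowski (w t))) - 2 * fst (w t) / t"
  using bounded_linear.has_vector_derivative[OF bounded_linear_fst assms]
  unfolding eq has_real_derivative_iff_has_vector_derivative by simp
 show "DERIV (\<lambda>t. snd (w t)) t :> - fst (w t) * (b + F p (minkowski (w t)))"
  using bounded_linear.has_vector_derivative[OF bounded_linear_snd assms]
  unfolding eq has_real_derivative_iff_has_vector_derivative by simp
qed

lemma DERIV_minkowski:
 assumes "(w has_vector_derivative soler_field m \<Omega> p t (w t)) (at t)"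
 shows "DERIV (\<lambda>t. minkowski (w t)) t :> 4 * fst (w t) * (fst (w t) / t - \<Omega> * snd (w t))"
proof -
 note d = soler_derivatives[OF assms]
 have "DERIV (\<lambda>t. snd (w t) * snd (w t) - fst (w t) * fst (w t)) t :> ((- fst (w t) * (b + F p (minkowski (w t)))) * snd (w t) + (- fst (w t) * (b + F p (minkowski (w t)))) * snd (w t))
  - ((snd (w t) * (a - F p (minkowski (w t))) - 2 * fst (w t) / t) * fst (w t)
   + (snd (w t) * (a - F p (minkowski (w t))) - 2 * fst (w t) / t) * fst (w t))"
  by (rule DERIV_diff[OF DERIV_mult[OF d(2) d(2)] DERIV_mult[OF d(1) d(1)]])
 then show ?thesis
  unfolding minkowski_def case_prod_beta power2_eq_square
  by (rule back_subst[where P = "\<lambda>D. (_ has_real_derivative D) _"]) (simp add: a_def b_def algebra_simps)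
qed

lemma DERIV_hamiltonian:
 assumes w: "(w has_vector_derivative soler_field m \<Omega> p t (w t)) (at t)" and s: "minkowski (w t) \<noteq> 0"
 shows "DERIV (\<lambda>t. hamiltonian p (w t)) t :> - 4 * (fst (w t))\<^sup>2 * (b + F p (minkowski (w t))) / t"
proof -
 note d = soler_derivatives[OF w]
 have G: "DERIV (\<lambda>t. Gp p (minkowski (w t))) t :> F p (minkowski (w t)) * (4 * fst (w t) * (fst (w t) / t - \<Omega> * snd (w t)))"
  by (rule DERIV_chain2[OF DERIV_Gp[OF s] DERIV_minkowski[OF w]])
 show ?thesis
  unfolding hamiltonian_def power2_eq_square
  by (rule back_subst[where P = "\<lambda>D. (_ has_real_derivative D) _", OF DERIV_diff[OF DERIV_add[OF
   DERIV_cmult[OF DERIV_mult[OF d(1) d(1)]] DERIV_cmult[OF DERIV_mult[OF d(2) d(2)]]] G]])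
   (simp add: a_def b_def algebra_simps add_divide_distrib diff_divide_distrib)
qed

end

locale nodal = frequency +
 fixes p :: real and k :: nat and w :: "real => real \<times> real" and x :: real and S :: "real set"
 assumes p: "0 < p" "p <= p1" and x: "0 < x" and w0: "w 0 = (0, x)"
  and S: "finite S" and cont: "continuous_on {0..} w" and C1: "w C1_differentiable_on ({0<..} - S)"
  and dw: "!!r. 0 < r ==> r \<notin> S ==> (w has_vector_derivative soler_field m \<Omega> p r (w r)) (at r)"
  and supp: "compactly_supported w" and nodes: "finite (crossings w)" "card (crossings w) = k"

lemma (in frequency) nodal_solutionD:
 assumes "0 < p" "p <= p1" "nodal_solution m \<Omega> k p w"
 obtains x S where "nodal m \<Omega> p k w x S"
proof -
 from assms(3) obtain x where x: "0 < x" "cauchy_solution m \<Omega> p x w"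
  and rest: "compactly_supported w" "finite (crossings w)" "card (crossings w) = k"
  by (auto simp: nodal_solution_def)
 from x(2) obtain S where "finite S" "w C1_differentiable_on ({0<..} - S)" "continuous_on {0..} w" "w 0 = (0, x)"
  "\<forall>r\<in>{0<..} - S. (w has_vector_derivative soler_field m \<Omega> p r (w r)) (at r)"
  by (auto simp: cauchy_solution_def extended_solution_def)
 then have "nodal m \<Omega> p k w x S"
  by (intro nodal.intro[OF frequency_axioms nodal_axioms.intro]) (use assms x rest in auto)
 then show thesis by (rule that)
qed

context nodal
begin

abbreviation "s r \<equiv> minkowski (w r)"

lemma p1: "p < 1"
 using p by (simp add: p1_def)

text \<open>Near a point of the light cone the equation forces \<open>F\<close> to be continuous, hence \<open>0\<close>, so the orbit
 would stay on the cone, where the derivative of \<open>s\<close> vanishes only at \<open>r = 1 / \<Omega>\<close>.\<close>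

lemma minkowski_nonzero:
 assumes r: "0 < r" "r \<notin> S" and wr: "w r \<noteq> 0"
 shows "s r \<noteq> 0"
proof
 assume s0: "s r = 0"
 then have ur: "fst (w r) \<noteq> 0" using wr by (auto simp: minkowski_def case_prod_beta prod_eq_iff)
 define U where "U = {0<..} - S"
 have U: "open U" "r \<in> U" using r S by (auto simp: U_def intro!: open_Diff finite_imp_closed)
 obtain D where D: "!!t. t \<in> U ==> (w has_vector_derivative D t) (at t)" "continuous_on U D"
  using C1 unfolding C1_differentiable_on_def U_def by auto
 have Deq: "D t = soler_field m \<Omega> p t (w t)" if "t \<in> U" for t
  using that by (intro vector_derivative_unique_at[OF D(1)[OF that]] dw) (auto simp: U_def)
 have sD: "snd (D t) = - fst (w t) * (b + F p (s t))" if "t \<in> U" for t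
  using Deq[OF that] soler_field_eq[of p t "fst (w t)" "snd (w t)"] by (simp add: minkowski_def case_prod_beta)
 have wU: "continuous_on U w" by (rule continuous_on_subset[OF cont]) (auto simp: U_def)
 have cw: "isCont w r" and cD: "isCont D r"
  using wU D(2) U continuous_on_eq_continuous_at by auto
 \<comment> \<open>This is \<open>F p (s t)\<close>, solved for from the second equation. It is
   continuous because the solution is \<open>C1\<close>, and it vanishes at \<open>r\<close> by the
   convention \<open>F p 0 = 0\<close>. Hence it is below 1 nearby, whereas \<open>F\<close> is at
   least 1 at small nonzero values of \<open>s\<close>.\<close>
 define g where "g t = - snd (D t) / fst (w t) - b" for t
 have "isCont g r" unfolding g_def[abs_def] using ur by (intro continuous_intros cw cD) auto
 moreover have "g r = 0" using sD[OF U(2)] ur s0 by (simp add: g_def F_def)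
 ultimately have "(g \<longlongrightarrow> 0) (nhds r)" by (metis isCont_def tendsto_at_iff_tendsto_nhds)
 then have ev1: "eventually (\<lambda>t. g t < 1) (nhds r)" by (rule order_tendstoD) simp
 have "isCont (\<lambda>t. \<bar>s t\<bar>) r"
  unfolding minkowski_def case_prod_beta by (intro continuous_intros cw)
 then have "((\<lambda>t. \<bar>s t\<bar>) \<longlongrightarrow> \<bar>s r\<bar>) (nhds r)" unfolding isCont_def
  by (rule tendsto_at_iff_tendsto_nhds[of "\<lambda>t. \<bar>s t\<bar>" r, THEN iffD1])
 then have ev2: "eventually (\<lambda>t. \<bar>s t\<bar> < p powr (1 / (1 - p))) (nhds r)"
  by (rule order_tendstoD) (use s0 p in auto)
 have "isCont (\<lambda>t. \<bar>fst (w t)\<bar>) r" by (intro continuous_intros cw)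
 then have "((\<lambda>t. \<bar>fst (w t)\<bar>) \<longlongrightarrow> \<bar>fst (w r)\<bar>) (nhds r)"
  unfolding isCont_def by (rule tendsto_at_iff_tendsto_nhds[of "\<lambda>t. \<bar>fst (w t)\<bar>" r, THEN iffD1])
 then have ev3: "eventually (\<lambda>t. 0 < \<bar>fst (w t)\<bar>) (nhds r)" by (rule order_tendstoD) (use ur in auto)
 have ev4: "eventually (\<lambda>t. t \<in> U) (nhds r)" using U eventually_nhds by blast
 have "eventually (\<lambda>t. s t = 0 \<and> fst (w t) \<noteq> 0 \<and> t \<in> U) (nhds r)"
  using ev1 ev2 ev3 ev4
 proof eventually_elim
  case (elim t)
  have "F p (s t) = g t" using sD[OF elim(4)] elim(3) by (simp add: g_def)
  then have "F p (s t) < 1" using elim(1) by simp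
  then show ?case using F_ge_1[OF p(1) p1, of "s t"] elim by force
 qed
 then obtain N where N: "open N" "r \<in> N" "!!t. t \<in> N ==> s t = 0 \<and> fst (w t) \<noteq> 0 \<and> t \<in> U"
  unfolding eventually_nhds by blast
 have "t = 1 / \<Omega>" if t: "t \<in> N" for t
 proof -
  have tp: "0 < t" "t \<notin> S" using N(3)[OF t] by (auto simp: U_def)
  have "DERIV (\<lambda>t. 0) t :> 0" by simp
  then have "DERIV s t :> 0"
   by (rule has_field_derivative_transform_within_open[OF _ N(1) t]) (use N(3) in auto)
  then have "4 * fst (w t) * (fst (w t) / t - \<Omega> * snd (w t)) = 0"
   using DERIV_unique[OF _ DERIV_minkowski[OF dw[OF tp]]] by metis
  then have "fst (w t) = \<Omega> * t * snd (w t)" using N(3)[OF t] tp by (simp add: field_simps)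
  moreover have "(snd (w t))\<^sup>2 = (fst (w t))\<^sup>2" using N(3)[OF t] by (simp add: minkowski_def case_prod_beta)
  ultimately have "(fst (w t))\<^sup>2 = (\<Omega> * t)\<^sup>2 * (fst (w t))\<^sup>2" by (metis power_mult_distrib)
  then have "(\<Omega> * t)\<^sup>2 = 1" using N(3)[OF t] by simp
  moreover have "0 < \<Omega> * t" using Om_pos tp(1) by (rule mult_pos_pos)
  ultimately have "\<Omega> * t = 1" by (simp add: power2_eq_1_iff)
  then show ?thesis using Om_pos by (simp add: field_simps)
 qed
 then have "finite N" by (intro finite_subset[of N "{1 / \<Omega>}"]) auto
 then show False using finite_imp_not_open N(1,2) by auto
qed

definition "R = Inf {r \<in> {0..}. w r = 0}"

lemma R: "0 < R" "w R = 0" "!!r. 0 <= r ==> r < R ==> w r \<noteq> 0"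
proof -
 let ?Z = "{r \<in> {0..}. w r = 0}"
 have cl: "closed ?Z" by (intro continuous_closed_preimage_constant cont) auto
 have bdd: "bdd_below ?Z" by (rule bdd_belowI[of _ 0]) auto
 have "bounded {r. 0 <= r \<and> w r \<noteq> 0}"
  using supp by (auto simp: compactly_supported_def dest: compact_imp_bounded intro: bounded_subset[OF _ closure_subset])
 then obtain B where B: "!!r. 0 <= r ==> w r \<noteq> 0 ==> \<bar>r\<bar> <= B" unfolding bounded_iff by auto
 have "\<bar>B\<bar> + 1 \<in> ?Z" using B[of "\<bar>B\<bar> + 1"] by force
 then have "?Z \<noteq> {}" by blast
 then have "R \<in> ?Z" unfolding R_def by (rule closed_contains_Inf[OF _ bdd cl])
 then show "w R = 0" by simp
 have "R \<noteq> 0" using \<open>w R = 0\<close> w0 x by (auto simp: zero_prod_def)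
 then show "0 < R" using \<open>R \<in> ?Z\<close> by simp
 show "w r \<noteq> 0" if "0 <= r" "r < R" for r
  using cInf_lower[of r ?Z] bdd that unfolding R_def by force
qed

lemma hamiltonian_antimono:
 assumes "0 <= c" "c <= d" "!!r. r \<in> {c<..<d} ==> w r \<noteq> 0"
 shows "hamiltonian p (w d) <= hamiltonian p (w c)"
proof -
 have "- hamiltonian p (w c) <= - hamiltonian p (w d)"
 proof (rule nondecreasing_off_finite[OF S assms(2)])
  show "continuous_on {c..d} (\<lambda>r. - hamiltonian p (w r))"
   using assms(1) by (intro continuous_intros continuous_on_hamiltonian p continuous_on_subset[OF cont]) auto
  fix r assume r: "r \<in> {c<..<d} - S"
  then have r': "0 < r" "r \<notin> S" using assms(1) by auto
  show "DERIV (\<lambda>r. - hamiltonian p (w r)) r :> - (- 4 * (fst (w r))\<^sup>2 * (b + F p (s r)) / r)"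
   by (rule DERIV_minus[OF DERIV_hamiltonian[OF dw[OF r'] minkowski_nonzero[OF r']]]) (use assms(3) r in auto)
  have "0 <= 4 * (fst (w r))\<^sup>2 * (b + F p (s r)) / r"
   using r' b_pos F_nonneg[OF p(1)] by (intro divide_nonneg_pos mult_nonneg_nonneg add_nonneg_nonneg) auto
  then show "0 <= - (- 4 * (fst (w r))\<^sup>2 * (b + F p (s r)) / r)" by simp
 qed
 then show ?thesis by simp
qed

lemma hamiltonian_zero: "hamiltonian p 0 = 0"
 by (simp add: hamiltonian_def minkowski_def zero_prod_def)

lemma hamiltonian_nonneg: "0 <= r ==> r <= R ==> 0 <= hamiltonian p (w r)"
 using hamiltonian_antimono[of r R] R by (auto simp: hamiltonian_zero)

text \<open>The solution is not known to remain 0 beyond \<open>R\<close>. But its energy is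
  nonpositive there, while a point with \<open>v = 0\<close> and \<open>u \<noteq> 0\<close> has
  positive energy; so every crossing lies before \<open>R\<close>.\<close>

lemma after:
 assumes r: "R <= r" and v: "snd (w r) = 0"
 shows "fst (w r) = 0"
proof (rule ccontr)
 assume u: "fst (w r) \<noteq> 0"
 let ?Z = "{t \<in> {0..r}. w t = 0}"
 have cl: "closed ?Z" by (intro continuous_closed_preimage_constant continuous_on_subset[OF cont]) auto
 have bdd: "bdd_above ?Z" by (rule bdd_aboveI[of _ r]) auto
 have "R \<in> ?Z" using R r by auto
 then have Z: "Sup ?Z \<in> ?Z" by (intro closed_contains_Sup cl bdd) auto
 \<comment> \<open>The energy is known to decrease only where \<open>w\<close> does not vanish, so
   the comparison starts at the last zero before \<open>r\<close>.\<close>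
 have "hamiltonian p (w r) <= hamiltonian p (w (Sup ?Z))"
 proof (rule hamiltonian_antimono)
  fix t assume t: "t \<in> {Sup ?Z<..<r}"
  show "w t \<noteq> 0"
  proof
   assume "w t = 0"
   then have "t \<in> ?Z" using t Z by auto
   from cSup_upper[OF this bdd] t show False by simp
  qed
 qed (use Z in auto)
 also have "\<dots> = 0" using Z hamiltonian_zero by simp
 finally have le: "hamiltonian p (w r) <= 0" .
 have "0 < b * (fst (w r))\<^sup>2" using u b_pos by simp
 moreover have "Gp p (s r) <= 0" by (rule Gp_nonpos) (simp add: minkowski_def case_prod_beta v)
 ultimately show False using le v by (simp add: hamiltonian_def)
qed

lemma lift:
 obtains l \<phi> where "orbit m \<Omega> p {0..<R} S (\<lambda>t. t) (\<lambda>_. 1) (\<lambda>t. F p (minkowski (w t))) l \<phi>"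
  "\<phi> 0 = 0" "!!t. t \<in> {0..<R} ==> w t = (exp (l t / 2) * sin (\<phi> t / 2), exp (l t / 2) * cos (\<phi> t / 2))"
proof (rule polar_lift[OF p, of "{0..<R}" S w x])
 show "is_interval {0..<R}" by (simp add: is_interval_co)
 show "continuous_on {0..<R} w" by (rule continuous_on_subset[OF cont]) auto
qed (use R S dw minkowski_nonzero w0 x in auto)

end

section \<open>Bounds uniform in the exponent\<close>

context frequency
begin

text \<open>Bounds, independent of \<open>p\<close>, for the square of the initial datum, for the
  amplitude and, by \<open>M\<close> and \<open>Rm\<close> below, for the radius of the support up
  to the first zero: compactness of the family rests on them.\<close>

definition "X0 k = 2 * Cg * (3 * real k + 2) / (\<gamma> ^ (3 * k + 2) * c0)"
definition "M k = 2 * (a * X0 k + 1) / a"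
definition "Rm k = r0 + 4 * (real k * (2 * pi) + pi) / a"

lemma X0_nonneg: "0 <= X0 k"
 unfolding X0_def using Cg_pos gamma_bounds(1) c0_bounds(1)
 by (intro divide_nonneg_pos mult_nonneg_nonneg mult_pos_pos) auto

lemma M_pos: "0 < M k" and X0_le_M: "X0 k <= M k"
proof -
 have X: "0 <= a * X0 k" using X0_nonneg[of k] a_pos by simp
 then show "0 < M k" unfolding M_def using a_pos by (intro divide_pos_pos) auto
 have "a * X0 k <= 2 * (a * X0 k + 1)" using X by (simp add: distrib_left)
 then show "X0 k <= M k" unfolding M_def using a_pos by (subst pos_le_divide_eq) (auto simp: mult.commute)
qed

end

locale nodal_lift = nodal +
 fixes l \<phi> :: "real => real"
 assumes orb: "orbit m \<Omega> p {0..<R} S (\<lambda>t. t) (\<lambda>_. 1) (\<lambda>t. F p (minkowski (w t))) l \<phi>"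
  and phi_0: "\<phi> 0 = 0"
  and polar: "!!t. t \<in> {0..<R} ==> w t = (exp (l t / 2) * sin (\<phi> t / 2), exp (l t / 2) * cos (\<phi> t / 2))"

sublocale nodal_lift \<subseteq> O: orbit m \<Omega> p "{0..<R}" S "\<lambda>t. t" "\<lambda>_. 1" "\<lambda>t. F p (minkowski (w t))" l \<phi>
 by (rule orb)

context nodal_lift
begin

lemma uv: "r \<in> {0..<R} ==> fst (w r) = O.u r" "r \<in> {0..<R} ==> snd (w r) = O.v r"
 using polar by (simp_all add: O.u_def O.v_def)

lemma E_w: "r \<in> {0..<R} ==> O.E r = (fst (w r))\<^sup>2 + (snd (w r))\<^sup>2"
 using O.E_eq uv by simp

lemma s_cos: "r \<in> {0..<R} ==> s r = O.E r * cos (\<phi> r)"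
 using O.s_eq uv by (simp add: minkowski_def case_prod_beta)

lemma h_nonneg: assumes "r \<in> {0..<R}" shows "0 <= O.h r"
proof -
 have "O.h r = hamiltonian p (w r)"
  using O.E_wt[of r] uv[OF assms] s_cos[OF assms] by (simp add: O.h_def hamiltonian_def O.G_def O.E_def)
 then show ?thesis using hamiltonian_nonneg[of r] assms by simp
qed

lemma E_small: assumes "0 < \<epsilon>" "r1 < R" obtains r where "r1 < r" "0 <= r" "r < R" "O.E r < \<epsilon>"
proof -
 define g where "g r = (fst (w r))\<^sup>2 + (snd (w r))\<^sup>2" for r
 have "continuous_on {0..R} g"
  unfolding g_def[abs_def] by (intro continuous_intros continuous_on_subset[OF cont]) auto
 then have "(g \<longlongrightarrow> g R) (at_left R)"
  using R(1) continuous_on_Icc_at_leftD by blast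
 moreover have "g R = 0" using R(2) by (simp add: g_def)
 ultimately have "eventually (\<lambda>r. g r < \<epsilon>) (at_left R)" using assms(1) by (intro order_tendstoD(2)) auto
 moreover have "eventually (\<lambda>r. r \<in> {max 0 r1<..<R}) (at_left R)"
  using assms(2) R(1) by (intro eventually_at_left_real) auto
 ultimately have "eventually (\<lambda>r. g r < \<epsilon> \<and> r \<in> {max 0 r1<..<R}) (at_left R)" by eventually_elim simp
 then obtain r where "g r < \<epsilon>" "r \<in> {max 0 r1<..<R}"
  using eventually_happens'[OF trivial_limit_at_left_real] by blast
 then show thesis using E_w[of r] by (intro that[of r]) (auto simp: g_def)
qed

lemma E_0: "O.E 0 = x\<^sup>2"
 using E_w[of 0] R(1) w0 by simp

lemma start: "0 \<in> {0..<R}" "\<bar>\<phi> 0\<bar> < pi" "0 <= O.q 0" "O.q 0 <= a / 2 * 0"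
 using R(1) by (simp_all add: O.q_def phi_0)

text \<open>Up to \<open>r0\<close> the amplitude keeps the fraction \<open>c0\<close> of its
  initial value, so the origin cannot be reached before.\<close>

lemma r0_less: "r0 < R"
proof (rule ccontr)
 assume "\<not> r0 < R"
 moreover have e: "0 < c0 * x\<^sup>2" using c0_bounds(1) x by simp
 obtain r where "0 < r" "0 <= r" "r < R" "O.E r < c0 * x\<^sup>2" by (rule E_small[OF e R(1)])
 ultimately have r: "0 <= r" "r < R" "O.E r < c0 * x\<^sup>2" "r <= r0" by linarith+
 have "c0 * O.E 0 <= O.E r"
  unfolding c0_def by (rule O.E_initial[OF start(1) _ r(1) h_nonneg r(4) start(2-4)]) (use r in simp_all)
 then show False using r E_0 by simp
qed

lemma initial:
 assumes "0 <= r" "r <= r0"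
 shows "0 <= O.q r" "O.q r <= a / 2 * r" "O.q r < q1" "0 <= \<phi> r" "\<phi> r < pi / 2"
 using O.initial_phase[OF start(1) _ assms(1) h_nonneg assms(2) start(2-4)] assms r0_less by auto

lemma phi_increase:
 assumes "r0 <= r" "r <= t" "t < R" shows "a / 4 * (t - r) <= \<phi> t - \<phi> r"
 using O.phi_increase[of r t] h_nonneg[of t] assms r0_pos by simp

lemma phi_strict: assumes "r0 <= r" "r < t" "t < R" shows "\<phi> r < \<phi> t"
proof -
 have "0 < a / 4 * (t - r)" using assms a_pos by simp
 then show ?thesis using phi_increase[of r t] assms by simp
qed

lemma phi_mono: assumes "r0 <= r" "r <= t" "t < R" shows "\<phi> r <= \<phi> t"
 using phi_strict[of r t] assms by (cases "r = t") auto

lemma phi_nonneg: "0 <= r ==> r < R ==> 0 <= \<phi> r"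
proof (cases "r <= r0")
 case False
 assume "0 <= r" "r < R"
 then have "\<phi> r0 <= \<phi> r" using phi_mono[of "r0" r] False by simp
 then show ?thesis using initial(4)[of "r0"] r0_pos by simp
qed (rule initial(4))

sublocale tail: polar_tail w l \<phi> "r0" R
proof (rule polar_tail.intro[OF r0_pos r0_less])
 show "continuous_on {r0..<R} \<phi>" by (rule continuous_on_subset[OF O.cont_phi]) (use r0_pos in auto)
 show "0 < snd (w r)" if "0 < r" "r <= r0" for r
 proof -
  have "\<bar>\<phi> r\<bar> < pi" using initial(4,5)[of r] that by simp
  from cos_half_pos[OF this] show ?thesis using uv(2)[of r] that r0_less by (simp add: O.v_def)
 qed
 show "w r = (exp (l r / 2) * sin (\<phi> r / 2), exp (l r / 2) * cos (\<phi> r / 2))" if "r \<in> {r0..<R}" for r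
  by (rule polar) (use that r0_pos in auto)
 show "0 <= \<phi> r0" "\<phi> r0 < pi"
  using initial(4,5)[of "r0"] r0_pos pi_gt_zero by linarith+
qed (fact phi_strict after)+

lemma phi_less: assumes "0 <= r" "r < R" shows "\<phi> r < real k * (2 * pi) + pi"
proof (cases "r <= r0")
 case True
 have "0 <= real k * (2 * pi)" by simp
 then show ?thesis using initial(5)[OF assms(1) True] pi_gt_zero by linarith
next
 case False
 then show ?thesis using tail.card_crossingsD(1)[OF nodes, of r] assms by simp
qed

lemma R_le: "R <= Rm k"
proof (rule dense_le_bounded[OF r0_less])
 fix r assume r: "r0 < r" "r < R"
 have "a / 4 * (r - r0) <= real k * (2 * pi) + pi"
  using phi_increase[of "r0" r] phi_less[of r] initial(4)[of "r0"] r r0_pos by simp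
 then show "r <= Rm k" using a_pos by (simp add: Rm_def field_simps)
qed

text \<open>The bound \<open>E_lower\<close> is linear in the initial amplitude and holds up to
  \<open>R\<close>, where the amplitude tends to 0. A large datum would contradict this.\<close>

lemma x_le: "x\<^sup>2 <= X0 k"
proof -
 let ?g = "\<gamma> ^ (3 * k + 2)"
 have "?g * (c0 * x\<^sup>2) <= 2 * Cg * (3 * k + 2)"
 proof (rule field_le_epsilon)
  fix e :: real assume "0 < e"
  obtain r where r: "0 < r" "0 <= r" "r < R" "O.E r < e" by (rule E_small[OF \<open>0 < e\<close> R(1)])
  have "?g * (c0 * O.E 0) - 2 * Cg * (3 * k + 2) <= O.E r"
   unfolding c0_def
   by (rule O.E_lower[OF start(1) _ r(2) h_nonneg _ start(2-4)])
    (use r phi_less[of r] r0_pos in simp_all)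
  then show "?g * (c0 * x\<^sup>2) <= 2 * Cg * (3 * k + 2) + e" using r(4) E_0 by simp
 qed
 then show ?thesis using gamma_bounds(1) c0_bounds(1) unfolding X0_def
  by (subst pos_le_divide_eq) (auto simp: algebra_simps)
qed

lemma E_le: assumes "0 <= r" "r < R" shows "O.E r <= M k"
proof -
 have "a / 2 * O.E r <= O.h r + 1" by (rule O.E_upper)
 also have "O.h r <= O.h 0" by (rule O.h_antimono) (use assms R(1) in auto)
 also have "O.h 0 <= a * x\<^sup>2"
 proof -
  have "0 <= O.G 0" unfolding O.G_def by (rule Gp_nonneg) (simp add: phi_0)
  then show ?thesis using E_0 by (simp add: O.h_def wt_def phi_0 a_def mult.commute)
 qed
 also have "a * x\<^sup>2 <= a * X0 k" using x_le a_pos by (intro mult_left_mono) auto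
 finally show ?thesis using a_pos by (simp add: M_def field_simps)
qed

end

lemma F_le:
 assumes "0 < p" "p < 1" "0 < \<sigma>" "\<sigma> <= \<bar>s\<bar>"
 shows "F p s <= p * (1 + 1 / \<sigma>)"
proof -
 have "\<bar>s\<bar> powr (p - 1) <= \<sigma> powr (p - 1)" using assms by (intro powr_mono2') auto
 also have "\<dots> <= 1 + 1 / \<sigma>"
 proof (cases "1 <= \<sigma>")
  case True
  then have "\<sigma> powr (p - 1) <= \<sigma> powr 0" using assms by (intro powr_mono) auto
  then show ?thesis using assms by (simp add: add_increasing2)
 next
  case False
  then have "\<sigma> powr (p - 1) <= \<sigma> powr (- 1)" using assms by (intro powr_mono') auto
  then show ?thesis using assms by (simp add: powr_minus divide_inverse)
 qed
 finally show ?thesis using assms by (simp add: F_def mult_left_mono)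
qed

lemma cos_half_turns:
 shows "(- 1) ^ j * cos (y + real j * pi) = cos y"
proof -
 have "((- 1) ^ j * (- 1) ^ j :: real) = 1" by (simp flip: power_mult_distrib)
 then show ?thesis by (simp add: cos_add cos_npi sin_npi flip: mult.assoc)
qed

section \<open>The successive positive and negative phases\<close>

context frequency
begin

text \<open>The radius needed for a quarter turn when the phase grows at most at the rate
  \<open>C2\<close>, as it does where cos phi is nonnegative.\<close>

definition "c1 = pi / (4 * (b + 1 / r0))"
definition "C2 = 2 * (b + 1 / r0)"
text \<open>A lower bound for |cos phi| at distance \<open>\<delta>\<close> from the light cone: 1/3
  is the bound before \<open>r0\<close>, the sine comes from the phase speed \<open>a / 4\<close>
  after it.\<close>

definition "cmin \<delta> = min (1 / 3) (sin (min (a / 4 * \<delta>) (pi / 2)))"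
definition "Mv k = sqrt (M k) * (\<Omega> + 1 / r0 + a / 2)"
definition "Ls k = 4 * M k * (\<Omega> + 1 / r0 + a / 2)"

lemma C2_pos: "0 < C2" and c1_pos: "0 < c1" and C2_c1: "C2 * c1 = pi / 2"
proof -
 define B where "B = b + 1 / r0"
 have "0 < B" using b_pos r0_pos by (simp add: B_def add_pos_pos)
 then show "0 < C2" "0 < c1" "C2 * c1 = pi / 2" unfolding C2_def c1_def B_def[symmetric] by simp_all
qed

lemma cmin_pos: "0 < \<delta> ==> 0 < cmin \<delta>"
 using a_pos by (auto simp: cmin_def intro!: sin_gt_zero min.strict_coboundedI2)

lemma Mv_pos: "0 < Mv k" and Ls_nonneg: "0 <= Ls k"
proof -
 have "0 < \<Omega> + 1 / r0 + a / 2" using Om_pos r0_pos a_pos by (simp add: add_pos_pos)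
 then show "0 < Mv k" "0 <= Ls k" using M_pos[of k] unfolding Mv_def Ls_def by simp_all
qed

end

context nodal_lift
begin

lemma int_interior: "0 < r ==> r < R ==> r \<notin> S ==> r \<in> interior {0..<R} - S"
 by simp

text \<open>Where cos phi is below \<open>- \<delta>\<close>, the term with \<open>F\<close> speeds
  up the rotation, so the gain of phase bounds the integral of \<open>F\<close>. This controls
  \<open>ln E\<close> without any pointwise bound on \<open>F\<close>.\<close>

lemma log_ratio:
 assumes cd: "r0 <= c" "c <= d" "d < R" and \<delta>: "0 < \<delta>" and neg: "!!r. r \<in> {c..d} ==> cos (\<phi> r) <= - \<delta>"
 shows "\<bar>l d - l c\<bar> <= (\<phi> d - \<phi> c) / \<delta> + Kg * (d - c)"
proof -
 have c0: "0 < c" using cd(1) r0_pos by simp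
 have I: "c \<in> {0..<R}" "d \<in> {0..<R}" using cd c0 by auto
 have sub: "{c..d} \<subseteq> {0..<R}" by (rule O.Icc[OF I])
 note cl = continuous_on_subset[OF O.cont_l sub] and cp = continuous_on_subset[OF O.cont_phi sub]
 define l' where "l' r = - 2 * (sin (\<phi> r) * (m * 1 + F p (s r)) + 1 * (1 - cos (\<phi> r)) / r)" for r
 define p' where "p' r = 2 * 1 * (wt (\<phi> r) - sin (\<phi> r) / r) - 2 * F p (s r) * cos (\<phi> r)" for r
 have bound: "\<bar>l' r\<bar> <= p' r / \<delta> + Kg * 1" and dl: "DERIV l r :> l' r"
  and dp: "DERIV \<phi> r :> p' r" if r: "r \<in> {c<..<d} - S" for r
 proof -
  have rr: "0 < r" "r < R" "r \<notin> S" "r0 <= r" using r cd c0 by auto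
  have rI: "r \<in> interior {0..<R} - S" by (rule int_interior) fact+
  show "DERIV l r :> l' r" "DERIV \<phi> r :> p' r"
   unfolding l'_def p'_def by (rule O.dl[OF rI], rule O.dphi[OF rI])
  have F0: "0 <= F p (s r)" by (rule F_nonneg[OF p(1)])
  have ang: "0 <= wt (\<phi> r) - sin (\<phi> r) / r" using O.sin_r_le[OF rr(4)] by simp
  have "2 * F p (s r) * \<delta> <= 2 * F p (s r) * (- cos (\<phi> r))"
   using neg[of r] r F0 by (intro mult_left_mono) auto
  then have "2 * F p (s r) * \<delta> <= 2 * (wt (\<phi> r) - sin (\<phi> r) / r) + 2 * F p (s r) * (- cos (\<phi> r))"
   by (rule add_increasing[rotated]) (use ang in simp)
  then have "2 * F p (s r) * \<delta> <= p' r" by (simp add: p'_def)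
  then have Fp: "2 * F p (s r) <= p' r / \<delta>" using \<delta> by (simp add: field_simps)
  define A where "A = sin (\<phi> r) * (m * 1 + F p (s r))"
  define B where "B = 1 * (1 - cos (\<phi> r)) / r"
  have "\<bar>A\<bar> <= 1 * (m + F p (s r))"
   unfolding A_def abs_mult using F0 m_pos by (intro mult_mono) auto
  then have "\<bar>A\<bar> <= m + F p (s r)" by simp
  moreover have "B <= 2 / r0" unfolding B_def
   using rr r0_pos cos_ge_minus_one[of "\<phi> r"] by (intro frac_le) auto
  moreover have "0 <= B" using rr by (simp add: B_def cos_le_one)
  ultimately have AB: "\<bar>A + B\<bar> <= m + F p (s r) + 2 / r0" by linarith
  have "\<bar>l' r\<bar> = 2 * \<bar>A + B\<bar>" 
   unfolding l'_def A_def[symmetric] B_def[symmetric] abs_mult by simp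
  also have "\<dots> <= 2 * (m + F p (s r) + 2 / r0)" using AB by (intro mult_left_mono) auto
  finally have "\<bar>l' r\<bar> <= 2 * F p (s r) + Kg" by (simp add: Kg_def algebra_simps)
  then show "\<bar>l' r\<bar> <= p' r / \<delta> + Kg * 1" using Fp by linarith
 qed
 have "\<bar>l d - l c\<bar> <= (\<phi> d / \<delta> + Kg * d) - (\<phi> c / \<delta> + Kg * c)"
 proof (rule increment_bound_off_finite[OF S cd(2) cl, where h = "\<lambda>r. \<phi> r / \<delta> + Kg * r"])
  show "continuous_on {c..d} (\<lambda>r. \<phi> r / \<delta> + Kg * r)" using \<delta> by (intro continuous_intros cp) auto
  fix r assume r: "r \<in> {c<..<d} - S"
  show "DERIV (\<lambda>r. \<phi> r / \<delta> + Kg * r) r :> (p' r / \<delta> + Kg * 1)"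
   by (rule DERIV_add[OF DERIV_cdivide[OF dp[OF r]] DERIV_cmult[OF DERIV_ident]])
 qed (fact dl bound)+
 then show ?thesis by (simp add: diff_divide_distrib right_diff_distrib)
qed

lemma bounded_below_contra:
 assumes "c < R" "0 <= c" "!!r. c < r ==> r < R ==> K <= l r"
 shows False
proof -
 obtain r where r: "c < r" "0 <= r" "r < R" "O.E r < exp K" by (rule E_small[OF _ assms(1)]) auto
 then show False using assms(3)[of r] by (simp add: O.E_def)
qed

text \<open>The orbit can only reach the origin while \<open>sin \<phi>\<close> is positive and \<open>cos \<phi>\<close> is nonnegative,
 since otherwise \<open>ln E\<close> is bounded below.\<close>

lemma passes_axis: assumes k: "0 < k" shows "\<exists>r\<in>{r0..<R}. real k * (2 * pi) <= \<phi> r"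
proof (rule ccontr)
 assume "\<not> ?thesis"
 then have up: "\<phi> r < real k * (2 * pi)" if "r \<in> {r0..<R}" for r using that by force
 obtain c where c: "c \<in> {r0..<R}" "real k * (2 * pi) - pi < \<phi> c"
  using tail.card_crossingsD(2)[OF nodes k] by auto
 have c0: "0 < c" "c < R" "r0 <= c" using c(1) r0_pos by auto
 have "l c - Kg * (R - c) <= l d" if d: "c < d" "d < R" for d
 proof -
  have sub: "{c..d} \<subseteq> {0..<R}" using d c0 by auto
  have "l c + Kg * c <= l d + Kg * d"
   using less_imp_le[OF d(1)]
  proof (rule nondecreasing_off_finite[OF S, where g = "\<lambda>r. l r + Kg * r"])
   show "continuous_on {c..d} (\<lambda>r. l r + Kg * r)"
    by (intro continuous_intros continuous_on_subset[OF O.cont_l sub])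
   fix r assume r: "r \<in> {c<..<d} - S"
   have rr: "0 < r" "r < R" "r \<notin> S" "r0 <= r" "c <= r" using r d c0 by auto
   have rI: "r \<in> interior {0..<R} - S" by (rule int_interior) fact+
   show "DERIV (\<lambda>r. l r + Kg * r) r :> (- 2 * (sin (\<phi> r) * (m * 1 + F p (s r)) + 1 * (1 - cos (\<phi> r)) / r)) + Kg * 1"
    by (rule DERIV_add[OF O.dl[OF rI] DERIV_cmult[OF DERIV_ident]])
   have "real k * (2 * pi) - pi <= \<phi> r" using phi_mono[OF c0(3) rr(5,2)] c(2) by simp
   moreover have "\<phi> r < real k * (2 * pi)" by (rule up) (use rr in auto)
   ultimately have "0 <= sin (real k * (2 * pi) - \<phi> r)" by (intro sin_ge_zero) auto
   moreover have "sin (real k * (2 * pi) - \<phi> r) = - sin (\<phi> r)"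
   proof -
    have e: "real k * (2 * pi) = 2 * real k * pi" by simp
    show ?thesis unfolding e sin_diff by (simp only: sin_2npi cos_2npi mult_zero_left mult_1_left diff_0)
   qed
   ultimately have "0 <= - sin (\<phi> r)" by simp
   then have "0 <= F p (s r) * (- sin (\<phi> r))" using F_nonneg[OF p(1)] by (intro mult_nonneg_nonneg) auto
   then show "0 <= (- 2 * (sin (\<phi> r) * (m * 1 + F p (s r)) + 1 * (1 - cos (\<phi> r)) / r)) + Kg * 1"
    using O.dl_lower[OF rI rr(4)] by simp
  qed
  moreover have "Kg * d <= Kg * R" using d Kg_pos by (intro mult_left_mono) auto
  ultimately show ?thesis by (simp add: right_diff_distrib)
 qed
 then show False by (intro bounded_below_contra[of c]) (use c0 in auto)
qed

lemma phi_le: assumes "0 <= r" "r < R" shows "\<phi> r <= real k * (2 * pi) + pi / 2"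
proof (cases "r < r0")
 case True
 have "0 <= real k * (2 * pi)" by simp
 then show ?thesis using initial(5)[of r] assms True by linarith
next
 case False
 then have r0: "r0 <= r" by simp
 show ?thesis
 proof (rule ccontr)
  assume big: "\<not> ?thesis"
  let ?K = "real k * (2 * pi)"
  define \<delta> where "\<delta> = - cos (\<phi> r - ?K)"
  have per: "cos (\<psi> - ?K) = cos \<psi>" for \<psi>
   using cos_2npi[of k] sin_2npi[of k] by (simp add: cos_diff mult_ac)
  have "cos (\<phi> r - ?K) < cos (pi / 2)"
   using big phi_less[OF assms] by (intro cos_monotone_0_pi) auto
  then have \<delta>: "0 < \<delta>" by (simp add: \<delta>_def)
  have "l r - (pi / \<delta> + Kg * R) <= l d" if d: "r < d" "d < R" for d
  proof -
   have "\<bar>l d - l r\<bar> <= (\<phi> d - \<phi> r) / \<delta> + Kg * (d - r)"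
   proof (rule log_ratio[OF r0 less_imp_le[OF d(1)] d(2) \<delta>])
    fix t assume t: "t \<in> {r..d}"
    have "cos (\<phi> t - ?K) <= cos (\<phi> r - ?K)"
     using big phi_less[of t] phi_mono[OF r0, of t] t d assms pi_gt_zero by (intro cos_monotone_0_pi_le) auto
    then show "cos (\<phi> t) <= - \<delta>" by (simp add: \<delta>_def per)
   qed
   moreover have "(\<phi> d - \<phi> r) / \<delta> <= pi / \<delta>"
    using phi_less[of d] d assms big \<delta> pi_gt_zero by (intro divide_right_mono) linarith+
   moreover have "Kg * (d - r) <= Kg * R" using d assms Kg_pos by (intro mult_left_mono) auto
   ultimately show ?thesis by linarith
  qed
  then show False by (intro bounded_below_contra[of r]) (use assms in auto)
 qed
qed

text \<open>The light cone corresponds to the phases \<open>pi / 2 + j * pi\<close>. Exactly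
  \<open>2 * k\<close> of them are crossed before the end, since by \<open>passes_axis\<close> and
  \<open>phi_le\<close> the orbit ends after the axis phase \<open>k * (2 * pi)\<close> but not
  beyond the cone phase that follows it. The last entry is the radius of the origin.\<close>

definition \<rho> :: "nat => real" where
 "\<rho> j = (if j < 2 * k then SOME r. r0 <= r \<and> r < R \<and> \<phi> r = pi / 2 + real j * pi else R)"

lemma rho:
 assumes "j < 2 * k" shows "r0 <= \<rho> j" "\<rho> j < R" "\<phi> (\<rho> j) = pi / 2 + real j * pi"
proof -
 have "0 < k" using assms by simp
 from passes_axis[OF this] obtain c where c: "c \<in> {r0..<R}" "real k * (2 * pi) <= \<phi> c" ..
 have "real j + 1 <= 2 * real k" using assms by linarith
 then have "(real j + 1) * pi <= (2 * real k) * pi" by (intro mult_right_mono) auto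
 moreover have "(real j + 1) * pi = real j * pi + pi" "(2 * real k) * pi = real k * (2 * pi)"
  by (simp_all add: algebra_simps)
 ultimately have "pi / 2 + real j * pi <= \<phi> c" using c(2) pi_gt_zero by linarith
 moreover have "\<phi> r0 <= pi / 2 + real j * pi" using initial(5)[of "r0"] r0_pos by (simp add: add_increasing2)
 moreover have "continuous_on {r0..c} \<phi>" by (rule continuous_on_subset[OF O.cont_phi]) (use c r0_pos in auto)
 ultimately obtain r where "r0 <= r" "r <= c" "\<phi> r = pi / 2 + real j * pi"
  using IVT'[of \<phi> "r0" "pi / 2 + real j * pi" c] c(1) by auto
 then have "\<exists>r. r0 <= r \<and> r < R \<and> \<phi> r = pi / 2 + real j * pi" using c(1) by force
 from someI_ex[OF this] show "r0 <= \<rho> j" "\<rho> j < R" "\<phi> (\<rho> j) = pi / 2 + real j * pi"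
  using assms by (simp_all add: \<rho>_def)
qed

lemma rho_last: "\<rho> (2 * k) = R"
 by (simp add: \<rho>_def)

lemma rho_ge: "r0 <= \<rho> j" and rho_le_R: "\<rho> j <= R"
 using rho[of j] r0_less by (cases "j < 2 * k"; simp add: \<rho>_def less_imp_le)+

lemma phi_before:
 assumes j: "j <= 2 * k" and r: "r0 <= r" "r < R" and \<delta>: "0 <= \<delta>" "r + \<delta> <= \<rho> j"
 shows "\<phi> r + a / 4 * \<delta> <= pi / 2 + real j * pi"
proof (cases "j < 2 * k")
 case True
 have "a / 4 * \<delta> <= a / 4 * (\<rho> j - r)" using \<delta> a_pos by (intro mult_left_mono) auto
 also have "\<dots> <= \<phi> (\<rho> j) - \<phi> r" using rho[OF True] r \<delta> by (intro phi_increase) auto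
 finally show ?thesis using rho(3)[OF True] by simp
next
 case False
 then have jk: "j = 2 * k" using j by simp
 have "R <= r + 4 * (real k * (2 * pi) + pi / 2 - \<phi> r) / a"
 proof (rule dense_le_bounded[OF r(2)])
  fix t assume t: "r < t" "t < R"
  have "a / 4 * (t - r) <= real k * (2 * pi) + pi / 2 - \<phi> r"
   using phi_increase[OF r(1), of t] phi_le[of t] t r r0_pos by simp
  then show "t <= r + 4 * (real k * (2 * pi) + pi / 2 - \<phi> r) / a" using a_pos by (simp add: field_simps)
 qed
 then have "\<delta> <= 4 * (real k * (2 * pi) + pi / 2 - \<phi> r) / a" using \<delta>(2) rho_last jk by simp
 then have "a / 4 * \<delta> <= real k * (2 * pi) + pi / 2 - \<phi> r" using a_pos by (simp add: field_simps)
 then show ?thesis using jk by (simp add: mult_ac)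
qed

lemma phi_after:
 assumes j: "j < 2 * k" and r: "r < R" and \<delta>: "0 <= \<delta>" "\<rho> j + \<delta> <= r"
 shows "pi / 2 + real j * pi + a / 4 * \<delta> <= \<phi> r"
proof -
 have "a / 4 * \<delta> <= a / 4 * (r - \<rho> j)" using \<delta> a_pos by (intro mult_left_mono) auto
 also have "\<dots> <= \<phi> r - \<phi> (\<rho> j)" using rho[OF j] r \<delta> by (intro phi_increase) auto
 finally show ?thesis using rho(3)[OF j] by simp
qed

lemma rho_strict: assumes "i < j" "j <= 2 * k" shows "\<rho> i < \<rho> j"
proof (rule ccontr)
 assume n: "\<not> \<rho> i < \<rho> j"
 have i: "i < 2 * k" using assms by simp
 have "\<phi> (\<rho> j) <= pi / 2 + real i * pi" if "j < 2 * k"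
  using phi_before[of i "\<rho> j" 0] rho[OF that] i n by simp
 moreover have "real i * pi < real j * pi" using assms(1) by simp
 ultimately show False using rho[of j] rho(2)[OF i] n rho_last assms(2) by (cases "j < 2 * k") auto
qed

text \<open>The radius lies between two consecutive entries of \<open>\<rho>\<close>, at distance at
  least \<open>\<delta>\<close> from them; there \<open>s\<close> has the sign of
  \<open>(- 1) ^ j\<close>. The phase with \<open>j = 0\<close> extends down to the centre.\<close>

definition "in_phase j \<delta> r \<longleftrightarrow> 0 <= r \<and> r < R \<and> r + \<delta> <= \<rho> j \<and> (0 < j \<longrightarrow> \<rho> (j - 1) + \<delta> <= r)"

lemma in_phase_phi:
 assumes j: "j <= 2 * k" and r: "in_phase j \<delta> r" and \<delta>: "0 <= \<delta>"
 shows "\<bar>\<phi> r - real j * pi\<bar> <= pi / 2" and "cmin \<delta> <= (- 1) ^ j * cos (\<phi> r)"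
proof -
 have rr: "0 <= r" "r < R" "r + \<delta> <= \<rho> j" "0 < j ==> \<rho> (j - 1) + \<delta> <= r" using r by (auto simp: in_phase_def)
 have "\<bar>\<phi> r - real j * pi\<bar> <= pi / 2 \<and> cmin \<delta> <= (- 1) ^ j * cos (\<phi> r)"
 proof (cases "r < r0")
  case True
  have "j = 0" using rr(4) rho_ge[of "j - 1"] True \<delta> by force
  moreover have "1 / 3 <= cos (\<phi> r)"
   using O.cos_initial[OF initial(4,5,1,3)[OF rr(1) less_imp_le[OF True]]] .
  ultimately show ?thesis
   using initial(4,5)[of r] rr True by (simp add: cmin_def)
 next
  case False
  define \<eta> where "\<eta> = min (a / 4 * \<delta>) (pi / 2)"
  have \<eta>: "0 <= \<eta>" "\<eta> <= a / 4 * \<delta>" "\<eta> <= pi / 2" using \<delta> a_pos by (auto simp: \<eta>_def)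
  define y where "y = \<phi> r - real j * pi"
  have "y <= pi / 2 - \<eta>" using phi_before[OF j _ rr(2) \<delta> rr(3)] False \<eta>(2) by (simp add: y_def)
  moreover have "- (pi / 2 - \<eta>) <= y"
  proof (cases "j = 0")
   case True
   then show ?thesis using phi_nonneg[OF rr(1,2)] \<eta>(3) by (simp add: y_def)
  next
   case False
   then have "pi / 2 + real (j - 1) * pi + a / 4 * \<delta> <= \<phi> r"
    using j by (intro phi_after rr \<delta>) auto
   moreover have "real (j - 1) * pi = real j * pi - pi" using False by (simp add: of_nat_diff left_diff_distrib)
   ultimately show ?thesis using \<eta>(2) by (simp add: y_def)
  qed
  ultimately have y: "\<bar>y\<bar> <= pi / 2 - \<eta>" by linarith
  have "sin \<eta> = cos (pi / 2 - \<eta>)" by (simp add: cos_diff)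
  also have "\<dots> <= cos \<bar>y\<bar>" using y \<eta> by (intro cos_monotone_0_pi_le) auto
  also have "\<dots> = (- 1) ^ j * cos (\<phi> r)" using cos_half_turns[of j y] by (simp add: y_def)
  finally have "cmin \<delta> <= (- 1) ^ j * cos (\<phi> r)"
   unfolding cmin_def \<eta>_def[symmetric] by (rule min.coboundedI2)
  moreover have "\<bar>\<phi> r - real j * pi\<bar> <= pi / 2" using y \<eta>(1) unfolding y_def by linarith
  ultimately show ?thesis by simp
 qed
 then show "\<bar>\<phi> r - real j * pi\<bar> <= pi / 2" "cmin \<delta> <= (- 1) ^ j * cos (\<phi> r)" by auto
qed

lemma s_phase:
 assumes "j <= 2 * k" "in_phase j \<delta> r" "0 <= \<delta>"
 shows "cmin \<delta> * O.E r <= (- 1) ^ j * s r"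
proof -
 have "r \<in> {0..<R}" using assms(2) by (auto simp: in_phase_def)
 moreover have "cmin \<delta> * O.E r <= ((- 1) ^ j * cos (\<phi> r)) * O.E r"
  using in_phase_phi(2)[OF assms] O.E_pos[of r] by (intro mult_right_mono) auto
 ultimately show ?thesis by (simp add: s_cos mult_ac)
qed

text \<open>Nonnegative energy gives \<open>s powr p <= b * E\<close>. Combined with
  \<open>F p s * s = p * s powr p\<close> and \<open>s >= cmin \<delta> * E\<close> it bounds
  \<open>F\<close>; combined with the latter alone it bounds \<open>E\<close> from below, by a
  quantity tending to \<open>1 / b\<close> as \<open>p\<close> tends to 0.\<close>

lemma positive_phase:
 assumes i: "i <= k" and r: "in_phase (2 * i) \<delta> r" and \<delta>: "0 < \<delta>"
 shows "F p (s r) <= p * (b / cmin \<delta>)" and "exp ((p * ln (cmin \<delta>) - ln b) / (1 - p)) <= O.E r"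
  and "0 <= (- 1) ^ i * snd (w r)" and "O.E r <= 2 * (snd (w r))\<^sup>2"
proof -
 have j: "2 * i <= 2 * k" using i by simp
 note ph = in_phase_phi[OF j r less_imp_le[OF \<delta>]]
 have rI: "r \<in> {0..<R}" using r by (auto simp: in_phase_def)
 have c: "0 < cmin \<delta>" "cmin \<delta> <= cos (\<phi> r)" using cmin_pos[OF \<delta>] ph(2) by auto
 have sp: "s r = O.E r * cos (\<phi> r)" "0 < s r" using s_cos[OF rI] c O.E_pos[of r] by auto
 have G: "s r powr p <= b * O.E r"
 proof -
  have "O.G r = s r powr p" using sp by (simp add: O.G_def O.E_def Gp_pos)
  moreover have "O.E r * wt (\<phi> r) <= O.E r * b" using wt_bounds(2) O.E_pos[of r] by (intro mult_left_mono) auto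
  ultimately show ?thesis using h_nonneg[OF rI] by (simp add: O.h_def mult.commute)
 qed
 have "F p (s r) * (O.E r * cmin \<delta>) <= F p (s r) * s r"
  using F_nonneg[OF p(1)] c O.E_pos[of r] unfolding sp(1) by (intro mult_left_mono) auto
 also have "\<dots> = p * s r powr p" using sp(2) by (simp add: F_mult_eq_Gp Gp_pos)
 also have "\<dots> <= p * (b * O.E r)" using G p by (intro mult_left_mono) auto
 finally have "(F p (s r) * cmin \<delta>) * O.E r <= (p * b) * O.E r" by (simp add: mult_ac)
 then have "F p (s r) * cmin \<delta> <= p * b" using O.E_pos[of r] by (simp add: mult_le_cancel_right)
 then show "F p (s r) <= p * (b / cmin \<delta>)" using c by (simp add: field_simps)
 have "p * (ln (cmin \<delta>) + ln (O.E r)) <= p * ln (s r)"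
 proof -
  have "ln (cmin \<delta>) + ln (O.E r) = ln (cmin \<delta> * O.E r)" using c O.E_pos[of r] by (simp add: ln_mult)
  also have "\<dots> <= ln (s r)" using c O.E_pos[of r] unfolding sp(1) by (subst ln_le_cancel_iff) (auto simp: mult.commute)
  finally show ?thesis using p by (intro mult_left_mono) auto
 qed
 also have "p * ln (s r) = ln (s r powr p)" using sp(2) by (simp add: ln_powr)
 also have "\<dots> <= ln (b * O.E r)" using G sp(2) b_pos O.E_pos[of r] by (subst ln_le_cancel_iff) auto
 also have "\<dots> = ln b + ln (O.E r)" using b_pos O.E_pos[of r] by (simp add: ln_mult)
 finally have "p * ln (cmin \<delta>) - ln b <= (1 - p) * l r" by (simp add: O.E_def algebra_simps)
 then have "(p * ln (cmin \<delta>) - ln b) / (1 - p) <= l r" using p1 by (simp add: field_simps)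
 then show "exp ((p * ln (cmin \<delta>) - ln b) / (1 - p)) <= O.E r" by (simp add: O.E_def)
 have half: "\<phi> r / 2 = (\<phi> r - real (2 * i) * pi) / 2 + real i * pi" by (simp add: diff_divide_distrib)
 have "0 <= cos ((\<phi> r - real (2 * i) * pi) / 2)"
 proof -
  define y where "y = \<phi> r - real (2 * i) * pi"
  have y: "\<bar>y\<bar> <= pi / 2" using ph(1) by (simp only: y_def)
  have "0 <= cos (y / 2)" by (rule cos_ge_zero) (use y pi_gt_zero in linarith)+
  then show ?thesis by (simp only: y_def)
 qed
 also have "\<dots> = (- 1) ^ i * cos (\<phi> r / 2)" unfolding half by (simp add: cos_half_turns)
 finally have "0 <= (- 1) ^ i * cos (\<phi> r / 2)" .
 from mult_nonneg_nonneg[OF exp_ge_zero this] have "0 <= exp (l r / 2) * ((- 1) ^ i * cos (\<phi> r / 2))" .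
 then show "0 <= (- 1) ^ i * snd (w r)" unfolding uv(2)[OF rI] O.v_def by (simp add: mult_ac)
 show "O.E r <= 2 * (snd (w r))\<^sup>2" using sp(2) E_w[OF rI] by (simp add: minkowski_def case_prod_beta)
qed

text \<open>An inequality of Harnack type with a constant independent of \<open>p\<close>: inside a
  negative phase the amplitude is either small everywhere or nowhere. This is the source of the
  alternative \<open>z j = 0\<close> in the limit.\<close>

lemma ratio_negative:
 assumes j: "j <= 2 * k" "odd j" and r: "in_phase j \<delta> r" "in_phase j \<delta> t" and \<delta>: "0 < \<delta>"
 shows "O.E r <= exp (pi / cmin \<delta> + Kg * Rm k) * O.E t"
proof -
 have *: "\<bar>l d - l c\<bar> <= pi / cmin \<delta> + Kg * Rm k" if "c <= d" "in_phase j \<delta> c" "in_phase j \<delta> d" for c d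
 proof -
  have cd: "0 <= c" "c < R" "d < R" "\<rho> (j - 1) + \<delta> <= c" "d + \<delta> <= \<rho> j"
   using that j(2) by (auto simp: in_phase_def odd_pos)
  have c0: "r0 <= c" using cd(4) rho_ge[of "j - 1"] \<delta> by simp
  have "\<bar>l d - l c\<bar> <= (\<phi> d - \<phi> c) / cmin \<delta> + Kg * (d - c)"
  proof (rule log_ratio[OF c0 that(1) cd(3) cmin_pos[OF \<delta>]])
   fix t assume "t \<in> {c..d}"
   then have "in_phase j \<delta> t" using that by (auto simp: in_phase_def)
   from in_phase_phi(2)[OF j(1) this] show "cos (\<phi> t) <= - cmin \<delta>" using \<delta> j(2) by simp
  qed
  moreover have "\<phi> d - \<phi> c <= pi"
   using in_phase_phi(1)[OF j(1) that(2)] in_phase_phi(1)[OF j(1) that(3)] \<delta> by linarith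
  then have "(\<phi> d - \<phi> c) / cmin \<delta> <= pi / cmin \<delta>" using cmin_pos[OF \<delta>] by (intro divide_right_mono) auto
  moreover have "Kg * (d - c) <= Kg * Rm k" using cd R_le Kg_pos by (intro mult_left_mono) auto
  ultimately show ?thesis by linarith
 qed
 have "l r <= pi / cmin \<delta> + Kg * Rm k + l t"
  using *[of r t] *[of t r] r by (cases "r <= t") auto
 then show ?thesis by (simp add: O.E_def flip: exp_add)
qed

text \<open>Where cos phi is nonnegative, \<open>F\<close> brakes the rotation, so an upper bound
  for the phase speed holds whatever the size of \<open>F\<close>.\<close>

lemma phi_rise:
 assumes cd: "r0 <= c" "c <= d" "d < R" and pos: "!!r. r \<in> {c..d} ==> 0 <= cos (\<phi> r)"
 shows "\<phi> d - \<phi> c <= C2 * (d - c)"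
proof -
 have c0: "0 < c" using cd(1) r0_pos by simp
 have sub: "{c..d} \<subseteq> {0..<R}" using cd c0 by auto
 have "C2 * c - \<phi> c <= C2 * d - \<phi> d"
  using cd(2)
 proof (rule nondecreasing_off_finite[OF S, where g = "\<lambda>r. C2 * r - \<phi> r"])
  show "continuous_on {c..d} (\<lambda>r. C2 * r - \<phi> r)"
   by (intro continuous_intros continuous_on_subset[OF O.cont_phi sub])
  fix r assume r: "r \<in> {c<..<d} - S"
  have rr: "0 < r" "r < R" "r \<notin> S" "r0 <= r" using r cd c0 by auto
  have rI: "r \<in> interior {0..<R} - S" by (rule int_interior) fact+
  show "DERIV (\<lambda>r. C2 * r - \<phi> r) r :> C2 * 1 - (2 * 1 * (wt (\<phi> r) - sin (\<phi> r) / r) - 2 * F p (s r) * cos (\<phi> r))"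
   by (rule DERIV_diff[OF DERIV_cmult[OF DERIV_ident] O.dphi[OF rI]])
  have "\<bar>sin (\<phi> r)\<bar> / r <= 1 / r0" using rr r0_pos by (intro frac_le) auto
  moreover have "\<bar>sin (\<phi> r) / r\<bar> = \<bar>sin (\<phi> r)\<bar> / r" using rr by simp
  ultimately have "- (1 / r0) <= sin (\<phi> r) / r" by linarith
  moreover have "0 <= 2 * F p (s r) * cos (\<phi> r)" using F_nonneg[OF p(1)] pos[of r] r by auto
  moreover have "C2 = 2 * b + 2 * (1 / r0)" by (simp add: C2_def)
  ultimately have "2 * wt (\<phi> r) - 2 * (sin (\<phi> r) / r) - 2 * F p (s r) * cos (\<phi> r) <= C2"
   using wt_bounds(2)[of "\<phi> r"] by linarith
  then show "0 <= C2 * 1 - (2 * 1 * (wt (\<phi> r) - sin (\<phi> r) / r) - 2 * F p (s r) * cos (\<phi> r))"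
   by (simp add: right_diff_distrib)
 qed
 then show ?thesis by (simp add: right_diff_distrib)
qed

lemma quarter_turn:
 assumes cd: "r0 <= c" "c <= d" "d < R" and y: "\<phi> d - \<phi> c = pi / 2"
  and n: "\<phi> c = real i * (2 * pi) \<or> \<phi> d = real i * (2 * pi)"
 shows "c + c1 <= d"
proof -
 have "C2 * c1 <= C2 * (d - c)"
 proof -
  have "\<phi> d - \<phi> c <= C2 * (d - c)"
  proof (rule phi_rise[OF cd])
   fix r assume r: "r \<in> {c..d}"
   then have "\<phi> c <= \<phi> r" "\<phi> r <= \<phi> d" using cd phi_mono by auto
   then have "0 <= cos (\<phi> r - real (2 * i) * pi)" using n y by (intro cos_ge_zero) auto
   also have "\<dots> = cos (\<phi> r)" using cos_half_turns[of "2 * i" "\<phi> r - real (2 * i) * pi"] by simp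
   finally show "0 <= cos (\<phi> r)" .
  qed
  then show ?thesis using y C2_c1 by simp
 qed
 then show ?thesis using C2_pos by (simp add: mult_le_cancel_left)
qed

lemma axis_point:
 assumes "r0 <= c" "c <= d" "d < R" "\<phi> c <= y" "y <= \<phi> d"
 obtains r where "c <= r" "r <= d" "\<phi> r = y"
proof -
 have "continuous_on {c..d} \<phi>" by (rule continuous_on_subset[OF O.cont_phi]) (use assms r0_pos in auto)
 then show thesis using IVT'[of \<phi> c y d] assms that by auto
qed

text \<open>The interval contains the quarter turn that ends on the axis, with cos phi nonnegative.
  Its length is bounded below independently of \<open>p\<close>, so positive intervals cannot vanish
  in the limit; nothing similar is claimed for negative ones.\<close>

lemma rho_gap: assumes i: "i < k" shows "\<rho> (2 * i + 1) + c1 <= \<rho> (2 * i + 2)"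
proof -
 have j: "2 * i + 1 < 2 * k" using i by simp
 obtain e where e: "e \<in> {r0..<R}" "real k * (2 * pi) <= \<phi> e" using passes_axis i by (metis gr_implies_not0 gr0I)
 let ?y = "real (Suc i) * (2 * pi)"
 have y: "\<phi> (\<rho> (2 * i + 1)) = ?y - pi / 2" using rho(3)[OF j] by (simp add: algebra_simps)
 have "?y <= real k * (2 * pi)" using i by (intro mult_right_mono) auto
 then have ye: "?y <= \<phi> e" by (rule order_trans) (rule e(2))
 have ce: "\<rho> (2 * i + 1) <= e"
 proof (rule ccontr)
  assume "\<not> \<rho> (2 * i + 1) <= e"
  then have "\<phi> e <= \<phi> (\<rho> (2 * i + 1))" using e(1) rho(2)[OF j] by (intro phi_mono) auto
  then show False using y ye pi_gt_zero by linarith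
 qed
 obtain r where r: "\<rho> (2 * i + 1) <= r" "r <= e" "\<phi> r = ?y"
  by (rule axis_point[OF rho(1)[OF j] ce, of ?y]) (use e y ye in auto)
 have "\<rho> (2 * i + 1) + c1 <= r"
  by (rule quarter_turn[OF rho(1)[OF j] r(1), of "Suc i"]) (use r e y in auto)
 moreover have "r <= \<rho> (2 * i + 2)"
 proof (cases "2 * i + 2 < 2 * k")
  case True
  have "\<phi> (\<rho> (2 * i + 2)) = ?y + pi / 2" using rho(3)[OF True] by (simp add: algebra_simps)
  then show ?thesis using phi_mono[of "\<rho> (2 * i + 2)" r] rho[OF True] r e(1) pi_gt_zero by force
 next
  case False
  then have "2 * i + 2 = 2 * k" using i by simp
  then show ?thesis using rho_last r e(1) by simp
 qed
 ultimately show ?thesis by simp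
qed

text \<open>Within distance \<open>c1\<close> of a negative phase the orbit has not yet left the
  adjacent quarter turns. There \<open>u\<close> keeps one sign, as \<open>v_jump\<close>
  requires.\<close>

lemma zone:
 assumes i: "i < k" and r: "0 <= r" "r < R" "\<rho> (2 * i) - c1 <= r" "r <= \<rho> (2 * i + 1) + c1"
 shows "real i * (2 * pi) <= \<phi> r" "\<phi> r <= real i * (2 * pi) + 2 * pi"
proof -
 have j: "2 * i < 2 * k" "2 * i + 1 < 2 * k" using i by auto
 have y: "\<phi> (\<rho> (2 * i)) = real i * (2 * pi) + pi / 2" "\<phi> (\<rho> (2 * i + 1)) = real i * (2 * pi) + 2 * pi - pi / 2"
  using rho(3)[OF j(1)] rho(3)[OF j(2)] by (simp_all add: algebra_simps)
 show "real i * (2 * pi) <= \<phi> r"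
 proof (rule ccontr)
  assume lt: "\<not> real i * (2 * pi) <= \<phi> r"
  then have "i \<noteq> 0" using phi_nonneg[OF r(1,2)] by (cases i) auto
  then have "\<rho> (2 * (i - 1) + 1) + c1 <= \<rho> (2 * (i - 1) + 2)" using i by (intro rho_gap) auto
  moreover have "2 * (i - 1) + 2 = 2 * i" using \<open>i \<noteq> 0\<close> by simp
  ultimately have "\<rho> (2 * (i - 1) + 1) + c1 <= \<rho> (2 * i)" by simp
  then have r0: "r0 <= r" using rho_ge[of "2 * (i - 1) + 1"] r(3) by simp
  have rc: "r <= \<rho> (2 * i)" using phi_mono[of "\<rho> (2 * i)" r] rho(1)[OF j(1)] r(2) y(1) lt pi_gt_zero by force
  obtain t where t: "r <= t" "t <= \<rho> (2 * i)" "\<phi> t = real i * (2 * pi)"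
   by (rule axis_point[OF r0 rc rho(2)[OF j(1)], of "real i * (2 * pi)"]) (use y lt in auto)
  have "t + c1 <= \<rho> (2 * i)"
   by (rule quarter_turn[OF _ t(2) rho(2)[OF j(1)], of i]) (use t r0 y in auto)
  then have "t = r" using t r(3) by linarith
  then show False using t lt by simp
 qed
 show "\<phi> r <= real i * (2 * pi) + 2 * pi"
 proof (rule ccontr)
  assume lt: "\<not> \<phi> r <= real i * (2 * pi) + 2 * pi"
  have rc: "\<rho> (2 * i + 1) <= r"
  proof (rule ccontr)
   assume c: "\<not> \<rho> (2 * i + 1) <= r"
   show False
   proof (cases "r0 <= r")
    case True
    have "\<phi> r <= \<phi> (\<rho> (2 * i + 1))" using rho(2)[OF j(2)] c by (intro phi_mono True) auto
    then show False using y(2) lt pi_gt_zero by linarith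
   next
    case False
    have "0 <= real i * (2 * pi)" by simp
    moreover have "\<phi> r < pi / 2" using initial(5)[of r] r(1) False by simp
    ultimately show False using lt pi_gt_zero by linarith
   qed
  qed
  obtain t where t: "\<rho> (2 * i + 1) <= t" "t <= r" "\<phi> t = real i * (2 * pi) + 2 * pi"
   by (rule axis_point[OF rho(1)[OF j(2)] rc r(2), of "real i * (2 * pi) + 2 * pi"]) (use y lt in auto)
  have "\<rho> (2 * i + 1) + c1 <= t"
   by (rule quarter_turn[OF rho(1)[OF j(2)] t(1), of "Suc i"]) (use t r y in \<open>auto simp: algebra_simps\<close>)
  then have "t = r" using t r(4) by linarith
  then show False using t lt by simp
 qed
qed

lemma uv_bounds:
 assumes "0 <= r" "r < R"
 shows "\<bar>fst (w r)\<bar> <= sqrt (M k)" "\<bar>snd (w r)\<bar> <= sqrt (M k)"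
  and "\<bar>fst (w r)\<bar> / r <= sqrt (M k) * (1 / r0 + a / 2)"
proof -
 have E: "(fst (w r))\<^sup>2 + (snd (w r))\<^sup>2 <= M k" using E_le[OF assms] E_w[of r] assms by simp
 then have "(fst (w r))\<^sup>2 <= M k" "(snd (w r))\<^sup>2 <= M k"
  using zero_le_power2[of "fst (w r)"] zero_le_power2[of "snd (w r)"] by linarith+
 then show u: "\<bar>fst (w r)\<bar> <= sqrt (M k)" and v: "\<bar>snd (w r)\<bar> <= sqrt (M k)"
  by (metis real_sqrt_abs real_sqrt_le_iff)+
 have s0: "0 <= sqrt (M k)" using M_pos[of k] by simp
 show "\<bar>fst (w r)\<bar> / r <= sqrt (M k) * (1 / r0 + a / 2)"
 proof (cases "r <= r0")
  case True
  \<comment> \<open>Near the centre \<open>u / r\<close> is bounded because \<open>u = q * v\<close>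
    and \<open>q <= a / 2 * r\<close>.\<close>
  have q: "0 <= O.q r" "O.q r <= a / 2 * r" "0 <= \<phi> r" "\<phi> r < pi / 2" using initial[OF assms(1) True] by auto
  have "0 < cos (\<phi> r / 2)" using q pi_gt_zero by (intro cos_half_pos) auto
  then have "fst (w r) = O.q r * snd (w r)"
   using uv[of r] assms by (simp add: O.u_def O.v_def O.q_def tan_def)
  then have "\<bar>fst (w r)\<bar> <= (a / 2 * r) * sqrt (M k)"
   using mult_mono[OF q(2) v] q by (simp add: abs_mult)
  then have "\<bar>fst (w r)\<bar> / r <= (a / 2) * sqrt (M k)"
   using assms(1) a_pos s0 by (cases "r = 0") (auto simp: field_simps)
  moreover have "0 <= sqrt (M k) * (1 / r0)" using s0 r0_pos by simp
  ultimately show ?thesis by (simp add: distrib_left mult.commute)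
 next
  case False
  then have "\<bar>fst (w r)\<bar> / r <= sqrt (M k) / r0" using u r0_pos s0 by (intro frac_le) auto
  moreover have "0 <= sqrt (M k) * (a / 2)" using s0 a_pos by simp
  ultimately show ?thesis by (simp add: distrib_left)
 qed
qed

text \<open>After removing \<open>i\<close> revolutions \<open>u\<close> is nonnegative throughout
  the zone, so \<open>v_jump\<close> applies; the sign \<open>(- 1) ^ i\<close> disappears with the
  absolute value.\<close>

lemma v_jump_zone:
 assumes i: "i < k" and st: "0 <= c" "c <= d" "d < R" "\<rho> (2 * i) - c1 <= c" "d <= \<rho> (2 * i + 1) + c1"
 shows "\<bar>Gp p (s d) - Gp p (s c)\<bar> <= 4 * Mv k * \<bar>snd (w c) - snd (w d)\<bar>"
proof -
 interpret Q: orbit m \<Omega> p "{0..<R}" S "\<lambda>t. t" "\<lambda>_. 1" "\<lambda>t. F p (minkowski (w t))" l "\<lambda>t. \<phi> t - of_nat i * (2 * pi)"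
  by (rule O.orbit_shift)
 have half: "\<phi> r / 2 = (\<phi> r - of_nat i * (2 * pi)) / 2 + real i * pi" for r by (simp add: diff_divide_distrib)
 have sgn: "((- 1) ^ i * (- 1) ^ i :: real) = 1" by (simp flip: power_mult_distrib)
 have Qv: "Q.v r = (- 1) ^ i * snd (w r)" and Qu: "Q.u r = (- 1) ^ i * fst (w r)" if "r \<in> {0..<R}" for r
  unfolding uv[OF that] Q.v_def Q.u_def O.v_def O.u_def half[of r] using sgn
  by (simp_all add: cos_add sin_add cos_npi sin_npi)
 have QG: "Q.G r = Gp p (s r)" if "r \<in> {0..<R}" for r
 proof -
  have "cos (\<phi> r - of_nat i * (2 * pi)) = cos (\<phi> r)"
   using cos_half_turns[of "2 * i" "\<phi> r - real (2 * i) * pi"] by (simp add: mult_ac)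
  then show ?thesis by (simp only: Q.G_def s_cos[OF that] O.E_def)
 qed
 have I: "c \<in> {0..<R}" "d \<in> {0..<R}" using st by auto
 have "\<bar>Q.G d - Q.G c\<bar> / (4 * Mv k) <= Q.v c - Q.v d"
 proof (rule Q.v_jump[OF I st(2) Mv_pos])
  fix r assume r: "r \<in> {c<..<d} - S"
  then have rr: "0 <= r" "r < R" "\<rho> (2 * i) - c1 <= r" "r <= \<rho> (2 * i + 1) + c1" using st by auto
  have "0 <= sin ((\<phi> r - of_nat i * (2 * pi)) / 2)" using zone[OF i rr] by (intro sin_ge_zero) auto
  then show "0 <= Q.u r" by (simp add: Q.u_def)
  have rI: "r \<in> {0..<R}" using rr by simp
  have "\<bar>\<Omega> * Q.v r - Q.u r / r\<bar> = \<bar>\<Omega> * snd (w r) - fst (w r) / r\<bar>"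
  proof -
   have "\<Omega> * Q.v r - Q.u r / r = (- 1) ^ i * (\<Omega> * snd (w r) - fst (w r) / r)"
    unfolding Qv[OF rI] Qu[OF rI] by (simp add: algebra_simps)
   then show ?thesis by (simp add: abs_mult)
  qed
  also have "\<dots> <= \<bar>\<Omega> * snd (w r)\<bar> + \<bar>fst (w r) / r\<bar>" by (rule abs_triangle_ineq4)
  also have "\<bar>\<Omega> * snd (w r)\<bar> <= \<Omega> * sqrt (M k)"
   using uv_bounds(2)[OF rr(1,2)] Om_pos by (simp add: abs_mult mult_left_mono)
  also have "\<bar>fst (w r) / r\<bar> <= sqrt (M k) * (1 / r0 + a / 2)"
   using uv_bounds(3)[OF rr(1,2)] rr(1) by (simp add: abs_divide)
  finally show "\<bar>\<Omega> * Q.v r - Q.u r / r\<bar> <= Mv k" by (simp add: Mv_def algebra_simps)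
 qed
 also have "\<dots> = (- 1) ^ i * (snd (w c) - snd (w d))" unfolding Qv[OF I(1)] Qv[OF I(2)] by (simp add: right_diff_distrib)
 also have "\<dots> <= \<bar>(- 1) ^ i * (snd (w c) - snd (w d))\<bar>" by (rule abs_ge_self)
 also have "\<dots> = \<bar>snd (w c) - snd (w d)\<bar>" by (simp add: abs_mult)
 finally show ?thesis unfolding QG[OF I(1)] QG[OF I(2)] using Mv_pos[of k] by (simp add: field_simps)
qed

text \<open>The constant does not depend on \<open>p\<close>, since \<open>F\<close> is absent from
  the derivative of \<open>s\<close>. In the limit this makes \<open>minkowski\<close> of the limit
  function continuous although its components jump.\<close>

lemma s_lipschitz:
 assumes "0 <= c" "c <= d" "d <= R"
 shows "\<bar>s d - s c\<bar> <= Ls k * (d - c)"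
proof -
 have bd: "\<bar>4 * fst (w r) * (fst (w r) / r - \<Omega> * snd (w r))\<bar> <= Ls k" if "0 <= r" "r < R" for r
 proof -
  have M: "sqrt (M k) * sqrt (M k) = M k" using M_pos[of k] by simp
  have "\<bar>fst (w r) / r - \<Omega> * snd (w r)\<bar> <= \<bar>fst (w r) / r\<bar> + \<bar>\<Omega> * snd (w r)\<bar>" by (rule abs_triangle_ineq4)
  also have "\<bar>fst (w r) / r\<bar> <= sqrt (M k) * (1 / r0 + a / 2)"
   using uv_bounds(3)[OF that] that(1) by (simp add: abs_divide)
  also have "\<bar>\<Omega> * snd (w r)\<bar> <= \<Omega> * sqrt (M k)"
   using uv_bounds(2)[OF that] Om_pos by (simp add: abs_mult mult_left_mono)
  finally have "\<bar>fst (w r) / r - \<Omega> * snd (w r)\<bar> <= sqrt (M k) * (\<Omega> + 1 / r0 + a / 2)" by (simp add: algebra_simps)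
  then have "\<bar>4 * fst (w r)\<bar> * \<bar>fst (w r) / r - \<Omega> * snd (w r)\<bar>
   <= (4 * sqrt (M k)) * (sqrt (M k) * (\<Omega> + 1 / r0 + a / 2))"
   using uv_bounds(1)[OF that] M_pos[of k] by (intro mult_mono) auto
  also have "\<dots> = 4 * (sqrt (M k) * sqrt (M k)) * (\<Omega> + 1 / r0 + a / 2)" by simp
  finally show ?thesis by (simp only: M Ls_def abs_mult)
 qed
 have cs: "continuous_on {c..d} s"
  by (intro continuous_on_minkowski continuous_on_subset[OF cont]) (use assms in auto)
 have ds: "DERIV s r :> 4 * fst (w r) * (fst (w r) / r - \<Omega> * snd (w r))"
  if "r \<in> {c<..<d} - S" for r by (rule DERIV_minkowski[OF dw]) (use that assms in auto)
 have "\<bar>s d - s c\<bar> <= Ls k * d - Ls k * c"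
 proof (rule increment_bound_off_finite[OF S assms(2) cs _ ds, where h = "\<lambda>r. Ls k * r"])
  show "DERIV (\<lambda>r. Ls k * r) r :> Ls k * 1" for r by (rule DERIV_cmult[OF DERIV_ident])
  show "\<bar>4 * fst (w r) * (fst (w r) / r - \<Omega> * snd (w r))\<bar> <= Ls k * 1" if "r \<in> {c<..<d} - S" for r
   using bd[of r] that assms by simp
 qed (intro continuous_intros)
 then show ?thesis by (simp add: right_diff_distrib)
qed

lemma s_rho: assumes "j <= 2 * k" shows "s (\<rho> j) = 0"
proof (cases "j < 2 * k")
 case True
 have "cos (\<phi> (\<rho> j)) = (- 1) ^ j * ((- 1) ^ j * cos (pi / 2 + real j * pi))"
  using rho(3)[OF True] by (simp flip: power_mult_distrib mult.assoc)
 then have "cos (\<phi> (\<rho> j)) = 0" by (simp add: cos_half_turns)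
 then show ?thesis using s_cos[of "\<rho> j"] rho[OF True] r0_pos by simp
next
 case False
 then have "\<rho> j = R" by (simp add: \<rho>_def)
 then show ?thesis using R(2) by (simp add: minkowski_def zero_prod_def)
qed

end

section \<open>The limit of vanishing exponent\<close>

lemma gronwall_forward:
 fixes N N' :: "real => real"
 assumes S: "finite S" and cd: "c <= d" and N: "continuous_on {c..d} N"
  and dN: "!!r. r \<in> {c<..<d} - S ==> DERIV N r :> N' r"
  and bd: "!!r. r \<in> {c<..<d} - S ==> N' r <= K * N r + \<eta>" and K: "0 <= K" "0 <= \<eta>"
 shows "N d <= (N c + \<eta> * (d - c)) * exp (K * (d - c))"
proof -
 define g where "g r = exp (- (K * (r - c)))" for r
 have dg: "DERIV g r :> g r * (- (K * (1 - 0)))" for r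
  unfolding g_def by (rule DERIV_fun_exp[OF DERIV_minus[OF DERIV_cmult[OF DERIV_diff[OF DERIV_ident DERIV_const]]]])
 have cg: "continuous_on {c..d} g" unfolding g_def by (intro continuous_intros)
 have "\<eta> * c - N c * g c <= \<eta> * d - N d * g d"
 proof (rule nondecreasing_off_finite[OF S cd, where g = "\<lambda>r. \<eta> * r - N r * g r"])
  show "continuous_on {c..d} (\<lambda>r. \<eta> * r - N r * g r)" by (intro continuous_intros N cg)
  fix r assume r: "r \<in> {c<..<d} - S"
  show "DERIV (\<lambda>r. \<eta> * r - N r * g r) r :> \<eta> * 1 - (N' r * g r + g r * (- (K * (1 - 0))) * N r)"
   by (rule DERIV_diff[OF DERIV_cmult[OF DERIV_ident] DERIV_mult[OF dN[OF r] dg]])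
  have g: "0 <= g r" "g r <= 1" using r K by (auto simp: g_def)
  have "g r * (N' r - K * N r) <= g r * \<eta>" using bd[OF r] g by (intro mult_left_mono) auto
  also have "\<dots> <= 1 * \<eta>" using g K by (intro mult_right_mono) auto
  finally show "0 <= \<eta> * 1 - (N' r * g r + g r * (- (K * (1 - 0))) * N r)" by (simp add: algebra_simps)
 qed
 then have "N d * g d <= N c + \<eta> * (d - c)" by (simp add: g_def right_diff_distrib)
 then have "N d * g d * exp (K * (d - c)) <= (N c + \<eta> * (d - c)) * exp (K * (d - c))"
  by (rule mult_right_mono) simp
 moreover have "g d * exp (K * (d - c)) = 1" by (simp add: g_def flip: exp_add)
 ultimately show ?thesis by (simp add: mult.assoc)
qed

lemma gronwall_backward:
 fixes N N' :: "real => real"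
 assumes S: "finite S" and cd: "c <= d" and N: "continuous_on {c..d} N"
  and dN: "!!r. r \<in> {c<..<d} - S ==> DERIV N r :> N' r"
  and bd: "!!r. r \<in> {c<..<d} - S ==> - N' r <= K * N r + \<eta>" and K: "0 <= K" "0 <= \<eta>"
 shows "N c <= (N d + \<eta> * (d - c)) * exp (K * (d - c))"
proof -
 have "N (- (- c)) <= (N (- (- d)) + \<eta> * (- c - - d)) * exp (K * (- c - - d))"
 proof (rule gronwall_forward[where N = "\<lambda>r. N (- r)" and N' = "\<lambda>r. N' (- r) * (- 1)" and S = "uminus ` S"])
  show "continuous_on {- d..- c} (\<lambda>r. N (- r))"
   by (rule continuous_on_compose2[OF N]) (auto intro!: continuous_intros)
  fix r assume r: "r \<in> {- d<..<- c} - uminus ` S"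
  then have r': "- r \<in> {c<..<d} - S" by (auto simp: image_iff)
  show "DERIV (\<lambda>r. N (- r)) r :> N' (- r) * (- 1)"
   by (rule DERIV_chain2[OF dN[OF r'] DERIV_minus[OF DERIV_ident]])
  show "N' (- r) * (- 1) <= K * N (- r) + \<eta>" using bd[OF r'] by simp
 qed (use S cd K in auto)
 then show ?thesis by simp
qed

section \<open>Free Dirac solutions and their distance from nodal solutions\<close>

context frequency
begin

definition Dv :: "real => real => real => real" where
 "Dv c e r = (c * sin (\<kappa> * r) + e * cos (\<kappa> * r)) / r"

text \<open>Obtained from the second equation, \<open>u = - v' / b\<close>, with
  \<open>v = g / r\<close> and \<open>g = c sin + e cos\<close>.\<close>

definition Du :: "real => real => real => real" where
 "Du c e r = (Dv c e r - \<kappa> * (c * cos (\<kappa> * r) - e * sin (\<kappa> * r))) / (b * r)"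

text \<open>The substitution \<open>g = r v\<close> turns the free Dirac system into \<open>g'' = - \<kappa>\<^sup>2 g\<close>.\<close>

definition D :: "real => real => real => real \<times> real" where
 "D c e r = (Du c e r, Dv c e r)"

lemma has_vector_derivative_D:
 assumes r: "0 < r"
 shows "(D c e has_vector_derivative dirac_field m \<Omega> r (D c e r)) (at r)"
proof -
 define n where "n r = c * sin (\<kappa> * r) + e * cos (\<kappa> * r)" for r
 define d where "d r = \<kappa> * (c * cos (\<kappa> * r) - e * sin (\<kappa> * r))" for r
 have dn: "DERIV n r :> d r"
  unfolding n_def[abs_def] d_def by (auto intro!: derivative_eq_intros simp: algebra_simps)
 have dd: "DERIV d r :> - (a * b) * n r"
  unfolding n_def d_def[abs_def] kappa_sq[symmetric]
  by (auto intro!: derivative_eq_intros simp: algebra_simps power2_eq_square)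
 have v: "DERIV (Dv c e) r :> (d r * r - n r * 1) / (r * r)"
  using DERIV_divide[OF dn DERIV_ident] r by (simp add: Dv_def[abs_def] n_def)
 have br: "b * r \<noteq> 0" using b_pos r by simp
 have "DERIV (\<lambda>r. (Dv c e r - d r) / (b * r)) r :> (((d r * r - n r * 1) / (r * r) - (- (a * b) * n r)) * (b * r) - (Dv c e r - d r) * (b * 1)) / (b * r * (b * r))"
  by (rule DERIV_divide[OF DERIV_diff[OF v dd] DERIV_cmult[OF DERIV_ident] br])
 then have u: "DERIV (Du c e) r :> (((d r * r - n r * 1) / (r * r) - (- (a * b) * n r)) * (b * r) - (Dv c e r - d r) * (b * 1)) / (b * r * (b * r))"
  by (simp add: Du_def[abs_def] d_def)
 define V where "V = Dv c e r"
 define U where "U = Du c e r"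
 have nr: "n r = r * V" using r by (simp add: V_def Dv_def n_def)
 have dr: "d r = V - b * r * U" using br by (simp add: V_def U_def Du_def d_def)
 have q: "(d r * r - n r * 1) / (r * r) = - U * b" unfolding nr dr using r by (simp add: algebra_simps)
 have "(- U * b - (- (a * b) * n r)) * (b * r) - (V - d r) * (b * 1) = (V * a - 2 * U / r) * (b * r * (b * r))"
  unfolding nr dr using r by (simp add: algebra_simps)
 then have e1: "(((d r * r - n r * 1) / (r * r) - (- (a * b) * n r)) * (b * r) - (Dv c e r - d r) * (b * 1)) / (b * r * (b * r))
  = Dv c e r * a - 2 * Du c e r / r"
  unfolding q V_def[symmetric] U_def[symmetric] using br by (simp add: nonzero_divide_eq_eq)
 have e2: "(d r * r - n r * 1) / (r * r) = - Du c e r * b" using q by (simp add: U_def)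
 show ?thesis
  using has_vector_derivative_Pair[OF u[unfolded e1 has_real_derivative_iff_has_vector_derivative]
   v[unfolded e2 has_real_derivative_iff_has_vector_derivative]]
  by (simp add: D_def[abs_def] dirac_field_def a_def b_def)
qed

lemma D_through: assumes \<beta>: "0 < \<beta>" obtains c e where "D c e \<beta> = z"
proof -
 define g where "g = \<beta> * snd z"
 define h where "h = snd z - b * \<beta> * fst z"
 define s where "s = sin (\<kappa> * \<beta>)"
 define t where "t = cos (\<kappa> * \<beta>)"
 define q where "q = h / \<kappa>"
 \<comment> \<open>The values of \<open>g\<close> and \<open>g' / \<kappa>\<close> at
   \<open>\<beta>\<close> arise from \<open>(e, c)\<close> by a rotation through the angle
   \<open>\<kappa> * \<beta>\<close>, which is inverted here.\<close>
 define c where "c = g * s + q * t"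
 define e where "e = g * t - q * s"
 have st: "s\<^sup>2 + t\<^sup>2 = 1" by (simp add: s_def t_def)
 have "c * s + e * t = g * (s\<^sup>2 + t\<^sup>2)" "c * t - e * s = q * (s\<^sup>2 + t\<^sup>2)"
  unfolding c_def e_def by (simp_all add: algebra_simps power2_eq_square)
 then have cs: "c * s + e * t = g" "c * t - e * s = q" by (simp_all only: st mult_1_right)
 have 1: "Dv c e \<beta> = snd z" unfolding Dv_def s_def[symmetric] t_def[symmetric] cs g_def using \<beta> by simp
 have "\<kappa> * (c * cos (\<kappa> * \<beta>) - e * sin (\<kappa> * \<beta>)) = h"
  unfolding s_def[symmetric] t_def[symmetric] cs q_def using kappa_pos by simp
 then have "Du c e \<beta> = fst z" unfolding Du_def 1 h_def using \<beta> b_pos by simp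
 then show thesis by (intro that[of c e]) (simp add: D_def 1)
qed

text \<open>The choice \<open>e = 0\<close> removes the part of \<open>v\<close> that is singular at
  the centre, and \<open>c = x / \<kappa>\<close> gives the central value \<open>x\<close>. The last
  two limits are the one-sided derivatives at 0.\<close>

lemma D_at_origin:
 shows "(Dv (x / \<kappa>) 0 \<longlongrightarrow> x) (at_right 0)" and "(Du (x / \<kappa>) 0 \<longlongrightarrow> 0) (at_right 0)"
  and "((\<lambda>r. Du (x / \<kappa>) 0 r / r) \<longlongrightarrow> a * x / 3) (at_right 0)"
  and "((\<lambda>r. (Dv (x / \<kappa>) 0 r - x) / r) \<longlongrightarrow> 0) (at_right 0)"
proof -
 note k = kappa_pos
 have sinc: "((\<lambda>r. sin (\<kappa> * r) / (\<kappa> * r)) \<longlongrightarrow> 1) (at_right 0)" using k by real_asymp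
 have q: "((\<lambda>r. (sin (\<kappa> * r) / (\<kappa> * r) - cos (\<kappa> * r)) / r\<^sup>2) \<longlongrightarrow>
   \<kappa> * \<kappa> / 2 - \<kappa> * (\<kappa> * \<kappa>) * inverse \<kappa> / 6) (at_right 0)" using k by real_asymp
 have q3: "\<kappa> * \<kappa> / 2 - \<kappa> * (\<kappa> * \<kappa>) * inverse \<kappa> / 6 = \<kappa>\<^sup>2 / 3"
  using k by (simp add: field_simps power2_eq_square)
 have q': "((\<lambda>r. (sin (\<kappa> * r) / (\<kappa> * r) - 1) / r) \<longlongrightarrow> 0) (at_right 0)" using k by real_asymp
 have v: "Dv (x / \<kappa>) 0 r = x * (sin (\<kappa> * r) / (\<kappa> * r))" for r by (simp add: Dv_def)
 have u: "Du (x / \<kappa>) 0 r = x / b * ((sin (\<kappa> * r) / (\<kappa> * r) - cos (\<kappa> * r)) / r)" for r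
  using k b_pos by (simp add: Du_def v right_diff_distrib diff_divide_distrib)
 have vf: "Dv (x / \<kappa>) 0 = (\<lambda>r. x * (sin (\<kappa> * r) / (\<kappa> * r)))" by (rule ext) (rule v)
 have "((\<lambda>r. x * (sin (\<kappa> * r) / (\<kappa> * r))) \<longlongrightarrow> x * 1) (at_right 0)" by (intro tendsto_intros sinc)
 then show "(Dv (x / \<kappa>) 0 \<longlongrightarrow> x) (at_right 0)" unfolding vf by simp
 have ufr: "Du (x / \<kappa>) 0 r / r = x / b * ((sin (\<kappa> * r) / (\<kappa> * r) - cos (\<kappa> * r)) / r\<^sup>2)" for r
  unfolding u power2_eq_square by (simp only: times_divide_eq_right divide_divide_eq_left)
 have lim: "x / b * (\<kappa>\<^sup>2 / 3) = a * x / 3" using b_pos by (simp add: kappa_sq)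
 have "((\<lambda>r. x / b * ((sin (\<kappa> * r) / (\<kappa> * r) - cos (\<kappa> * r)) / r\<^sup>2)) \<longlongrightarrow> x / b * (\<kappa>\<^sup>2 / 3)) (at_right 0)"
  by (intro tendsto_intros q[unfolded q3])
 then show ur: "((\<lambda>r. Du (x / \<kappa>) 0 r / r) \<longlongrightarrow> a * x / 3) (at_right 0)" unfolding ufr lim .
 have "((\<lambda>r. Du (x / \<kappa>) 0 r / r * r) \<longlongrightarrow> a * x / 3 * 0) (at_right 0)" by (intro tendsto_intros ur)
 moreover have "eventually (\<lambda>r. Du (x / \<kappa>) 0 r / r * r = Du (x / \<kappa>) 0 r) (at_right (0::real))"
  using eventually_at_right_less[of "0::real"] by eventually_elim simp
 ultimately have "(Du (x / \<kappa>) 0 \<longlongrightarrow> a * x / 3 * 0) (at_right 0)" by (rule Lim_transform_eventually)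
 then show "(Du (x / \<kappa>) 0 \<longlongrightarrow> 0) (at_right 0)" by (simp only: mult_zero_right)
 have dvr: "(Dv (x / \<kappa>) 0 r - x) / r = x * ((sin (\<kappa> * r) / (\<kappa> * r) - 1) / r)" for r
  unfolding v by (simp add: right_diff_distrib)
 have "((\<lambda>r. x * ((sin (\<kappa> * r) / (\<kappa> * r) - 1) / r)) \<longlongrightarrow> x * 0) (at_right 0)" by (intro tendsto_intros q')
 then show "((\<lambda>r. (Dv (x / \<kappa>) 0 r - x) / r) \<longlongrightarrow> 0) (at_right 0)" unfolding dvr by (simp only: mult_zero_right)
qed

definition gap2 :: "real \<times> real => real \<times> real => real" where
 "gap2 y z = (fst y - fst z)\<^sup>2 + (snd y - snd z)\<^sup>2"

lemma norm_gap2: "norm (y - z) = sqrt (gap2 y z)"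
 by (simp add: norm_prod_def gap2_def)

text \<open>The radial term contributes \<open>- 4 * y^2 / r\<close> with \<open>y\<close> the
  difference of the first components. This helps forwards, so an estimate can start at the centre,
  and costs the rate \<open>4 / r\<close> backwards. The term with \<open>F\<close> enters only
  through its bound \<open>\<epsilon>\<close>.\<close>

lemma DERIV_gap2:
 assumes w: "(w has_vector_derivative soler_field m \<Omega> p r (w r)) (at r)"
  and w0: "(w0 has_vector_derivative dirac_field m \<Omega> r (w0 r)) (at r)"
  and r: "0 < r" and F: "0 <= F p (minkowski (w r))" "F p (minkowski (w r)) <= \<epsilon>" "\<epsilon> <= 1"
  and \<mu>: "(fst (w r))\<^sup>2 + (snd (w r))\<^sup>2 <= \<mu>"
 obtains N' where "DERIV (\<lambda>r. gap2 (w r) (w0 r)) r :> N'"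
  "N' <= (2 * m + 1) * gap2 (w r) (w0 r) + \<epsilon> * \<mu>"
  "- N' <= (2 * m + 1 + 4 / r) * gap2 (w r) (w0 r) + \<epsilon> * \<mu>"
proof -
 define f where "f = F p (minkowski (w r))"
 define y where "y = fst (w r) - fst (w0 r)"
 define z where "z = snd (w r) - snd (w0 r)"
 define u where "u = fst (w r)"
 define v where "v = snd (w r)"
 have eq: "dirac_field m \<Omega> r (w0 r) = (snd (w0 r) * a - 2 * fst (w0 r) / r, - fst (w0 r) * b)"
  by (simp add: dirac_field_def case_prod_beta a_def b_def)
 have d0: "DERIV (\<lambda>r. fst (w0 r)) r :> snd (w0 r) * a - 2 * fst (w0 r) / r"
  "DERIV (\<lambda>r. snd (w0 r)) r :> - fst (w0 r) * b"
  using bounded_linear.has_vector_derivative[OF bounded_linear_fst w0]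
   bounded_linear.has_vector_derivative[OF bounded_linear_snd w0]
  unfolding eq has_real_derivative_iff_has_vector_derivative by simp_all
 note d = soler_derivatives[OF w, folded f_def u_def v_def]
 note dy = DERIV_diff[OF d(1) d0(1)] and dz = DERIV_diff[OF d(2) d0(2)]
 define N' where "N' = - (4 * m * (y * z)) - 4 * y\<^sup>2 / r - f * (2 * (y * v) + 2 * (z * u))"
 have N: "DERIV (\<lambda>r. gap2 (w r) (w0 r)) r :> N'"
  unfolding gap2_def power2_eq_square
  by (rule back_subst[where P = "\<lambda>D. (_ has_real_derivative D) _", OF DERIV_add[OF DERIV_mult[OF dy dy] DERIV_mult[OF dz dz]]])
   (simp add: N'_def y_def z_def u_def v_def a_def b_def power2_eq_square algebra_simps add_divide_distrib diff_divide_distrib)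
 have g: "gap2 (w r) (w0 r) = y\<^sup>2 + z\<^sup>2" by (simp add: gap2_def y_def z_def)
 have p: "\<bar>2 * (s * t)\<bar> <= s\<^sup>2 + t\<^sup>2" for s t :: real
 proof -
  have "0 <= (s - t)\<^sup>2" "0 <= (s + t)\<^sup>2" by simp_all
  then show ?thesis by (simp add: power2_diff power2_sum abs_le_iff)
 qed
 have f: "0 <= f" "f <= \<epsilon>" "f <= 1" using F by (auto simp: f_def)
 have "\<bar>2 * m * (2 * (y * z))\<bar> = 2 * m * \<bar>2 * (y * z)\<bar>" using m_pos by (simp add: abs_mult)
 also have "\<dots> <= 2 * m * (y\<^sup>2 + z\<^sup>2)" using p[of y z] m_pos by (intro mult_left_mono) auto
 finally have 1: "\<bar>4 * m * (y * z)\<bar> <= 2 * m * (y\<^sup>2 + z\<^sup>2)" by simp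
 have "\<bar>2 * (y * v) + 2 * (z * u)\<bar> <= (y\<^sup>2 + z\<^sup>2) + \<mu>" using p[of y v] p[of z u] \<mu> by (simp add: u_def v_def)
 note Q = this
 have "f * (y\<^sup>2 + z\<^sup>2) <= 1 * (y\<^sup>2 + z\<^sup>2)" using f by (intro mult_right_mono) auto
 then have fn: "f * (y\<^sup>2 + z\<^sup>2) <= y\<^sup>2 + z\<^sup>2" by (simp only: mult_1_left)
 have "0 <= (fst (w r))\<^sup>2 + (snd (w r))\<^sup>2" by simp
 then have "0 <= \<mu>" using \<mu> by (rule order_trans)
 with f(2) have f\<mu>: "f * \<mu> <= \<epsilon> * \<mu>" by (rule mult_right_mono)
 have "\<bar>f * (2 * (y * v) + 2 * (z * u))\<bar> = f * \<bar>2 * (y * v) + 2 * (z * u)\<bar>" using f(1) by (simp only: abs_mult abs_of_nonneg)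
 also have "\<dots> <= f * ((y\<^sup>2 + z\<^sup>2) + \<mu>)" using Q f(1) by (rule mult_left_mono)
 also have "\<dots> = f * (y\<^sup>2 + z\<^sup>2) + f * \<mu>" by (rule distrib_left)
 also have "\<dots> <= (y\<^sup>2 + z\<^sup>2) + \<epsilon> * \<mu>" by (rule add_mono[OF fn f\<mu>])
 finally have 2: "\<bar>f * (2 * (y * v) + 2 * (z * u))\<bar> <= (y\<^sup>2 + z\<^sup>2) + \<epsilon> * \<mu>" .
 have 3: "0 <= 4 * y\<^sup>2 / r" using r by simp
 have 4: "4 * y\<^sup>2 / r <= 4 / r * (y\<^sup>2 + z\<^sup>2)" using r by (simp add: field_simps)
 have e: "(2 * m + 1) * (y\<^sup>2 + z\<^sup>2) = 2 * m * (y\<^sup>2 + z\<^sup>2) + (y\<^sup>2 + z\<^sup>2)"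
  "(2 * m + 1 + 4 / r) * (y\<^sup>2 + z\<^sup>2) = 2 * m * (y\<^sup>2 + z\<^sup>2) + (y\<^sup>2 + z\<^sup>2) + 4 / r * (y\<^sup>2 + z\<^sup>2)"
  by (simp_all only: distrib_right mult_1_left)
 have *: "- A - B - C <= P + n + \<eta>" "- (- A - B - C) <= P + n + T + \<eta>"
  if "\<bar>A\<bar> <= P" "\<bar>C\<bar> <= n + \<eta>" "0 <= B" "B <= T" for A B C P n \<eta> T :: real
  using that by linarith+
 show thesis
 proof (rule that[OF N])
  show "N' <= (2 * m + 1) * gap2 (w r) (w0 r) + \<epsilon> * \<mu>" unfolding g e N'_def by (rule *(1)[OF 1 2 3 4])
  show "- N' <= (2 * m + 1 + 4 / r) * gap2 (w r) (w0 r) + \<epsilon> * \<mu>" unfolding g e N'_def by (rule *(2)[OF 1 2 3 4])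
 qed
qed

lemma gap2_gronwall:
 assumes S: "finite S" and cd: "0 <= c" "c <= d" and cont: "continuous_on {c..d} w" "continuous_on {c..d} w0"
  and w: "!!r. r \<in> {c<..<d} - S ==> (w has_vector_derivative soler_field m \<Omega> p r (w r)) (at r)"
  and w0: "!!r. r \<in> {c<..<d} ==> (w0 has_vector_derivative dirac_field m \<Omega> r (w0 r)) (at r)"
  and F: "!!r. r \<in> {c<..<d} ==> F p (minkowski (w r)) <= \<epsilon>" "0 < p" "0 <= \<epsilon>" "\<epsilon> <= 1"
  and \<mu>: "!!r. r \<in> {c<..<d} ==> (fst (w r))\<^sup>2 + (snd (w r))\<^sup>2 <= \<mu>" "0 <= \<mu>"
 shows "gap2 (w d) (w0 d) <= (gap2 (w c) (w0 c) + \<epsilon> * \<mu> * (d - c)) * exp ((2 * m + 1) * (d - c))"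
  and "0 < c ==> gap2 (w c) (w0 c) <= (gap2 (w d) (w0 d) + \<epsilon> * \<mu> * (d - c)) * exp ((2 * m + 1 + 4 / c) * (d - c))"
proof -
 have C: "continuous_on {c..d} (\<lambda>r. gap2 (w r) (w0 r))" unfolding gap2_def by (intro continuous_intros cont)
 have "\<forall>r\<in>{c<..<d} - S. \<exists>N'. DERIV (\<lambda>r. gap2 (w r) (w0 r)) r :> N' \<and>
  N' <= (2 * m + 1) * gap2 (w r) (w0 r) + \<epsilon> * \<mu> \<and> - N' <= (2 * m + 1 + 4 / r) * gap2 (w r) (w0 r) + \<epsilon> * \<mu>"
 proof
  fix r assume r: "r \<in> {c<..<d} - S"
  then have r': "r \<in> {c<..<d}" and r0: "0 < r" using cd by auto
  show "\<exists>N'. DERIV (\<lambda>r. gap2 (w r) (w0 r)) r :> N' \<and>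
   N' <= (2 * m + 1) * gap2 (w r) (w0 r) + \<epsilon> * \<mu> \<and> - N' <= (2 * m + 1 + 4 / r) * gap2 (w r) (w0 r) + \<epsilon> * \<mu>"
   by (rule DERIV_gap2[OF w[OF r] w0[OF r'] r0 F_nonneg[OF F(2)] F(1)[OF r'] F(4) \<mu>(1)[OF r']]) blast
 qed
 then obtain N' where N': "!!r. r \<in> {c<..<d} - S ==> DERIV (\<lambda>r. gap2 (w r) (w0 r)) r :> N' r"
  "!!r. r \<in> {c<..<d} - S ==> N' r <= (2 * m + 1) * gap2 (w r) (w0 r) + \<epsilon> * \<mu>"
  "!!r. r \<in> {c<..<d} - S ==> - N' r <= (2 * m + 1 + 4 / r) * gap2 (w r) (w0 r) + \<epsilon> * \<mu>"
  unfolding bchoice_iff by blast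
 have \<eta>: "0 <= \<epsilon> * \<mu>" using F(3) \<mu>(2) by simp
 have K: "0 <= 2 * m + 1" using m_pos by simp
 show "gap2 (w d) (w0 d) <= (gap2 (w c) (w0 c) + \<epsilon> * \<mu> * (d - c)) * exp ((2 * m + 1) * (d - c))"
  by (rule gronwall_forward[OF S cd(2) C N'(1,2) K \<eta>])
 assume c: "0 < c"
 have K': "0 <= 2 * m + 1 + 4 / c" using m_pos c by simp
 show "gap2 (w c) (w0 c) <= (gap2 (w d) (w0 d) + \<epsilon> * \<mu> * (d - c)) * exp ((2 * m + 1 + 4 / c) * (d - c))"
 proof (rule gronwall_backward[OF S cd(2) C N'(1) _ K' \<eta>])
  fix r assume r: "r \<in> {c<..<d} - S"
  have "4 / r <= 4 / c" using r c by (intro divide_left_mono) auto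
  then have "(2 * m + 1 + 4 / r) * gap2 (w r) (w0 r) <= (2 * m + 1 + 4 / c) * gap2 (w r) (w0 r)"
   by (intro mult_right_mono) (auto simp: gap2_def)
  then show "- N' r <= (2 * m + 1 + 4 / c) * gap2 (w r) (w0 r) + \<epsilon> * \<mu>" using N'(3)[OF r] by linarith
 qed
qed

end

text \<open>\<open>in_phase\<close> expressed by the radii alone, so that the passage to the limit
  need not refer to polar coordinates.\<close>

definition phase :: "nat => (nat => real) => nat => real => real => bool" where
 "phase k \<rho> j \<delta> r \<longleftrightarrow> 0 <= r \<and> r < \<rho> (2 * k) \<and> r + \<delta> <= \<rho> j \<and> (0 < j \<longrightarrow> \<rho> (j - 1) + \<delta> <= r)"

definition energy :: "real \<times> real => real" where
 "energy z = (fst z)\<^sup>2 + (snd z)\<^sup>2"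

text \<open>What the limit \<open>p \<longlongrightarrow> 0\<close> needs to know about a nodal solution. The radii \<open>\<rho> 0, \<dots>, \<rho> (2 k - 1)\<close>
 are those where the orbit crosses the light cone, and at \<open>\<rho> (2 k)\<close> it reaches the origin.\<close>

locale profile = frequency +
 fixes p :: real and k :: nat and w :: "real => real \<times> real" and x :: real and S :: "real set" and \<rho> :: "nat => real"
 assumes p: "0 < p" "p < 1" and cont: "continuous_on {0..} w" and w0: "w 0 = (0, x)" and x: "\<bar>x\<bar> <= sqrt (M k)"
  and S: "finite S"
  and dw: "!!r. 0 < r ==> r \<notin> S ==> (w has_vector_derivative soler_field m \<Omega> p r (w r)) (at r)"
  and energy: "!!r. 0 <= r ==> r < \<rho> (2 * k) ==> energy (w r) <= M k"
  and rho: "!!j. r0 <= \<rho> j" "!!j. \<rho> j <= Rm k" "!!i j. i < j ==> j <= 2 * k ==> \<rho> i < \<rho> j"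
  and gap: "!!i. i < k ==> \<rho> (2 * i + 1) + c1 <= \<rho> (2 * i + 2)"
  and sign: "!!j \<delta> r. j <= 2 * k ==> phase k \<rho> j \<delta> r ==> 0 <= \<delta> ==> cmin \<delta> * energy (w r) <= (- 1) ^ j * minkowski (w r)"
  and positive: "!!i \<delta> r. i <= k ==> phase k \<rho> (2 * i) \<delta> r ==> 0 < \<delta> ==> F p (minkowski (w r)) <= p * (b / cmin \<delta>)"
   "!!i \<delta> r. i <= k ==> phase k \<rho> (2 * i) \<delta> r ==> 0 < \<delta> ==> exp ((p * ln (cmin \<delta>) - ln b) / (1 - p)) <= energy (w r)"
   "!!i \<delta> r. i <= k ==> phase k \<rho> (2 * i) \<delta> r ==> 0 < \<delta> ==> 0 <= (- 1) ^ i * snd (w r)"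
   "!!i \<delta> r. i <= k ==> phase k \<rho> (2 * i) \<delta> r ==> 0 < \<delta> ==> energy (w r) <= 2 * (snd (w r))\<^sup>2"
  and ratio: "!!j \<delta> r t. j <= 2 * k ==> odd j ==> phase k \<rho> j \<delta> r ==> phase k \<rho> j \<delta> t ==> 0 < \<delta> ==>
   energy (w r) <= exp (pi / cmin \<delta> + Kg * Rm k) * energy (w t)"
  and jump: "!!i c d. i < k ==> 0 <= c ==> c <= d ==> d < \<rho> (2 * k) ==> \<rho> (2 * i) - c1 <= c ==> d <= \<rho> (2 * i + 1) + c1 ==>
   \<bar>Gp p (minkowski (w d)) - Gp p (minkowski (w c))\<bar> <= 4 * Mv k * \<bar>snd (w c) - snd (w d)\<bar>"
  and lipschitz: "!!c d. 0 <= c ==> c <= d ==> d <= \<rho> (2 * k) ==> \<bar>minkowski (w d) - minkowski (w c)\<bar> <= Ls k * (d - c)"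
  and s_rho: "!!j. j <= 2 * k ==> minkowski (w (\<rho> j)) = 0"

lemma (in nodal_lift) phase_iff: "phase k \<rho> j \<delta> r \<longleftrightarrow> in_phase j \<delta> r"
 by (simp add: phase_def in_phase_def rho_last)

lemma (in nodal_lift) phase_E: "phase k \<rho> j \<delta> r ==> energy (w r) = O.E r"
 using E_w[of r] by (simp add: phase_iff in_phase_def energy_def)

lemma (in nodal_lift) profile: "profile m \<Omega> p k w x S \<rho>"
proof (rule profile.intro[OF frequency_axioms profile_axioms.intro])
 show "\<bar>x\<bar> <= sqrt (M k)"
  using order_trans[OF x_le X0_le_M] by (intro real_le_rsqrt) simp
 show "energy (w r) <= M k" if "0 <= r" "r < \<rho> (2 * k)" for r
  using E_le[of r] E_w[of r] that by (simp add: energy_def rho_last)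
 show "\<rho> j <= Rm k" for j using rho_le_R R_le by (rule order_trans)
 fix j \<delta> r assume h: "phase k \<rho> j \<delta> r"
 note e = phase_E[OF h]
 show "cmin \<delta> * energy (w r) <= (- 1) ^ j * s r" if "j <= 2 * k" "0 <= \<delta>"
  using s_phase[OF that(1) _ that(2)] h by (simp add: e phase_iff)
 show "energy (w r) <= exp (pi / cmin \<delta> + Kg * Rm k) * energy (w t)"
  if "j <= 2 * k" "odd j" "phase k \<rho> j \<delta> t" "0 < \<delta>" for t
  using ratio_negative[OF that(1,2) _ _ that(4), of r t] h that(3) by (simp add: e phase_E[OF that(3)] phase_iff)
next
 fix i \<delta> r assume i: "i <= k" and h: "phase k \<rho> (2 * i) \<delta> r" and \<delta>: "0 < \<delta>"
 note P = positive_phase[OF i h[unfolded phase_iff] \<delta>]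
 show "F p (s r) <= p * (b / cmin \<delta>)" by (rule P(1))
 show "exp ((p * ln (cmin \<delta>) - ln b) / (1 - p)) <= energy (w r)" using P(2) by (simp add: phase_E[OF h])
 show "0 <= (- 1) ^ i * snd (w r)" by (rule P(3))
 show "energy (w r) <= 2 * (snd (w r))\<^sup>2" using P(4) by (simp add: phase_E[OF h])
next
 fix i c d assume "i < k" "0 <= c" "c <= d" "d < \<rho> (2 * k)" "\<rho> (2 * i) - c1 <= c" "d <= \<rho> (2 * i + 1) + c1"
 then show "\<bar>Gp p (s d) - Gp p (s c)\<bar> <= 4 * Mv k * \<bar>snd (w c) - snd (w d)\<bar>"
  unfolding rho_last by (rule v_jump_zone)
next
 fix c d assume "0 <= c" "c <= d" "d <= \<rho> (2 * k)"
 then show "\<bar>s d - s c\<bar> <= Ls k * (d - c)" unfolding rho_last by (rule s_lipschitz)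
qed (fact p(1) p1 cont w0 S dw rho_ge rho_strict rho_gap s_rho)+

lemma (in nodal) profile_exists: "\<exists>\<rho>. profile m \<Omega> p k w x S \<rho>"
proof (rule lift)
 fix l \<phi> assume "orbit m \<Omega> p {0..<R} S (\<lambda>t. t) (\<lambda>_. 1) (\<lambda>t. F p (minkowski (w t))) l \<phi>"
  "\<phi> 0 = 0" "!!t. t \<in> {0..<R} ==> w t = (exp (l t / 2) * sin (\<phi> t / 2), exp (l t / 2) * cos (\<phi> t / 2))"
 then have "nodal_lift m \<Omega> p k w x S l \<phi>"
  by (intro nodal_lift.intro[OF nodal_axioms nodal_lift_axioms.intro])
 from nodal_lift.profile[OF this] show "\<exists>\<rho>. profile m \<Omega> p k w x S \<rho>" by (rule exI[of "\<lambda>\<rho>. profile m \<Omega> p k w x S \<rho>"])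
qed

lemma tendsto_energy [tendsto_intros]:
 "(f \<longlongrightarrow> y) net ==> ((\<lambda>n. energy (f n)) \<longlongrightarrow> energy y) net"
 unfolding energy_def by (intro tendsto_intros)

lemma tendsto_minkowski [tendsto_intros]:
 "(f \<longlongrightarrow> y) net ==> ((\<lambda>n. minkowski (f n)) \<longlongrightarrow> minkowski y) net"
 unfolding minkowski_def case_prod_beta by (intro tendsto_intros)

lemma energy_norm: "norm z = sqrt (energy z)"
 by (simp add: norm_prod_def energy_def)

lemma energy_pos: "z \<noteq> 0 ==> 0 < energy z"
 using energy_norm[of z] by (metis norm_le_zero_iff not_le real_sqrt_le_0_iff)

text \<open>A subsequence along which everything converges that can be made to converge by
  compactness: the radii, the central value, and the solution at the midpoint of each interval of
  positive limit length. The midpoint values are needed because a jump does not pass on the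
  constants of integration.\<close>

locale limit_family = frequency +
 fixes k :: nat and p x :: "nat => real" and w :: "nat => real => real \<times> real" and S :: "nat => real set"
  and \<rho> :: "nat => nat => real" and r :: "nat => real" and x0 :: real and z :: "nat => real \<times> real"
 assumes prof: "!!n. profile m \<Omega> (p n) k (w n) (x n) (S n) (\<rho> n)"
  and p_lim: "p \<longlonglongrightarrow> 0" and rho_lim: "!!j. j <= 2 * k ==> (\<lambda>n. \<rho> n j) \<longlonglongrightarrow> r j" and x_lim: "x \<longlonglongrightarrow> x0"
  and z_lim: "!!j. j <= 2 * k ==> 0 < j ==> r (j - 1) < r j ==> (\<lambda>n. w n ((r (j - 1) + r j) / 2)) \<longlonglongrightarrow> z j"
begin

definition "J j = (if j = 0 then {0..<r 0} else {r (j - 1)<..<r j})"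
definition "mid j = (r (j - 1) + r j) / 2"
definition "ce j = (SOME q. D (fst q) (snd q) (mid j) = z j)"
text \<open>The limit on the interval \<open>J j\<close>. The zero branch is for negative intervals
  on which the amplitude tends to 0, so that no bound for \<open>F\<close> is available. The clause
  for \<open>t = 0\<close> fills the removable singularity of \<open>D\<close>.\<close>

definition "sol j t = (if j = 0 then if t = 0 then (0, x0) else D (x0 / \<kappa>) 0 t
 else if z j = 0 then 0 else D (fst (ce j)) (snd (ce j)) t)"

lemmas prof_p = profile.p[OF prof]

lemma r_ge: "j <= 2 * k ==> r0 <= r j"
 by (rule LIMSEQ_le_const[OF rho_lim]) (use profile.rho(1)[OF prof] in auto)

lemma rho_mono: assumes "i <= j" "j <= 2 * k" shows "\<rho> n i <= \<rho> n j"
 using profile.rho(3)[OF prof, of i j n] assms by (cases "i = j") auto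

lemma r_mono: "i <= j ==> j <= 2 * k ==> r i <= r j"
 by (rule LIMSEQ_le[OF rho_lim rho_lim]) (use rho_mono in auto)

lemma r_gap: assumes "i < k" shows "r (2 * i + 1) + c1 <= r (2 * i + 2)"
proof (rule LIMSEQ_le)
 show "(\<lambda>n. \<rho> n (2 * i + 1) + c1) \<longlonglongrightarrow> r (2 * i + 1) + c1" by (intro tendsto_intros rho_lim) (use assms in auto)
 show "(\<lambda>n. \<rho> n (2 * i + 2)) \<longlonglongrightarrow> r (2 * i + 2)" by (rule rho_lim) (use assms in auto)
qed (use profile.gap[OF prof assms] in blast)

lemma J_pos: "j <= 2 * k ==> t \<in> J j ==> 0 <= t" "j <= 2 * k ==> 0 < j ==> t \<in> J j ==> 0 < t"
proof -
 have *: "0 < t" if "j <= 2 * k" "0 < j" "t \<in> J j" for j t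
 proof -
  have "r0 <= r (j - 1)" by (rule r_ge) (use that in simp)
  then show ?thesis using that r0_pos by (simp add: J_def)
 qed
 show "j <= 2 * k ==> t \<in> J j ==> 0 <= t"
  using *[of j t] by (cases "j = 0") (auto simp: J_def)
 show "j <= 2 * k ==> 0 < j ==> t \<in> J j ==> 0 < t" by (rule *)
qed

lemma J_convex: "c \<in> J j ==> d \<in> J j ==> t \<in> {c..d} ==> t \<in> J j"
 by (auto simp: J_def split: if_splits)

lemma J_mid: assumes "0 < j" "c \<in> J j" shows "mid j \<in> J j" "r (j - 1) < r j"
 using assms by (auto simp: J_def mid_def)

lemma J_unique: assumes "i <= 2 * k" "j <= 2 * k" "t \<in> J i" "t \<in> J j" shows "i = j"
proof -
 have *: False if "i < j" "j <= 2 * k" "t \<in> J i" "t \<in> J j" for i j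
 proof -
  have "t < r i" using that by (auto simp: J_def split: if_splits)
  also have "r i <= r (j - 1)" using that by (intro r_mono) auto
  finally show False using that by (auto simp: J_def split: if_splits)
 qed
 show ?thesis using *[of i j] *[of j i] assms by (cases i j rule: linorder_cases) auto
qed

lemma sol_mid: assumes "0 < j" "j <= 2 * k" "c \<in> J j" shows "sol j (mid j) = z j"
proof -
 have "0 < mid j" using J_pos(2)[OF assms(2,1)] J_mid[OF assms(1,3)] by blast
 then obtain c e where "D c e (mid j) = z j" by (rule D_through)
 then have "D (fst (c, e)) (snd (c, e)) (mid j) = z j" by simp
 then have "D (fst (ce j)) (snd (ce j)) (mid j) = z j" unfolding ce_def by (rule someI)
 then show ?thesis using assms(1) by (simp add: sol_def)
qed

lemma sol_deriv: assumes t: "0 < t" shows "(sol j has_vector_derivative dirac_field m \<Omega> t (sol j t)) (at t)"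
proof (cases "j = 0")
 case True
 have "(sol j has_vector_derivative dirac_field m \<Omega> t (D (x0 / \<kappa>) 0 t)) (at t)"
  by (rule has_vector_derivative_transform_within_open[OF has_vector_derivative_D[OF t], of "{0<..}"])
   (use t True in \<open>auto simp: sol_def\<close>)
 then show ?thesis using True t by (simp add: sol_def)
next
 case False
 show ?thesis
 proof (cases "z j = 0")
  case True
  have "sol j = (\<lambda>_. 0)" by (rule ext) (simp add: sol_def True False)
  moreover have "dirac_field m \<Omega> t (0 :: real \<times> real) = 0" by (simp add: dirac_field_def zero_prod_def)
  ultimately show ?thesis by simp
 next
  case z: False
  have "sol j = D (fst (ce j)) (snd (ce j))" by (rule ext) (simp add: sol_def z False)
  then show ?thesis using has_vector_derivative_D[OF t] by simp
 qed
qed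

lemma sol_isCont: "0 < t ==> isCont (sol j) t"
 by (rule has_vector_derivative_continuous[OF sol_deriv])

lemma D_origin: "(D (x0 / \<kappa>) 0 \<longlongrightarrow> (0, x0)) (at_right 0)"
 unfolding D_def[abs_def] by (intro tendsto_Pair D_at_origin)

lemma sol_cont: assumes "0 <= c" "0 < c \<or> j = 0" shows "continuous_on {c..d} (sol j)"
 unfolding continuous_on_def
proof
 fix t assume t: "t \<in> {c..d}"
 show "(sol j \<longlongrightarrow> sol j t) (at t within {c..d})"
 proof (cases "0 < t")
  case True
  show ?thesis
   using continuous_at_imp_continuous_at_within[OF sol_isCont[OF True]] unfolding continuous_within .
 next
  case False
  then have t0: "t = 0" "c = 0" using t assms(1) by simp_all
  then have j0: "j = 0" using assms(2) by simp
  have "(sol 0 \<longlongrightarrow> (0, x0)) (at_right 0)"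
   proof (rule Lim_transform_eventually[OF D_origin])
   show "eventually (\<lambda>t. D (x0 / \<kappa>) 0 t = sol 0 t) (at_right 0)"
    using eventually_at_right_less[of "0::real"] by eventually_elim (simp add: sol_def)
  qed
  moreover have "at 0 within {0..d} <= at_right 0"
   unfolding at_within_def by (intro inf_mono order_refl) auto
  ultimately have "(sol 0 \<longlongrightarrow> (0, x0)) (at 0 within {0..d})" by (rule tendsto_mono[rotated])
  then show ?thesis by (simp add: t0 j0 sol_def)
 qed
qed

lemma phase_ev:
 assumes j: "j <= 2 * k" and cd: "c \<in> J j" "d \<in> J j"
 obtains \<delta> where "0 < \<delta>" "eventually (\<lambda>n. \<forall>t\<in>{c..d}. phase k (\<rho> n) j \<delta> t) sequentially"
proof -
 define \<delta> where "\<delta> = (if j = 0 then (r 0 - d) / 2 else min (c - r (j - 1)) (r j - d) / 2)"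
 have \<delta>: "0 < \<delta>" "d + \<delta> < r j" "0 < j ==> r (j - 1) < c - \<delta>"
  using cd by (auto simp: J_def \<delta>_def min_def field_simps split: if_splits)
 have 1: "eventually (\<lambda>n. d + \<delta> < \<rho> n j) sequentially"
  by (rule order_tendstoD(1)[OF rho_lim[OF j] \<delta>(2)])
 have 2: "eventually (\<lambda>n. 0 < j \<longrightarrow> \<rho> n (j - 1) < c - \<delta>) sequentially"
 proof (cases "0 < j")
  case True
  have "j - 1 <= 2 * k" using j by simp
  from order_tendstoD(2)[OF rho_lim[OF this] \<delta>(3)[OF True]] show ?thesis by eventually_elim simp
 qed simp
 have "eventually (\<lambda>n. \<forall>t\<in>{c..d}. phase k (\<rho> n) j \<delta> t) sequentially"
  using 1 2
 proof eventually_elim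
  case (elim n)
  show ?case
  proof
   fix t assume t: "t \<in> {c..d}"
   have "0 <= t" using J_pos(1)[OF j cd(1)] t by simp
   moreover have "t < \<rho> n (2 * k)" using elim(1) rho_mono[OF j order_refl, of n] t \<delta>(1) by simp
   ultimately show "phase k (\<rho> n) j \<delta> t" using t elim by (auto simp: phase_def)
  qed
 qed
 with \<delta>(1) show thesis by (rule that)
qed

text \<open>Gronwall's lemma in both directions from a point where convergence is known: the centre
  for \<open>j = 0\<close>, where only the forward direction occurs, and the midpoint
  otherwise.\<close>

lemma uniform_from_base:
 assumes j: "j <= 2 * k" and cd: "c \<in> J j" "d \<in> J j" and \<beta>: "c <= \<beta>" "\<beta> <= d" "\<beta> = c \<or> 0 < c" "0 < c \<or> j = 0"
  and base: "(\<lambda>n. w n \<beta>) \<longlonglongrightarrow> sol j \<beta>"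
  and \<epsilon>: "\<epsilon> \<longlonglongrightarrow> 0" "!!n. 0 <= \<epsilon> n" and F: "eventually (\<lambda>n. \<forall>t\<in>{c..d}. F (p n) (minkowski (w n t)) <= \<epsilon> n) sequentially"
 shows "uniform_limit {c..d} w (sol j) sequentially"
proof (rule uniform_limitI)
 fix \<eta> :: real assume \<eta>: "0 < \<eta>"
 have c0: "0 <= c" by (rule J_pos(1)[OF j cd(1)])
 define K where "K = 2 * m + 1 + (if 0 < c then 4 / c else 0)"
 define B where "B n = (gap2 (w n \<beta>) (sol j \<beta>) + \<epsilon> n * M k * (d - c)) * exp (K * (d - c))" for n
 have "B \<longlonglongrightarrow> (gap2 (sol j \<beta>) (sol j \<beta>) + 0 * M k * (d - c)) * exp (K * (d - c))"
  unfolding B_def[abs_def] gap2_def by (intro tendsto_intros base \<epsilon>)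
 then have B: "B \<longlonglongrightarrow> 0" by (simp add: gap2_def)
 have e1: "eventually (\<lambda>n. B n < \<eta>\<^sup>2) sequentially" by (rule order_tendstoD(2)[OF B]) (use \<eta> in simp)
 have e2: "eventually (\<lambda>n. \<epsilon> n < 1) sequentially" by (rule order_tendstoD(2)[OF \<epsilon>(1)]) simp
 obtain \<delta> where "eventually (\<lambda>n. \<forall>t\<in>{c..d}. phase k (\<rho> n) j \<delta> t) sequentially" by (rule phase_ev[OF j cd])
 from this e1 e2 F show "eventually (\<lambda>n. \<forall>t\<in>{c..d}. dist (w n t) (sol j t) < \<eta>) sequentially"
 proof eventually_elim
  case (elim n)
  have En: "(fst (w n t))\<^sup>2 + (snd (w n t))\<^sup>2 <= M k" if "t \<in> {c..d}" for t
   using profile.energy[OF prof, of t n] elim(1) that by (auto simp: phase_def energy_def)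
  have wc: "continuous_on {c'..d'} (w n)" if "0 <= c'" for c' d'
   by (rule continuous_on_subset[OF profile.cont[OF prof]]) (use that in auto)
  have est: "gap2 (w n d') (sol j d') <= (gap2 (w n c') (sol j c') + \<epsilon> n * M k * (d' - c')) * exp ((2 * m + 1) * (d' - c'))"
   "0 < c' ==> gap2 (w n c') (sol j c') <= (gap2 (w n d') (sol j d') + \<epsilon> n * M k * (d' - c')) * exp ((2 * m + 1 + 4 / c') * (d' - c'))"
   if cd': "c <= c'" "c' <= d'" "d' <= d" for c' d'
  proof -
   have c'0: "0 <= c'" and c'1: "0 < c' \<or> j = 0" using c0 cd'(1) \<beta>(4) by auto
   have h1: "(w n has_vector_derivative soler_field m \<Omega> (p n) t (w n t)) (at t)" if "t \<in> {c'<..<d'} - S n" for t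
    by (rule profile.dw[OF prof]) (use that c'0 in auto)
   have h2: "(sol j has_vector_derivative dirac_field m \<Omega> t (sol j t)) (at t)" if "t \<in> {c'<..<d'}" for t
    by (rule sol_deriv) (use that c'0 in auto)
   have h3: "F (p n) (minkowski (w n t)) <= \<epsilon> n" if "t \<in> {c'<..<d'}" for t
    using elim(4) that cd' by simp
   have h4: "(fst (w n t))\<^sup>2 + (snd (w n t))\<^sup>2 <= M k" if "t \<in> {c'<..<d'}" for t
    by (rule En) (use that cd' in simp)
   note G = gap2_gronwall[OF profile.S[OF prof, of n] c'0 cd'(2) wc[OF c'0] sol_cont[OF c'0 c'1] h1 h2 h3 prof_p(1)
    \<epsilon>(2) less_imp_le[OF elim(3)] h4 less_imp_le[OF M_pos]]
   show "gap2 (w n d') (sol j d') <= (gap2 (w n c') (sol j c') + \<epsilon> n * M k * (d' - c')) * exp ((2 * m + 1) * (d' - c'))"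
    by (rule G(1)) assumption+
   show "gap2 (w n c') (sol j c') <= (gap2 (w n d') (sol j d') + \<epsilon> n * M k * (d' - c')) * exp ((2 * m + 1 + 4 / c') * (d' - c'))"
    if "0 < c'" by (rule G(2)) (assumption | rule that)+
  qed
  have g0: "0 <= gap2 y q" for y q by (simp add: gap2_def)
  have le: "(gap2 (w n \<beta>) (sol j \<beta>) + \<epsilon> n * M k * s) * exp (K' * s) <= B n"
   if "0 <= s" "s <= d - c" "0 <= K'" "K' <= K" for s K'
   unfolding B_def using that g0 \<epsilon>(2)[of n] M_pos[of k]
   by (intro mult_mono add_mono mult_nonneg_nonneg add_nonneg_nonneg exp_le_cancel_iff[THEN iffD2] mult_left_mono) auto
  show ?case
  proof
   fix t assume t: "t \<in> {c..d}"
   have "gap2 (w n t) (sol j t) <= B n"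
   proof (cases "\<beta> <= t")
    case True
    show ?thesis
     by (rule order_trans[OF est(1)[OF \<beta>(1) True] le]) (use t True m_pos \<beta> c0 in \<open>auto simp: K_def\<close>)
   next
    case False
    then have c1: "0 < c" using \<beta>(3) t by auto
    have t0: "0 < t" using c1 t by simp
    have "4 / t <= 4 / c" using t c1 by (intro divide_left_mono) auto
    then show ?thesis
     by (intro order_trans[OF est(2)[of t \<beta>] le]) (use t False m_pos \<beta> c1 t0 in \<open>auto simp: K_def\<close>)
   qed
   then have "gap2 (w n t) (sol j t) < \<eta>\<^sup>2" using elim(2) by simp
   then have "sqrt (gap2 (w n t) (sol j t)) < \<eta>" using \<eta> by (intro real_less_lsqrt) (auto simp: g0)
   then show "dist (w n t) (sol j t) < \<eta>" by (simp add: dist_norm norm_gap2)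
  qed
 qed
qed

lemma p_mult: "(\<lambda>n. p n * C) \<longlonglongrightarrow> 0"
 using tendsto_mult[OF p_lim tendsto_const[of C]] by simp

lemma odd_ratio:
 assumes j: "j <= 2 * k" "odd j" and cd: "c \<in> J j" "d \<in> J j"
 obtains C \<sigma> where "0 < C" "0 < \<sigma>"
  "eventually (\<lambda>n. \<forall>t\<in>{c..d}. \<forall>t'\<in>{c..d}. energy (w n t) <= C * energy (w n t')) sequentially"
  "eventually (\<lambda>n. \<forall>t\<in>{c..d}. \<sigma> * energy (w n t) <= - minkowski (w n t)) sequentially"
proof -
 obtain \<delta> where \<delta>: "0 < \<delta>" "eventually (\<lambda>n. \<forall>t\<in>{c..d}. phase k (\<rho> n) j \<delta> t) sequentially" by (rule phase_ev[OF j(1) cd])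
 show thesis
 proof (rule that[of "exp (pi / cmin \<delta> + Kg * Rm k)" "cmin \<delta>"])
  show "eventually (\<lambda>n. \<forall>t\<in>{c..d}. \<forall>t'\<in>{c..d}. energy (w n t) <= exp (pi / cmin \<delta> + Kg * Rm k) * energy (w n t')) sequentially"
   using \<delta>(2) by eventually_elim (intro ballI profile.ratio[OF prof j _ _ \<delta>(1)], auto)
  show "eventually (\<lambda>n. \<forall>t\<in>{c..d}. cmin \<delta> * energy (w n t) <= - minkowski (w n t)) sequentially"
   using \<delta>(2)
  proof eventually_elim
   case (elim n)
   show ?case
   proof
    fix t assume "t \<in> {c..d}"
    then show "cmin \<delta> * energy (w n t) <= - minkowski (w n t)"
     using profile.sign[OF prof j(1), of n \<delta> t] elim \<delta>(1) j(2) by simp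
   qed
  qed
 qed (use cmin_pos[OF \<delta>(1)] in simp_all)
qed

text \<open>In a positive interval \<open>F = O(p)\<close> by the energy. In a negative one with
  \<open>z j \<noteq> 0\<close> the ratio bound spreads the amplitude at the midpoint over the whole
  compact interval, so that \<open>s\<close> stays away from 0 and again
  \<open>F = O(p)\<close>.\<close>

lemma uniform_live:
 assumes j: "j <= 2 * k" and cd: "c \<in> J j" "d \<in> J j" and live: "even j \<or> z j \<noteq> 0"
 shows "uniform_limit {c..d} w (sol j) sequentially"
proof -
 \<comment> \<open>The interval is enlarged to contain the base point from which the comparison
   starts.\<close>
 define c' where "c' = (if j = 0 then 0 else min c (mid j))"
 define d' where "d' = (if j = 0 then d else max d (mid j))"
 define \<beta> where "\<beta> = (if j = 0 then 0 else mid j)"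
 have J0: "0 <= c" "0 <= d" using J_pos(1)[OF j] cd by auto
 have cd': "c' \<in> J j" "d' \<in> J j"
  using J_mid(1)[OF _ cd(1)] cd J0 by (auto simp: c'_def d'_def min_def max_def J_def split: if_splits)
 have sub: "{c..d} \<subseteq> {c'..d'}" using J0 by (auto simp: c'_def d'_def)
 have c'0: "0 < c' \<or> j = 0" using J_pos(2)[OF j _ cd'(1)] by auto
 have \<beta>: "c' <= \<beta>" "\<beta> <= d'" "\<beta> = c' \<or> 0 < c'" using c'0 J0 by (auto simp: c'_def d'_def \<beta>_def)
 have base: "(\<lambda>n. w n \<beta>) \<longlonglongrightarrow> sol j \<beta>"
 proof (cases "j = 0")
  case True
  have "(\<lambda>n. (0, x n)) \<longlonglongrightarrow> (0, x0)" by (intro tendsto_intros x_lim)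
  then show ?thesis using profile.w0[OF prof] True by (simp add: \<beta>_def sol_def)
 next
  case False
  then show ?thesis
   using z_lim[OF j _ J_mid(2)[OF _ cd(1)]] sol_mid[OF _ j cd(1)] by (simp add: \<beta>_def mid_def)
 qed
 have "\<exists>C\<ge>0. eventually (\<lambda>n. \<forall>t\<in>{c'..d'}. F (p n) (minkowski (w n t)) <= p n * C) sequentially"
 proof (cases "even j")
  case True
  then obtain i where i: "j = 2 * i" by (rule evenE)
  then have ik: "i <= k" using j by simp
  obtain \<delta> where \<delta>: "0 < \<delta>" "eventually (\<lambda>n. \<forall>t\<in>{c'..d'}. phase k (\<rho> n) j \<delta> t) sequentially" by (rule phase_ev[OF j cd'])
  have "eventually (\<lambda>n. \<forall>t\<in>{c'..d'}. F (p n) (minkowski (w n t)) <= p n * (b / cmin \<delta>)) sequentially"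
   using \<delta>(2)
  proof eventually_elim
   case (elim n)
   show ?case
   proof
    fix t assume "t \<in> {c'..d'}"
    then have "phase k (\<rho> n) (2 * i) \<delta> t" using elim i by simp
    then show "F (p n) (minkowski (w n t)) <= p n * (b / cmin \<delta>)" by (rule profile.positive(1)[OF prof ik _ \<delta>(1)])
   qed
  qed
  moreover have "0 <= b / cmin \<delta>" using b_pos cmin_pos[OF \<delta>(1)] by simp
  ultimately show ?thesis by blast
 next
  case False
  then have z: "z j \<noteq> 0" and j0: "0 < j" using live by (auto intro: odd_pos)
  obtain C \<sigma> where C: "0 < C" "0 < \<sigma>"
   "eventually (\<lambda>n. \<forall>t\<in>{c'..d'}. \<forall>t'\<in>{c'..d'}. energy (w n t) <= C * energy (w n t')) sequentially"
   "eventually (\<lambda>n. \<forall>t\<in>{c'..d'}. \<sigma> * energy (w n t) <= - minkowski (w n t)) sequentially"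
   by (rule odd_ratio[OF j False cd'])
  have zl: "(\<lambda>n. energy (w n \<beta>)) \<longlonglongrightarrow> energy (z j)"
   using tendsto_intros(1) base sol_mid[OF j0 j cd(1)] j0 by (intro tendsto_energy) (simp add: \<beta>_def)
  have "eventually (\<lambda>n. energy (z j) / 2 < energy (w n \<beta>)) sequentially"
   by (rule order_tendstoD(1)[OF zl]) (use energy_pos[OF z] in simp)
  with C(3,4) have "eventually (\<lambda>n. \<forall>t\<in>{c'..d'}. F (p n) (minkowski (w n t)) <= p n * (1 + 1 / (\<sigma> * (energy (z j) / 2 / C)))) sequentially"
  proof eventually_elim
   case (elim n)
   show ?case
   proof
    fix t assume t: "t \<in> {c'..d'}"
    have "energy (w n \<beta>) <= C * energy (w n t)" using elim(1) t \<beta> by simp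
    then have "energy (z j) / 2 / C <= energy (w n t)" using elim(3) C(1) by (simp add: field_simps)
    then have "\<sigma> * (energy (z j) / 2 / C) <= \<sigma> * energy (w n t)"
     using C(2) by (intro mult_left_mono) auto
    also have "\<dots> <= \<bar>minkowski (w n t)\<bar>" using elim(2) t by fastforce
    finally show "F (p n) (minkowski (w n t)) <= p n * (1 + 1 / (\<sigma> * (energy (z j) / 2 / C)))"
     by (intro F_le prof_p) (use C energy_pos[OF z] in auto)
   qed
  qed
  moreover have "0 <= 1 + 1 / (\<sigma> * (energy (z j) / 2 / C))" using C energy_pos[OF z] by simp
  ultimately show ?thesis by blast
 qed
 then obtain C where C: "0 <= C" "eventually (\<lambda>n. \<forall>t\<in>{c'..d'}. F (p n) (minkowski (w n t)) <= p n * C) sequentially" by blast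
 have pC: "0 <= p n * C" for n using prof_p(1)[of n] C(1) by simp
 have "uniform_limit {c'..d'} w (sol j) sequentially"
  by (rule uniform_from_base[OF j cd' \<beta> c'0 base p_mult pC C(2)])
 then show ?thesis using sub by (rule uniform_limit_on_subset)
qed

text \<open>What \<open>uniform_live\<close> leaves open is a negative interval with
  \<open>z j = 0\<close>; there the ratio bound alone carries the convergence to 0 from the midpoint
  to every point.\<close>

lemma pointwise: assumes j: "j <= 2 * k" and t: "t \<in> J j" shows "(\<lambda>n. w n t) \<longlonglongrightarrow> sol j t"
proof (cases "even j \<or> z j \<noteq> 0")
 case True
 from tendsto_uniform_limitI[OF uniform_live[OF j t t True]] show ?thesis by simp
next
 case False
 then have od: "odd j" "z j = 0" and j0: "0 < j" by (auto intro: odd_pos)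
 define c where "c = min t (mid j)"
 define d where "d = max t (mid j)"
 have cd: "c \<in> J j" "d \<in> J j" using J_mid(1)[OF j0 t] t by (auto simp: c_def d_def min_def max_def)
 have I: "t \<in> {c..d}" "mid j \<in> {c..d}" by (auto simp: c_def d_def)
 obtain C \<sigma> where C: "eventually (\<lambda>n. \<forall>t\<in>{c..d}. \<forall>t'\<in>{c..d}. energy (w n t) <= C * energy (w n t')) sequentially"
  by (rule odd_ratio[OF j od(1) cd])
 have zl: "(\<lambda>n. w n (mid j)) \<longlonglongrightarrow> z j" unfolding mid_def by (rule z_lim[OF j j0 J_mid(2)[OF j0 t]])
 have "(\<lambda>n. sqrt (C * energy (w n (mid j)))) \<longlonglongrightarrow> sqrt (C * energy (z j))" by (intro tendsto_intros zl)
 then have null: "(\<lambda>n. sqrt (C * energy (w n (mid j)))) \<longlonglongrightarrow> 0" using od(2) by (simp add: energy_def)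
 have "eventually (\<lambda>n. norm (w n t) <= sqrt (C * energy (w n (mid j)))) sequentially"
  using C by eventually_elim (use I in \<open>simp add: energy_norm\<close>)
 from Lim_null_comparison[OF this null] show ?thesis using od j0 by (simp add: sol_def)
qed

text \<open>In the limit the amplitude is at least \<open>1 / b\<close>, and where \<open>s\<close>
  is positive \<open>v^2\<close> makes up at least half of it. This lower bound for
  \<open>v\<close>, with its sign, is what the discontinuities rest on.\<close>

lemma positive_limit:
 assumes i: "i <= k" and t: "t \<in> J (2 * i)"
 shows "sqrt (1 / (2 * b)) <= (- 1) ^ i * snd (sol (2 * i) t)" and "0 < minkowski (sol (2 * i) t)"
proof -
 have j: "2 * i <= 2 * k" using i by simp
 obtain \<delta> where \<delta>: "0 < \<delta>" "eventually (\<lambda>n. \<forall>t\<in>{t..t}. phase k (\<rho> n) (2 * i) \<delta> t) sequentially" by (rule phase_ev[OF j t t])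
 have ph: "eventually (\<lambda>n. phase k (\<rho> n) (2 * i) \<delta> t) sequentially" using \<delta>(2) by eventually_elim simp
 note lim = pointwise[OF j t]
 have b: "exp (- ln b) = 1 / b" using b_pos by (simp add: exp_minus inverse_eq_divide)
 have "(\<lambda>n. exp ((p n * ln (cmin \<delta>) - ln b) / (1 - p n))) \<longlonglongrightarrow> exp ((0 * ln (cmin \<delta>) - ln b) / (1 - 0))"
  by (intro tendsto_intros p_lim) simp
 then have "(\<lambda>n. exp ((p n * ln (cmin \<delta>) - ln b) / (1 - p n))) \<longlonglongrightarrow> 1 / b" by (simp add: b)
 moreover have "eventually (\<lambda>n. exp ((p n * ln (cmin \<delta>) - ln b) / (1 - p n)) <= energy (w n t)) sequentially"
  using ph by eventually_elim (rule profile.positive(2)[OF prof i _ \<delta>(1)])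
 ultimately have E: "1 / b <= energy (sol (2 * i) t)"
  by (rule tendsto_le[OF sequentially_bot tendsto_energy[OF lim]])
 have l1: "(\<lambda>n. (- 1) ^ i * snd (w n t)) \<longlonglongrightarrow> (- 1) ^ i * snd (sol (2 * i) t)" by (intro tendsto_intros lim)
 have "eventually (\<lambda>n. 0 <= (- 1) ^ i * snd (w n t)) sequentially"
  using ph by eventually_elim (rule profile.positive(3)[OF prof i _ \<delta>(1)])
 then have s: "0 <= (- 1) ^ i * snd (sol (2 * i) t)"
  by (rule tendsto_lowerbound[OF l1 _ sequentially_bot])
 have l2: "(\<lambda>n. 2 * (snd (w n t))\<^sup>2) \<longlonglongrightarrow> 2 * (snd (sol (2 * i) t))\<^sup>2" by (intro tendsto_intros lim)
 have "eventually (\<lambda>n. energy (w n t) <= 2 * (snd (w n t))\<^sup>2) sequentially"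
  using ph by eventually_elim (rule profile.positive(4)[OF prof i _ \<delta>(1)])
 then have "energy (sol (2 * i) t) <= 2 * (snd (sol (2 * i) t))\<^sup>2"
  by (rule tendsto_le[OF sequentially_bot l2 tendsto_energy[OF lim]])
 then have "1 / b <= 2 * (snd (sol (2 * i) t))\<^sup>2" using E by simp
 moreover have "((- 1) ^ i * snd (sol (2 * i) t))\<^sup>2 = (snd (sol (2 * i) t))\<^sup>2" by (simp add: power_mult_distrib flip: power_mult)
 ultimately have "1 / (2 * b) <= ((- 1) ^ i * snd (sol (2 * i) t))\<^sup>2" by simp
 then show "sqrt (1 / (2 * b)) <= (- 1) ^ i * snd (sol (2 * i) t)" by (rule real_le_lsqrt[OF s])
 have "eventually (\<lambda>n. cmin \<delta> * energy (w n t) <= minkowski (w n t)) sequentially"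
  using ph
 proof eventually_elim
  case (elim n)
  from profile.sign[OF prof j elim less_imp_le[OF \<delta>(1)]] show ?case by simp
 qed
 then have "cmin \<delta> * energy (sol (2 * i) t) <= minkowski (sol (2 * i) t)"
  by (rule tendsto_le[OF sequentially_bot tendsto_minkowski[OF lim] tendsto_mult_left[OF tendsto_energy[OF lim]]])
 moreover have "0 < cmin \<delta> * energy (sol (2 * i) t)"
  using cmin_pos[OF \<delta>(1)] E b_pos by (intro mult_pos_pos) (auto intro: less_le_trans[of 0 "1 / b"])
 ultimately show "0 < minkowski (sol (2 * i) t)" by simp
qed

lemma negative_limit:
 assumes j: "j <= 2 * k" "odd j" and t: "t \<in> J j"
 shows "minkowski (sol j t) <= 0" and "z j \<noteq> 0 ==> minkowski (sol j t) < 0"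
proof -
 have j0: "0 < j" using j(2) by (rule odd_pos)
 define c where "c = min t (mid j)"
 define d where "d = max t (mid j)"
 have cd: "c \<in> J j" "d \<in> J j" using J_mid(1)[OF j0 t] t by (auto simp: c_def d_def min_def max_def)
 have I: "t \<in> {c..d}" "mid j \<in> {c..d}" by (auto simp: c_def d_def)
 obtain C \<sigma> where C: "0 < C" "0 < \<sigma>"
  "eventually (\<lambda>n. \<forall>t\<in>{c..d}. \<forall>t'\<in>{c..d}. energy (w n t) <= C * energy (w n t')) sequentially"
  "eventually (\<lambda>n. \<forall>t\<in>{c..d}. \<sigma> * energy (w n t) <= - minkowski (w n t)) sequentially"
  by (rule odd_ratio[OF j cd])
 note lim = pointwise[OF j(1) t]
 have zl: "(\<lambda>n. w n (mid j)) \<longlonglongrightarrow> z j" unfolding mid_def by (rule z_lim[OF j(1) j0 J_mid(2)[OF j0 t]])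
 have "eventually (\<lambda>n. \<sigma> * energy (w n t) <= - minkowski (w n t)) sequentially"
  using C(4) by eventually_elim (use I in simp)
 then have 1: "\<sigma> * energy (sol j t) <= - minkowski (sol j t)"
  by (rule tendsto_le[OF sequentially_bot tendsto_minus[OF tendsto_minkowski[OF lim]] tendsto_mult_left[OF tendsto_energy[OF lim]]])
 have "eventually (\<lambda>n. energy (w n (mid j)) <= C * energy (w n t)) sequentially"
  using C(3) by eventually_elim (use I in simp)
 then have 2: "energy (z j) <= C * energy (sol j t)"
  by (rule tendsto_le[OF sequentially_bot tendsto_mult_left[OF tendsto_energy[OF lim]] tendsto_energy[OF zl]])
 have "0 <= \<sigma> * energy (sol j t)" using C(2) by (simp add: energy_def)
 then show "minkowski (sol j t) <= 0" using 1 by simp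
 assume "z j \<noteq> 0"
 then have "0 < energy (z j)" by (rule energy_pos)
 then have "0 < C * energy (sol j t)" using 2 by simp
 then have "0 < \<sigma> * energy (sol j t)" using C by (simp add: zero_less_mult_iff)
 then show "minkowski (sol j t) < 0" using 1 by simp
qed

end

section \<open>The limit function and its jumps\<close>

context limit_family
begin

text \<open>The branches are glued with the value 0 at the interface radii, which makes
  \<open>minkowski\<close> vanish there, and with 0 beyond the last of them.\<close>

definition w0 :: "real => real \<times> real" where
 "w0 t = (if \<exists>j\<le>2 * k. t \<in> J j then sol (SOME j. j <= 2 * k \<and> t \<in> J j) t else 0)"

lemma w0_J: assumes "j <= 2 * k" "t \<in> J j" shows "w0 t = sol j t"
proof -
 have ex: "\<exists>j\<le>2 * k. t \<in> J j" using assms by blast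
 from someI_ex[OF this] have "(SOME j. j <= 2 * k \<and> t \<in> J j) = j" using J_unique assms by blast
 then show ?thesis using ex by (simp add: w0_def)
qed

lemma w0_outside: "(!!j. j <= 2 * k ==> t \<notin> J j) ==> w0 t = 0"
 by (auto simp: w0_def)

lemma r_notin_J: assumes "i <= 2 * k" "j <= 2 * k" shows "r i \<notin> J j"
proof
 assume J: "r i \<in> J j"
 show False
 proof (cases "j <= i")
  case True
  then show False using r_mono[OF True assms(1)] J by (auto simp: J_def split: if_splits)
 next
  case False
  then have "r i <= r (j - 1)" using assms by (intro r_mono) auto
  then show False using J False by (auto simp: J_def split: if_splits)
 qed
qed

lemma w0_r: "i <= 2 * k ==> w0 (r i) = 0"
 by (rule w0_outside) (rule r_notin_J)

lemma J_upper: assumes "j <= 2 * k" "t \<in> J j" shows "t < r j" "t < r (2 * k)"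
proof -
 show "t < r j" using assms(2) by (auto simp: J_def split: if_splits)
 then show "t < r (2 * k)" using r_mono[OF assms(1) order_refl] by simp
qed

lemma w0_beyond: "r (2 * k) <= t ==> w0 t = 0"
 by (rule w0_outside) (use J_upper(2) in force)

lemma w0_negative: "t < 0 ==> w0 t = 0"
 by (rule w0_outside) (use J_pos(1) in force)

lemma cover:
 assumes "0 <= t" "t <= r (2 * k)"
 shows "(\<exists>j\<le>2 * k. t \<in> J j) \<or> (\<exists>j\<le>2 * k. t = r j)"
proof -
 define j where "j = (LEAST j. t <= r j)"
 have j: "t <= r j" unfolding j_def by (rule LeastI) (rule assms(2))
 have jk: "j <= 2 * k" unfolding j_def by (rule Least_le) (rule assms(2))
 have below: "r i < t" if "i < j" for i using not_less_Least[of i "\<lambda>j. t <= r j"] that by (simp add: j_def)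
 show ?thesis
 proof (cases "t = r j")
  case False
  then have "t \<in> J j" using j below[of "j - 1"] assms(1) by (auto simp: J_def)
  then show ?thesis using jk by blast
 qed (use jk in blast)
qed

lemma w0_deriv:
 assumes t: "0 < t" "t \<notin> r ` {..2 * k}"
 shows "(w0 has_vector_derivative dirac_field m \<Omega> t (w0 t)) (at t)"
proof (cases "t <= r (2 * k)")
 case True
 then obtain j where j: "j <= 2 * k" "t \<in> J j" using cover[of t] t by auto
 have op: "open (J j \<inter> {0<..})"
 proof (cases "j = 0")
  case True
  then have "J j \<inter> {0<..} = {0<..<r 0}" by (auto simp: J_def)
  then show ?thesis by simp
 qed (simp add: J_def open_Int)
 have "(w0 has_vector_derivative dirac_field m \<Omega> t (sol j t)) (at t)"
  by (rule has_vector_derivative_transform_within_open[OF sol_deriv[OF t(1)] op]) (use j t w0_J in auto)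
 then show ?thesis using w0_J[OF j] by simp
next
 case False
 have "((\<lambda>_. 0) has_vector_derivative (0 :: real \<times> real)) (at t)" by simp
 then have "(w0 has_vector_derivative 0) (at t)"
  by (rule has_vector_derivative_transform_within_open[of _ _ _ "{r (2 * k)<..}"]) (use False w0_beyond in auto)
 moreover have "dirac_field m \<Omega> t (0 :: real \<times> real) = 0" by (simp add: dirac_field_def zero_prod_def)
 ultimately show ?thesis using w0_beyond[of t] False by simp
qed

text \<open>\<open>minkowski\<close> along the solution, frozen at the radius of the origin, where
  it is 0. The estimates say nothing about the solution beyond that radius.\<close>

definition "cm n t = minkowski (w n (min t (\<rho> n (2 * k))))"

lemma cm_lipschitz: assumes "0 <= c" "c <= d" shows "\<bar>cm n d - cm n c\<bar> <= Ls k * (d - c)"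
proof -
 have "0 < \<rho> n (2 * k)" using profile.rho(1)[OF prof, of n "2 * k"] r0_pos by simp
 then have "\<bar>cm n d - cm n c\<bar> <= Ls k * (min d (\<rho> n (2 * k)) - min c (\<rho> n (2 * k)))"
  unfolding cm_def using assms by (intro profile.lipschitz[OF prof]) auto
 also have "\<dots> <= Ls k * (d - c)" using assms Ls_nonneg by (intro mult_left_mono) auto
 finally show ?thesis .
qed

lemma minkowski_0 [simp]: "minkowski 0 = 0"
 by (simp add: minkowski_def zero_prod_def)

lemma cm_limit: assumes t: "0 <= t" shows "(\<lambda>n. cm n t) \<longlonglongrightarrow> minkowski (w0 t)"
proof -
 consider j where "j <= 2 * k" "t \<in> J j" | j where "j <= 2 * k" "t = r j" | "r (2 * k) < t"
  using cover[OF t] by force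
 then show ?thesis
 proof cases
  case 1
  have "(\<lambda>n. minkowski (w n t)) \<longlonglongrightarrow> minkowski (w0 t)"
   unfolding w0_J[OF 1] by (rule tendsto_minkowski[OF pointwise[OF 1]])
  moreover have "eventually (\<lambda>n. minkowski (w n t) = cm n t) sequentially"
   using order_tendstoD(1)[OF rho_lim[OF order_refl] J_upper(2)[OF 1]] by eventually_elim (simp add: cm_def)
  ultimately show ?thesis by (rule Lim_transform_eventually)
 next
  case 2
  have "\<bar>cm n t\<bar> <= Ls k * \<bar>t - \<rho> n j\<bar>" for n
  proof -
   have "cm n (\<rho> n j) = 0"
    using rho_mono[OF 2(1) order_refl, of n] profile.s_rho[OF prof 2(1), of n] by (simp add: cm_def min_def)
   moreover have "0 <= \<rho> n j" using profile.rho(1)[OF prof, of n j] r0_pos by simp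
   ultimately show ?thesis
    using cm_lipschitz[of t "\<rho> n j" n] cm_lipschitz[of "\<rho> n j" t n] t by (cases "t <= \<rho> n j") auto
  qed
  moreover have "(\<lambda>n. Ls k * \<bar>t - \<rho> n j\<bar>) \<longlonglongrightarrow> Ls k * \<bar>t - r j\<bar>" by (intro tendsto_intros rho_lim 2)
  then have "(\<lambda>n. Ls k * \<bar>t - \<rho> n j\<bar>) \<longlonglongrightarrow> 0" using 2(2) by simp
  ultimately have "(\<lambda>n. cm n t) \<longlonglongrightarrow> 0"
   by (intro Lim_null_comparison[of "\<lambda>n. cm n t" "\<lambda>n. Ls k * \<bar>t - \<rho> n j\<bar>"] always_eventually) auto
  then show ?thesis using w0_r 2 by simp
 next
  case 3
  have "eventually (\<lambda>n. 0 = cm n t) sequentially"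
   using order_tendstoD(2)[OF rho_lim[OF order_refl] 3]
   by eventually_elim (use profile.s_rho[OF prof order_refl] in \<open>simp add: cm_def min_def\<close>)
  then have "(\<lambda>n. cm n t) \<longlonglongrightarrow> 0" by (rule Lim_transform_eventually[OF tendsto_const])
  then show ?thesis using w0_beyond[of t] 3 by simp
 qed
qed

lemma continuous_on_s0: "continuous_on {0..} (\<lambda>t. minkowski (w0 t))"
proof (rule lipschitz_on_continuous_on)
 have lip: "\<bar>minkowski (w0 d) - minkowski (w0 c)\<bar> <= Ls k * (d - c)" if "0 <= c" "c <= d" for c d
 proof (rule LIMSEQ_le_const2)
  show "(\<lambda>n. \<bar>cm n d - cm n c\<bar>) \<longlonglongrightarrow> \<bar>minkowski (w0 d) - minkowski (w0 c)\<bar>"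
   by (intro tendsto_intros cm_limit) (use that in auto)
 qed (use cm_lipschitz[OF that] in blast)
 show "(Ls k)-lipschitz_on {0..} (\<lambda>t. minkowski (w0 t))"
 proof (rule lipschitz_onI[OF _ Ls_nonneg])
  fix c d :: real assume "c \<in> {0..}" "d \<in> {0..}"
  then show "dist (minkowski (w0 c)) (minkowski (w0 d)) <= Ls k * dist c d"
   using lip[of c d] lip[of d c] by (cases "c <= d") (auto simp: dist_real_def abs_minus_commute)
 qed
qed

lemma energy_w0: "energy (w0 t) <= M k"
proof (cases "\<exists>j\<le>2 * k. t \<in> J j")
 case True
 then obtain j where j: "j <= 2 * k" "t \<in> J j" by blast
 have "eventually (\<lambda>n. energy (w n t) <= M k) sequentially"
  using order_tendstoD(1)[OF rho_lim[OF order_refl] J_upper(2)[OF j]]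
  by eventually_elim (rule profile.energy[OF prof J_pos(1)[OF j]])
 then show ?thesis unfolding w0_J[OF j]
  by (rule tendsto_upperbound[OF tendsto_energy[OF pointwise[OF j]] _ sequentially_bot])
next
 case False
 then have "w0 t = 0" by (intro w0_outside) blast
 then show ?thesis using M_pos[of k] by (simp add: energy_def)
qed

lemma L_infinity_w0: "L_infinity_on {0..} w0"
proof -
 have "w0 \<in> borel_measurable borel"
 proof (rule borel_measurable_continuous_countable_exceptions)
  show "countable (insert 0 (r ` {..2 * k}))" by (intro countable_finite) auto
  show "continuous_on (- insert 0 (r ` {..2 * k})) w0"
  proof (intro continuous_at_imp_continuous_on ballI)
   fix t assume t: "t \<in> - insert 0 (r ` {..2 * k})"
   show "isCont w0 t"
   proof (cases "0 < t")
    case True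
    show ?thesis by (rule has_vector_derivative_continuous[OF w0_deriv[OF True]]) (use t in simp)
   next
    case False
    then have "eventually (\<lambda>y. y \<in> {..<0}) (nhds t)" using t by (intro eventually_nhds_in_open) auto
    then have "eventually (\<lambda>y. w0 y = 0) (nhds t)" by eventually_elim (simp add: w0_negative)
    then have "isCont w0 t = isCont (\<lambda>_. 0 :: real \<times> real) t" by (rule isCont_cong)
    then show ?thesis by simp
   qed
  qed
 qed
 then have "w0 \<in> borel_measurable lborel" by simp
 then have "w0 \<in> borel_measurable lebesgue" by (rule measurable_completion)
 then have "w0 \<in> borel_measurable (lebesgue_on {0..})" by (rule measurable_restrict_space1)
 moreover have "AE t in lebesgue_on {0..}. norm (w0 t) <= sqrt (M k)"
  by (intro AE_I2) (simp add: energy_norm energy_w0)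
 ultimately show ?thesis unfolding L_infinity_on_def by blast
qed

text \<open>As \<open>w0\<close> is 0 at the interface radii and on intervals of zero branch, a
  compact interval on which \<open>minkowski\<close> does not vanish lies inside a single
  \<open>J j\<close> that \<open>uniform_live\<close> covers.\<close>

lemma uniform_limit_w0:
 assumes sub: "{c..d} \<subseteq> {t. 0 <= t \<and> \<bar>minkowski (w0 t)\<bar> > 0}"
 shows "uniform_limit {c..d} w w0 sequentially"
proof (cases "c <= d")
 case True
 then have c: "0 <= c" "minkowski (w0 c) \<noteq> 0" using sub by auto
 then have "c < r (2 * k)" using w0_beyond[of c] by force
 moreover have "c \<noteq> r j" if "j <= 2 * k" for j using c w0_r[OF that] by auto
 ultimately obtain j where j: "j <= 2 * k" "c \<in> J j" using cover[of c] c(1) by fastforce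
 have "d < r j"
 proof (rule ccontr)
  assume "\<not> d < r j"
  then have "r j \<in> {c..d}" using J_upper(1)[OF j] by simp
  then show False using sub w0_r[OF j(1)] by fastforce
 qed
 then have d: "d \<in> J j" using j(2) True by (auto simp: J_def split: if_splits)
 have live: "even j \<or> z j \<noteq> 0"
 proof (rule ccontr)
  assume "\<not> ?thesis"
  then have "sol j c = 0" by (auto simp: sol_def dest: odd_pos)
  then show False using c(2) w0_J[OF j] by simp
 qed
 have "sol j t = w0 t" if "t \<in> {c..d}" for t using w0_J[OF j(1) J_convex[OF j(2) d that]] by simp
 then have "uniform_limit {c..d} w (sol j) sequentially = uniform_limit {c..d} w w0 sequentially"
  by (intro uniform_limit_cong') auto
 then show ?thesis using uniform_live[OF j d live] by simp
next
 case False
 then show ?thesis by (intro uniform_limitI) simp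
qed

text \<open>Where the limit of \<open>s\<close> is nonzero, \<open>Gp (p n) s\<close> tends to its
  sign. A change of sign of \<open>minkowski\<close> therefore costs a fixed amount of
  \<open>v\<close>, however close the two points are.\<close>

lemma jump_limit:
 assumes i: "i < k" and jc: "jc <= 2 * k" "c \<in> J jc" and jd: "jd <= 2 * k" "d \<in> J jd" and cd: "c <= d"
  and zone: "r (2 * i) - c1 < c" "d < r (2 * i + 1) + c1" and nz: "minkowski (w0 c) \<noteq> 0" "minkowski (w0 d) \<noteq> 0"
 shows "\<bar>sgn (minkowski (w0 d)) - sgn (minkowski (w0 c))\<bar> <= 4 * Mv k * \<bar>snd (w0 c) - snd (w0 d)\<bar>"
proof -
 have wl: "(\<lambda>n. w n c) \<longlonglongrightarrow> w0 c" "(\<lambda>n. w n d) \<longlonglongrightarrow> w0 d"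
  using pointwise[OF jc] pointwise[OF jd] w0_J[OF jc] w0_J[OF jd] by auto
 have G: "(\<lambda>n. Gp (p n) (minkowski (w n t))) \<longlonglongrightarrow> sgn (minkowski (w0 t))"
  if t: "(\<lambda>n. w n t) \<longlonglongrightarrow> w0 t" "minkowski (w0 t) \<noteq> 0" for t
 proof -
  note l = tendsto_minkowski[OF t(1)]
  have "(\<lambda>n. sgn (minkowski (w n t)) * \<bar>minkowski (w n t)\<bar> powr p n) \<longlonglongrightarrow>
   sgn (minkowski (w0 t)) * \<bar>minkowski (w0 t)\<bar> powr 0"
   by (intro tendsto_mult tendsto_sgn tendsto_powr tendsto_rabs l p_lim) (use t(2) in auto)
  then show ?thesis using t(2) by (simp add: Gp_def)
 qed
 have l: "(\<lambda>n. \<rho> n (2 * i) - c1) \<longlonglongrightarrow> r (2 * i) - c1" "(\<lambda>n. \<rho> n (2 * i + 1) + c1) \<longlonglongrightarrow> r (2 * i + 1) + c1"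
  by (rule tendsto_diff[OF rho_lim tendsto_const] tendsto_add[OF rho_lim tendsto_const], use i in simp)+
 have ev: "eventually (\<lambda>n. \<bar>Gp (p n) (minkowski (w n d)) - Gp (p n) (minkowski (w n c))\<bar>
  <= 4 * Mv k * \<bar>snd (w n c) - snd (w n d)\<bar>) sequentially"
  using order_tendstoD(2)[OF l(1) zone(1)] order_tendstoD(1)[OF l(2) zone(2)]
   order_tendstoD(1)[OF rho_lim[OF order_refl] J_upper(2)[OF jd]]
 proof eventually_elim
  case (elim n)
  show ?case by (rule profile.jump[OF prof i J_pos(1)[OF jc] cd]) (use elim in auto)
 qed
 show ?thesis
  by (rule tendsto_le[OF sequentially_bot _ _ ev]) (intro tendsto_intros wl G nz)+
qed

definition "vm = sqrt (1 / (2 * b))"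

lemma vm_pos: "0 < vm"
 using b_pos by (simp add: vm_def)

lemma left_of_even: assumes "i <= k" obtains y where "y < r (2 * i)" "{y<..<r (2 * i)} \<subseteq> J (2 * i)"
proof (cases "i = 0")
 case True
 then show ?thesis using r_ge[of 0] r0_pos by (intro that[of 0]) (auto simp: J_def)
next
 case False
 have "2 * (i - 1) + 1 = 2 * i - 1" "2 * (i - 1) + 2 = 2 * i" using False by auto
 moreover have "i - 1 < k" using False assms by simp
 ultimately have "r (2 * i - 1) < r (2 * i)" using r_gap[of "i - 1"] c1_pos by simp
 then show ?thesis using False by (intro that[of "r (2 * i - 1)"]) (auto simp: J_def)
qed

lemma right_of_odd: assumes "i < k"
 shows "r (2 * i + 1) < r (2 * i + 2)" "J (2 * i + 2) = {r (2 * i + 1)<..<r (2 * i + 2)}"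
 using r_gap[OF assms] c1_pos by (auto simp: J_def)

text \<open>Immediately to the left of \<open>r (2 * i)\<close> there is always a positive interval,
  on which \<open>(- 1) ^ i * v\<close> is at least \<open>vm\<close>. In
  \<open>limit_from_right\<close> the positive interval to the right of \<open>r (2 * i + 1)\<close>
  has the opposite sign.\<close>

lemma limit_from_left: assumes i: "i <= k" and L: "(w0 \<longlongrightarrow> L) (at (r (2 * i)))" shows "vm <= (- 1) ^ i * snd L"
proof -
 obtain y where y: "y < r (2 * i)" "{y<..<r (2 * i)} \<subseteq> J (2 * i)" by (rule left_of_even[OF i])
 have "(w0 \<longlongrightarrow> L) (at_left (r (2 * i)))" using L by (simp add: filterlim_at_split)
 then have lim: "((\<lambda>t. (- 1) ^ i * snd (w0 t)) \<longlongrightarrow> (- 1) ^ i * snd L) (at_left (r (2 * i)))" by (intro tendsto_intros)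
 have "eventually (\<lambda>t. vm <= (- 1) ^ i * snd (w0 t)) (at_left (r (2 * i)))"
  using eventually_at_left_real[OF y(1)]
 proof eventually_elim
  case (elim t)
  then have "t \<in> J (2 * i)" using y(2) by auto
  then show ?case using positive_limit(1)[OF i] w0_J[of "2 * i" t] i by (simp add: vm_def)
 qed
 then show ?thesis by (rule tendsto_lowerbound[OF lim _ trivial_limit_at_left_real])
qed

lemma limit_from_right: assumes i: "i < k" and L: "(w0 \<longlongrightarrow> L) (at (r (2 * i + 1)))" shows "vm <= - ((- 1) ^ i * snd L)"
proof -
 have "(w0 \<longlongrightarrow> L) (at_right (r (2 * i + 1)))" using L by (simp add: filterlim_at_split)
 then have lim: "((\<lambda>t. - ((- 1) ^ i * snd (w0 t))) \<longlongrightarrow> - ((- 1) ^ i * snd L)) (at_right (r (2 * i + 1)))"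
  by (intro tendsto_intros)
 have "eventually (\<lambda>t. vm <= - ((- 1) ^ i * snd (w0 t))) (at_right (r (2 * i + 1)))"
  using eventually_at_right_real[OF right_of_odd(1)[OF i]]
 proof eventually_elim
  case (elim t)
  then have "t \<in> J (2 * Suc i)" using right_of_odd(2)[OF i] by simp
  then show ?case using positive_limit(1)[of "Suc i" t] w0_J[of "2 * Suc i" t] i by (simp add: vm_def)
 qed
 then show ?thesis by (rule tendsto_lowerbound[OF lim _ trivial_limit_at_right_real])
qed

text \<open>At the ends of a negative interval of positive length. If the branch in it is zero, a
  limit would be 0, against \<open>vm\<close>; otherwise \<open>minkowski\<close> changes its sign
  strictly and \<open>jump_limit\<close> forbids a limit of \<open>v\<close>.\<close>

lemma no_limit_at_negative:
 assumes i: "i < k" and lt: "r (2 * i) < r (2 * i + 1)" and y: "y = r (2 * i) \<or> y = r (2 * i + 1)"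
  and L: "(w0 \<longlongrightarrow> L) (at y)"
 shows False
proof -
 let ?j = "2 * i + 1"
 have j: "?j <= 2 * k" "odd ?j" using i by auto
 have Jj: "J ?j = {r (2 * i)<..<r ?j}" by (simp add: J_def)
 have Lleft: "(w0 \<longlongrightarrow> L) (at_left y)" and Lright: "(w0 \<longlongrightarrow> L) (at_right y)"
  using L by (simp_all add: filterlim_at_split)
 have snd: "snd L \<noteq> 0"
  using y limit_from_left[of i L] limit_from_right[OF i, of L] L i vm_pos by auto
 show False
 proof (cases "z ?j = 0")
  case True
  have zero: "w0 t = 0" if "t \<in> J ?j" for t using w0_J[OF j(1) that] True by (simp add: sol_def)
  have "L = 0" using y
  proof
   assume y: "y = r (2 * i)"
   have "eventually (\<lambda>t. w0 t = 0) (at_right y)"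
    using eventually_at_right_real[OF lt] unfolding y by eventually_elim (rule zero, simp only: Jj)
   from tendsto_unique[OF trivial_limit_at_right_real Lright tendsto_eventually[OF this]] show ?thesis .
  next
   assume y: "y = r ?j"
   have "eventually (\<lambda>t. w0 t = 0) (at_left y)"
    using eventually_at_left_real[OF lt] unfolding y by eventually_elim (rule zero, simp only: Jj)
   from tendsto_unique[OF trivial_limit_at_left_real Lleft tendsto_eventually[OF this]] show ?thesis .
  qed
  then show False using snd by simp
 next
  case z: False
  \<comment> \<open>Two points within \<open>\<epsilon>\<close> of the limit on either side would
    allow a change of sign of at most 1, whereas the signs differ by 2.\<close>
  define \<epsilon> where "\<epsilon> = 1 / (8 * Mv k)"
  have \<epsilon>: "0 < \<epsilon>" using Mv_pos[of k] by (simp add: \<epsilon>_def)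
  have near: "eventually (\<lambda>t. \<bar>snd (w0 t) - snd L\<bar> < \<epsilon>) (at_left y)" "eventually (\<lambda>t. \<bar>snd (w0 t) - snd L\<bar> < \<epsilon>) (at_right y)"
   using tendstoD[OF tendsto_snd[OF Lleft] \<epsilon>] tendstoD[OF tendsto_snd[OF Lright] \<epsilon>] by (simp_all add: dist_real_def)
  obtain jc jd where J: "jc <= 2 * k" "jd <= 2 * k" "eventually (\<lambda>t. t \<in> J jc) (at_left y)" "eventually (\<lambda>t. t \<in> J jd) (at_right y)"
   and par: "even jc \<and> jd = ?j \<or> jc = ?j \<and> even jd"
  proof (cases "y = r (2 * i)")
   case True
   obtain y' where y': "y' < r (2 * i)" "{y'<..<r (2 * i)} \<subseteq> J (2 * i)" by (rule left_of_even[of i]) (use i in simp)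
   have "eventually (\<lambda>t. t \<in> J (2 * i)) (at_left y)"
    unfolding True by (rule eventually_mono[OF eventually_at_left_real[OF y'(1)]]) (use y'(2) in auto)
   moreover have "eventually (\<lambda>t. t \<in> J ?j) (at_right y)"
    using eventually_at_right_real[OF lt] unfolding True by eventually_elim (simp only: Jj)
   ultimately show ?thesis using j i by (intro that[of "2 * i" ?j]) auto
  next
   case False
   then have y: "y = r ?j" using y by simp
   have "eventually (\<lambda>t. t \<in> J ?j) (at_left y)"
    using eventually_at_left_real[OF lt] unfolding y by eventually_elim (simp only: Jj)
   moreover have "eventually (\<lambda>t. t \<in> J (2 * i + 2)) (at_right y)"
    using eventually_at_right_real[OF right_of_odd(1)[OF i]] unfolding y right_of_odd(2)[OF i] .
   ultimately show ?thesis using j i by (intro that[of ?j "2 * i + 2"]) auto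
  qed
  have yz: "r (2 * i) - c1 < y" "y < r ?j + c1" using y lt c1_pos by auto
  obtain c where c: "c \<in> J jc" "\<bar>snd (w0 c) - snd L\<bar> < \<epsilon>" "r (2 * i) - c1 < c" "c < y"
   using eventually_happens'[OF trivial_limit_at_left_real eventually_conj[OF J(3) eventually_conj[OF near(1) eventually_at_left_real[OF yz(1)]]]]
   by auto
  obtain d where d: "d \<in> J jd" "\<bar>snd (w0 d) - snd L\<bar> < \<epsilon>" "y < d" "d < r ?j + c1"
   using eventually_happens'[OF trivial_limit_at_right_real eventually_conj[OF J(4) eventually_conj[OF near(2) eventually_at_right_real[OF yz(2)]]]]
   by auto
  have sg: "0 < minkowski (w0 t)" if "even j" "j <= 2 * k" "t \<in> J j" for j t
   using positive_limit(2)[of "j div 2" t] w0_J[OF that(2,3)] that by auto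
  have sn: "minkowski (w0 t) < 0" if "t \<in> J ?j" for t
   using negative_limit(2)[OF j that z] w0_J[OF j(1) that] by simp
  have sgns: "minkowski (w0 c) \<noteq> 0" "minkowski (w0 d) \<noteq> 0" "\<bar>sgn (minkowski (w0 d)) - sgn (minkowski (w0 c))\<bar> = 2"
   using par
  proof -
   have "minkowski (w0 c) \<noteq> 0 \<and> minkowski (w0 d) \<noteq> 0 \<and> \<bar>sgn (minkowski (w0 d)) - sgn (minkowski (w0 c))\<bar> = 2"
    using par
   proof
    assume "even jc \<and> jd = ?j"
    then show ?thesis using sg[OF _ J(1) c(1)] sn[of d] d(1) by auto
   next
    assume "jc = ?j \<and> even jd"
    then show ?thesis using sg[OF _ J(2) d(1)] sn[of c] c(1) by auto
   qed
   then show "minkowski (w0 c) \<noteq> 0" "minkowski (w0 d) \<noteq> 0" "\<bar>sgn (minkowski (w0 d)) - sgn (minkowski (w0 c))\<bar> = 2" by auto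
  qed
  have "2 <= 4 * Mv k * \<bar>snd (w0 c) - snd (w0 d)\<bar>"
   using jump_limit[OF i J(1) c(1) J(2) d(1) _ c(3) d(4) sgns(1,2)] c(4) d(3) sgns(3) by simp
  also have "\<dots> < 4 * Mv k * (2 * \<epsilon>)"
   using c(2) d(2) Mv_pos[of k] by (intro mult_strict_left_mono) auto
  also have "\<dots> = 1" using Mv_pos[of k] by (simp add: \<epsilon>_def)
  finally show False by simp
 qed
qed

text \<open>Three situations: the last radius, with 0 on its right and \<open>v\<close> away from 0
  on its left; a negative interval that has shrunk to a point, with \<open>v\<close> of opposite
  signs on both sides; and the ends of a negative interval of positive length.\<close>

lemma discontinuity: assumes j: "j <= 2 * k" shows "nonremovable_discontinuity w0 (r j)"
 unfolding nonremovable_discontinuity_def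
proof
 assume "\<exists>L. (w0 \<longlongrightarrow> L) (at (r j))"
 then obtain L where L: "(w0 \<longlongrightarrow> L) (at (r j))" ..
 show False
 proof (cases "j = 2 * k")
  case True
  have "(w0 \<longlongrightarrow> L) (at_right (r (2 * k)))" using L True by (simp add: filterlim_at_split)
  moreover have "eventually (\<lambda>t. w0 t = 0) (at_right (r (2 * k)))"
   using eventually_at_right_less[of "r (2 * k)"] by eventually_elim (simp add: w0_beyond)
  ultimately have "L = 0" using tendsto_unique[OF trivial_limit_at_right_real _ tendsto_eventually] by blast
  then show False using limit_from_left[OF order_refl, of L] L True vm_pos by simp
 next
  case False
  define i where "i = j div 2"
  have i: "i < k" "j = 2 * i \<or> j = 2 * i + 1" using j False by (auto simp: i_def)
  have mono: "r (2 * i) <= r (2 * i + 1)" using i by (intro r_mono) auto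
  show False
  proof (cases "r (2 * i) < r (2 * i + 1)")
   case True
   show False by (rule no_limit_at_negative[OF i(1) True _ L]) (use i(2) in auto)
  next
   case False
   then have "r (2 * i) = r j" "r (2 * i + 1) = r j" using mono i(2) by auto
   then show False using limit_from_left[of i L] limit_from_right[OF i(1), of L] L i(1) vm_pos by simp
  qed
 qed
qed

lemma w0_0: "w0 0 = (0, x0)"
 using w0_J[of 0 0] r_ge[of 0] r0_pos by (simp add: J_def sol_def)

lemma C1_w0: "C1_within ({0..} - r ` {..2 * k}) w0"
proof -
 let ?A = "{0..} - r ` {..2 * k}"
 \<comment> \<open>At 0 the field has a meaningless value, so its limit is used:
   \<open>u / r\<close> tends to \<open>a * x0 / 3\<close>, and
   \<open>a * x0 - 2 * (a * x0 / 3) = a * x0 / 3\<close>.\<close>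
 define D' where "D' t = (if t = 0 then (a * x0 / 3, 0) else dirac_field m \<Omega> t (w0 t))" for t
 have A0: "at 0 within ?A <= at_right 0" unfolding at_within_def by (intro inf_mono order_refl) auto
 have "0 < r 0" using r_ge[of 0] r0_pos by simp
 have ev: "eventually (\<lambda>t. 0 < t \<and> w0 t = D (x0 / \<kappa>) 0 t) (at_right 0)"
 proof (rule eventually_mono[OF eventually_at_right_real[OF \<open>0 < r 0\<close>]])
  fix t assume "t \<in> {0<..<r 0}"
  then show "0 < t \<and> w0 t = D (x0 / \<kappa>) 0 t" using w0_J[of 0 t] by (simp add: J_def sol_def)
 qed
 note O = D_at_origin[of "x0"]
 show ?thesis unfolding C1_within_def
 proof (intro exI[of _ D'] conjI ballI)
  show "continuous_on ?A D'" unfolding continuous_on_def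
  proof
   fix t assume t: "t \<in> ?A"
   show "(D' \<longlongrightarrow> D' t) (at t within ?A)"
   proof (cases "t = 0")
    case True
    have "((\<lambda>t. (Dv (x0 / \<kappa>) 0 t * a - 2 * (Du (x0 / \<kappa>) 0 t / t), - Du (x0 / \<kappa>) 0 t * b)) \<longlongrightarrow>
     (x0 * a - 2 * (a * x0 / 3), - 0 * b)) (at_right 0)"
     by (intro tendsto_intros O)
    moreover have "(x0 * a - 2 * (a * x0 / 3), - 0 * b) = D' t" by (simp add: D'_def True)
    ultimately have l: "((\<lambda>t. (Dv (x0 / \<kappa>) 0 t * a - 2 * (Du (x0 / \<kappa>) 0 t / t), - Du (x0 / \<kappa>) 0 t * b))
     \<longlongrightarrow> D' t) (at_right 0)" by (simp only:)
    have "(D' \<longlongrightarrow> D' t) (at_right 0)"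
     by (rule Lim_transform_eventually[OF l], rule eventually_mono[OF ev])
      (simp add: D'_def dirac_field_def D_def a_def b_def)
    then show ?thesis unfolding True by (rule tendsto_mono[OF A0])
   next
    case False
    then have t': "0 < t" "t \<notin> r ` {..2 * k}" using t by auto
    have "isCont w0 t" by (rule has_vector_derivative_continuous[OF w0_deriv[OF t']])
    then have wl: "(w0 \<longlongrightarrow> w0 t) (at t)" by (simp add: isCont_def)
    have "((\<lambda>t. dirac_field m \<Omega> t (w0 t)) \<longlongrightarrow> dirac_field m \<Omega> t (w0 t)) (at t)"
     unfolding dirac_field_def case_prod_beta by (intro tendsto_intros wl) (use t' in simp)
    moreover have "eventually (\<lambda>t. dirac_field m \<Omega> t (w0 t) = D' t) (at t)"
     using eventually_neq_at_within[of 0 t UNIV] by eventually_elim (simp add: D'_def)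
    ultimately have "(D' \<longlongrightarrow> dirac_field m \<Omega> t (w0 t)) (at t)" by (rule Lim_transform_eventually)
    then have "(D' \<longlongrightarrow> D' t) (at t)" using False by (simp add: D'_def)
    then show ?thesis by (rule tendsto_within_subset) simp
   qed
  qed
  fix t assume t: "t \<in> ?A"
  show "(w0 has_vector_derivative D' t) (at t within ?A)"
  proof (cases "t = 0")
   case True
   have "((\<lambda>t. (fst (w0 t) - fst (w0 0)) / (t - 0)) \<longlongrightarrow> a * x0 / 3) (at_right 0)"
    by (rule Lim_transform_eventually[OF O(3)]) (use ev in \<open>auto elim!: eventually_mono simp: w0_0 D_def\<close>)
   then have f: "((\<lambda>t. fst (w0 t)) has_real_derivative a * x0 / 3) (at 0 within ?A)"
    unfolding has_field_derivative_iff by (rule tendsto_mono[OF A0])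
   have "((\<lambda>t. (snd (w0 t) - snd (w0 0)) / (t - 0)) \<longlongrightarrow> 0) (at_right 0)"
    by (rule Lim_transform_eventually[OF O(4)]) (use ev in \<open>auto elim!: eventually_mono simp: w0_0 D_def\<close>)
   then have s: "((\<lambda>t. snd (w0 t)) has_real_derivative 0) (at 0 within ?A)"
    unfolding has_field_derivative_iff by (rule tendsto_mono[OF A0])
   show ?thesis
    using has_vector_derivative_Pair[OF f[unfolded has_real_derivative_iff_has_vector_derivative]
     s[unfolded has_real_derivative_iff_has_vector_derivative]] by (simp add: True D'_def)
  next
   case False
   then have t': "0 < t" "t \<notin> r ` {..2 * k}" using t by auto
   show ?thesis using has_vector_derivative_at_within[OF w0_deriv[OF t']] False by (simp add: D'_def)
  qed
 qed
qed

end

lemma strict_mono_enumeration: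
 fixes P :: "real set"
 assumes P: "finite P"
 obtains R where "strict_mono_on {1..card P} R" "R ` {1..card P} = P"
proof -
 define xs where "xs = sorted_list_of_set P"
 have xs: "set xs = P" "length xs = card P" "sorted_wrt (<) xs" using P by (simp_all add: xs_def)
 show thesis
 proof (rule that[of "\<lambda>i. xs ! (i - 1)"])
  show "strict_mono_on {1..card P} (\<lambda>i. xs ! (i - 1))"
  proof (rule strict_mono_onI)
   fix i j assume "i \<in> {1..card P}" "j \<in> {1..card P}" "i < j"
   then show "xs ! (i - 1) < xs ! (j - 1)" by (intro sorted_wrt_nth_less[OF xs(3)]) (auto simp: xs(2))
  qed
  show "(\<lambda>i. xs ! (i - 1)) ` {1..card P} = P"
  proof
   show "(\<lambda>i. xs ! (i - 1)) ` {1..card P} \<subseteq> P" using xs by (auto intro!: nth_mem)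
   show "P \<subseteq> (\<lambda>i. xs ! (i - 1)) ` {1..card P}"
   proof
    fix y assume "y \<in> P"
    then obtain n where "n < card P" "y = xs ! n" using xs by (metis in_set_conv_nth)
    then show "y \<in> (\<lambda>i. xs ! (i - 1)) ` {1..card P}" by (intro image_eqI[of _ _ "Suc n"]) auto
   qed
  qed
 qed
qed

text \<open>The limits \<open>r j\<close> coincide where a negative interval has shrunk, so
  \<open>R\<close> lists the distinct values and \<open>l\<close> may be smaller than
  \<open>2 * k + 1\<close>. The positive intervals after the first are counted by their left ends
  \<open>r (2 * i + 1)\<close>, which remain distinct by \<open>r_gap\<close>.\<close>

theorem (in limit_family) limit_solution:
 "\<exists>l R w0. 1 <= l \<and> l <= 2 * k + 1 \<and> strict_mono_on {1..l} R \<and> (\<forall>i\<in>{1..l}. 0 < R i) \<and>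
  C1_within ({0..} - R ` {1..l}) w0 \<and> L_infinity_on {0..} w0 \<and>
  continuous_on {0..} (\<lambda>r. minkowski (w0 r)) \<and>
  (\<forall>r\<in>{0..<R 1}. minkowski (w0 r) > 0) \<and>
  card {i\<in>{1..<l}. \<forall>r\<in>{R i<..<R (Suc i)}. minkowski (w0 r) > 0} = k \<and>
  (\<forall>a b. {a..b} \<subseteq> {r. 0 <= r \<and> \<bar>minkowski (w0 r)\<bar> > 0} \<longrightarrow> uniform_limit {a..b} w w0 sequentially) \<and>
  (\<forall>r\<in>{0<..R l} - R ` {1..l}. (w0 has_vector_derivative dirac_field m \<Omega> r (w0 r)) (at r)) \<and>
  (\<forall>i\<in>{1..l}. nonremovable_discontinuity w0 (R i)) \<and>
  (\<forall>r\<ge>R l. w0 r = 0) \<and> (\<forall>i\<in>{1..l}. minkowski (w0 (R i)) = 0)"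
proof -
 let ?P = "r ` {..2 * k}"
 define l where "l = card ?P"
 obtain R where R: "strict_mono_on {1..l} R" "R ` {1..l} = ?P"
  unfolding l_def by (rule strict_mono_enumeration[of ?P]) auto
 have l1: "1 <= l" by (simp add: l_def card_gt_0_iff Suc_le_eq)
 have l2: "l <= 2 * k + 1" using card_image_le[of "{..2 * k}" r] by (simp add: l_def)
 have less: "R i < R j" if "i \<in> {1..l}" "j \<in> {1..l}" "i < j" for i j
  using strict_mono_onD[OF R(1) that(1,2,3)] .
 have le: "R i <= R j" if "i \<in> {1..l}" "j \<in> {1..l}" "i <= j" for i j
  using less[OF that(1,2)] that(3) by (cases "i = j") auto
 have lt: "i < j" if "i \<in> {1..l}" "j \<in> {1..l}" "R i < R j" for i j
  using le[OF that(2,1)] that(3) by force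
 have Rr: "\<exists>j\<le>2 * k. R i = r j" if "i \<in> {1..l}" for i using R(2) that by blast
 have rR: "\<exists>i\<in>{1..l}. R i = r j" if "j <= 2 * k" for j
 proof -
  have "r j \<in> R ` {1..l}" unfolding R(2) using that by simp
  then show ?thesis by force
 qed
 have R1: "R 1 = r 0"
 proof (rule antisym)
  obtain i where "i \<in> {1..l}" "R i = r 0" using rR[of 0] by auto
  then show "R 1 <= r 0" using le[of 1 i] l1 by auto
  obtain j where "j <= 2 * k" "R 1 = r j" using Rr[of 1] l1 by auto
  then show "r 0 <= R 1" using r_mono[of 0 j] by simp
 qed
 have Rl: "R l = r (2 * k)"
 proof (rule antisym)
  obtain i where "i \<in> {1..l}" "R i = r (2 * k)" using rR[of "2 * k"] by auto
  then show "r (2 * k) <= R l" using le[of i l] l1 by auto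
  obtain j where "j <= 2 * k" "R l = r j" using Rr[of l] l1 by auto
  then show "R l <= r (2 * k)" using r_mono[of j "2 * k"] by simp
 qed
 have pos: "0 < minkowski (w0 t)" if "i <= k" "t \<in> J (2 * i)" for i t
  using positive_limit(2)[OF that] w0_J[of "2 * i" t] that by simp
 have "\<forall>i\<in>{..<k}. \<exists>n. n \<in> {1..l} \<and> R n = r (2 * i + 1)"
 proof
  fix i assume "i \<in> {..<k}"
  then have "2 * i + 1 <= 2 * k" by simp
  from rR[OF this] show "\<exists>n. n \<in> {1..l} \<and> R n = r (2 * i + 1)" by blast
 qed
 then obtain N where N: "!!i. i < k ==> N i \<in> {1..l}" "!!i. i < k ==> R (N i) = r (2 * i + 1)"
  unfolding bchoice_iff by auto
 have Ninj: "inj_on N {..<k}"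
 proof (rule linorder_inj_onI)
  fix i j assume ij: "i < j" "i \<in> {..<k}" "j \<in> {..<k}"
  have "r (2 * i + 1) < r (2 * i + 2)" using right_of_odd(1)[of i] ij by simp
  also have "\<dots> <= r (2 * j + 1)" using ij by (intro r_mono) auto
  finally show "N i \<noteq> N j" using N(2)[of i] N(2)[of j] ij by auto
 qed auto
 have "{i\<in>{1..<l}. \<forall>t\<in>{R i<..<R (Suc i)}. minkowski (w0 t) > 0} = N ` {..<k}"
 proof (intro equalityI subsetI)
  fix n assume "n \<in> {i\<in>{1..<l}. \<forall>t\<in>{R i<..<R (Suc i)}. minkowski (w0 t) > 0}"
  then have n: "n \<in> {1..l}" "Suc n \<in> {1..l}" and np: "!!t. R n < t ==> t < R (Suc n) ==> minkowski (w0 t) > 0" by auto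
  \<comment> \<open>The largest index with this limit radius: several indices may share it, and only
    the largest one tells the sign on the interval to its right.\<close>
  define j where "j = Max {j. j <= 2 * k \<and> r j <= R n}"
  have fin: "finite {j. j <= 2 * k \<and> r j <= R n}" by simp
  obtain j' where j': "j' <= 2 * k" "R n = r j'" using Rr[OF n(1)] by blast
  have "j \<in> {j. j <= 2 * k \<and> r j <= R n}" unfolding j_def by (rule Max_in[OF fin]) (use j' in auto)
  then have j: "j <= 2 * k" "r j <= R n" by auto
  have "j' <= j" unfolding j_def by (rule Max_ge[OF fin]) (use j' in simp)
  then have rj: "r j = R n" using j r_mono[of j' j] j'(2) by simp
  have "R n < r (2 * k)" using less[OF n] le[OF n(2), of l] n Rl by simp
  then have jk: "j < 2 * k" using rj j(1) by (cases "j = 2 * k") auto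
  have "\<not> r (Suc j) <= R n"
  proof
   assume "r (Suc j) <= R n"
   then have "Suc j <= j" unfolding j_def by (intro Max_ge[OF fin]) (use jk j_def in auto)
   then show False by simp
  qed
  then have nx: "R n < r (Suc j)" by simp
  have Jj: "J (Suc j) = {R n<..<r (Suc j)}" by (simp add: J_def rj)
  have "odd j"
  proof (rule ccontr)
   assume "\<not> odd j"
   then have "odd (Suc j)" by simp
   define t where "t = (R n + min (r (Suc j)) (R (Suc n))) / 2"
   have t: "R n < t" "t < R (Suc n)" "t < r (Suc j)" using nx less[OF n] by (auto simp: t_def min_def)
   then have tJ: "t \<in> J (Suc j)" unfolding Jj by simp
   have "minkowski (w0 t) <= 0"
    using negative_limit(1)[OF _ \<open>odd (Suc j)\<close> tJ] w0_J[OF _ tJ] jk by simp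
   then show False using np[OF t(1,2)] by simp
  qed
  then obtain i where i: "j = 2 * i + 1" by (rule oddE)
  then have ik: "i < k" using jk by simp
  have "R (N i) = R n" using N(2)[OF ik] rj i by simp
  then have "N i = n" using less[OF N(1)[OF ik] n(1)] less[OF n(1) N(1)[OF ik]] by (cases "N i" n rule: linorder_cases) auto
  then show "n \<in> N ` {..<k}" using ik by blast
 next
  fix n assume "n \<in> N ` {..<k}"
  then obtain i where i: "i < k" "n = N i" by auto
  have n: "n \<in> {1..l}" "R n = r (2 * i + 1)" using N[OF i(1)] i(2) by auto
  obtain n' where n': "n' \<in> {1..l}" "R n' = r (2 * i + 2)" using rR[of "2 * i + 2"] i(1) by auto
  have nn: "n < n'" by (rule lt[OF n(1) n'(1)]) (use right_of_odd(1)[OF i(1)] n(2) n'(2) in simp)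
  have "R (Suc n) <= r (2 * i + 2)" using le[of "Suc n" n'] nn n(1) n' by auto
  then have "t \<in> J (2 * Suc i)" if "t \<in> {R n<..<R (Suc n)}" for t
   using that right_of_odd(2)[OF i(1)] n(2) by auto
  then have "\<forall>t\<in>{R n<..<R (Suc n)}. minkowski (w0 t) > 0" using pos[of "Suc i"] i(1) by auto
  then show "n \<in> {i\<in>{1..<l}. \<forall>t\<in>{R i<..<R (Suc i)}. minkowski (w0 t) > 0}" using n(1) nn n'(1) by auto
 qed
 then have cardk: "card {i\<in>{1..<l}. \<forall>t\<in>{R i<..<R (Suc i)}. minkowski (w0 t) > 0} = k"
  using card_image[OF Ninj] by simp
 show ?thesis
 proof (intro exI[of _ l] exI[of _ R] exI[of _ w0] conjI)
  show "\<forall>i\<in>{1..l}. 0 < R i"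
  proof
   fix i assume "i \<in> {1..l}"
   then obtain j where "j <= 2 * k" "R i = r j" using Rr by blast
   then show "0 < R i" using r_ge[of j] r0_pos by simp
  qed
  show "C1_within ({0..} - R ` {1..l}) w0" unfolding R(2) by (rule C1_w0)
  show "\<forall>r\<in>{0..<R 1}. minkowski (w0 r) > 0" unfolding R1 using pos[of 0] by (simp add: J_def)
  show "\<forall>a b. {a..b} \<subseteq> {r. 0 <= r \<and> \<bar>minkowski (w0 r)\<bar> > 0} \<longrightarrow> uniform_limit {a..b} w w0 sequentially"
   by (intro allI impI uniform_limit_w0)
  show "\<forall>r\<in>{0<..R l} - R ` {1..l}. (w0 has_vector_derivative dirac_field m \<Omega> r (w0 r)) (at r)"
   unfolding R(2) by (intro ballI w0_deriv) auto
  show "\<forall>i\<in>{1..l}. nonremovable_discontinuity w0 (R i)"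
  proof
   fix i assume "i \<in> {1..l}"
   then obtain j where "j <= 2 * k" "R i = r j" using Rr by blast
   then show "nonremovable_discontinuity w0 (R i)" using discontinuity by simp
  qed
  show "\<forall>r\<ge>R l. w0 r = 0" unfolding Rl by (intro allI impI w0_beyond)
  show "\<forall>i\<in>{1..l}. minkowski (w0 (R i)) = 0"
  proof
   fix i assume "i \<in> {1..l}"
   then obtain j where "j <= 2 * k" "R i = r j" using Rr by blast
   then show "minkowski (w0 (R i)) = 0" using w0_r by simp
  qed
 qed (fact l1 l2 R(1) L_infinity_w0 continuous_on_s0 cardk)+
qed

section \<open>Extraction of a convergent family and conclusion\<close>

lemma common_convergent_subsequence:
 fixes f :: "nat => nat => 'a::{heine_borel, real_normed_vector}"
 assumes "!!j. j < N ==> \<exists>B. eventually (\<lambda>n. norm (f j n) <= B) sequentially"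
 shows "\<exists>\<sigma> :: nat => nat. strict_mono \<sigma> \<and> (\<forall>j<N. convergent (f j \<circ> \<sigma>))"
 using assms
 proof (induction N)
  case 0
  show ?case by (rule exI[of _ id]) (simp add: strict_mono_def)
 next
  case (Suc N)
  have "\<exists>\<sigma> :: nat => nat. strict_mono \<sigma> \<and> (\<forall>j<N. convergent (f j \<circ> \<sigma>))"
   by (rule Suc.IH) (rule Suc.prems, simp)
  then obtain \<sigma> :: "nat => nat" where \<sigma>: "strict_mono \<sigma>" "\<forall>j<N. convergent (f j \<circ> \<sigma>)" by blast
  obtain B where "eventually (\<lambda>n. norm (f N n) <= B) sequentially" using Suc.prems[of N] by auto
  then obtain n0 where n0: "!!n. n0 <= n ==> norm (f N n) <= B" by (auto simp: eventually_sequentially)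
  have "bounded (range (\<lambda>n. f N (\<sigma> (n + n0))))"
   using n0 seq_suble[OF \<sigma>(1)] by (intro boundedI[of _ B]) (auto intro: order_trans[OF le_add2])
  then obtain L \<tau> where \<tau>: "strict_mono (\<tau> :: nat => nat)" "((\<lambda>n. f N (\<sigma> (n + n0))) \<circ> \<tau>) \<longlonglongrightarrow> L"
   using bounded_imp_convergent_subsequence by blast
  define \<tau>' where "\<tau>' n = \<tau> n + n0" for n
  have \<tau>': "strict_mono \<tau>'" using \<tau>(1) by (simp add: strict_mono_def \<tau>'_def)
  have "convergent (f j \<circ> (\<sigma> \<circ> \<tau>'))" if "j < Suc N" for j
  proof (cases "j = N")
   case True
   then show ?thesis using \<tau>(2) by (auto simp: convergent_def \<tau>'_def o_def)
  next
   case False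
   then have "convergent (f j \<circ> \<sigma>)" using that \<sigma>(2) by simp
   from convergent_subseq_convergent[OF this \<tau>'] show ?thesis by (simp add: o_assoc)
  qed
  then show ?case using strict_mono_o[OF \<sigma>(1) \<tau>'] by blast
 qed

text \<open>Two successive extractions are needed: the midpoints at which the second one evaluates
  the solutions are determined by the limits of the radii obtained from the first.\<close>

theorem (in frequency) nodal_limit:
 assumes p0: "0 < p0" and nodal: "!!p. p \<in> {0<..<p0} ==> nodal_solution m \<Omega> k p (w p)"
 shows "\<exists>q X \<rho> r x0 z. (\<forall>n. q n \<in> {0<..<p0} \<and> q (Suc n) < q n) \<and> q \<longlonglongrightarrow> 0 \<and>
  limit_family m \<Omega> k q (fst \<circ> X) (\<lambda>n. w (q n)) (snd \<circ> X) \<rho> r x0 z"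
proof -
 define c where "c = min p0 p1"
 have c: "0 < c" "c <= p0" "c <= p1" using p0 p1_pos by (auto simp: c_def)
 define q where "q n = c / (real n + 2)" for n
 have q: "0 < q n" "q n < c" for n using c(1) by (auto simp: q_def field_simps intro: add_pos_nonneg)
 have qp: "q n \<in> {0<..<p0}" "q n <= p1" for n using q[of n] c by auto
 have qdec: "q j < q i" if "i < j" for i j using c(1) that by (simp add: q_def divide_strict_left_mono)
 have qlim: "q \<longlonglongrightarrow> 0" unfolding q_def[abs_def] by real_asymp
 have "\<forall>n. \<exists>Y. profile m \<Omega> (q n) k (w (q n)) (fst (fst Y)) (snd (fst Y)) (snd Y)"
 proof
  fix n
  obtain x S where "nodal m \<Omega> (q n) k (w (q n)) x S"
   by (rule nodal_solutionD[OF q(1) qp(2) nodal[OF qp(1)]])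
  from nodal.profile_exists[OF this] obtain \<rho> where "profile m \<Omega> (q n) k (w (q n)) x S \<rho>" ..
  then have "profile m \<Omega> (q n) k (w (q n)) (fst (fst ((x, S), \<rho>))) (snd (fst ((x, S), \<rho>))) (snd ((x, S), \<rho>))" by simp
  then show "\<exists>Y. profile m \<Omega> (q n) k (w (q n)) (fst (fst Y)) (snd (fst Y)) (snd Y)" by (rule exI)
 qed
 from choice[OF this] obtain Y where Y: "!!n. profile m \<Omega> (q n) k (w (q n)) (fst (fst (Y n))) (snd (fst (Y n))) (snd (Y n))" by blast
 define f where "f j n = (if j <= 2 * k then snd (Y n) j else fst (fst (Y n)))" for j n
 have "\<exists>B. eventually (\<lambda>n. norm (f j n) <= B) sequentially" for j
 proof (intro exI always_eventually allI)
  fix n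
  have "r0 <= snd (Y n) j" "snd (Y n) j <= Rm k" by (rule profile.rho[OF Y])+
  then have "\<bar>snd (Y n) j\<bar> <= Rm k" using r0_pos by simp
  then show "norm (f j n) <= max (Rm k) (sqrt (M k))" using profile.x[OF Y, of n] by (auto simp: f_def)
 qed
 then have "\<exists>\<sigma> :: nat => nat. strict_mono \<sigma> \<and> (\<forall>j<2 * k + 2. convergent (f j \<circ> \<sigma>))"
  by (rule common_convergent_subsequence)
 then obtain \<sigma> :: "nat => nat" where \<sigma>: "strict_mono \<sigma>" "\<forall>j<2 * k + 2. convergent (f j \<circ> \<sigma>)" by blast
 define r where "r j = lim (f j \<circ> \<sigma>)" for j
 have flim: "(f j \<circ> \<sigma>) \<longlonglongrightarrow> r j" if "j < 2 * k + 2" for j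
  using \<sigma>(2) that unfolding r_def convergent_LIMSEQ_iff by blast
 have rlim: "(\<lambda>n. snd (Y (\<sigma> n)) j) \<longlonglongrightarrow> r j" if "j <= 2 * k" for j
  using flim[of j] that by (simp add: f_def o_def)
 have xlim: "(\<lambda>n. fst (fst (Y (\<sigma> n)))) \<longlonglongrightarrow> r (2 * k + 1)"
  using flim[of "2 * k + 1"] by (simp add: f_def o_def)
 define y where "y j = (r (j - 1) + r j) / 2" for j
 \<comment> \<open>The default 0 stands for intervals of limit length 0, on which no midpoint value
   is asked for.\<close>
 define g where "g j n = (if r (j - 1) < r j then w (q (\<sigma> n)) (y j) else 0)" for j n
 have "\<exists>B. eventually (\<lambda>n. norm (g j n) <= B) sequentially" if j: "j < 2 * k + 1" for j
 proof (cases "r (j - 1) < r j")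
  case True
  have jk: "j <= 2 * k" "j - 1 <= 2 * k" using j by auto
  have "r0 <= r (j - 1)" by (rule LIMSEQ_le_const[OF rlim[OF jk(2)]]) (use profile.rho(1)[OF Y] in auto)
  then have y0: "0 <= y j" "y j < r j" using True r0_pos by (auto simp: y_def)
  have "eventually (\<lambda>n. norm (g j n) <= sqrt (M k)) sequentially"
   using order_tendstoD(1)[OF rlim[OF jk(1)] y0(2)]
  proof eventually_elim
   case (elim n)
   have "snd (Y (\<sigma> n)) j <= snd (Y (\<sigma> n)) (2 * k)"
    using profile.rho(3)[OF Y, of j "2 * k" "\<sigma> n"] jk by (cases "j = 2 * k") auto
   then have "energy (w (q (\<sigma> n)) (y j)) <= M k" by (intro profile.energy[OF Y y0(1)]) (use elim in simp)
   then show ?case using True by (simp add: g_def energy_norm)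
  qed
  then show ?thesis by (rule exI)
 next
  case False
  then show ?thesis by (intro exI[of _ 0]) (simp add: g_def)
 qed
 then have "\<exists>\<tau> :: nat => nat. strict_mono \<tau> \<and> (\<forall>j<2 * k + 1. convergent (g j \<circ> \<tau>))"
  by (rule common_convergent_subsequence)
 then obtain \<tau> :: "nat => nat" where \<tau>: "strict_mono \<tau>" "\<forall>j<2 * k + 1. convergent (g j \<circ> \<tau>)" by blast
 define s where "s n = \<sigma> (\<tau> n)" for n
 have s: "strict_mono s" using \<sigma>(1) \<tau>(1) by (simp add: strict_mono_def s_def)
 have sub: "(\<lambda>n. h (s n)) \<longlonglongrightarrow> L" if "(\<lambda>n. h (\<sigma> n)) \<longlonglongrightarrow> L" for h :: "nat => real" and L
  using LIMSEQ_subseq_LIMSEQ[OF that \<tau>(1)] by (simp add: o_def s_def)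
 have fam: "limit_family m \<Omega> k (\<lambda>n. q (s n)) (fst \<circ> (\<lambda>n. fst (Y (s n)))) (\<lambda>n. w (q (s n))) (snd \<circ> (\<lambda>n. fst (Y (s n))))
  (\<lambda>n. snd (Y (s n))) r (r (2 * k + 1)) (\<lambda>j. lim (g j \<circ> \<tau>))"
 proof (rule limit_family.intro[OF frequency_axioms limit_family_axioms.intro])
  show "profile m \<Omega> (q (s n)) k (w (q (s n))) ((fst \<circ> (\<lambda>n. fst (Y (s n)))) n) ((snd \<circ> (\<lambda>n. fst (Y (s n)))) n) (snd (Y (s n)))" for n
   using Y[of "s n"] by simp
  show "(\<lambda>n. q (s n)) \<longlonglongrightarrow> 0" using LIMSEQ_subseq_LIMSEQ[OF qlim s] by (simp add: o_def)
  show "(\<lambda>n. snd (Y (s n)) j) \<longlonglongrightarrow> r j" if "j <= 2 * k" for j by (rule sub[OF rlim[OF that]])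
  show "(fst \<circ> (\<lambda>n. fst (Y (s n)))) \<longlonglongrightarrow> r (2 * k + 1)" using sub[OF xlim] by (simp add: o_def)
  show "(\<lambda>n. w (q (s n)) ((r (j - 1) + r j) / 2)) \<longlonglongrightarrow> lim (g j \<circ> \<tau>)"
   if "j <= 2 * k" "0 < j" "r (j - 1) < r j" for j
  proof -
   have "j < 2 * k + 1" using that by simp
   then have "(g j \<circ> \<tau>) \<longlonglongrightarrow> lim (g j \<circ> \<tau>)" using \<tau>(2) unfolding convergent_LIMSEQ_iff by blast
   then show ?thesis using that(3) by (simp add: g_def y_def o_def s_def)
  qed
 qed
 show ?thesis
 proof (intro exI conjI allI)
  show "q (s n) \<in> {0<..<p0}" "q (s (Suc n)) < q (s n)" for n
   using qp(1)[of "s n"] qdec[OF strict_monoD[OF s lessI]] by auto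
  show "(\<lambda>n. q (s n)) \<longlonglongrightarrow> 0" using LIMSEQ_subseq_LIMSEQ[OF qlim s] by (simp add: o_def)
 qed (rule fam)
qed

theorem theorem1p3:
  fixes m :: real
  assumes "m > 0"
  shows "\<exists>\<Omega>\<^sub>b>m. \<forall>\<Omega>>\<Omega>\<^sub>b. \<forall>k::nat.
    (\<exists>p\<^sub>0. 0 < p\<^sub>0 \<and> p\<^sub>0 \<le> 1 \<and> (\<forall>p\<in>{0<..<p\<^sub>0}. \<exists>w. nodal_solution m \<Omega> k p w)) \<and>
    (\<forall>p\<^sub>0 w. 0 < p\<^sub>0 \<and> p\<^sub>0 \<le> 1 \<and> (\<forall>p\<in>{0<..<p\<^sub>0}. nodal_solution m \<Omega> k p (w p)) \<longrightarrow>
      (\<exists>(l::nat) (R :: nat \<Rightarrow> real) (w\<^sub>0 :: real \<Rightarrow> real \<times> real) (pn :: nat \<Rightarrow> real).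
        1 \<le> l \<and> l \<le> 2 * k + 1 \<and> strict_mono_on {1..l} R \<and> (\<forall>i\<in>{1..l}. 0 < R i) \<and>
        C1_within ({0..} - R ` {1..l}) w\<^sub>0 \<and> L_infinity_on {0..} w\<^sub>0 \<and>
        (\<forall>n. pn n \<in> {0<..<p\<^sub>0} \<and> pn (Suc n) < pn n) \<and> pn \<longlonglongrightarrow> 0 \<and>
        continuous_on {0..} (\<lambda>r. minkowski (w\<^sub>0 r)) \<and>
        (\<forall>r\<in>{0..<R 1}. minkowski (w\<^sub>0 r) > 0) \<and>
        card {i\<in>{1..<l}. \<forall>r\<in>{R i<..<R (Suc i)}. minkowski (w\<^sub>0 r) > 0} = k \<and>
        (\<forall>a b. {a..b} \<subseteq> {r. 0 \<le> r \<and> \<bar>minkowski (w\<^sub>0 r)\<bar> > 0} \<longrightarrow>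
          uniform_limit {a..b} (\<lambda>n. w (pn n)) w\<^sub>0 sequentially) \<and>
        (\<forall>r\<in>{0<..R l} - R ` {1..l}.
          (w\<^sub>0 has_vector_derivative dirac_field m \<Omega> r (w\<^sub>0 r)) (at r)) \<and>
        (\<forall>i\<in>{1..l}. nonremovable_discontinuity w\<^sub>0 (R i)) \<and>
        (\<forall>r\<ge>R l. w\<^sub>0 r = 0) \<and>
        (\<forall>i\<in>{1..l}. minkowski (w\<^sub>0 (R i)) = 0)))"
\<comment> \<open>Any number above \<open>m\<close> would serve as the witness; \<open>m + 1\<close>
  is arbitrary, and what is extracted from it is \<open>m < \<Omega>\<close>.\<close>
proof (rule exI[of _ "m + 1"], intro conjI allI impI, goal_cases)
  case (2 \<Omega> k)
  interpret frequency m \<Omega> by unfold_locales (use assms 2 in auto)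
  show ?case
  proof (intro exI[of _ "p1"] conjI ballI)
    fix p assume "p \<in> {0<..<p1}"
    then show "\<exists>w. nodal_solution m \<Omega> k p w" by (intro nodal_solution_exists) auto
  qed (use p1_pos in \<open>auto simp: p1_def\<close>)
next
  case (3 \<Omega> k c w)
  interpret frequency m \<Omega> by unfold_locales (use assms 3 in auto)
  have "\<exists>q X \<rho> r x\<^sub>0 z. (\<forall>n. q n \<in> {0<..<c} \<and> q (Suc n) < q n) \<and> q \<longlonglongrightarrow> 0 \<and>
    limit_family m \<Omega> k q (fst \<circ> X) (\<lambda>n. w (q n)) (snd \<circ> X) \<rho> r x\<^sub>0 z"
    by (rule nodal_limit) (use 3(2) in auto)
  then obtain q X \<rho> r x\<^sub>0 z where q: "\<forall>n. q n \<in> {0<..<c} \<and> q (Suc n) < q n" "q \<longlonglongrightarrow> 0"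
    and fam: "limit_family m \<Omega> k q (fst \<circ> X) (\<lambda>n. w (q n)) (snd \<circ> X) \<rho> r x\<^sub>0 z"
    by blast
  from limit_family.limit_solution[OF fam] q show ?case
  proof (elim exE, goal_cases)
    case (1 l R w\<^sub>0)
    then show ?case by (intro exI[of _ l] exI[of _ R] exI[of _ w\<^sub>0] exI[of _ q]) simp
  qed
qed simp

end
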